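(* Consider the elliptic $R$-matrix. Let $\mathcal L(z)=\mathcal L(z)_W$ be an FRT-operator over a topologically free $\mathbb{C}[[h]]$-module $W$ and let $Y_W(\cdot,z)$ be the corresponding generalized $\phi$-coordinated $V(R)$-module map. For any $w\in\mathfrak z(W)$ all coefficients of the series $$Y_W(\mathrm{qdet}\,L^+(0)\mathbf1,z^2)w=\mathrm{tr}_{1,2}\,A_{12}\,\mathcal L_{[2]}(x_1,x_2)w\big|_{x_1=z,\ x_2=ze^{-h/2}}$$ belong to the submodule of invariants $\mathfrak z(W)$.
   Context: Elliptic $R$-matrix. $h$ is a formal parameter and $c\in\mathbb{C}$ is fixed. With $(z;p)_\infty=\prod_{k\geqslant0}(1-zp^k)$ put $$f(z)=\frac{(z;q^4)_\infty(zq^4;q^4)_\infty}{(zq^2;q^4)_\infty^2},\quad \alpha(z)=\frac{(p^{1/2}qz;p)_\infty}{(p^{1/2}q^{-1}z;p)_\infty}\prod_{k\geqslant1}f(p^kz^2),\quad \beta(z)=\frac{(-pqz;p)_\infty}{(-pq^{-1}z;p)_\infty}\prod_{k\geqslant1}f(p^kz^2)$$ ($f$ regarded as a power series in $z$ over $\mathbb{C}(q)$). Let $$R(z)=\begin{pmatrix}a(z)&&&d(z)\\&b(z)&c(z)&\\&c(z)&b(z)&\\d(z)&&&a(z)\end{pmatrix},$$ where $a(z),b(z)$ contain only even and $c(z),d(z)$ only odd powers of $z$, and $$a(z)+d(z)=q^{-1/2}f(z^2)^{-1}\frac{\alpha(z^{-1})}{\alpha(z)},\qquad b(z)+c(z)=q^{1/2}f(z^2)^{-1}\frac{1+q^{-1}z}{1+qz}\frac{\beta(z^{-1})}{\beta(z)}.$$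 Let $R^*(z)$ be obtained from $R(z)$ by replacing $p$ with $p^*=pq^{-2c}$. Throughout, $q^{1/2}=e^{h/4}$ (so $q^{-2c}=e^{-ch}$) and $p=ah^{2b}$ for a fixed real $a>0$ and a fixed integer $b>0$. Then $R(z),R^*(z)\in(\mathrm{End}\,\mathbb{C}^2)^{\otimes2}((z))[[h]]$; the coefficients of powers of $h$ are rational functions of $z$ (because $f(z)|_{q=e^{h/2}}=1+\sum_{k\geqslant1}b_k(z/(1-z))^k$ with $b_k\in h^k\mathbb{C}[[h]]$), and $R(e^u),R^*(e^u)\in(\mathrm{End}\,\mathbb{C}^2)^{\otimes2}((u))[[h]]$ are obtained by substituting $z=e^u$ and expanding in Laurent series in $u$ ($e^{u-v}$ being expanded in $\mathbb{C}((u))((v))[[h]]$, $e^{-u+v}$ likewise). $\iota_{x,y}$ denotes expansion of rational functions in $x,y$ in $\mathbb{C}((x))((y))$, applied to each coefficient of $h$. Subscripts of matrices indicate tensor copies; a $\mathbb{C}[[h]]$-module is topologically free if it is isomorphic to $V_0[[h]]$ for a vector space $V_0$; the subscript $h$ in $W((z))_h$ denotes $h$-adic completion. Algebra $V(R)$: the topologically free associative unital algebra over $\mathbb{C}[[h]]$ generated by $l_{ij}^{(-r)}$ ($r\geqslant1$, $i,j=1,2$) subject to $$R_{21}(e^{-u+v})L_1^+(u)L_2^+(v)=L_2^+(v)L_1^+(u)R^*_{12}(e^{u-v}),\quad L^+(u)=\sum_{i,j}e_{ij}\otimes l_{ij}^+(u),\quad l^+_{ij}(u)=\sum_{r\geqslant1}l_{ij}^{(-r)}u^{r-1}.$$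 Its unit is $\mathbf1$, and $L^+_{[n]}(u_1,\ldots,u_n)=L_1^+(u_1)\cdots L_n^+(u_n)$. FRT-operator over a topologically free $\mathbb{C}[[h]]$-module $W$: a series $\mathcal L(z)\in\mathrm{End}\,\mathbb{C}^2\otimes\mathrm{Hom}(W,W((z))_h)$ such that $$\iota_{x,y}(R_{12}(x/y))\,\mathcal L_1(x)\mathcal L_2(y)=\mathcal L_2(y)\mathcal L_1(x)R^*_{12}(x/y),$$ where $R^*_{12}(x/y)$ on the right is expanded in $\mathbb{C}((y))((x))[[h]]$. For such an operator, $$\mathcal L_{[n]}(x_1,\ldots,x_n)=\Big(\prod^{\rightarrow}_{i=1,\ldots,n-1}\ \prod^{\rightarrow}_{j=i+1,\ldots,n}\iota_{x_i,x_j}R_{ij}(x_i/x_j)\Big)\mathcal L_1(x_1)\cdots\mathcal L_n(x_n)$$ (arrows: index increasing from left to right); its matrix entries applied to $w\in W$ lie in $W((x_1,\ldots,x_n))_h$. The corresponding generalized $\phi$-coordinated $V(R)$-module map is the (unique, well-defined) $\mathbb{C}[[h]]$-module map $Y_W(\cdot,z)$ from $V(R)$ to $\mathrm{Hom}(W,W((z^{1/2}))_h)$ determined by $Y_W(\mathbf1,z)=1_W$ and $$Y_W(L_{[n]}^+(u_1,\ldots,u_n)\mathbf1,z)=\mathcal L_{[n]}(x_1,\ldots,x_n)\big|_{x_1=z^{1/2}e^{u_1},\ldots,x_n=z^{1/2}e^{u_n}},\quad n\geqslant1.$$ Quantum determinant: $\mathrm{qdet}\,L^+(u)=\mathrm{tr}_{1,2}\,A_{12}L_1^+(u)L_2^+(u-h/2)\mathbf1\in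 V(R)[[u]]$, where $A=\frac12(I-P)$, $I$ is the identity and $P=\sum_{i,j}e_{ij}\otimes e_{ji}$ the permutation operator on $\mathbb{C}^2\otimes\mathbb{C}^2$, and the trace is over both copies of $\mathrm{End}\,\mathbb{C}^2$. Submodule of invariants: $$\mathfrak z(W)=\{w\in W:\mathcal L_{[n]}(z_1,\ldots,z_n)w\in(\mathrm{End}\,\mathbb{C}^2)^{\otimes n}\otimes W[[z_1,\ldots,z_n]]\text{ for all }n\geqslant1\}.$$ *)

theory Defs
  imports
    "HOL-Analysis.Analysis"
    "HOL-Computational_Algebra.Computational_Algebra"
begin

unbundle no vec_syntax
unbundle Formal_Power_Series.fps_syntax
unbundle Formal_Laurent_Series.fps_syntax

section \<open>Rational functions and their expansions\<close>

type_synonym ratfun = "complex poly fract"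

text \<open>
  Substitution of \<open>x\<close> for the variable of a rational function, with values in a field containing
  the complex numbers via \<open>e\<close>; it is only used for \<open>x\<close> transcendental over \<open>\<complex>\<close>. All expansions of rational functions below are of this form: the
  expansion of \<open>r(z)\<close> in powers of \<open>z\<close> is its value at the variable of the field of Laurent series.
\<close>
definition rat_subst :: "(complex \<Rightarrow> 'f::field) \<Rightarrow> 'f \<Rightarrow> ratfun \<Rightarrow> 'f" where
  "rat_subst e x r = (THE y. \<exists>n d. d \<noteq> 0 \<and> r = Fract n d \<and> poly (map_poly e d) x \<noteq> 0 \<and>
     y = poly (map_poly e n) x / poly (map_poly e d) x)"

definition rat_expand :: "ratfun \<Rightarrow> complex fls" where
  "rat_expand r = rat_subst fls_const fls_X r"

definition rat_of_series :: "complex fps \<Rightarrow> ratfun" where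
  "rat_of_series F = (THE r. rat_expand r = fps_to_fls F)"

definition cz :: "complex \<Rightarrow> ratfun" where
  "cz x = to_fract [:x:]"

definition zvar :: ratfun where
  "zvar = to_fract [:0, 1:]"

text \<open>The embedding of \<open>\<complex>[[h]]\<close> into \<open>\<complex>(z)[[h]]\<close>.\<close>
definition hconst :: "complex fps \<Rightarrow> ratfun fps" where
  "hconst x = Abs_fps (\<lambda>n. cz (x $ n))"

text \<open>Substitution of \<open>x\<close> for \<open>z\<close> in each coefficient of a power of \<open>h\<close>.\<close>
definition zsubst :: "ratfun \<Rightarrow> ratfun fps \<Rightarrow> ratfun fps" where
  "zsubst x F = Abs_fps (\<lambda>n. rat_subst cz x (F $ n))"


section \<open>The elliptic R-matrix\<close>

text \<open>
  \<open>qpow r\<close> is \<open>q\<^sup>r = e\<^bsup>rh/2\<^esup>\<close>. Infinite products and series of formal power series are taken with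
  respect to the adic topology of the library.
\<close>
definition qpow :: "complex \<Rightarrow> complex fps" where
  "qpow r = fps_exp (r / 2)"

definition qpoch :: "'a::comm_ring_1 fps \<Rightarrow> 'a fps \<Rightarrow> 'a fps" where
  "qpoch x p = (\<Prod>k. 1 - x * p ^ k)"

text \<open>
  The function \<open>f\<close> as a power series in \<open>z\<close> over \<open>\<complex>(q)\<close>. The infinite product is first formed in
  \<open>\<complex>((z))[[q]]\<close>, so that the outer variable \<open>fps_X\<close> is \<open>q\<close>; it only involves nonnegative powers of
  \<open>z\<close>. The coefficient of \<open>z\<^sup>m\<close>, a power series in \<open>q\<close>, is then recognised as the expansion of a
  rational function of \<open>q\<close>.
\<close>
definition f_prod :: "complex fls fps" where
  "f_prod = (let z = fps_const fls_X; q = fps_X in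
     qpoch z (q ^ 4) * qpoch (z * q ^ 4) (q ^ 4) / qpoch (z * q ^ 2) (q ^ 4) ^ 2)"

definition f_coeff :: "nat \<Rightarrow> ratfun" where
  "f_coeff m = rat_of_series (Abs_fps (\<lambda>n. (f_prod $ n) $$ int m))"

text \<open>The coefficient of \<open>z\<^sup>m\<close> in \<open>f(z)\<close> at \<open>q = e\<^bsup>h/2\<^esup>\<close>; there is no pole at \<open>h = 0\<close>.\<close>
definition f_hcoeff :: "nat \<Rightarrow> complex fps" where
  "f_hcoeff m = fls_regpart (rat_subst fls_const (fps_to_fls (qpow 1)) (f_coeff m))"

text \<open>\<open>f(z)\<close> at \<open>q = e\<^bsup>h/2\<^esup>\<close> as a series in \<open>h\<close> whose coefficients are rational functions of \<open>z\<close>.\<close>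
definition f_rat :: "ratfun fps" where
  "f_rat = Abs_fps (\<lambda>n. rat_of_series (Abs_fps (\<lambda>m. f_hcoeff m $ n)))"

text \<open>\<open>f(x)\<close> for \<open>x\<close> divisible by \<open>h\<close>.\<close>
definition f_at :: "ratfun fps \<Rightarrow> ratfun fps" where
  "f_at x = (\<Sum>m. hconst (f_hcoeff m) * x ^ m)"

text \<open>
  The functions below depend on \<open>p\<close> through its square root \<open>s = p\<^bsup>1/2\<^esup>\<close>; the argument \<open>x\<close> is
  \<open>z\<close> or its inverse.
\<close>
definition ell_alpha :: "complex fps \<Rightarrow> ratfun fps \<Rightarrow> ratfun fps" where
  "ell_alpha s x = (let p = hconst (s ^ 2) in
     qpoch (hconst (s * qpow 1) * x) p / qpoch (hconst (s * qpow (- 1)) * x) p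
       * (\<Prod>k. f_at (p ^ (k + 1) * x ^ 2)))"

definition ell_beta :: "complex fps \<Rightarrow> ratfun fps \<Rightarrow> ratfun fps" where
  "ell_beta s x = (let p = hconst (s ^ 2) in
     qpoch (- (p * hconst (qpow 1) * x)) p / qpoch (- (p * hconst (qpow (- 1)) * x)) p
       * (\<Prod>k. f_at (p ^ (k + 1) * x ^ 2)))"

definition ell_ad :: "complex fps \<Rightarrow> ratfun fps" where
  "ell_ad s = (let z = fps_const zvar; z' = fps_const (inverse zvar) in
     hconst (qpow (- 1 / 2)) * inverse (zsubst (zvar ^ 2) f_rat)
       * (ell_alpha s z' / ell_alpha s z))"

definition ell_bc :: "complex fps \<Rightarrow> ratfun fps" where
  "ell_bc s = (let z = fps_const zvar; z' = fps_const (inverse zvar) in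
     hconst (qpow (1 / 2)) * inverse (zsubst (zvar ^ 2) f_rat)
       * ((1 + hconst (qpow (- 1)) * z) / (1 + hconst (qpow 1) * z))
       * (ell_beta s z' / ell_beta s z))"

text \<open>The parts of \<open>F(z)\<close> consisting of the even, respectively odd, powers of \<open>z\<close>.\<close>
definition even_part :: "ratfun fps \<Rightarrow> ratfun fps" where
  "even_part F = fps_const (cz (1 / 2)) * (F + zsubst (- zvar) F)"

definition odd_part :: "ratfun fps \<Rightarrow> ratfun fps" where
  "odd_part F = fps_const (cz (1 / 2)) * (F - zsubst (- zvar) F)"

text \<open>
  An element of \<open>(End \<complex>\<^sup>2)\<^bsup>\<otimes>2\<^esup>\<close> is given by its entries: the value at \<open>(i\<^sub>1, i\<^sub>2)\<close> and \<open>(j\<^sub>1, j\<^sub>2)\<close>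
  is the coefficient of \<open>e\<^bsub>i\<^sub>1j\<^sub>1\<^esub> \<otimes> e\<^bsub>i\<^sub>2j\<^sub>2\<^esub>\<close>.
\<close>
type_synonym rmat = "2 \<times> 2 \<Rightarrow> 2 \<times> 2 \<Rightarrow> ratfun fps"

definition ell_R :: "complex fps \<Rightarrow> rmat" where
  "ell_R s = (\<lambda>(i1, i2) (j1, j2).
     if i1 = j1 \<and> i2 = j2 then
       (if i1 = i2 then even_part (ell_ad s) else even_part (ell_bc s))
     else if i1 \<noteq> j1 \<and> i2 \<noteq> j2 then
       (if i1 = i2 then odd_part (ell_ad s) else odd_part (ell_bc s))
     else 0)"

text \<open>
  The elliptic R-matrix with \<open>p = a h\<^bsup>2b\<^esup>\<close>, and the one with \<open>p\<^sup>* = p q\<^bsup>-2c\<^esup>\<close>. The square root of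
  \<open>p\<^sup>*\<close> is \<open>p\<^bsup>1/2\<^esup> q\<^bsup>-c\<^esup>\<close>.
\<close>
definition R_ell :: "real \<Rightarrow> nat \<Rightarrow> rmat" where
  "R_ell a b = ell_R (fps_const (complex_of_real (sqrt a)) * fps_X ^ b)"

definition R_ell_star :: "real \<Rightarrow> nat \<Rightarrow> complex \<Rightarrow> rmat" where
  "R_ell_star a b c =
     ell_R (fps_const (complex_of_real (sqrt a)) * fps_X ^ b * qpow (- c))"

definition R_flip :: "rmat \<Rightarrow> rmat" where
  "R_flip R = (\<lambda>(i1, i2) (j1, j2). R (i2, i1) (j2, j1))"

text \<open>
  The field \<open>\<complex>((x))((y))\<close> is \<open>complex fls fls\<close>, where \<open>x\<close> is the inner and \<open>y\<close> the outer variable.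
  \<open>R_coeff X R I J m n\<close> is the coefficient, in \<open>\<complex>[[h]]\<close>, of \<open>x\<^sup>m y\<^sup>n\<close> in the \<open>(I, J)\<close> entry of \<open>R(X)\<close>.
\<close>
definition R_coeff ::
  "complex fls fls \<Rightarrow> rmat \<Rightarrow> 2 \<times> 2 \<Rightarrow> 2 \<times> 2 \<Rightarrow> int \<Rightarrow> int \<Rightarrow> complex fps" where
  "R_coeff X R I J m n =
     Abs_fps (\<lambda>k. rat_subst (\<lambda>t. fls_const (fls_const t)) X (R I J $ k) $$ n $$ m)"

definition inner_over_outer :: "complex fls fls" where
  "inner_over_outer = fls_const fls_X / fls_X"

definition outer_over_inner :: "complex fls fls" where
  "outer_over_inner = fls_X / fls_const fls_X"

text \<open>The exponential of \<open>s x + t y\<close>.\<close>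
definition exp2 :: "complex \<Rightarrow> complex \<Rightarrow> complex fls fls" where
  "exp2 s t = fls_const (fps_to_fls (fps_exp s))
     * fps_to_fls (Abs_fps (\<lambda>k. fls_const (fps_exp t $ k)))"


section \<open>Topologically free modules and \<open>h\<close>-adic sums\<close>

text \<open>
  A module is isomorphic to \<open>V\<^sub>0[[h]]\<close> for some vector space \<open>V\<^sub>0\<close> iff it is so for a vector space
  \<open>V\<^sub>0\<close> of elements of the module, namely the one corresponding to the constant series. This allows
  to quantify over \<open>V\<^sub>0\<close>.
\<close>
definition topologically_free :: "(complex fps \<Rightarrow> 'w::ab_group_add \<Rightarrow> 'w) \<Rightarrow> bool" where
  "topologically_free sW \<longleftrightarrow> module sW \<and>
     (\<exists>V0 (\<phi> :: 'w \<Rightarrow> nat \<Rightarrow> 'w).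
        module.subspace (\<lambda>x. sW (fps_const x)) V0 \<and>
        bij_betw \<phi> UNIV {g. range g \<subseteq> V0} \<and>
        (\<forall>v w n. \<phi> (v + w) n = \<phi> v n + \<phi> w n) \<and>
        (\<forall>x w n. \<phi> (sW x w) n = (\<Sum>k\<le>n. sW (fps_const (x $ k)) (\<phi> w (n - k)))))"

definition hpow :: "(complex fps \<Rightarrow> 'w \<Rightarrow> 'w) \<Rightarrow> nat \<Rightarrow> 'w set" where
  "hpow sW n = range (sW (fps_X ^ n))"

definition has_hsum ::
  "(complex fps \<Rightarrow> 'w::ab_group_add \<Rightarrow> 'w) \<Rightarrow> ('i \<Rightarrow> 'w) \<Rightarrow> 'i set \<Rightarrow> 'w \<Rightarrow> bool" where
  "has_hsum sW g A x \<longleftrightarrow>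
     (\<forall>n. \<exists>F. finite F \<and> F \<subseteq> A \<and>
        (\<forall>G. finite G \<and> F \<subseteq> G \<and> G \<subseteq> A \<longrightarrow> x - sum g G \<in> hpow sW n))"

definition hsum ::
  "(complex fps \<Rightarrow> 'w::ab_group_add \<Rightarrow> 'w) \<Rightarrow> ('i \<Rightarrow> 'w) \<Rightarrow> 'i set \<Rightarrow> 'w" where
  "hsum sW g A = (THE x. has_hsum sW g A x)"

text \<open>
  Elements of \<open>Hom(W, W((z))\<^sub>h)\<close>: the coefficient of \<open>z\<^sup>m\<close> is \<open>T m\<close>. A series belongs to the
  \<open>h\<close>-adic completion of \<open>W((z))\<close> iff modulo each power of \<open>h\<close> it has finitely many negative powers.
\<close>
definition laurent_hom ::
  "(complex fps \<Rightarrow> 'w::ab_group_add \<Rightarrow> 'w) \<Rightarrow> (int \<Rightarrow> 'w \<Rightarrow> 'w) \<Rightarrow> bool" where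
  "laurent_hom sW T \<longleftrightarrow> (\<forall>m. module_hom sW sW (T m)) \<and>
     (\<forall>w n. \<exists>N. \<forall>m<N. T m w \<in> hpow sW n)"


section \<open>The algebra \<open>V(R)\<close>\<close>

text \<open>
  The generator \<open>(r, i, j)\<close> stands for \<open>l\<^sub>i\<^sub>j\<^bsup>(-r-1)\<^esup>\<close>, so that it is the coefficient of \<open>u\<^sup>r\<close> in
  \<open>l\<^sub>i\<^sub>j\<^sup>+(u)\<close>.
\<close>
type_synonym gen = "nat \<times> 2 \<times> 2"

text \<open>
  The topologically free algebra \<open>F[[h]]\<close>, where \<open>F\<close> is the free algebra over \<open>\<complex>\<close> on \<open>'g\<close>: a series
  is given by its coefficients at the words.
\<close>
definition free_alg :: "('g list \<Rightarrow> complex fps) set" where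
  "free_alg = {x. \<forall>n. finite {ws. x ws $ n \<noteq> 0}}"

definition free_mult ::
  "('g list \<Rightarrow> complex fps) \<Rightarrow> ('g list \<Rightarrow> complex fps) \<Rightarrow> 'g list \<Rightarrow> complex fps" where
  "free_mult x y = (\<lambda>ws. \<Sum>i\<le>length ws. x (take i ws) * y (drop i ws))"

text \<open>
  Two-sided ideals \<open>J\<close> of \<open>F[[h]]\<close> for which the quotient is topologically free, i.e.\ \<open>J\<close> is closed
  in the \<open>h\<close>-adic topology and the quotient has no \<open>h\<close>-torsion.
\<close>
definition is_top_ideal :: "('g list \<Rightarrow> complex fps) set \<Rightarrow> bool" where
  "is_top_ideal J \<longleftrightarrow> J \<subseteq> free_alg \<and> (\<lambda>_. 0) \<in> J \<and>
     (\<forall>x\<in>J. \<forall>y\<in>J. (\<lambda>ws. x ws + y ws) \<in> J) \<and>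
     (\<forall>x\<in>J. \<forall>y\<in>free_alg. free_mult x y \<in> J \<and> free_mult y x \<in> J) \<and>
     (\<forall>x\<in>free_alg. (\<lambda>ws. fps_X * x ws) \<in> J \<longrightarrow> x \<in> J) \<and>
     (\<forall>x\<in>free_alg. (\<forall>n. \<exists>y\<in>J. \<forall>ws. \<forall>k<n. x ws $ k = y ws $ k) \<longrightarrow> x \<in> J)"

definition top_ideal ::
  "('g list \<Rightarrow> complex fps) set \<Rightarrow> ('g list \<Rightarrow> complex fps) set" where
  "top_ideal S = \<Inter> {J. is_top_ideal J \<and> S \<subseteq> J}"

definition free_eval ::
  "(complex fps \<Rightarrow> 'v::ring_1 \<Rightarrow> 'v) \<Rightarrow> ('g \<Rightarrow> 'v) \<Rightarrow> ('g list \<Rightarrow> complex fps) \<Rightarrow> 'v" where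
  "free_eval sV l x = hsum sV (\<lambda>ws. sV (x ws) (prod_list (map l ws))) UNIV"

text \<open>
  \<open>'v\<close> is the topologically free associative unital algebra over \<open>\<complex>[[h]]\<close> generated by the elements
  \<open>l g\<close> subject to the relations in \<open>S\<close>.
\<close>
definition presented_algebra ::
  "(complex fps \<Rightarrow> 'v::ring_1 \<Rightarrow> 'v) \<Rightarrow> ('g \<Rightarrow> 'v) \<Rightarrow> ('g list \<Rightarrow> complex fps) set \<Rightarrow> bool" where
  "presented_algebra sV l S \<longleftrightarrow> topologically_free sV \<and>
     (\<forall>c x y. sV c (x * y) = sV c x * y \<and> sV c (x * y) = x * sV c y) \<and>
     free_eval sV l ` free_alg = UNIV \<and>
     {x \<in> free_alg. free_eval sV l x = 0} = top_ideal S"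

text \<open>
  The difference of the coefficients of \<open>u\<^sup>m v\<^sup>n\<close> in the \<open>((i\<^sub>1, i\<^sub>2), (j\<^sub>1, j\<^sub>2))\<close> entries of
  \<open>R\<^sub>2\<^sub>1(e\<^bsup>-u+v\<^esup>) L\<^sub>1\<^sup>+(u) L\<^sub>2\<^sup>+(v)\<close> and \<open>L\<^sub>2\<^sup>+(v) L\<^sub>1\<^sup>+(u) R\<^sup>*\<^sub>1\<^sub>2(e\<^bsup>u-v\<^esup>)\<close>. On the left the word \<open>[(r, k, k'), (t, l, l')]\<close>
  arises from \<open>l\<^sub>k\<^sub>k\<^sub>'\<^sup>+(u) l\<^sub>l\<^sub>l\<^sub>'\<^sup>+(v)\<close>, on the right from \<open>l\<^sub>k\<^sub>k\<^sub>'\<^sup>+(v) l\<^sub>l\<^sub>l\<^sub>'\<^sup>+(u)\<close>.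
\<close>
definition VR_relation ::
  "rmat \<Rightarrow> rmat \<Rightarrow> 2 \<times> 2 \<Rightarrow> 2 \<times> 2 \<Rightarrow> int \<Rightarrow> int \<Rightarrow> gen list \<Rightarrow> complex fps" where
  "VR_relation R Rs I J m n ws = (case ws of
     [(r, k, k'), (t, l, l')] \<Rightarrow>
       (if (k', l') = J
        then R_coeff (exp2 (- 1) 1) (R_flip R) I (k, l) (m - int r) (n - int t) else 0)
       - (if (l, k) = I
          then R_coeff (exp2 1 (- 1)) Rs (l', k') J (m - int t) (n - int r) else 0)
     | _ \<Rightarrow> 0)"

definition is_VR ::
  "rmat \<Rightarrow> rmat \<Rightarrow> (complex fps \<Rightarrow> 'v::ring_1 \<Rightarrow> 'v) \<Rightarrow> (gen \<Rightarrow> 'v) \<Rightarrow> bool" where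
  "is_VR R Rs sV l \<longleftrightarrow>
     presented_algebra sV l {VR_relation R Rs I J m n | I J m n. True}"

text \<open>The entries of \<open>A = (I - P)/2\<close>.\<close>
definition A_entry :: "2 \<times> 2 \<Rightarrow> 2 \<times> 2 \<Rightarrow> complex" where
  "A_entry = (\<lambda>(i1, i2) (j1, j2).
     ((if i1 = j1 \<and> i2 = j2 then 1 else 0) - (if i1 = j2 \<and> i2 = j1 then 1 else 0)) / 2)"

text \<open>
  The coefficient of \<open>u\<^sup>s\<close> in \<open>qdet L\<^sup>+(u) = tr A\<^sub>1\<^sub>2 L\<^sub>1\<^sup>+(u) L\<^sub>2\<^sup>+(u - h/2) 1\<close>; the polynomial \<open>[:- h/2, 1:]\<close>
  is \<open>u - h/2\<close>.
\<close>
definition qdet_coeff ::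
  "(complex fps \<Rightarrow> 'v::ring_1 \<Rightarrow> 'v) \<Rightarrow> (gen \<Rightarrow> 'v) \<Rightarrow> nat \<Rightarrow> 'v" where
  "qdet_coeff sV l s =
     (\<Sum>(i1, i2)\<in>UNIV. \<Sum>(k1, k2)\<in>UNIV.
        sV (fps_const (A_entry (i1, i2) (k1, k2)))
          (\<Sum>r\<le>s. hsum sV
             (\<lambda>t. sV (coeff ([:- (fps_const (1 / 2) * fps_X), 1:] ^ t) (s - r))
                    (l (r, k1, i1) * l (t, k2, i2))) UNIV))"


section \<open>FRT-operators and the associated maps\<close>

text \<open>
  \<open>L i j m\<close> is the coefficient of \<open>e\<^sub>i\<^sub>j \<otimes> z\<^sup>m\<close> in \<open>\<L>(z)\<close>. The defining relation is stated for the
  coefficients of \<open>x\<^sup>m y\<^sup>n\<close>. On the right the expansion is in \<open>\<complex>((y))((x))[[h]]\<close>, so that \<open>y\<close> is the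
  inner variable there.
\<close>
definition frt_operator ::
  "(complex fps \<Rightarrow> 'w::ab_group_add \<Rightarrow> 'w) \<Rightarrow> rmat \<Rightarrow> rmat \<Rightarrow> (2 \<Rightarrow> 2 \<Rightarrow> int \<Rightarrow> 'w \<Rightarrow> 'w) \<Rightarrow> bool"
  where
  "frt_operator sW R Rs L \<longleftrightarrow> (\<forall>i j. laurent_hom sW (L i j)) \<and>
     (\<forall>i1 i2 j1 j2 m n w.
        hsum sW (\<lambda>(s, t). \<Sum>(k1, k2)\<in>UNIV.
            sW (R_coeff inner_over_outer R (i1, i2) (k1, k2) s t)
              (L k1 j1 (m - s) (L k2 j2 (n - t) w))) UNIV =
        hsum sW (\<lambda>(s, t). \<Sum>(k1, k2)\<in>UNIV.
            sW (R_coeff outer_over_inner Rs (k1, k2) (j1, j2) t s)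
              (L i2 k2 (n - t) (L i1 k1 (m - s) w))) UNIV)"

text \<open>
  A series in \<open>x\<^sub>1, \<dots>, x\<^sub>n\<close> with coefficients in \<open>(End \<complex>\<^sup>2)\<^bsup>\<otimes>n\<^esup> \<otimes> W\<close>: the arguments are the lists of
  the row indices, of the column indices and of the exponents, all of length \<open>n\<close>.
\<close>
type_synonym 'w tseries = "2 list \<Rightarrow> 2 list \<Rightarrow> int list \<Rightarrow> 'w"

text \<open>\<open>\<L>\<^sub>1(x\<^sub>1) \<dots> \<L>\<^sub>n(x\<^sub>n) w\<close>\<close>
fun L_prod :: "(2 \<Rightarrow> 2 \<Rightarrow> int \<Rightarrow> 'w \<Rightarrow> 'w) \<Rightarrow> 'w \<Rightarrow> 'w tseries" where
  "L_prod L w (i # I) (j # J) (m # M) = L i j m (L_prod L w I J M)"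
| "L_prod L w _ _ _ = w"

text \<open>
  Left multiplication by \<open>R\<^sub>\<mu>\<^sub>\<nu>(x\<^sub>\<mu>/x\<^sub>\<nu>)\<close>, expanded in \<open>\<complex>((x\<^sub>\<mu>))((x\<^sub>\<nu>))\<close>. Positions are counted from
  \<open>0\<close>.
\<close>
definition R_act ::
  "(complex fps \<Rightarrow> 'w::ab_group_add \<Rightarrow> 'w) \<Rightarrow> rmat \<Rightarrow> nat \<times> nat \<Rightarrow> 'w tseries \<Rightarrow> 'w tseries" where
  "R_act sW R = (\<lambda>(\<mu>, \<nu>) S I J M.
     hsum sW (\<lambda>(s, t). \<Sum>(k, l)\<in>UNIV.
         sW (R_coeff inner_over_outer R (I ! \<mu>, I ! \<nu>) (k, l) s t)
           (S (I[\<mu> := k, \<nu> := l]) J (M[\<mu> := M ! \<mu> - s, \<nu> := M ! \<nu> - t]))) UNIV)"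

text \<open>
  \<open>\<L>\<^sub>[\<^sub>n\<^sub>](x\<^sub>1, \<dots>, x\<^sub>n) w\<close>: the pairs \<open>(\<mu>, \<nu>)\<close> with \<open>\<mu> < \<nu>\<close> are listed in lexicographic order, and the
  factor corresponding to the last pair acts first.
\<close>
definition L_br ::
  "(complex fps \<Rightarrow> 'w::ab_group_add \<Rightarrow> 'w) \<Rightarrow> rmat \<Rightarrow> (2 \<Rightarrow> 2 \<Rightarrow> int \<Rightarrow> 'w \<Rightarrow> 'w)
    \<Rightarrow> nat \<Rightarrow> 'w \<Rightarrow> 'w tseries" where
  "L_br sW R L n w =
     foldr (R_act sW R) [(\<mu>, \<nu>). \<mu> \<leftarrow> [0..<n], \<nu> \<leftarrow> [Suc \<mu>..<n]] (L_prod L w)"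

text \<open>
  The characterisation of the map \<open>Y\<^sub>W\<close>: the operator \<open>Y v s\<close> is the coefficient of \<open>(z\<^bsup>1/2\<^esup>)\<^sup>s\<close> in
  \<open>Y\<^sub>W(v, z)\<close>. The last condition compares the coefficients of \<open>u\<^sub>1\<^bsup>r\<^sub>1\<^esup> \<dots> u\<^sub>n\<^bsup>r\<^sub>n\<^esup>\<close>: under the
  substitution \<open>x\<^sub>k = z\<^bsup>1/2\<^esup> e\<^bsup>u\<^sub>k\<^esup>\<close> the monomial \<open>x\<^sub>1\<^bsup>m\<^sub>1\<^esup> \<dots> x\<^sub>n\<^bsup>m\<^sub>n\<^esup>\<close> becomes \<open>(z\<^bsup>1/2\<^esup>)\<^bsup>m\<^sub>1 + \<dots> + m\<^sub>n\<^esup>\<close>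
  times the product of the \<open>e\<^bsup>m\<^sub>k u\<^sub>k\<^esup>\<close>.
\<close>
definition coord_map ::
  "(complex fps \<Rightarrow> 'w::ab_group_add \<Rightarrow> 'w) \<Rightarrow> (complex fps \<Rightarrow> 'v::ring_1 \<Rightarrow> 'v) \<Rightarrow> (gen \<Rightarrow> 'v)
    \<Rightarrow> rmat \<Rightarrow> (2 \<Rightarrow> 2 \<Rightarrow> int \<Rightarrow> 'w \<Rightarrow> 'w) \<Rightarrow> ('v \<Rightarrow> int \<Rightarrow> 'w \<Rightarrow> 'w) \<Rightarrow> bool" where
  "coord_map sW sV l R L Y \<longleftrightarrow>
     (\<forall>v. laurent_hom sW (Y v)) \<and>
     (\<forall>v v' s w. Y (v + v') s w = Y v s w + Y v' s w) \<and>
     (\<forall>x v s w. Y (sV x v) s w = sW x (Y v s w)) \<and>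
     (\<forall>s w. Y 1 s w = (if s = 0 then w else 0)) \<and>
     (\<forall>n\<ge>1. \<forall>I J r s w. length I = n \<and> length J = n \<and> length r = n \<longrightarrow>
        Y (prod_list (map l (zip r (zip I J)))) s w =
        hsum sW (\<lambda>M. sW (fps_const (\<Prod>k<n. fps_exp (of_int (M ! k)) $ (r ! k)))
                        (L_br sW R L n w I J M))
          {M. length M = n \<and> sum_list M = s})"

definition invariants ::
  "(complex fps \<Rightarrow> 'w::ab_group_add \<Rightarrow> 'w) \<Rightarrow> rmat \<Rightarrow> (2 \<Rightarrow> 2 \<Rightarrow> int \<Rightarrow> 'w \<Rightarrow> 'w) \<Rightarrow> 'w set" where
  "invariants sW R L = {w. \<forall>n\<ge>1. \<forall>I J M.
     length I = n \<and> length J = n \<and> length M = n \<and> (\<exists>m\<in>set M. m < 0) \<longrightarrow>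
     L_br sW R L n w I J M = 0}"

text \<open>
  The coefficient of \<open>z\<^sup>s\<close> in \<open>tr A\<^sub>1\<^sub>2 \<L>\<^sub>[\<^sub>2\<^sub>](x\<^sub>1, x\<^sub>2) w\<close> at \<open>x\<^sub>1 = z\<close>, \<open>x\<^sub>2 = z e\<^bsup>-h/2\<^esup>\<close>.
\<close>
definition tr_A_L2 ::
  "(complex fps \<Rightarrow> 'w::ab_group_add \<Rightarrow> 'w) \<Rightarrow> rmat \<Rightarrow> (2 \<Rightarrow> 2 \<Rightarrow> int \<Rightarrow> 'w \<Rightarrow> 'w)
    \<Rightarrow> 'w \<Rightarrow> int \<Rightarrow> 'w" where
  "tr_A_L2 sW R L w s =
     hsum sW (\<lambda>(m1, m2). sW (fps_exp (- 1 / 2) powi m2)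
         (\<Sum>(i1, i2)\<in>UNIV. \<Sum>(k1, k2)\<in>UNIV.
            sW (fps_const (A_entry (i1, i2) (k1, k2)))
              (L_br sW R L 2 w [k1, k2] [i1, i2] [m1, m2])))
       {(m1, m2). m1 + m2 = s}"

end

theory Submission
  imports Defs
begin

text \<open>
  Write \<open>q = e\<^bsup>h/2\<^esup>\<close> and \<open>u(y) = tr\<^sub>1\<^sub>2 A\<^sub>1\<^sub>2 \<L>\<^sub>[\<^sub>2\<^sub>](y, y q\<^sup>-\<^sup>1) w\<close>. The coefficients of \<open>u(y)\<close> are invariants
  because the R-matrix has quantum determinant one, in the form of the fusion identity
  \<open>A\<^sub>1\<^sub>2 R\<^sub>0\<^sub>1(z) R\<^sub>0\<^sub>2(q z) = A\<^sub>1\<^sub>2\<close> (lemma \<open>fusion\<close>). In \<open>\<L>\<^sub>[\<^sub>m\<^sub>+\<^sub>2\<^sub>](x\<^sub>1, \<dots>, x\<^sub>m, y, y q\<^sup>-\<^sup>1) w\<close> the last two tensor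
  positions interact with the position \<open>i \<le> m\<close> through \<open>R\<^sub>i\<^sub>,\<^sub>m\<^sub>+\<^sub>1(x\<^sub>i/y) R\<^sub>i\<^sub>,\<^sub>m\<^sub>+\<^sub>2(q x\<^sub>i/y)\<close>, and \<open>A\<close> at the
  last two positions, which commutes with the factors between positions \<open>\<le> m\<close>, absorbs these pairs
  one after the other. Taking the trace over the last two positions therefore gives
  \<open>tr A \<L>\<^sub>[\<^sub>m\<^sub>+\<^sub>2\<^sub>](x\<^sub>1, \<dots>, x\<^sub>m, y, y q\<^sup>-\<^sup>1) w = \<L>\<^sub>[\<^sub>m\<^sub>](x\<^sub>1, \<dots>, x\<^sub>m) u(y)\<close> (lemma \<open>qtrace_L_br_rows\<close>). The
  left-hand side has no negative powers of the \<open>x\<^sub>i\<close> since \<open>w\<close> is invariant, so neither has the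
  right-hand side, which is the invariance of the coefficients of \<open>u(y)\<close>.

  For the fusion identity, \<open>R\<close> is expanded at \<open>z = \<infinity>\<close>, which is how \<open>R(x/y)\<close> enters the products
  (lemma \<open>R_coeff_eq\<close>). In terms of the entries the identity says that
  \<open>a(z) b(q z) - c(z) c(q z) = 1 = b(z) a(q z) - d(z) d(q z)\<close>, \<open>a(z) c(q z) = c(z) b(q z)\<close> and
  \<open>b(z) d(q z) = d(z) a(q z)\<close>. By parity these four equations amount to one equation for
  \<open>(a - c)(z) (b + c)(q z)\<close> and one for \<open>(b + d)(z) (a - d)(q z)\<close>. Now \<open>a + d\<close> and \<open>b + c\<close> are quotients
  of theta functions times a common scalar factor \<open>\<kappa>(z)\<close> (lemmas \<open>AD_equation\<close>, \<open>BC_equation\<close>), so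
  that two ingredients remain. One is the value of \<open>\<kappa>(z) \<kappa>(q z)\<close> (lemma \<open>kappa_equation\<close>), a
  consequence of the functional equation \<open>f(z) f(q\<^sup>2 z) = (1 - z)/(1 - q\<^sup>2 z)\<close>. The other is a pair
  of quadratic identities between theta functions (lemma \<open>theta_identities\<close>), which follow from
  the triple product identity and from the expansion of products of two theta series in theta
  series of the squared nome.

  The function \<open>f\<close> is given as a product in \<open>q\<close> whose \<open>z\<close>-coefficients are reinterpreted as rational
  functions of \<open>q\<close>, evaluated at \<open>q = e\<^bsup>h/2\<^esup>\<close>, and resummed to rational functions of \<open>z\<close>. The functional
  equation survives these steps because it is a recursion with a unique solution (\<open>f_recursion\<close>),
  and the resummation exists because the functional equation can be solved by polynomials in
  \<open>z/(1 - z)\<close>, on which \<open>z d/dz\<close> acts polynomially (\<open>poly_equation_f_poly\<close>).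

  The identity \<open>Y(qdet L\<^sup>+(0), y\<^sup>2) w = u(y)\<close> expresses that substituting \<open>u\<^sub>2 = - h/2\<close> in \<open>(y e\<^bsup>u\<^sub>2\<^esup>)\<^sup>m\<close>
  gives \<open>y\<^sup>m q\<^sup>-\<^sup>m\<close> (lemma \<open>Y_qdet\<close>).
\<close>

section \<open>Sums in \<open>h\<close>-adically complete modules\<close>

text \<open>
  These two properties carry the calculus of \<open>h\<close>-adic sums. They hold for topologically free
  modules and for the ring \<open>lser\<close> of series below, so that theta series and the action of the
  R-matrix can be treated by the same lemmas.
\<close>
locale hadic = module sW for sW :: "complex fps \<Rightarrow> 'w::ab_group_add \<Rightarrow> 'w" +
  assumes separated: "\<And>x. (\<And>n. x \<in> hpow sW n) \<Longrightarrow> x = 0"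
    and complete: "\<And>f. (\<And>n. f (Suc n) - f n \<in> hpow sW n) \<Longrightarrow> \<exists>x. \<forall>n. x - f n \<in> hpow sW n"
begin

lemma hpow_zero [simp]: "0 \<in> hpow sW n"
  unfolding hpow_def by (metis rangeI scale_zero_right)

lemma hpow_add [intro]: "x \<in> hpow sW n \<Longrightarrow> y \<in> hpow sW n \<Longrightarrow> x + y \<in> hpow sW n"
  unfolding hpow_def by (auto simp flip: scale_right_distrib)

lemma hpow_neg [intro]: "x \<in> hpow sW n \<Longrightarrow> - x \<in> hpow sW n"
  unfolding hpow_def by (auto simp flip: scale_minus_right)

lemma hpow_diff: "x \<in> hpow sW n \<Longrightarrow> y \<in> hpow sW n \<Longrightarrow> x - y \<in> hpow sW n"
  unfolding hpow_def by (auto simp flip: scale_right_diff_distrib)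

lemma hpow_scale [intro]: "x \<in> hpow sW n \<Longrightarrow> sW c x \<in> hpow sW n"
  unfolding hpow_def by (metis (no_types, lifting) imageE rangeI scale_left_commute)

lemma hpow_sum [intro]: "(\<And>i. i \<in> A \<Longrightarrow> g i \<in> hpow sW n) \<Longrightarrow> sum g A \<in> hpow sW n"
  by (induction A rule: infinite_finite_induct) auto

lemma hpow_antimono: "x \<in> hpow sW n \<Longrightarrow> m \<le> n \<Longrightarrow> x \<in> hpow sW m"
proof -
  assume "x \<in> hpow sW n" "m \<le> n"
  then obtain y where "x = sW (fps_X ^ n) y" by (auto simp: hpow_def)
  hence "x = sW (fps_X ^ m) (sW (fps_X ^ (n - m)) y)"
    using \<open>m \<le> n\<close> by (simp flip: power_add)
  thus ?thesis unfolding hpow_def by blast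
qed

lemma hpow_scale_left:
  assumes "\<And>k. k < n \<Longrightarrow> c $ k = 0"
  shows "sW c x \<in> hpow sW n"
proof -
  have "c = fps_X ^ n * fps_shift n c"
    using assms by (intro fps_ext) (auto simp: fps_X_power_mult_nth)
  hence "sW c x = sW (fps_X ^ n) (sW (fps_shift n c) x)" by simp
  thus ?thesis unfolding hpow_def by blast
qed

lemma hpow_diff_trans:
  "x - y \<in> hpow sW n \<Longrightarrow> y - z \<in> hpow sW n \<Longrightarrow> x - z \<in> hpow sW n"
  using hpow_add[of "x - y" n "y - z"] by simp

lemma hpow_eqI: "(\<And>n. x - y \<in> hpow sW n) \<Longrightarrow> x = y"
  using separated[of "x - y"] by simp

definition hsummable :: "('i \<Rightarrow> 'w) \<Rightarrow> 'i set \<Rightarrow> bool" where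
  "hsummable g A \<longleftrightarrow> (\<forall>n. finite {i\<in>A. g i \<notin> hpow sW n})"

text \<open>
  Outside a finite set the individual terms are divisible by \<open>h\<^sup>n\<close>, since two neighbouring partial
  sums differ by one term. A single partial sum then determines the value modulo \<open>h\<^sup>n\<close>.
\<close>
lemma has_hsum_iff:
  "has_hsum sW g A x \<longleftrightarrow>
     (\<forall>n. \<exists>F. finite F \<and> F \<subseteq> A \<and> (\<forall>i\<in>A - F. g i \<in> hpow sW n) \<and> x - sum g F \<in> hpow sW n)"
  (is "_ \<longleftrightarrow> ?R")
proof
  assume h: "has_hsum sW g A x"
  show ?R
  proof
    fix n
    obtain F where F: "finite F" "F \<subseteq> A"
      "\<forall>G. finite G \<and> F \<subseteq> G \<and> G \<subseteq> A \<longrightarrow> x - sum g G \<in> hpow sW n"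
      using spec[OF h[unfolded has_hsum_def], of n] by (elim exE conjE) (rule that)
    have "g i \<in> hpow sW n" if "i \<in> A - F" for i
    proof -
      have "x - sum g F \<in> hpow sW n" "x - sum g (insert i F) \<in> hpow sW n"
        using F(3)[rule_format, of F] F(3)[rule_format, of "insert i F"] F(1,2) that
        by (simp_all add: subset_insertI)
      hence "(x - sum g F) - (x - sum g (insert i F)) \<in> hpow sW n" by (rule hpow_diff)
      thus ?thesis using that F(1) by simp
    qed
    thus "\<exists>F. finite F \<and> F \<subseteq> A \<and> (\<forall>i\<in>A - F. g i \<in> hpow sW n) \<and> x - sum g F \<in> hpow sW n"
      using F(1,2) F(3)[rule_format, of F] by (intro exI[of _ F]) simp
  qed
next
  assume r: ?R
  show "has_hsum sW g A x"
    unfolding has_hsum_def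
  proof
    fix n
    obtain F where F: "finite F" "F \<subseteq> A" "\<forall>i\<in>A - F. g i \<in> hpow sW n" "x - sum g F \<in> hpow sW n"
      using spec[OF r, of n] by (elim exE conjE) (rule that)
    have "x - sum g G \<in> hpow sW n" if "finite G" "F \<subseteq> G" "G \<subseteq> A" for G
    proof -
      have "sum g G = sum g F + sum g (G - F)"
        using that F(1) by (metis add.commute sum.subset_diff)
      moreover have "sum g (G - F) \<in> hpow sW n" using F that by (intro hpow_sum) auto
      ultimately show ?thesis using hpow_diff[OF F(4), of "sum g (G - F)"]
        by (simp add: algebra_simps)
    qed
    thus "\<exists>F. finite F \<and> F \<subseteq> A \<and> (\<forall>G. finite G \<and> F \<subseteq> G \<and> G \<subseteq> A \<longrightarrow> x - sum g G \<in> hpow sW n)"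
      using F(1,2) by (intro exI[of _ F]) simp
  qed
qed

lemma has_hsum_imp_hsummable: "has_hsum sW g A x \<Longrightarrow> hsummable g A"
  unfolding has_hsum_iff hsummable_def
proof
  fix n assume "\<forall>n. \<exists>F. finite F \<and> F \<subseteq> A \<and> (\<forall>i\<in>A - F. g i \<in> hpow sW n) \<and> x - sum g F \<in> hpow sW n"
  then obtain F where F: "finite F" "\<forall>i\<in>A - F. g i \<in> hpow sW n" by blast
  have "{i \<in> A. g i \<notin> hpow sW n} \<subseteq> F" using F(2) by blast
  with F(1) show "finite {i \<in> A. g i \<notin> hpow sW n}" by (rule finite_subset[rotated])
qed

lemma has_hsum_partial:
  assumes "has_hsum sW g A x" "finite G" "G \<subseteq> A" "\<And>i. i \<in> A - G \<Longrightarrow> g i \<in> hpow sW n"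
  shows "x - sum g G \<in> hpow sW n"
proof -
  obtain F where F: "finite F" "F \<subseteq> A" "\<forall>i\<in>A - F. g i \<in> hpow sW n" "x - sum g F \<in> hpow sW n"
    using spec[OF assms(1)[unfolded has_hsum_iff], of n] by (elim exE conjE) (rule that)
  have "sum g F - sum g G = sum g (F - G) - sum g (G - F)"
    using sum.Int_Diff[OF F(1), of g G] sum.Int_Diff[OF assms(2), of g F]
    by (simp add: Int_commute)
  moreover have "sum g (F - G) \<in> hpow sW n" "sum g (G - F) \<in> hpow sW n"
    using F assms by (auto intro!: hpow_sum)
  ultimately have "sum g F - sum g G \<in> hpow sW n" by (metis hpow_diff)
  with F(4) show ?thesis by (rule hpow_diff_trans)
qed

lemma hsummable_finite: "hsummable g A \<Longrightarrow> finite {i\<in>A. g i \<notin> hpow sW n}"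
  unfolding hsummable_def by (rule spec)

lemma has_hsum_partial':
  assumes "has_hsum sW g A x"
  shows "x - sum g {i\<in>A. g i \<notin> hpow sW n} \<in> hpow sW n"
  by (rule has_hsum_partial[OF assms hsummable_finite[OF has_hsum_imp_hsummable[OF assms]]]) blast+

lemma has_hsum_unique:
  assumes "has_hsum sW g A x" "has_hsum sW g A y"
  shows "x = y"
proof (rule hpow_eqI)
  fix n
  from hpow_diff[OF has_hsum_partial'[OF assms(1)] has_hsum_partial'[OF assms(2)]]
  show "x - y \<in> hpow sW n" by (simp only: diff_diff_eq2 diff_add_cancel)
qed

lemma hsum_eqI: "has_hsum sW g A x \<Longrightarrow> hsum sW g A = x"
  unfolding hsum_def using has_hsum_unique by blast

text \<open>
  The partial sums over the finite sets of terms outside \<open>h\<^sup>n W\<close> form a Cauchy sequence.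
\<close>
lemma has_hsum_hsum:
  assumes "hsummable g A"
  shows "has_hsum sW g A (hsum sW g A)"
proof -
  define F where "F n = {i\<in>A. g i \<notin> hpow sW n}" for n
  have fin: "finite (F n)" for n using assms by (auto simp: hsummable_def F_def)
  have sub: "F n \<subseteq> F (Suc n)" for n
    unfolding F_def using hpow_antimono[of _ "Suc n" n] by auto
  have "sum g (F (Suc n)) - sum g (F n) \<in> hpow sW n" for n
  proof -
    have "sum g (F (Suc n)) - sum g (F n) = sum g (F (Suc n) - F n)"
      using fin sub by (simp add: sum_diff)
    also have "\<dots> \<in> hpow sW n" by (intro hpow_sum) (auto simp: F_def)
    finally show ?thesis .
  qed
  then obtain x where x: "\<And>n. x - sum g (F n) \<in> hpow sW n"
    using complete[of "\<lambda>n. sum g (F n)"] by auto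
  have "has_hsum sW g A x"
    unfolding has_hsum_iff
  proof
    fix n show "\<exists>F. finite F \<and> F \<subseteq> A \<and> (\<forall>i\<in>A - F. g i \<in> hpow sW n) \<and> x - sum g F \<in> hpow sW n"
      by (rule exI[of _ "F n"]) (use fin x in \<open>auto simp: F_def\<close>)
  qed
  thus ?thesis using hsum_eqI by metis
qed

lemma hsum_in_hpow:
  assumes "has_hsum sW g A x" "\<And>i. i \<in> A \<Longrightarrow> g i \<in> hpow sW n"
  shows "x \<in> hpow sW n"
  using has_hsum_partial[OF assms(1), of "{}" n] assms(2) by simp

lemma has_hsum_finite: "finite A \<Longrightarrow> has_hsum sW g A (sum g A)"
  unfolding has_hsum_iff by (intro allI exI[of _ A]) auto

lemma has_hsum_support:
  assumes "has_hsum sW g B x" "B \<subseteq> A" "\<And>i. i \<in> A - B \<Longrightarrow> g i = 0"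
  shows "has_hsum sW g A x"
  unfolding has_hsum_iff
proof
  fix n
  obtain F where F: "finite F" "F \<subseteq> B" "\<forall>i\<in>B - F. g i \<in> hpow sW n" "x - sum g F \<in> hpow sW n"
    using spec[OF assms(1)[unfolded has_hsum_iff], of n] by (elim exE conjE) (rule that)
  have "g i \<in> hpow sW n" if "i \<in> A - F" for i
    using F(3) assms(3)[of i] that by (cases "i \<in> B") auto
  thus "\<exists>F. finite F \<and> F \<subseteq> A \<and> (\<forall>i\<in>A - F. g i \<in> hpow sW n) \<and> x - sum g F \<in> hpow sW n"
    using F assms(2) by (intro exI[of _ F]) auto
qed

lemma has_hsum_finite_support:
  assumes "finite F" "F \<subseteq> A" "\<And>i. i \<in> A - F \<Longrightarrow> g i = 0"
  shows "has_hsum sW g A (sum g F)"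
  using has_hsum_support[OF has_hsum_finite] assms by blast

lemma has_hsum_cong:
  "(\<And>i. i \<in> A \<Longrightarrow> f i = g i) \<Longrightarrow> has_hsum sW f A x \<longleftrightarrow> has_hsum sW g A x"
proof -
  assume fg: "\<And>i. i \<in> A \<Longrightarrow> f i = g i"
  have "sum f G = sum g G" if "G \<subseteq> A" for G using fg that by (intro sum.cong) auto
  hence "x - sum f G = x - sum g G" if "G \<subseteq> A" for G using that by simp
  thus ?thesis unfolding has_hsum_def by (metis (no_types, lifting))
qed

lemma has_hsum_reindex:
  assumes "inj_on f A"
  shows "has_hsum sW g (f ` A) x \<longleftrightarrow> has_hsum sW (\<lambda>i. g (f i)) A x"
proof
  assume h: "has_hsum sW g (f ` A) x"
  show "has_hsum sW (\<lambda>i. g (f i)) A x" unfolding has_hsum_iff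
  proof
    fix n
    obtain F where F: "finite F" "F \<subseteq> f ` A" "\<forall>i\<in>f ` A - F. g i \<in> hpow sW n" "x - sum g F \<in> hpow sW n"
      using spec[OF h[unfolded has_hsum_iff], of n] by (elim exE conjE) (rule that)
    obtain G where G: "G \<subseteq> A" "F = f ` G" using F(2) by (auto simp: subset_image_iff)
    have inj: "inj_on f G" using G assms inj_on_subset by blast
    have "finite G" using F(1) G inj by (simp add: finite_image_iff)
    moreover have "sum g F = (\<Sum>i\<in>G. g (f i))" using G inj by (simp add: sum.reindex)
    moreover have "\<forall>i\<in>A - G. g (f i) \<in> hpow sW n"
      using F(3) G assms by (auto dest: inj_onD)
    ultimately show "\<exists>F. finite F \<and> F \<subseteq> A \<and> (\<forall>i\<in>A - F. g (f i) \<in> hpow sW n) \<and>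
        x - (\<Sum>i\<in>F. g (f i)) \<in> hpow sW n"
      using F(4) G(1) by auto
  qed
next
  assume h: "has_hsum sW (\<lambda>i. g (f i)) A x"
  show "has_hsum sW g (f ` A) x" unfolding has_hsum_iff
  proof
    fix n
    obtain G where G: "finite G" "G \<subseteq> A" "\<forall>i\<in>A - G. g (f i) \<in> hpow sW n"
      "x - (\<Sum>i\<in>G. g (f i)) \<in> hpow sW n"
      using spec[OF h[unfolded has_hsum_iff], of n] by (elim exE conjE) (rule that)
    have inj: "inj_on f G" using G assms inj_on_subset by blast
    have "sum g (f ` G) = (\<Sum>i\<in>G. g (f i))" using G inj by (simp add: sum.reindex)
    thus "\<exists>F. finite F \<and> F \<subseteq> f ` A \<and> (\<forall>i\<in>f ` A - F. g i \<in> hpow sW n) \<and>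
        x - sum g F \<in> hpow sW n"
      using G by (intro exI[of _ "f ` G"]) auto
  qed
qed

lemma has_hsum_add:
  assumes "has_hsum sW f A x" "has_hsum sW g A y"
  shows "has_hsum sW (\<lambda>i. f i + g i) A (x + y)"
  unfolding has_hsum_def
proof
  fix n
  obtain F where F: "finite F" "F \<subseteq> A" "\<forall>G. finite G \<and> F \<subseteq> G \<and> G \<subseteq> A \<longrightarrow> x - sum f G \<in> hpow sW n"
    using spec[OF assms(1)[unfolded has_hsum_def], of n] by (elim exE conjE) (rule that)
  obtain F' where F': "finite F'" "F' \<subseteq> A"
    "\<forall>G. finite G \<and> F' \<subseteq> G \<and> G \<subseteq> A \<longrightarrow> y - sum g G \<in> hpow sW n"
    using spec[OF assms(2)[unfolded has_hsum_def], of n] by (elim exE conjE) (rule that)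
  have "(x + y) - (\<Sum>i\<in>G. f i + g i) \<in> hpow sW n" if "finite G" "F \<union> F' \<subseteq> G" "G \<subseteq> A" for G
  proof -
    have "x - sum f G \<in> hpow sW n" "y - sum g G \<in> hpow sW n"
      using F(3)[rule_format, of G] F'(3)[rule_format, of G] that by auto
    hence "(x - sum f G) + (y - sum g G) \<in> hpow sW n" by (rule hpow_add)
    thus ?thesis by (simp add: sum.distrib algebra_simps)
  qed
  thus "\<exists>F. finite F \<and> F \<subseteq> A \<and>
     (\<forall>G. finite G \<and> F \<subseteq> G \<and> G \<subseteq> A \<longrightarrow> x + y - (\<Sum>i\<in>G. f i + g i) \<in> hpow sW n)"
    using F(1,2) F'(1,2) by (intro exI[of _ "F \<union> F'"]) simp
qed

lemma has_hsum_zero: "has_hsum sW (\<lambda>i. 0) A 0"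
  using has_hsum_finite_support[of "{}" A "\<lambda>_. 0"] by simp

lemma has_hsum_sum:
  assumes "\<And>k. k \<in> K \<Longrightarrow> has_hsum sW (f k) A (x k)"
  shows "has_hsum sW (\<lambda>i. \<Sum>k\<in>K. f k i) A (\<Sum>k\<in>K. x k)"
  using assms by (induction K rule: infinite_finite_induct) (auto intro!: has_hsum_zero has_hsum_add)

lemma has_hsum_disjoint_union:
  assumes "has_hsum sW g A x" "has_hsum sW g B y" "A \<inter> B = {}"
  shows "has_hsum sW g (A \<union> B) (x + y)"
proof -
  have "has_hsum sW (\<lambda>i. if i \<in> A then g i else 0) A x"
    using assms(1) by (subst has_hsum_cong[of _ _ g]) auto
  hence 1: "has_hsum sW (\<lambda>i. if i \<in> A then g i else 0) (A \<union> B) x"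
    by (rule has_hsum_support) auto
  have "has_hsum sW (\<lambda>i. if i \<in> B then g i else 0) B y"
    using assms(2) by (subst has_hsum_cong[of _ _ g]) auto
  hence 2: "has_hsum sW (\<lambda>i. if i \<in> B then g i else 0) (A \<union> B) y"
    by (rule has_hsum_support) auto
  show ?thesis
    using has_hsum_add[OF 1 2] assms(3) by (subst (asm) has_hsum_cong[of _ _ g]) auto
qed

lemma hsummable_Sigma_slice:
  assumes "hsummable (\<lambda>(i, j). g i j) (Sigma A B)" "i \<in> A"
  shows "hsummable (g i) (B i)"
  unfolding hsummable_def
proof
  fix n
  have "finite {p \<in> Sigma A B. (case p of (i, j) \<Rightarrow> g i j) \<notin> hpow sW n}" (is "finite ?X")
    using assms(1) by (simp add: hsummable_def)
  hence "finite (snd ` ?X)" by (rule finite_imageI)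
  moreover have "{j \<in> B i. g i j \<notin> hpow sW n} \<subseteq> snd ` ?X"
    using assms(2) by force
  ultimately show "finite {j \<in> B i. g i j \<notin> hpow sW n}" by (rule rev_finite_subset)
qed

text \<open>
  Modulo \<open>h\<^sup>n\<close> only finitely many pairs contribute, hence only finitely many outer indices, and for
  those the inner sums are finite.
\<close>
lemma has_hsum_Sigma:
  assumes "has_hsum sW (\<lambda>(i, j). g i j) (Sigma A B) x"
  shows "has_hsum sW (\<lambda>i. hsum sW (g i) (B i)) A x"
  unfolding has_hsum_iff
proof
  fix n
  let ?X = "{p \<in> Sigma A B. (case p of (i, j) \<Rightarrow> g i j) \<notin> hpow sW n}"
  have summ: "hsummable (\<lambda>(i, j). g i j) (Sigma A B)" using assms by (rule has_hsum_imp_hsummable)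
  hence fin: "finite ?X" by (simp add: hsummable_def)
  have hs: "has_hsum sW (g i) (B i) (hsum sW (g i) (B i))" if "i \<in> A" for i
    using hsummable_Sigma_slice[OF summ that] by (rule has_hsum_hsum)
  let ?F = "fst ` ?X"
  let ?S = "\<lambda>i. {j \<in> B i. g i j \<notin> hpow sW n}"
  have finS: "finite (?S i)" if "i \<in> A" for i
    using hsummable_Sigma_slice[OF summ that] by (simp add: hsummable_def)
  have out: "hsum sW (g i) (B i) \<in> hpow sW n" if "i \<in> A - ?F" for i
  proof (rule hsum_in_hpow[OF hs])
    show "i \<in> A" using that by simp
    fix j assume "j \<in> B i"
    thus "g i j \<in> hpow sW n" using that by force
  qed
  have "?X = Sigma ?F ?S" by force
  moreover have "sum (\<lambda>(i, j). g i j) (Sigma ?F ?S) = (\<Sum>i\<in>?F. \<Sum>j\<in>?S i. g i j)"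
    by (rule sum.Sigma[symmetric]) (use fin finS in auto)
  ultimately have 1: "sum (\<lambda>(i, j). g i j) ?X = (\<Sum>i\<in>?F. \<Sum>j\<in>?S i. g i j)" by simp
  have "(\<Sum>i\<in>?F. \<Sum>j\<in>?S i. g i j) - (\<Sum>i\<in>?F. hsum sW (g i) (B i)) \<in> hpow sW n"
  proof -
    have "(\<Sum>j\<in>?S i. g i j) - hsum sW (g i) (B i) \<in> hpow sW n" if "i \<in> ?F" for i
    proof -
      have "i \<in> A" using that by auto
      hence "hsum sW (g i) (B i) - (\<Sum>j\<in>?S i. g i j) \<in> hpow sW n"
        by (intro has_hsum_partial[OF hs]) (use finS in auto)
      from hpow_neg[OF this] show ?thesis by simp
    qed
    thus ?thesis by (simp flip: sum_subtractf add: hpow_sum)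
  qed
  moreover have "x - sum (\<lambda>(i, j). g i j) ?X \<in> hpow sW n"
    by (rule has_hsum_partial[OF assms]) (use fin in auto)
  ultimately have "x - (\<Sum>i\<in>?F. hsum sW (g i) (B i)) \<in> hpow sW n"
    unfolding 1 using hpow_diff_trans by blast
  thus "\<exists>F. finite F \<and> F \<subseteq> A \<and> (\<forall>i\<in>A - F. hsum sW (g i) (B i) \<in> hpow sW n) \<and>
      x - (\<Sum>i\<in>F. hsum sW (g i) (B i)) \<in> hpow sW n"
    using fin out by (intro exI[of _ ?F]) auto
qed

lemma has_hsum_scalars:
  assumes "\<And>k. finite {i\<in>A. g i $ k \<noteq> 0}"
    and "\<And>k. c $ k = (\<Sum>i\<in>{i\<in>A. g i $ k \<noteq> 0}. g i $ k)"
  shows "has_hsum sW (\<lambda>i. sW (g i) x) A (sW c x)"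
  unfolding has_hsum_iff
proof
  fix n
  let ?F = "\<Union>k<n. {i\<in>A. g i $ k \<noteq> 0}"
  have "sW c x - (\<Sum>i\<in>?F. sW (g i) x) = sW (c - sum g ?F) x"
    by (simp add: scale_left_diff_distrib scale_sum_left)
  also have "\<dots> \<in> hpow sW n"
  proof (rule hpow_scale_left)
    fix k assume k: "k < n"
    have "(\<Sum>i\<in>{i\<in>A. g i $ k \<noteq> 0}. g i $ k) = (\<Sum>i\<in>?F. g i $ k)"
      by (rule sum.mono_neutral_left) (use assms(1) k in auto)
    thus "(c - sum g ?F) $ k = 0" using assms(2) by (simp add: fps_sum_nth)
  qed
  finally have "sW c x - (\<Sum>i\<in>?F. sW (g i) x) \<in> hpow sW n" .
  moreover have "sW (g i) x \<in> hpow sW n" if "i \<in> A - ?F" for i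
    using that by (intro hpow_scale_left) auto
  ultimately show "\<exists>F. finite F \<and> F \<subseteq> A \<and> (\<forall>i\<in>A - F. sW (g i) x \<in> hpow sW n) \<and>
      sW c x - (\<Sum>i\<in>F. sW (g i) x) \<in> hpow sW n"
    using assms(1) by (intro exI[of _ ?F]) auto
qed

end

text \<open>
  A linear map is continuous because it maps \<open>h\<^sup>n W\<close> to \<open>h\<^sup>n V\<close>.
\<close>
lemma has_hsum_map:
  assumes "hadic sW" "hadic sV" "has_hsum sW g A x"
    and add: "\<And>x y. f (x + y) = f x + f y"
    and scale: "\<And>c x. f (sW c x) = sV c (f x)"
  shows "has_hsum sV (\<lambda>i. f (g i)) A (f x)"
proof -
  interpret W: hadic sW by fact
  interpret V: hadic sV by fact
  interpret f: additive f by standard (rule add)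
  have hp: "f y \<in> hpow sV n" if "y \<in> hpow sW n" for y n
    using that unfolding hpow_def by (auto simp: scale)
  show ?thesis unfolding V.has_hsum_iff
  proof
    fix n
    obtain F where F: "finite F" "F \<subseteq> A" "\<forall>i\<in>A - F. g i \<in> hpow sW n" "x - sum g F \<in> hpow sW n"
      using spec[OF assms(3)[unfolded W.has_hsum_iff], of n] by (elim exE conjE) (rule that)
    have "f x - (\<Sum>i\<in>F. f (g i)) = f (x - sum g F)" by (simp add: f.diff f.sum)
    thus "\<exists>F. finite F \<and> F \<subseteq> A \<and> (\<forall>i\<in>A - F. f (g i) \<in> hpow sV n) \<and>
      f x - (\<Sum>i\<in>F. f (g i)) \<in> hpow sV n"
      using F hp by metis
  qed
qed

lemma (in hadic) has_hsum_scale: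
  assumes "has_hsum sW g A x"
  shows "has_hsum sW (\<lambda>i. sW c (g i)) A (sW c x)"
  by (rule has_hsum_map[OF hadic_axioms hadic_axioms assms]) (simp_all add: scale_right_distrib mult.commute)

text \<open>
  In the coordinates \<open>\<phi>\<close> the multiples of \<open>h\<^sup>n\<close> are the elements whose first \<open>n\<close> coordinates vanish;
  separatedness and completeness are then those of sequences.
\<close>
lemma hadic_topologically_free:
  assumes "topologically_free sW"
  shows "hadic sW"
proof -
  from assms obtain V0 and \<phi> :: "'a \<Rightarrow> nat \<Rightarrow> 'a"
    where m: "module sW" and bij: "bij_betw \<phi> UNIV {g. range g \<subseteq> V0}"
      and add: "\<And>v w n. \<phi> (v + w) n = \<phi> v n + \<phi> w n"
      and sc: "\<And>x w n. \<phi> (sW x w) n = (\<Sum>k\<le>n. sW (fps_const (x $ k)) (\<phi> w (n - k)))"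
    unfolding topologically_free_def by blast
  interpret module sW by (rule m)
  have zero: "\<phi> 0 n = 0" for n using add[of 0 0 n] by simp
  have diff: "\<phi> (v - w) n = \<phi> v n - \<phi> w n" for v w n
    using add[of "v - w" w n] by simp
  have inj: "v = w" if "\<And>n. \<phi> v n = \<phi> w n" for v w
    using bij ext[of "\<phi> v" "\<phi> w", OF that] by (simp add: bij_betw_def inj_eq)
  have surj: "\<exists>v. \<phi> v = g" if "range g \<subseteq> V0" for g
  proof -
    have "g \<in> \<phi> ` UNIV" using bij that by (simp add: bij_betw_def)
    thus ?thesis by blast
  qed
  have inV: "\<phi> v n \<in> V0" for v n
  proof -
    have "\<phi> v \<in> {g. range g \<subseteq> V0}" using bij by (metis UNIV_I bij_betwE)
    thus ?thesis by blast
  qed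
  have shift: "\<phi> (sW (fps_X ^ n) w) k = (if k < n then 0 else \<phi> w (k - n))" for n w k
  proof -
    have "\<phi> (sW (fps_X ^ n) w) k = (\<Sum>j\<le>k. if j = n then \<phi> w (k - j) else 0)"
      unfolding sc by (intro sum.cong) (auto simp: fps_X_power_nth)
    thus ?thesis by (auto simp: sum.delta)
  qed
  have hp: "v \<in> hpow sW n \<longleftrightarrow> (\<forall>k<n. \<phi> v k = 0)" for v n
  proof
    assume "v \<in> hpow sW n" thus "\<forall>k<n. \<phi> v k = 0" by (auto simp: hpow_def shift)
  next
    assume v: "\<forall>k<n. \<phi> v k = 0"
    obtain w where w: "\<phi> w = (\<lambda>k. \<phi> v (k + n))" using surj[of "\<lambda>k. \<phi> v (k + n)"] inV by auto
    have "v = sW (fps_X ^ n) w" by (rule inj) (use v w in \<open>auto simp: shift\<close>)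
    thus "v \<in> hpow sW n" by (auto simp: hpow_def)
  qed
  show ?thesis
  proof
    fix x assume "\<And>n. x \<in> hpow sW n"
    hence "\<phi> x n = \<phi> 0 n" for n using hp[of x "Suc n"] zero by simp
    thus "x = 0" by (rule inj)
  next
    fix f assume f: "\<And>n. f (Suc n) - f n \<in> hpow sW n"
    obtain x where x: "\<phi> x = (\<lambda>k. \<phi> (f (Suc k)) k)"
      using surj[of "\<lambda>k. \<phi> (f (Suc k)) k"] inV by auto
    have stable: "\<phi> (f n) k = \<phi> (f (Suc k)) k" if "Suc k \<le> n" for n k
      using that
    proof (induction n rule: dec_induct)
      case (step n)
      thus ?case using f[of n] by (auto simp: hp diff)
    qed simp
    have "\<phi> (x - f n) k = 0" if "k < n" for n k
      using stable[of k n] that by (simp only: diff x Suc_le_eq) simp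
    hence "\<forall>n. x - f n \<in> hpow sW n" using hp by blast
    thus "\<exists>x. \<forall>n. x - f n \<in> hpow sW n" by blast
  qed
qed

section \<open>Homomorphisms and substitution into rational functions\<close>

locale rhom =
  fixes \<phi> :: "'a::comm_ring_1 \<Rightarrow> 'b::comm_ring_1"
  assumes hom_add: "\<phi> (x + y) = \<phi> x + \<phi> y"
    and mult: "\<phi> (x * y) = \<phi> x * \<phi> y"
    and one: "\<phi> 1 = 1"
begin

sublocale additive \<phi> by standard (rule hom_add)

lemma power: "\<phi> (x ^ n) = \<phi> x ^ n"
  by (induction n) (auto simp: one mult)

lemma prod: "\<phi> (prod g A) = (\<Prod>i\<in>A. \<phi> (g i))"
  by (induction A rule: infinite_finite_induct) (auto simp: one mult)

lemmas hom = add mult one zero minus diff power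

end

lemma rhom_comp: "rhom \<phi> \<Longrightarrow> rhom \<psi> \<Longrightarrow> rhom (\<lambda>x. \<psi> (\<phi> x))"
  unfolding rhom_def by simp

locale fhom = rhom \<phi> for \<phi> :: "'a::field \<Rightarrow> 'b::field"
begin

lemma eq_0_iff: "\<phi> x = 0 \<longleftrightarrow> x = 0"
proof
  assume "\<phi> x = 0"
  show "x = 0"
  proof (rule ccontr)
    assume "x \<noteq> 0"
    hence "\<phi> x * \<phi> (inverse x) = 1" by (simp flip: mult add: one)
    thus False using \<open>\<phi> x = 0\<close> by simp
  qed
qed (simp add: zero)

lemma inj: "inj \<phi>"
proof (rule injI)
  fix x y assume "\<phi> x = \<phi> y"
  hence "\<phi> (x - y) = 0" by (simp add: diff)
  thus "x = y" by (simp add: eq_0_iff)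
qed

lemma inverse: "\<phi> (inverse x) = inverse (\<phi> x)"
proof (cases "x = 0")
  case False
  hence "\<phi> x * \<phi> (inverse x) = 1" by (simp flip: mult add: one)
  thus ?thesis by (simp add: inverse_unique)
qed (simp add: zero)

lemma divide: "\<phi> (x / y) = \<phi> x / \<phi> y"
  by (simp add: divide_inverse mult inverse)

end

lemma fhomI: "rhom \<phi> \<Longrightarrow> fhom \<phi>" by (simp add: fhom_def)

lemma rhom_poly_eval:
  assumes "fhom e"
  shows "rhom (\<lambda>p. poly (map_poly e p) x)"
proof -
  interpret e: fhom e by fact
  have pc: "poly (map_poly e (pCons c p)) x = e c + x * poly (map_poly e p) x" for c p
    by (subst map_poly_pCons) (auto simp: e.zero)
  have sm: "poly (map_poly e (smult c p)) x = e c * poly (map_poly e p) x" for c p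
    by (induction p) (auto simp: pc e.mult e.zero algebra_simps)
  have ad: "poly (map_poly e (p + q)) x = poly (map_poly e p) x + poly (map_poly e q) x" for p q
    by (induction p q rule: poly_induct2) (auto simp: pc e.add algebra_simps)
  show ?thesis
  proof
    show "poly (map_poly e (p + q)) x = poly (map_poly e p) x + poly (map_poly e q) x" for p q by (rule ad)
    show "poly (map_poly e (p * q)) x = poly (map_poly e p) x * poly (map_poly e q) x" for p q
      by (induction p) (auto simp: pc ad sm e.zero algebra_simps)
    show "poly (map_poly e 1) x = 1" by (simp add: e.one)
  qed
qed

text \<open>
  Substitution of \<open>x\<close> into rational functions. As polynomials over \<open>\<complex>\<close> split into linear factors, \<open>x\<close>
  is transcendental over \<open>\<complex>\<close> as soon as it is not a constant.
\<close>
locale transcendental_subst = e: fhom e for e :: "complex \<Rightarrow> 'f::field" +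
  fixes x :: 'f
  assumes transcendental: "x \<notin> range e"
begin

definition ev :: "complex poly \<Rightarrow> 'f" where "ev p = poly (map_poly e p) x"

sublocale ev: rhom ev
  unfolding ev_def[abs_def] by (rule rhom_poly_eval) (rule e.fhom_axioms)

lemma ev_pCons: "ev (pCons c p) = e c + x * ev p"
  unfolding ev_def by (subst map_poly_pCons) (auto simp: e.zero)

lemma ev_nonzero: "p \<noteq> 0 \<Longrightarrow> ev p \<noteq> 0"
proof (induction "degree p" arbitrary: p rule: less_induct)
  case less
  show ?case
  proof (cases "degree p = 0")
    case True
    then obtain c where "p = [:c:]" using degree_eq_zeroE by blast
    thus ?thesis using less.prems by (simp add: ev_pCons ev.zero e.eq_0_iff)
  next
    case False
    hence "\<not> constant (poly p)" by (simp add: constant_degree)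
    then obtain a where "poly p a = 0" using fundamental_theorem_of_algebra by blast
    hence "[:- a, 1:] dvd p" by (simp only: poly_eq_0_iff_dvd)
    then obtain q where q: "p = [:- a, 1:] * q" by (elim dvdE)
    hence q0: "q \<noteq> 0" using less.prems by auto
    have "degree p = degree [:- a, 1:] + degree q"
      unfolding q using q0 by (intro degree_mult_eq) auto
    hence "ev q \<noteq> 0" using less.hyps[of q] q0 by simp
    moreover have "ev [:- a, 1:] = x - e a" by (simp add: ev_pCons ev.zero e.minus e.one)
    moreover have "x - e a \<noteq> 0" using transcendental by auto
    ultimately show ?thesis unfolding q ev.mult by simp
  qed
qed

lemma rat_subst_Fract:
  assumes "d \<noteq> 0"
  shows "rat_subst e x (Fract n d) = ev n / ev d"
  unfolding rat_subst_def ev_def[symmetric]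
proof (rule the_equality)
  show "\<exists>n' d'. d' \<noteq> 0 \<and> Fract n d = Fract n' d' \<and> ev d' \<noteq> 0 \<and> ev n / ev d = ev n' / ev d'"
    using assms ev_nonzero by blast
next
  fix y assume "\<exists>n' d'. d' \<noteq> 0 \<and> Fract n d = Fract n' d' \<and> ev d' \<noteq> 0 \<and> y = ev n' / ev d'"
  then obtain n' d' where *: "d' \<noteq> 0" "Fract n d = Fract n' d'" "y = ev n' / ev d'" by blast
  hence "n * d' = n' * d" using assms by (simp add: eq_fract)
  hence "ev n * ev d' = ev n' * ev d" by (simp flip: ev.mult)
  moreover have "ev d \<noteq> 0" "ev d' \<noteq> 0" using assms *(1) by (simp_all add: ev_nonzero)
  ultimately show "y = ev n / ev d" unfolding *(3) by (simp add: frac_eq_eq)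
qed

sublocale r: fhom "rat_subst e x"
proof
  fix r s :: ratfun
  obtain a b where r: "r = Fract a b" "b \<noteq> 0" by (cases r)
  obtain c d where s: "s = Fract c d" "d \<noteq> 0" by (cases s)
  show "rat_subst e x (r + s) = rat_subst e x r + rat_subst e x s"
    using r s ev_nonzero by (simp add: rat_subst_Fract ev.add ev.mult field_simps)
  show "rat_subst e x (r * s) = rat_subst e x r * rat_subst e x s"
    using r s by (simp add: rat_subst_Fract ev.mult)
  show "rat_subst e x 1 = 1"
    by (simp add: One_fract_def rat_subst_Fract ev.one)
qed

lemma rat_subst_cz: "rat_subst e x (cz c) = e c"
  by (simp add: cz_def to_fract_def rat_subst_Fract ev_pCons ev.zero ev.one)

lemma rat_subst_zvar: "rat_subst e x zvar = x"
  by (simp add: zvar_def to_fract_def rat_subst_Fract ev_pCons ev.zero ev.one e.zero e.one)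

end

text \<open>
  Two ways of expanding rational functions are compared by means of this lemma: it suffices to
  compare them on constants and on \<open>z\<close>.
\<close>
lemma rhom_ratfun_unique:
  fixes \<phi> \<psi> :: "ratfun \<Rightarrow> 'f::field"
  assumes "rhom \<phi>" "rhom \<psi>" "\<And>c. \<phi> (cz c) = \<psi> (cz c)" "\<phi> zvar = \<psi> zvar"
  shows "\<phi> r = \<psi> r"
proof -
  interpret \<phi>: fhom \<phi> using assms(1) by (rule fhomI)
  interpret \<psi>: fhom \<psi> using assms(2) by (rule fhomI)
  have p: "\<phi> (to_fract p) = \<psi> (to_fract p)" for p
  proof (induction p)
    case (pCons a p)
    have "to_fract (pCons a p) = cz a + zvar * to_fract p"
      by (simp add: cz_def zvar_def flip: to_fract_add to_fract_mult)
    thus ?case using pCons assms(3,4) by (simp add: \<phi>.add \<phi>.mult \<psi>.add \<psi>.mult)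
  qed (simp add: \<phi>.zero \<psi>.zero)
  obtain a b where r: "r = Fract a b" "b \<noteq> 0" by (cases r)
  show ?thesis unfolding r Fract_conv_to_fract by (simp add: \<phi>.divide \<psi>.divide p)
qed

lemma cz_rhom: "rhom cz"
  by standard (simp_all add: cz_def one_pCons flip: to_fract_add to_fract_mult to_fract_1)

lemma fls_const_rhom: "rhom (fls_const :: 'a::comm_ring_1 \<Rightarrow> 'a fls)"
  by standard (simp_all add: fls_plus_const)

lemma fps_to_fls_rhom: "rhom (fps_to_fls :: 'a::comm_ring_1 fps \<Rightarrow> 'a fls)"
  by standard (simp_all add: fls_times_fps_to_fls)

lemma zvar_not_const: "zvar \<notin> range cz" "- zvar \<notin> range cz" "zvar ^ 2 \<notin> range cz"
  by (auto simp: zvar_def cz_def power2_eq_square one_pCons simp flip: to_fract_mult to_fract_uminus)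

section \<open>Homomorphisms of power series in \<open>h\<close>\<close>

locale hhom = rhom \<Phi> for \<Phi> :: "'a::comm_ring_1 fps \<Rightarrow> 'b::comm_ring_1 fps" +
  assumes fps_X: "\<Phi> fps_X = fps_X"
begin

text \<open>
  A ring homomorphism that fixes \<open>h\<close> preserves congruence modulo powers of \<open>h\<close>, i.e. it is
  continuous in the \<open>h\<close>-adic topology.
\<close>
lemma cong_nth:
  assumes "\<And>k. k \<le> n \<Longrightarrow> F $ k = G $ k"
  shows "\<Phi> F $ n = \<Phi> G $ n"
proof -
  have "F - G = fps_X ^ Suc n * fps_shift (Suc n) (F - G)"
    using assms by (intro fps_ext) (auto simp: fps_X_power_mult_nth simp del: power_Suc)
  hence "\<Phi> F - \<Phi> G = fps_X ^ Suc n * \<Phi> (fps_shift (Suc n) (F - G))"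
    by (metis diff mult power fps_X)
  hence "(\<Phi> F - \<Phi> G) $ n = 0" by (simp add: fps_X_power_mult_nth del: power_Suc)
  thus ?thesis by simp
qed

end

definition fps_lift :: "('a::zero \<Rightarrow> 'b::zero) \<Rightarrow> 'a fps \<Rightarrow> 'b fps" where
  "fps_lift \<phi> F = Abs_fps (\<lambda>n. \<phi> (F $ n))"

lemma fps_lift_nth [simp]: "fps_lift \<phi> F $ n = \<phi> (F $ n)"
  by (simp add: fps_lift_def)

lemma hhom_fps_lift:
  assumes "rhom \<phi>"
  shows "hhom (fps_lift \<phi>)"
proof -
  interpret rhom \<phi> by fact
  show ?thesis
    by standard (auto simp: fps_eq_iff fps_mult_nth sum hom)
qed

section \<open>Infinite products of power series in \<open>h\<close>\<close>

text \<open>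
  The value of a convergent infinite product is nonzero by definition in \<open>has_prod\<close>; this holds
  when no factor vanishes and the factors converge to \<open>1\<close>.
\<close>
definition hprod_ok :: "(nat \<Rightarrow> 'a::idom fps) \<Rightarrow> bool" where
  "hprod_ok f \<longleftrightarrow> (\<forall>k. f k \<noteq> 0) \<and> (\<forall>N. \<exists>K. \<forall>k\<ge>K. \<forall>m\<le>N. f k $ m = 1 $ m)"

lemma fps_mult_one_cong:
  fixes F G :: "'a::comm_ring_1 fps"
  assumes "\<And>m. m \<le> N \<Longrightarrow> G $ m = 1 $ m"
  shows "(F * G) $ N = F $ N"
proof -
  have "(F * G) $ N = (\<Sum>i\<le>N. F $ i * G $ (N - i))" by (simp add: fps_mult_nth atMost_atLeast0)
  also have "\<dots> = (\<Sum>i\<le>N. if i = N then F $ i else 0)"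
    using assms by (intro sum.cong) auto
  finally show ?thesis by simp
qed

lemma fps_prod_nth_zero: "(\<Prod>i\<in>A. F i :: 'a::comm_ring_1 fps) $ 0 = (\<Prod>i\<in>A. F i $ 0)"
  by (induction A rule: infinite_finite_induct) auto

text \<open>
  Each coefficient of the partial products is eventually constant. The limit is nonzero: from
  some stage on, the remaining factors have constant term \<open>1\<close>, so that the lowest coefficient of
  the partial product survives.
\<close>
lemma prodinf_nth:
  fixes f :: "nat \<Rightarrow> 'a::idom fps"
  assumes "hprod_ok f"
  shows "\<exists>K. \<forall>n\<ge>K. \<forall>M\<le>N. prodinf f $ M = (\<Prod>k<n. f k) $ M"
proof -
  from assms have nz: "f k \<noteq> 0" for k by (auto simp: hprod_ok_def)
  from assms obtain K where K: "\<And>N k m. k \<ge> K N \<Longrightarrow> m \<le> N \<Longrightarrow> f k $ m = 1 $ m"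
    unfolding hprod_ok_def by metis
  define L where "L = Abs_fps (\<lambda>N. (\<Prod>k<K N. f k) $ N)"
  have stable: "(\<Prod>k<n. f k) $ N = L $ N" if "n \<ge> K N" for n N
    using that
  proof (induction n rule: dec_induct)
    case (step n)
    thus ?case using K[of N n] by (simp add: fps_mult_one_cong)
  qed (simp add: L_def)
  have lim: "(\<lambda>n. \<Prod>k\<le>n. f k) \<longlonglongrightarrow> L"
  proof (rule tendsto_fpsI)
    fix N show "\<forall>\<^sub>F n in sequentially. (\<Prod>k\<le>n. f k) $ N = L $ N"
      using eventually_ge_at_top[of "K N"]
    proof eventually_elim
      case (elim n)
      thus ?case using stable[of N "Suc n"] by (simp add: lessThan_Suc_atMost)
    qed
  qed
  have "L \<noteq> 0"
  proof
    assume "L = 0"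
    define Q where "Q = (\<Prod>k<K 0. f k)"
    have Q0: "Q \<noteq> 0" using nz by (simp add: Q_def)
    define d where "d = subdegree Q"
    define n where "n = max (K 0) (K d)"
    have spl: "(\<Prod>k<n. f k) = Q * (\<Prod>k\<in>{K 0..<n}. f k)"
      unfolding Q_def by (subst prod.union_disjoint[symmetric]) (auto intro!: prod.cong simp: n_def)
    have "(\<Prod>k\<in>{K 0..<n}. f k) $ 0 = 1"
      by (subst fps_prod_nth_zero) (use K[of 0 _ 0] in auto)
    moreover have "(Q * R) $ d = Q $ d * R $ 0" for R :: "'a fps"
    proof -
      have "(Q * R) $ d = (\<Sum>i=0..d. if i = d then Q $ i * R $ (d - i) else 0)"
        unfolding fps_mult_nth
      proof (intro sum.cong refl)
        fix i assume "i \<in> {0..d}"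
        hence "i = d \<or> i < d" by auto
        thus "Q $ i * R $ (d - i) = (if i = d then Q $ i * R $ (d - i) else 0)"
          using nth_less_subdegree_zero[of i Q] by (auto simp: d_def)
      qed
      thus ?thesis by simp
    qed
    ultimately have "(\<Prod>k<n. f k) $ d = Q $ d" unfolding spl by simp
    moreover have "Q $ d \<noteq> 0" using Q0 by (simp add: d_def)
    ultimately show False using stable[of d n] \<open>L = 0\<close> by (simp add: n_def)
  qed
  hence "f has_prod L" using lim by (auto simp: has_prod_def raw_has_prod_def)
  hence "prodinf f = L" by (rule has_prod_unique[symmetric])
  show ?thesis
  proof (intro exI[of _ "Max (K ` {..N})"] allI impI)
    fix n M assume "n \<ge> Max (K ` {..N})" "M \<le> N"
    hence "n \<ge> K M" by (auto simp: Max_le_iff)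
    thus "prodinf f $ M = (\<Prod>k<n. f k) $ M" using stable \<open>prodinf f = L\<close> by simp
  qed
qed

lemma prodinf_eqI:
  fixes f :: "nat \<Rightarrow> 'a::idom fps"
  assumes "hprod_ok f" "\<And>N. \<exists>K. \<forall>n\<ge>K. (\<Prod>k<n. f k) $ N = F $ N"
  shows "prodinf f = F"
proof (rule fps_ext)
  fix N
  obtain K1 where K1: "\<forall>n\<ge>K1. \<forall>M\<le>N. prodinf f $ M = (\<Prod>k<n. f k) $ M"
    using prodinf_nth[OF assms(1)] by blast
  obtain K2 where K2: "\<forall>n\<ge>K2. (\<Prod>k<n. f k) $ N = F $ N" using assms(2) by blast
  show "prodinf f $ N = F $ N" using K1[rule_format, of "max K1 K2" N] K2[rule_format, of "max K1 K2"] by simp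
qed

lemma hprod_ok_mult:
  fixes f g :: "nat \<Rightarrow> 'a::idom fps"
  assumes "hprod_ok f" "hprod_ok g"
  shows "hprod_ok (\<lambda>k. f k * g k)"
  unfolding hprod_ok_def
proof (intro conjI allI)
  show "f k * g k \<noteq> 0" for k using assms by (simp add: hprod_ok_def)
  fix N
  obtain K1 where K1: "\<forall>k\<ge>K1. \<forall>m\<le>N. f k $ m = 1 $ m" using assms(1) unfolding hprod_ok_def by blast
  obtain K2 where K2: "\<forall>k\<ge>K2. \<forall>m\<le>N. g k $ m = 1 $ m" using assms(2) unfolding hprod_ok_def by blast
  have "(f k * g k) $ m = 1 $ m" if "k \<ge> max K1 K2" "m \<le> N" for k m
    using that K1 K2 by (subst fps_mult_one_cong) auto
  thus "\<exists>K. \<forall>k\<ge>K. \<forall>m\<le>N. (f k * g k) $ m = 1 $ m" by blast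
qed

lemma prodinf_mult_fps:
  fixes f g :: "nat \<Rightarrow> 'a::idom fps"
  assumes "hprod_ok f" "hprod_ok g"
  shows "prodinf (\<lambda>k. f k * g k) = prodinf f * prodinf g"
proof (rule prodinf_eqI[OF hprod_ok_mult[OF assms]])
  fix N
  obtain K1 where K1: "\<forall>n\<ge>K1. \<forall>M\<le>N. prodinf f $ M = (\<Prod>k<n. f k) $ M"
    using prodinf_nth[OF assms(1)] by blast
  obtain K2 where K2: "\<forall>n\<ge>K2. \<forall>M\<le>N. prodinf g $ M = (\<Prod>k<n. g k) $ M"
    using prodinf_nth[OF assms(2)] by blast
  show "\<exists>K. \<forall>n\<ge>K. (\<Prod>k<n. f k * g k) $ N = (prodinf f * prodinf g) $ N"
    by (rule exI[of _ "max K1 K2"]) (use K1 K2 in \<open>auto simp: prod.distrib fps_mult_nth\<close>)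
qed

lemma hprod_ok_Suc: "hprod_ok f \<Longrightarrow> hprod_ok (\<lambda>k. f (Suc k))"
  unfolding hprod_ok_def by (meson le_SucI)

lemma prodinf_head:
  fixes f :: "nat \<Rightarrow> 'a::idom fps"
  assumes "hprod_ok f"
  shows "prodinf f = f 0 * prodinf (\<lambda>k. f (Suc k))"
proof (rule prodinf_eqI[OF assms])
  fix N
  obtain K where K: "\<forall>n\<ge>K. \<forall>M\<le>N. prodinf (\<lambda>k. f (Suc k)) $ M = (\<Prod>k<n. f (Suc k)) $ M"
    using prodinf_nth[OF hprod_ok_Suc[OF assms]] by blast
  show "\<exists>K. \<forall>n\<ge>K. (\<Prod>k<n. f k) $ N = (f 0 * prodinf (\<lambda>k. f (Suc k))) $ N"
  proof (intro exI[of _ "Suc K"] allI impI)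
    fix n assume "Suc K \<le> n"
    then obtain m where m: "n = Suc m" "K \<le> m" by (metis Suc_le_D Suc_le_mono)
    show "(\<Prod>k<n. f k) $ N = (f 0 * prodinf (\<lambda>k. f (Suc k))) $ N"
      unfolding m(1) prod.lessThan_Suc_shift using K m(2) by (simp add: fps_mult_nth)
  qed
qed

lemma hprod_ok_hhom:
  fixes \<Phi> :: "'a::idom fps \<Rightarrow> 'b::idom fps"
  assumes "hhom \<Phi>" "hprod_ok f" "\<And>k. \<Phi> (f k) \<noteq> 0"
  shows "hprod_ok (\<lambda>k. \<Phi> (f k))"
  unfolding hprod_ok_def
proof (intro conjI allI)
  show "\<Phi> (f k) \<noteq> 0" for k by (rule assms(3))
  interpret hhom \<Phi> by fact
  fix N
  obtain K where K: "\<forall>k\<ge>K. \<forall>m\<le>N. f k $ m = 1 $ m" using assms(2) unfolding hprod_ok_def by blast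
  have "\<Phi> (f k) $ m = 1 $ m" if "k \<ge> K" "m \<le> N" for k m
    using cong_nth[of m "f k" 1] K that by (simp add: one)
  thus "\<exists>K. \<forall>k\<ge>K. \<forall>m\<le>N. \<Phi> (f k) $ m = 1 $ m" by blast
qed

lemma hhom_prodinf:
  fixes \<Phi> :: "'a::idom fps \<Rightarrow> 'b::idom fps"
  assumes "hhom \<Phi>" "hprod_ok f" "\<And>k. \<Phi> (f k) \<noteq> 0"
  shows "\<Phi> (prodinf f) = prodinf (\<lambda>k. \<Phi> (f k))"
proof (rule sym, rule prodinf_eqI)
  show "hprod_ok (\<lambda>k. \<Phi> (f k))" using assms by (rule hprod_ok_hhom)
next
  interpret hhom \<Phi> by fact
  fix N
  obtain K where K: "\<forall>n\<ge>K. \<forall>M\<le>N. prodinf f $ M = (\<Prod>k<n. f k) $ M"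
    using prodinf_nth[OF assms(2)] by blast
  have "(\<Prod>k<n. \<Phi> (f k)) $ N = \<Phi> (prodinf f) $ N" if "n \<ge> K" for n
    unfolding prod[symmetric] using K that by (intro cong_nth) auto
  thus "\<exists>K. \<forall>n\<ge>K. (\<Prod>k<n. \<Phi> (f k)) $ N = \<Phi> (prodinf f) $ N" by blast
qed

lemma fps_power_nth_below:
  fixes p :: "'a::comm_ring_1 fps"
  assumes "p $ 0 = 0" "m < k"
  shows "(p ^ k) $ m = 0"
  using startsby_zero_power_prefix[OF assms(1), of k] assms(2) by blast

lemma fps_mult_power_nth_below:
  fixes p :: "'a::comm_ring_1 fps"
  assumes "p $ 0 = 0" "m < k"
  shows "(x * p ^ k) $ m = 0"
  unfolding fps_mult_nth using fps_power_nth_below[OF assms(1)] assms(2) by (intro sum.neutral) auto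

lemma hprod_ok_qpoch:
  fixes x p :: "'a::idom fps"
  assumes "p $ 0 = 0" "x $ 0 \<noteq> 1"
  shows "hprod_ok (\<lambda>k. 1 - x * p ^ k)"
  unfolding hprod_ok_def
proof (intro conjI allI)
  fix k
  have "(1 - x * p ^ k) $ 0 \<noteq> 0"
    using assms by (cases k) auto
  thus "1 - x * p ^ k \<noteq> 0" by force
next
  fix N
  show "\<exists>K. \<forall>k\<ge>K. \<forall>m\<le>N. (1 - x * p ^ k) $ m = 1 $ m"
    by (rule exI[of _ "Suc N"]) (auto simp: fps_mult_power_nth_below assms(1))
qed

lemma qpoch_rec:
  fixes x p :: "'a::idom fps"
  assumes "p $ 0 = 0" "x $ 0 \<noteq> 1"
  shows "qpoch x p = (1 - x) * qpoch (x * p) p"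
  unfolding qpoch_def
  by (subst prodinf_head[OF hprod_ok_qpoch[OF assms]]) (simp add: mult.assoc)

lemma qpoch_nth_0:
  fixes x p :: "'a::idom fps"
  assumes "p $ 0 = 0" "x $ 0 \<noteq> 1"
  shows "qpoch x p $ 0 = 1 - x $ 0"
proof -
  obtain K where K: "\<forall>n\<ge>K. \<forall>M\<le>0. qpoch x p $ M = (\<Prod>k<n. 1 - x * p ^ k) $ M"
    unfolding qpoch_def using prodinf_nth[OF hprod_ok_qpoch[OF assms]] by blast
  have "qpoch x p $ 0 = (\<Prod>k<Suc K. 1 - x * p ^ k) $ 0"
    using K[rule_format, of "Suc K" 0] by (simp only: order.refl le_SucI simp_thms)
  also have "\<dots> = (\<Prod>k<Suc K. if k = 0 then 1 - x $ 0 else 1)"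
    unfolding fps_prod_nth_zero by (intro prod.cong) (auto simp: assms(1) power_0_left fps_power_zeroth)
  also have "\<dots> = 1 - x $ 0" by (simp add: prod.lessThan_Suc_shift del: prod.lessThan_Suc)
  finally show ?thesis .
qed

lemma hhom_qpoch:
  fixes \<Phi> :: "'a::idom fps \<Rightarrow> 'b::idom fps"
  assumes "hhom \<Phi>" "p $ 0 = 0" "x $ 0 \<noteq> 1" "\<Phi> x $ 0 \<noteq> 1"
  shows "\<Phi> (qpoch x p) = qpoch (\<Phi> x) (\<Phi> p)"
proof -
  interpret hhom \<Phi> by fact
  have p0: "\<Phi> p $ 0 = 0" using cong_nth[of 0 p 0] assms(2) by (simp add: zero)
  have eq: "\<Phi> (1 - x * p ^ k) = 1 - \<Phi> x * \<Phi> p ^ k" for k by (simp add: hom)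
  have nz: "\<Phi> (1 - x * p ^ k) \<noteq> 0" for k
    using hprod_ok_qpoch[OF p0 assms(4)] unfolding eq by (simp add: hprod_ok_def)
  show ?thesis unfolding qpoch_def
    by (subst hhom_prodinf[OF assms(1) hprod_ok_qpoch[OF assms(2,3)] nz]) (simp add: eq)
qed

section \<open>The ring \<open>\<complex>((t))[[h]]\<close>\<close>

text \<open>
  The inner variable \<open>fls_X\<close> stands for \<open>z\<close> when a rational function is expanded at \<open>0\<close> and for \<open>1/z\<close>
  when it is expanded at infinity; the outer variable \<open>fps_X\<close> is \<open>h\<close>.
\<close>
type_synonym lser = "complex fls fps"

definition hc :: "complex fps \<Rightarrow> lser" where "hc = fps_lift fls_const"

interpretation hc: hhom hc
  unfolding hc_def by (intro hhom_fps_lift fls_const_rhom)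

lemma hc_nth [simp]: "hc c $ n = fls_const (c $ n)" by (simp add: hc_def)

text \<open>
  With this scalar multiplication \<open>lser\<close> is a complete module over \<open>\<complex>[[h]]\<close>, so that bilateral
  series in \<open>lser\<close> are instances of \<open>hsum\<close>.
\<close>
definition h_scale :: "complex fps \<Rightarrow> lser \<Rightarrow> lser" where "h_scale c x = hc c * x"

lemma hpow_lser: "x \<in> hpow h_scale n \<longleftrightarrow> (\<forall>k<n. x $ k = 0)"
proof
  assume "x \<in> hpow h_scale n"
  then obtain y where "x = fps_X ^ n * y"
    by (auto simp: hpow_def h_scale_def hc.power hc.fps_X)
  thus "\<forall>k<n. x $ k = 0" by (simp add: fps_X_power_mult_nth)
next
  assume "\<forall>k<n. x $ k = 0"
  hence "x = h_scale (fps_X ^ n) (fps_shift n x)"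
    by (intro fps_ext) (auto simp: h_scale_def hc.power hc.fps_X fps_X_power_mult_nth)
  thus "x \<in> hpow h_scale n" by (auto simp: hpow_def)
qed

interpretation lser: hadic h_scale
proof
  fix a b :: "complex fps" and x y :: lser
  show "h_scale a (x + y) = h_scale a x + h_scale a y" "h_scale (a + b) x = h_scale a x + h_scale b x"
    "h_scale a (h_scale b x) = h_scale (a * b) x" "h_scale 1 x = x"
    by (simp_all add: h_scale_def hc.hom algebra_simps)
next
  fix x assume "\<And>n. x \<in> hpow h_scale n"
  thus "x = 0" by (auto simp: hpow_lser fps_eq_iff)
next
  fix f :: "nat \<Rightarrow> lser" assume f: "\<And>n. f (Suc n) - f n \<in> hpow h_scale n"
  define x where "x = Abs_fps (\<lambda>k. f (Suc k) $ k)"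
  have stable: "f n $ k = f (Suc k) $ k" if "Suc k \<le> n" for n k
    using that
  proof (induction n rule: dec_induct)
    case (step n)
    thus ?case using f[of n] by (simp add: hpow_lser Suc_le_eq)
  qed simp
  have "(x - f n) $ k = 0" if "k < n" for n k
    using stable[of k n] that by (simp only: x_def Suc_le_eq fps_sub_nth fps_nth_Abs_fps) simp
  hence "x - f n \<in> hpow h_scale n" for n
    unfolding hpow_lser by blast
  thus "\<exists>x. \<forall>n. x - f n \<in> hpow h_scale n" by blast
qed

lemma hpow_lser_mult: "x \<in> hpow h_scale n \<Longrightarrow> y * x \<in> hpow h_scale n" "x \<in> hpow h_scale n \<Longrightarrow> x * y \<in> hpow h_scale n"
  by (auto simp: hpow_lser fps_mult_nth intro!: sum.neutral)

lemma hpow_lser_power: "S $ 0 = 0 \<Longrightarrow> n \<le> k \<Longrightarrow> S ^ k \<in> hpow h_scale n"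
  unfolding hpow_lser using fps_power_nth_below by fastforce

lemma has_hsum_mult:
  assumes "has_hsum h_scale f A x" "has_hsum h_scale g B y"
  shows "has_hsum h_scale (\<lambda>(i, j). f i * g j) (A \<times> B) (x * y)"
  unfolding lser.has_hsum_iff
proof
  fix n
  obtain F where F: "finite F" "F \<subseteq> A" "\<forall>i\<in>A - F. f i \<in> hpow h_scale n" "x - sum f F \<in> hpow h_scale n"
    using spec[OF assms(1)[unfolded lser.has_hsum_iff], of n] by (elim exE conjE) (rule that)
  obtain G where G: "finite G" "G \<subseteq> B" "\<forall>i\<in>B - G. g i \<in> hpow h_scale n" "y - sum g G \<in> hpow h_scale n"
    using spec[OF assms(2)[unfolded lser.has_hsum_iff], of n] by (elim exE conjE) (rule that)
  have out: "\<forall>p\<in>A \<times> B - F \<times> G. (case p of (i, j) \<Rightarrow> f i * g j) \<in> hpow h_scale n"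
    using F(3) G(3) by (auto intro: hpow_lser_mult)
  have "(x - sum f F) * y + sum f F * (y - sum g G) \<in> hpow h_scale n"
    by (intro lser.hpow_add hpow_lser_mult F(4) G(4))
  also have "(x - sum f F) * y + sum f F * (y - sum g G) = x * y - sum f F * sum g G"
    by (simp add: algebra_simps)
  also have "sum f F * sum g G = (\<Sum>(i, j)\<in>F \<times> G. f i * g j)"
    by (simp add: sum_product sum.cartesian_product)
  finally show "\<exists>F. finite F \<and> F \<subseteq> A \<times> B \<and>
        (\<forall>p\<in>A \<times> B - F. (case p of (i, j) \<Rightarrow> f i * g j) \<in> hpow h_scale n) \<and>
        x * y - (\<Sum>(i, j)\<in>F. f i * g j) \<in> hpow h_scale n"
    using out F(1,2) G(1,2) by (intro exI[of _ "F \<times> G"]) auto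
qed

section \<open>Integer powers of units\<close>

lemma powi_diff:
  fixes x :: lser
  assumes "x $ 0 \<noteq> 0"
  shows "x powi (int a - int b) = x ^ a * inverse x ^ b"
proof -
  have i: "inverse x * x = 1" using assms by (rule inverse_mult_eq_1)
  have c: "x ^ k * inverse x ^ k = 1" for k
    using i by (simp add: mult.commute flip: power_mult_distrib)
  show ?thesis
  proof (cases "a \<ge> b")
    case True
    then obtain k where "a = k + b" by (metis le_Suc_ex add.commute)
    thus ?thesis using c[of b] by (simp add: power_int_def power_add mult.assoc)
  next
    case False
    then obtain k where k: "b = a + k" "k > 0" by (metis less_imp_add_positive not_le)
    hence "x powi (int a - int b) = inverse x ^ k" by (simp add: power_int_def)
    also have "\<dots> = x ^ a * inverse x ^ b" unfolding k(1) power_add using c[of a]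
      by (simp flip: mult.assoc)
    finally show ?thesis .
  qed
qed

lemma powi_cases: obtains a b where "n = int a - int b"
  by (rule int_diff_cases)

lemma powi_add:
  fixes x :: lser
  assumes "x $ 0 \<noteq> 0"
  shows "x powi (m + n) = x powi m * x powi n"
proof -
  obtain a b where m: "m = int a - int b" by (rule powi_cases)
  obtain c d where n: "n = int c - int d" by (rule powi_cases)
  have "m + n = int (a + c) - int (b + d)" by (simp add: m n)
  thus ?thesis unfolding m n by (simp only: powi_diff[OF assms] power_add) (simp add: algebra_simps)
qed

lemma powi_mult:
  fixes x y :: lser
  assumes "x $ 0 \<noteq> 0" "y $ 0 \<noteq> 0"
  shows "(x * y) powi n = x powi n * y powi n"
proof -
  obtain a b where n: "n = int a - int b" by (rule powi_cases)
  show ?thesis unfolding n using assms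
    by (simp add: powi_diff fps_inverse_mult power_mult_distrib)
qed

lemma powi_inverse:
  fixes x :: lser
  assumes "x $ 0 \<noteq> 0"
  shows "inverse x powi n = x powi (- n)"
proof -
  obtain a b where n: "n = int a - int b" by (rule powi_cases)
  have "- n = int b - int a" by (simp add: n)
  moreover have "inverse x $ 0 \<noteq> 0" using assms by simp
  ultimately show ?thesis unfolding n using assms
    by (simp add: powi_diff fps_inverse_idempotent)
qed

lemma powi_one: fixes x :: lser shows "x powi 1 = x"
  by (simp add: power_int_def)

lemma powi_neg_one: "(- 1 :: lser) powi (- 1 - n) = - ((- 1) powi n)"
proof -
  have i: "inverse (- 1 :: lser) = - 1" using fps_inverse_minus[of "1::lser"] by simp
  have u: "(- 1 :: lser) $ 0 \<noteq> 0" by simp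
  obtain a b where n: "n = int a - int b" by (rule powi_cases)
  have "- 1 - n = int b - int (Suc a)" by (simp add: n)
  thus ?thesis unfolding n by (simp only: powi_diff[OF u] i) (simp add: mult.commute)
qed

section \<open>Theta series and their products\<close>

text \<open>
  A pair of integers is \<open>(r - s, r + s)\<close> or \<open>(r - s, r + s + 1)\<close> according to the parity of its sum.
  This turns a product of two theta series into two products of theta series of the squared
  nome.
\<close>
lemma has_hsum_parity:
  fixes T :: "int \<times> int \<Rightarrow> lser"
  assumes "has_hsum h_scale (\<lambda>(r, s). T (r - s, r + s)) UNIV x"
    and "has_hsum h_scale (\<lambda>(r, s). T (r - s, r + s + 1)) UNIV y"
  shows "has_hsum h_scale T UNIV (x + y)"
proof -
  define f0 f1 :: "int \<times> int \<Rightarrow> int \<times> int"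
    where "f0 = (\<lambda>(r, s). (r - s, r + s))" and "f1 = (\<lambda>(r, s). (r - s, r + s + 1))"
  have inj: "inj f0" "inj f1" by (auto simp: inj_on_def f0_def f1_def)
  have "has_hsum h_scale T (range f0) x"
    unfolding lser.has_hsum_reindex[OF inj(1)] using assms(1) by (simp add: f0_def case_prod_unfold)
  moreover have "has_hsum h_scale T (range f1) y"
    unfolding lser.has_hsum_reindex[OF inj(2)] using assms(2) by (simp add: f1_def case_prod_unfold)
  moreover have "range f0 \<inter> range f1 = {}" by (auto simp: f0_def f1_def) presburger
  moreover have "(m, n) \<in> range f0 \<union> range f1" for m n
  proof (cases "even (m + n)")
    case True
    then obtain r where "m + n = 2 * r" by (elim evenE)
    hence "(m, n) = f0 (r, r - m)" by (simp add: f0_def)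
    thus ?thesis by blast
  next
    case False
    then obtain r where "m + n = 2 * r + 1" by (elim oddE)
    hence "(m, n) = f1 (r, r - m)" by (simp add: f1_def)
    thus ?thesis by blast
  qed
  hence "range f0 \<union> range f1 = UNIV" by auto
  ultimately show ?thesis using lser.has_hsum_disjoint_union by metis
qed

definition qsum :: "lser \<Rightarrow> (int \<Rightarrow> int) \<Rightarrow> lser \<Rightarrow> lser" where
  "qsum S E x = hsum h_scale (\<lambda>n. S ^ nat (E n) * x powi n) UNIV"

lemma has_hsum_qsum:
  assumes "S $ 0 = 0" "\<And>n. \<bar>n\<bar> - 1 \<le> E n"
  shows "has_hsum h_scale (\<lambda>n. S ^ nat (E n) * x powi n) UNIV (qsum S E x)"
  unfolding qsum_def
proof (rule lser.has_hsum_hsum)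
  show "lser.hsummable (\<lambda>n. S ^ nat (E n) * x powi n) UNIV"
    unfolding lser.hsummable_def
  proof
    fix N
    have "{n \<in> UNIV. S ^ nat (E n) * x powi n \<notin> hpow h_scale N} \<subseteq> {- int N - 1..int N + 1}"
    proof
      fix n assume "n \<in> {n \<in> UNIV. S ^ nat (E n) * x powi n \<notin> hpow h_scale N}"
      hence "\<not> N \<le> nat (E n)" using hpow_lser_power[OF assms(1)] hpow_lser_mult(2) by blast
      thus "n \<in> {- int N - 1..int N + 1}" using assms(2)[of n] by auto
    qed
    thus "finite {n \<in> UNIV. S ^ nat (E n) * x powi n \<notin> hpow h_scale N}"
      using finite_subset by blast
  qed
qed

text \<open>
  The nome is \<open>p = S\<^sup>2\<close>. Up to factors, \<open>tha\<close> and \<open>thb\<close> are the functions \<open>(- S x; p)(- S/x; p)\<close> and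
  \<open>(- x; p)(- p/x; p)\<close>; the series \<open>th0\<close> and \<open>th1\<close> are their analogues for the nome \<open>p\<^sup>2\<close>, in which
  products of two of them are expanded.
\<close>
definition tha :: "lser \<Rightarrow> lser \<Rightarrow> lser" where "tha S = qsum S (\<lambda>n. n * n)"
definition thb :: "lser \<Rightarrow> lser \<Rightarrow> lser" where "thb S = qsum S (\<lambda>n. n * n - n)"
definition th0 :: "lser \<Rightarrow> lser \<Rightarrow> lser" where "th0 S = qsum S (\<lambda>n. 2 * n * n)"
definition th1 :: "lser \<Rightarrow> lser \<Rightarrow> lser" where "th1 S = qsum S (\<lambda>n. 2 * n * n + 2 * n)"

lemma abs_le_square: "\<bar>n\<bar> \<le> n * (n::int)"
proof (cases "n = 0")
  case False
  hence "1 * \<bar>n\<bar> \<le> \<bar>n\<bar> * \<bar>n\<bar>" by (intro mult_right_mono) auto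
  thus ?thesis by (simp add: abs_mult_self_eq)
qed simp

lemma square_bounds:
  fixes n :: int
  shows "0 \<le> n * n" "0 \<le> n * n - n" "0 \<le> 2 * n * n" "0 \<le> 2 * n * n + 2 * n"
    "\<bar>n\<bar> - 1 \<le> n * n" "\<bar>n\<bar> - 1 \<le> n * n - n" "\<bar>n\<bar> - 1 \<le> 2 * n * n" "\<bar>n\<bar> - 1 \<le> 2 * n * n + 2 * n"
proof -
  have 1: "\<bar>n\<bar> \<le> n * n" by (rule abs_le_square)
  have 2: "\<bar>n - 1\<bar> \<le> (n - 1) * (n - 1)" by (rule abs_le_square)
  have 3: "\<bar>n + 1\<bar> \<le> (n + 1) * (n + 1)" by (rule abs_le_square)
  show "0 \<le> n * n" "0 \<le> n * n - n" "0 \<le> 2 * n * n" "0 \<le> 2 * n * n + 2 * n"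
    "\<bar>n\<bar> - 1 \<le> n * n" "\<bar>n\<bar> - 1 \<le> n * n - n" "\<bar>n\<bar> - 1 \<le> 2 * n * n" "\<bar>n\<bar> - 1 \<le> 2 * n * n + 2 * n"
    using 1 2 3 by (simp_all add: algebra_simps)
qed

lemma square_bounds':
  fixes n :: int
  shows "0 \<le> 2 * n * n - 2 * n" "\<bar>n\<bar> - 1 \<le> 2 * n * n - 2 * n"
  using square_bounds[of "n"] square_bounds(8)[of "n - 1"] by (simp_all add: algebra_simps)

lemmas has_hsum_th1 = has_hsum_qsum[of _ "\<lambda>n. 2 * n * n + 2 * n", OF _ square_bounds(8), folded th1_def]

lemma power_nat_add: "0 \<le> a \<Longrightarrow> 0 \<le> b \<Longrightarrow> S ^ nat a * S ^ nat b = (S::lser) ^ nat (a + b)"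
  by (simp add: nat_add_distrib power_add)

lemma has_hsum_mult_left:
  assumes "has_hsum h_scale g A x"
  shows "has_hsum h_scale (\<lambda>i. y * g i) A (y * x)"
  using lser.hadic_axioms lser.hadic_axioms assms
  by (rule has_hsum_map) (simp_all add: h_scale_def algebra_simps)

lemma quotient_product_powi:
  fixes x y :: lser
  assumes "x $ 0 \<noteq> 0" "y $ 0 \<noteq> 0"
  shows "x powi (r - s) * y powi (r + s) = (x * y) powi r * (y * inverse x) powi s"
proof -
  have "x powi (r - s) = x powi r * x powi (- s)" using powi_add[OF assms(1), of r "- s"] by simp
  moreover have "inverse x $ 0 \<noteq> 0" using assms(1) by simp
  hence "(y * inverse x) powi s = y powi s * x powi (- s)"
    by (simp only: powi_mult[OF assms(2), of "inverse x" s] powi_inverse[OF assms(1)] not_False_eq_True)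
  ultimately show ?thesis
    by (simp only: powi_add[OF assms(2)] powi_mult[OF assms] mult_ac)
qed

text \<open>
  The substitution of \<open>has_hsum_parity\<close> separates the variables because the exponents are
  quadratic. The conditions \<open>even\<close> and \<open>odd\<close> are the resulting identities of exponents on the two
  classes of pairs.
\<close>
lemma qsum_mult:
  assumes S: "S $ 0 = 0" and x: "x $ 0 \<noteq> 0" and y: "y $ 0 \<noteq> 0"
    and pos: "\<And>n. 0 \<le> E n" "\<And>n. 0 \<le> E0 n" "\<And>n. 0 \<le> E1 n" "\<And>n. 0 \<le> F0 n" "\<And>n. 0 \<le> F1 n"
    and large: "\<And>n. \<bar>n\<bar> - 1 \<le> E n" "\<And>n. \<bar>n\<bar> - 1 \<le> E0 n" "\<And>n. \<bar>n\<bar> - 1 \<le> E1 n"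
      "\<And>n. \<bar>n\<bar> - 1 \<le> F0 n" "\<And>n. \<bar>n\<bar> - 1 \<le> F1 n"
    and even: "\<And>r s. E (r - s) + E (r + s) = E0 r + E1 s"
    and odd: "\<And>r s. E (r - s) + E (r + s + 1) = F0 r + F1 s + int c"
  shows "qsum S E x * qsum S E y = qsum S E0 (x * y) * qsum S E1 (y * inverse x)
    + S ^ c * y * (qsum S F0 (x * y) * qsum S F1 (y * inverse x))"
proof (rule lser.has_hsum_unique)
  let ?T = "\<lambda>(m, n). (S ^ nat (E m) * x powi m) * (S ^ nat (E n) * y powi n)"
  let ?t = "\<lambda>G z n. S ^ nat (G n) * z powi n"
  show "has_hsum h_scale ?T UNIV (qsum S E x * qsum S E y)"
    using has_hsum_mult[OF has_hsum_qsum[OF S large(1)] has_hsum_qsum[OF S large(1)]] by simp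
  show "has_hsum h_scale ?T UNIV (qsum S E0 (x * y) * qsum S E1 (y * inverse x)
    + S ^ c * y * (qsum S F0 (x * y) * qsum S F1 (y * inverse x)))"
  proof (rule has_hsum_parity)
    have "?t E x (r - s) * ?t E y (r + s) = ?t E0 (x * y) r * ?t E1 (y * inverse x) s" for r s
    proof -
      have "S ^ nat (E (r - s)) * S ^ nat (E (r + s)) = S ^ nat (E0 r) * S ^ nat (E1 s)"
        by (simp only: power_nat_add pos even)
      moreover have "?t E x (r - s) * ?t E y (r + s)
          = (S ^ nat (E (r - s)) * S ^ nat (E (r + s))) * (x powi (r - s) * y powi (r + s))"
        by (simp only: mult_ac)
      ultimately show ?thesis unfolding quotient_product_powi[OF x y] by (simp only: mult_ac)
    qed
    hence E: "(\<lambda>(r, s). ?T (r - s, r + s)) = (\<lambda>(r, s). ?t E0 (x * y) r * ?t E1 (y * inverse x) s)"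
      unfolding fun_eq_iff by (simp only: split_paired_All case_prod_conv simp_thms)
    show "has_hsum h_scale (\<lambda>(r, s). ?T (r - s, r + s)) UNIV (qsum S E0 (x * y) * qsum S E1 (y * inverse x))"
      unfolding E UNIV_Times_UNIV[symmetric]
      by (intro has_hsum_mult has_hsum_qsum S large)
  next
    have "?t E x (r - s) * ?t E y (r + s + 1) = S ^ c * y * (?t F0 (x * y) r * ?t F1 (y * inverse x) s)" for r s
    proof -
      have "S ^ nat (E (r - s)) * S ^ nat (E (r + s + 1)) = S ^ nat (F0 r) * S ^ nat (F1 s) * S ^ nat (int c)"
        by (simp only: power_nat_add pos odd add_nonneg_nonneg of_nat_0_le_iff)
      moreover have "y powi (r + s + 1) = y powi (r + s) * y"
        using powi_add[OF y, of "r + s" 1] by (simp add: powi_one)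
      hence "?t E x (r - s) * ?t E y (r + s + 1)
          = (S ^ nat (E (r - s)) * S ^ nat (E (r + s + 1))) * (x powi (r - s) * y powi (r + s)) * y"
        by (simp only: mult_ac)
      ultimately show ?thesis unfolding quotient_product_powi[OF x y] nat_int by (simp only: mult_ac)
    qed
    hence E: "(\<lambda>(r, s). ?T (r - s, r + s + 1))
        = (\<lambda>p. S ^ c * y * (case p of (r, s) \<Rightarrow> ?t F0 (x * y) r * ?t F1 (y * inverse x) s))"
      unfolding fun_eq_iff by (simp only: split_paired_All case_prod_conv simp_thms)
    show "has_hsum h_scale (\<lambda>(r, s). ?T (r - s, r + s + 1)) UNIV
        (S ^ c * y * (qsum S F0 (x * y) * qsum S F1 (y * inverse x)))"
      unfolding E UNIV_Times_UNIV[symmetric]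
      by (intro has_hsum_mult_left has_hsum_mult has_hsum_qsum S large)
  qed
qed

lemma th1_shift:
  assumes S: "S $ 0 = 0" and x: "x $ 0 \<noteq> 0"
  shows "qsum S (\<lambda>n. 2 * n * n - 2 * n) x = x * th1 S x"
proof (rule lser.has_hsum_unique[OF has_hsum_qsum[OF S square_bounds'(2)]])
  have b: "range (\<lambda>n::int. n + 1) = UNIV" by (auto intro!: surjI[of _ "\<lambda>n. n - 1"])
  have inj: "inj (\<lambda>n::int. n + 1)" by (auto simp: inj_on_def)
  have e: "S ^ nat (2 * (n + 1) * (n + 1) - 2 * (n + 1)) * x powi (n + 1) = x * (S ^ nat (2 * n * n + 2 * n) * x powi n)" for n
  proof -
    have "2 * (n + 1) * (n + 1) - 2 * (n + 1) = 2 * n * n + 2 * n" by (simp add: algebra_simps)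
    thus ?thesis by (simp only: powi_add[OF x] powi_one) (simp add: algebra_simps)
  qed
  have "has_hsum h_scale (\<lambda>n. S ^ nat (2 * n * n - 2 * n) * x powi n) (range (\<lambda>n. n + 1)) (x * th1 S x)"
    unfolding lser.has_hsum_reindex[OF inj] e
    by (intro has_hsum_mult_left has_hsum_th1 S)
  thus "has_hsum h_scale (\<lambda>n. S ^ nat (2 * n * n - 2 * n) * x powi n) UNIV (x * th1 S x)" by (simp add: b)
qed

lemma tha_mult:
  assumes S: "S $ 0 = 0" and x: "x $ 0 \<noteq> 0" and y: "y $ 0 \<noteq> 0"
  shows "tha S x * tha S y =
    th0 S (x * y) * th0 S (y * inverse x) + S * y * (th1 S (x * y) * th1 S (y * inverse x))"
  unfolding tha_def th0_def th1_def
  using qsum_mult[of S x y "\<lambda>n. n * n" "\<lambda>n. 2 * n * n" "\<lambda>n. 2 * n * n" "\<lambda>n. 2 * n * n + 2 * n"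
      "\<lambda>n. 2 * n * n + 2 * n" 1, OF S x y square_bounds(1,3,3,4,4,5,7,7,8,8)]
  by (simp add: algebra_simps)

lemma thb_mult:
  assumes S: "S $ 0 = 0" and x: "x $ 0 \<noteq> 0" and y: "y $ 0 \<noteq> 0"
  shows "thb S x * thb S y =
    x * y * th1 S (x * y) * th0 S (y * inverse x) + y * (th0 S (x * y) * th1 S (y * inverse x))"
proof -
  have xy: "(x * y) $ 0 \<noteq> 0" using x y by simp
  show ?thesis
    using qsum_mult[of S x y "\<lambda>n. n * n - n" "\<lambda>n. 2 * n * n - 2 * n" "\<lambda>n. 2 * n * n" "\<lambda>n. 2 * n * n"
      "\<lambda>n. 2 * n * n + 2 * n" 0, OF S x y square_bounds(2) square_bounds'(1) square_bounds(3,3,4,6)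
      square_bounds'(2) square_bounds(7,7,8)]
    unfolding th1_shift[OF S xy] by (simp add: algebra_simps thb_def th0_def th1_def)
qed

text \<open>
  The terms with indices \<open>n\<close> and \<open>- 1 - n\<close> cancel.
\<close>
lemma th1_minus_one:
  assumes S: "S $ 0 = 0"
  shows "th1 S (- 1) = 0"
proof -
  let ?g = "\<lambda>n. S ^ nat (2 * n * n + 2 * n) * (- 1) powi n"
  have h: "has_hsum h_scale ?g UNIV (th1 S (- 1))" by (rule has_hsum_th1[OF S])
  have b: "range (\<lambda>n::int. - 1 - n) = UNIV" by (auto intro!: surjI[of _ "\<lambda>n. - 1 - n"])
  have "has_hsum h_scale ?g (range (\<lambda>n. - 1 - n)) (th1 S (- 1))" using h by (simp add: b)
  hence "has_hsum h_scale (\<lambda>n. ?g (- 1 - n)) UNIV (th1 S (- 1))"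
    by (subst (asm) lser.has_hsum_reindex) (auto simp: inj_on_def)
  moreover have "?g (- 1 - n) = - 1 * ?g n" for n
  proof -
    have "2 * (- 1 - n) * (- 1 - n) + 2 * (- 1 - n) = 2 * n * n + 2 * n" by (simp add: algebra_simps)
    thus ?thesis by (simp only: powi_neg_one) simp
  qed
  ultimately have "has_hsum h_scale (\<lambda>n. - 1 * ?g n) UNIV (th1 S (- 1))" by (simp only:)
  moreover have "has_hsum h_scale (\<lambda>n. - 1 * ?g n) UNIV (- 1 * th1 S (- 1))"
    by (rule has_hsum_mult_left[OF h])
  ultimately have "th1 S (- 1) = - 1 * th1 S (- 1)" by (rule lser.has_hsum_unique)
  hence "2 * th1 S (- 1) = 0" by (metis add.right_inverse mult_2 mult_minus_left mult_1)
  thus ?thesis by simp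
qed

section \<open>The triple product identity\<close>

definition qpoch_fin :: "lser \<Rightarrow> nat \<Rightarrow> lser" where
  "qpoch_fin P m = (\<Prod>k<m. 1 - P * P ^ k)"

lemma qpoch_fin_Suc: "qpoch_fin P (Suc m) = qpoch_fin P m * (1 - P * P ^ m)"
  by (simp add: qpoch_fin_def)

lemma qpoch_fin_unit: "P $ 0 = 0 \<Longrightarrow> qpoch_fin P m $ 0 = 1"
  by (simp add: qpoch_fin_def fps_prod_nth_zero)

lemma qpoch_fin_inverse: "P $ 0 = 0 \<Longrightarrow> qpoch_fin P m * inverse (qpoch_fin P m) = 1"
  by (subst mult.commute, rule inverse_mult_eq_1) (simp add: qpoch_fin_unit)

lemma inverse_qpoch_fin_Suc:
  assumes "P $ 0 = 0"
  shows "inverse (qpoch_fin P m) = (1 - P * P ^ m) * inverse (qpoch_fin P (Suc m))"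
proof -
  have "inverse (qpoch_fin P m) = inverse (qpoch_fin P m) * (qpoch_fin P (Suc m) * inverse (qpoch_fin P (Suc m)))"
    by (simp add: qpoch_fin_inverse[OF assms])
  also have "\<dots> = (qpoch_fin P m * inverse (qpoch_fin P m)) * ((1 - P * P ^ m) * inverse (qpoch_fin P (Suc m)))"
    by (simp only: qpoch_fin_Suc mult_ac)
  finally show ?thesis by (simp only: qpoch_fin_inverse[OF assms] mult_1)
qed

text \<open>
  The Gaussian binomial coefficient of \<open>2 n\<close> over \<open>n + j\<close> in the variable \<open>P\<close>, indexed symmetrically
  around the middle.
\<close>
definition qbin :: "lser \<Rightarrow> nat \<Rightarrow> int \<Rightarrow> lser" where
  "qbin P n j = (if \<bar>j\<bar> \<le> int n
     then qpoch_fin P (2 * n) * (inverse (qpoch_fin P (nat (int n + j))) * inverse (qpoch_fin P (nat (int n - j)))) else 0)"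

text \<open>
  Two steps of the Pascal recursion at once, since passing from \<open>n\<close> to \<open>n + 1\<close> adds two factors to
  the product.
\<close>
lemma qbin_Suc:
  assumes P: "P $ 0 = 0" and i: "\<bar>i\<bar> \<le> int (Suc n)"
  shows "qbin P (Suc n) i = (1 + P * P ^ (2 * n)) * qbin P n i
    + P ^ nat (int n - (i - 1)) * qbin P n (i - 1) + P ^ nat (int n + (i + 1)) * qbin P n (i + 1)"
proof -
  consider "\<bar>i\<bar> \<le> int n" | "i = int n + 1" | "i = - int n - 1" using i by linarith
  thus ?thesis
  proof cases
    case 1
    define a b where "a = nat (int n + i)" and "b = nat (int n - i)"
    have ab: "a + b = 2 * n" using 1 by (simp add: a_def b_def)
    let ?I = "inverse (qpoch_fin P (Suc a)) * inverse (qpoch_fin P (Suc b))"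
    let ?p = "qpoch_fin P (2 * n)"
    have 0: "qbin P n i = ?p * ((1 - P * P ^ a) * (1 - P * P ^ b)) * ?I"
      using 1 inverse_qpoch_fin_Suc[OF P, of a] inverse_qpoch_fin_Suc[OF P, of b]
      by ((simp add: qbin_def flip: a_def b_def), (simp add: mult_ac)?)
    have m: "qbin P n (i - 1) = ?p * ((1 - P ^ a) * (1 - P * P ^ a)) * ?I"
    proof (cases "a = 0")
      case True
      hence "i = - int n" using 1 by (simp add: a_def)
      thus ?thesis using True by (simp add: qbin_def)
    next
      case False
      then obtain a' where a': "a = Suc a'" by (cases a) auto
      have e: "nat (int n + (i - 1)) = a'" "nat (int n - (i - 1)) = Suc b" "\<bar>i - 1\<bar> \<le> int n"
        using 1 a' by (auto simp: a_def b_def)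
      show ?thesis unfolding qbin_def e using e(3)
        by (simp add: inverse_qpoch_fin_Suc[OF P, of a'] inverse_qpoch_fin_Suc[OF P, of "Suc a'"] a' mult_ac)
    qed
    have p: "qbin P n (i + 1) = ?p * ((1 - P ^ b) * (1 - P * P ^ b)) * ?I"
    proof (cases "b = 0")
      case True
      hence "i = int n" using 1 by (simp add: b_def)
      thus ?thesis using True by (simp add: qbin_def)
    next
      case False
      then obtain b' where b': "b = Suc b'" by (cases b) auto
      have e: "nat (int n - (i + 1)) = b'" "nat (int n + (i + 1)) = Suc a" "\<bar>i + 1\<bar> \<le> int n"
        using 1 b' by (auto simp: a_def b_def)
      show ?thesis unfolding qbin_def e using e(3)
        by (simp add: inverse_qpoch_fin_Suc[OF P, of b'] inverse_qpoch_fin_Suc[OF P, of "Suc b'"] b' mult_ac)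
    qed
    have e: "nat (int (Suc n) + i) = Suc a" "nat (int (Suc n) - i) = Suc b"
      "nat (int n - (i - 1)) = Suc b" "nat (int n + (i + 1)) = Suc a"
      using 1 by (auto simp: a_def b_def)
    have s: "qbin P (Suc n) i = qpoch_fin P (Suc (Suc (2 * n))) * ?I"
      using i unfolding qbin_def e by simp
    have xy: "P ^ (2 * n) = P ^ a * P ^ b" by (simp add: ab flip: power_add)
    show ?thesis
      unfolding s 0 m p e qpoch_fin_Suc power_Suc xy by algebra
  next
    case 2
    have e: "qbin P n i = 0" "qbin P n (i + 1) = 0" using 2 by (simp_all add: qbin_def)
    have "qbin P n (i - 1) = 1" "qbin P (Suc n) i = 1"
      using 2 by (simp_all add: qbin_def nat_add_distrib nat_mult_distrib qpoch_fin_def[of P 0] qpoch_fin_inverse[OF P] flip: mult_2)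
    thus ?thesis unfolding e using 2 by simp
  next
    case 3
    have e: "qbin P n i = 0" "qbin P n (i - 1) = 0" using 3 by (simp_all add: qbin_def)
    have "qbin P n (i + 1) = 1" "qbin P (Suc n) i = 1"
      using 3 by (simp_all add: qbin_def nat_add_distrib nat_mult_distrib qpoch_fin_def[of P 0] qpoch_fin_inverse[OF P] flip: mult_2)
    thus ?thesis unfolding e using 3 by simp
  qed
qed

text \<open>
  The finite form of the triple product. The family \<open>e\<close> replaces \<open>P\<^bsup>j (j - 1)/2\<^esup> u\<^sup>j\<close>: only its
  behaviour under multiplication by \<open>u\<close> and \<open>v = P/u\<close> matters, so that \<open>u\<close> may be a nonunit although \<open>j\<close>
  runs over all integers.
\<close>
lemma finite_triple_product:
  assumes P: "P $ 0 = 0" and uv: "u * v = P" and e0: "e 0 = 1"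
    and U: "\<And>n j. j \<le> int n \<Longrightarrow> P ^ n * u * e j = P ^ nat (int n - j) * e (j + 1)"
    and V: "\<And>n j. - int n \<le> j \<Longrightarrow> P ^ n * v * e j = P ^ nat (int n + j) * e (j - 1)"
  shows "(\<Prod>k<n. (1 + u * P ^ k) * (1 + v * P ^ k)) = (\<Sum>j\<in>{- int n..int n}. qbin P n j * e j)"
proof (induction n)
  case 0
  show ?case by (simp add: qbin_def qpoch_fin_def e0)
next
  case (Suc n)
  let ?J = "{- int (Suc n)..int (Suc n)}"
  have "(1 + u * P ^ n) * (1 + v * P ^ n) = 1 + u * v * (P ^ n * P ^ n) + P ^ n * u + P ^ n * v"
    by (simp add: algebra_simps)
  also have "\<dots> = (1 + P * P ^ (2 * n)) + P ^ n * u + P ^ n * v"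
    unfolding uv by (simp add: mult_2 power_add)
  finally have f: "(1 + u * P ^ n) * (1 + v * P ^ n) = (1 + P * P ^ (2 * n)) + P ^ n * u + P ^ n * v" .
  have 1: "(\<Sum>j\<in>{- int n..int n}. qbin P n j * e j * (1 + P * P ^ (2 * n)))
      = (\<Sum>j\<in>?J. (1 + P * P ^ (2 * n)) * qbin P n j * e j)"
    by (rule sum.mono_neutral_cong_left) (auto simp: qbin_def)
  have 2: "(\<Sum>j\<in>{- int n..int n}. qbin P n j * e j * (P ^ n * u))
      = (\<Sum>i\<in>?J. P ^ nat (int n - (i - 1)) * qbin P n (i - 1) * e i)"
  proof -
    have "(\<Sum>j\<in>{- int n..int n}. qbin P n j * e j * (P ^ n * u))
      = (\<Sum>j\<in>{- int n..int n}. P ^ nat (int n - j) * qbin P n j * e (j + 1))"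
    proof (intro sum.cong refl)
      fix j assume "j \<in> {- int n..int n}"
      hence "P ^ n * u * e j = P ^ nat (int n - j) * e (j + 1)" by (intro U) simp
      thus "qbin P n j * e j * (P ^ n * u) = P ^ nat (int n - j) * qbin P n j * e (j + 1)"
        by (metis (no_types, lifting) mult.assoc mult.commute)
    qed
    also have "\<dots> = (\<Sum>i\<in>{- int n + 1..int n + 1}. P ^ nat (int n - (i - 1)) * qbin P n (i - 1) * e i)"
      by (rule sum.reindex_bij_witness[of _ "\<lambda>i. i - 1" "\<lambda>j. j + 1"]) auto
    also have "\<dots> = (\<Sum>i\<in>?J. P ^ nat (int n - (i - 1)) * qbin P n (i - 1) * e i)"
      by (rule sum.mono_neutral_left) (auto simp: qbin_def)
    finally show ?thesis .
  qed
  have 3: "(\<Sum>j\<in>{- int n..int n}. qbin P n j * e j * (P ^ n * v))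
      = (\<Sum>i\<in>?J. P ^ nat (int n + (i + 1)) * qbin P n (i + 1) * e i)"
  proof -
    have "(\<Sum>j\<in>{- int n..int n}. qbin P n j * e j * (P ^ n * v))
      = (\<Sum>j\<in>{- int n..int n}. P ^ nat (int n + j) * qbin P n j * e (j - 1))"
    proof (intro sum.cong refl)
      fix j assume "j \<in> {- int n..int n}"
      hence "P ^ n * v * e j = P ^ nat (int n + j) * e (j - 1)" by (intro V) simp
      thus "qbin P n j * e j * (P ^ n * v) = P ^ nat (int n + j) * qbin P n j * e (j - 1)"
        by (metis (no_types, lifting) mult.assoc mult.commute)
    qed
    also have "\<dots> = (\<Sum>i\<in>{- int n - 1..int n - 1}. P ^ nat (int n + (i + 1)) * qbin P n (i + 1) * e i)"
      by (rule sum.reindex_bij_witness[of _ "\<lambda>i. i + 1" "\<lambda>j. j - 1"]) auto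
    also have "\<dots> = (\<Sum>i\<in>?J. P ^ nat (int n + (i + 1)) * qbin P n (i + 1) * e i)"
      by (rule sum.mono_neutral_left) (auto simp: qbin_def)
    finally show ?thesis .
  qed
  have "(\<Prod>k<Suc n. (1 + u * P ^ k) * (1 + v * P ^ k))
    = (\<Sum>j\<in>{- int n..int n}. qbin P n j * e j) * ((1 + P * P ^ (2 * n)) + P ^ n * u + P ^ n * v)"
    by (simp only: prod.lessThan_Suc Suc.IH f)
  also have "\<dots> = (\<Sum>j\<in>{- int n..int n}. qbin P n j * e j * (1 + P * P ^ (2 * n)))
     + (\<Sum>j\<in>{- int n..int n}. qbin P n j * e j * (P ^ n * u))
     + (\<Sum>j\<in>{- int n..int n}. qbin P n j * e j * (P ^ n * v))"
    by (simp only: distrib_left sum_distrib_right sum.distrib)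
  also have "\<dots> = (\<Sum>i\<in>?J. ((1 + P * P ^ (2 * n)) * qbin P n i
    + P ^ nat (int n - (i - 1)) * qbin P n (i - 1) + P ^ nat (int n + (i + 1)) * qbin P n (i + 1)) * e i)"
    unfolding 1 2 3 by (simp only: distrib_right sum.distrib)
  also have "\<dots> = (\<Sum>i\<in>?J. qbin P (Suc n) i * e i)"
    by (intro sum.cong refl) (subst qbin_Suc[OF P], auto)
  finally show ?case .
qed

lemma prodinf_partial:
  fixes f :: "nat \<Rightarrow> lser"
  assumes "hprod_ok f"
  shows "\<exists>K. \<forall>n\<ge>K. prodinf f - (\<Prod>k<n. f k) \<in> hpow h_scale N"
proof -
  obtain K where "\<forall>n\<ge>K. \<forall>M\<le>N. prodinf f $ M = (\<Prod>k<n. f k) $ M"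
    using prodinf_nth[OF assms] by blast
  hence "\<forall>n\<ge>K. prodinf f - (\<Prod>k<n. f k) \<in> hpow h_scale N" by (auto simp: hpow_lser)
  thus ?thesis by blast
qed

text \<open>
  The limit of \<open>finite_triple_product\<close>: for fixed \<open>j\<close> the Gaussian binomial coefficients tend to
  \<open>1/(P; P)\<close>.
\<close>
lemma triple_product:
  assumes P: "P $ 0 = 0" and uv: "u * v = P" and e0: "e 0 = 1"
    and U: "\<And>n j. j \<le> int n \<Longrightarrow> P ^ n * u * e j = P ^ nat (int n - j) * e (j + 1)"
    and V: "\<And>n j. - int n \<le> j \<Longrightarrow> P ^ n * v * e j = P ^ nat (int n + j) * e (j - 1)"
    and e: "\<And>N. \<exists>M::nat. \<forall>j. int M < \<bar>j\<bar> \<longrightarrow> e j \<in> hpow h_scale N"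
    and u: "u $ 0 \<noteq> - 1" and v: "v $ 0 \<noteq> - 1"
  shows "has_hsum h_scale e UNIV (qpoch P P * (qpoch (- u) P * qpoch (- v) P))"
  unfolding lser.has_hsum_iff
proof
  fix N
  let ?f = "\<lambda>k. (1 - (- u) * P ^ k) * (1 - (- v) * P ^ k)"
  let ?T = "qpoch (- u) P * qpoch (- v) P"
  have u': "(- u) $ 0 \<noteq> 1" and v': "(- v) $ 0 \<noteq> 1" using u v by (auto simp: minus_equation_iff)
  have oku: "hprod_ok (\<lambda>k. 1 - (- u) * P ^ k)" and okv: "hprod_ok (\<lambda>k. 1 - (- v) * P ^ k)"
    using hprod_ok_qpoch[OF P u'] hprod_ok_qpoch[OF P v'] .
  have T: "?T = prodinf ?f"
    unfolding qpoch_def by (rule prodinf_mult_fps[OF oku okv, symmetric])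
  obtain K where K: "\<And>n. n \<ge> K \<Longrightarrow> ?T - (\<Prod>k<n. ?f k) \<in> hpow h_scale N"
    unfolding T using prodinf_partial[OF hprod_ok_mult[OF oku okv]] by blast
  have okJ: "hprod_ok (\<lambda>k. 1 - P * P ^ k)" using P by (intro hprod_ok_qpoch) auto
  obtain K' where K': "\<And>n. n \<ge> K' \<Longrightarrow> qpoch P P - qpoch_fin P n \<in> hpow h_scale N"
    unfolding qpoch_def qpoch_fin_def using prodinf_partial[OF okJ] by blast
  obtain M where M: "\<And>j. int M < \<bar>j\<bar> \<Longrightarrow> e j \<in> hpow h_scale N" using e by blast
  \<comment> \<open>So large that all products involved have converged modulo \<open>h\<^sup>N\<close>, and that \<open>n \<plusminus> j \<ge> K'\<close> for \<open>\<bar>j\<bar> \<le> M\<close>.\<close>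
  define n where "n = M + K + K'"
  let ?F = "{- int M..int M}"
  have fin: "(\<Prod>k<n. ?f k) = (\<Sum>j\<in>{- int n..int n}. qbin P n j * e j)"
    using finite_triple_product[OF P uv e0 U V] by simp
  let ?J = "qpoch P P"
  \<comment> \<open>Modulo \<open>h\<^sup>N\<close> all finite products in \<open>qbin P n j\<close> may be replaced by \<open>(P; P)\<close>.\<close>
  have q: "?J * qbin P n j - 1 \<in> hpow h_scale N" if "j \<in> ?F" for j
  proof -
    define a b where "a = nat (int n + j)" and "b = nat (int n - j)"
    have "a \<ge> K'" "b \<ge> K'" "\<bar>j\<bar> \<le> int n" using that by (auto simp: a_def b_def n_def)
    hence qb: "qbin P n j = qpoch_fin P (2 * n) * (inverse (qpoch_fin P a) * inverse (qpoch_fin P b))"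
      by (simp add: qbin_def a_def b_def)
    have h: "?J - qpoch_fin P a \<in> hpow h_scale N" "?J - qpoch_fin P b \<in> hpow h_scale N" "?J - qpoch_fin P (2 * n) \<in> hpow h_scale N"
      using \<open>a \<ge> K'\<close> \<open>b \<ge> K'\<close> by (auto intro!: K' simp: n_def)
    have ia: "qpoch_fin P a * inverse (qpoch_fin P a) = 1" and ib: "qpoch_fin P b * inverse (qpoch_fin P b) = 1"
      by (rule qpoch_fin_inverse[OF P])+
    have "?J * qbin P n j - 1 = ((?J - qpoch_fin P a) * qpoch_fin P b + ?J * (?J - qpoch_fin P b) - ?J * (?J - qpoch_fin P (2 * n)))
        * (inverse (qpoch_fin P a) * inverse (qpoch_fin P b))"
      unfolding qb using ia ib by algebra
    also have "\<dots> \<in> hpow h_scale N"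
      by (rule hpow_lser_mult(2)[OF lser.hpow_diff[OF lser.hpow_add[OF
          hpow_lser_mult(2)[OF h(1)] hpow_lser_mult(1)[OF h(2)]] hpow_lser_mult(1)[OF h(3)]]])
    finally show ?thesis .
  qed
  have sub: "?F \<subseteq> {- int n..int n}" by (auto simp: n_def)
  have "?J * (\<Prod>k<n. ?f k) - sum e ?F
      = (\<Sum>j\<in>{- int n..int n} - ?F. ?J * qbin P n j * e j) + (\<Sum>j\<in>?F. (?J * qbin P n j - 1) * e j)"
  proof -
    have "?J * (\<Prod>k<n. ?f k) = (\<Sum>j\<in>{- int n..int n}. ?J * qbin P n j * e j)"
      unfolding fin by (simp add: sum_distrib_left mult.assoc)
    also have "\<dots> = (\<Sum>j\<in>{- int n..int n} - ?F. ?J * qbin P n j * e j) + (\<Sum>j\<in>?F. ?J * qbin P n j * e j)"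
      by (rule sum.subset_diff[OF sub]) simp
    finally show ?thesis by (simp add: left_diff_distrib sum_subtractf)
  qed
  also have "\<dots> \<in> hpow h_scale N"
  proof (intro lser.hpow_add lser.hpow_sum)
    fix j assume "j \<in> {- int n..int n} - ?F"
    hence "int M < \<bar>j\<bar>" by auto
    thus "?J * qbin P n j * e j \<in> hpow h_scale N" by (rule hpow_lser_mult(1)[OF M])
  next
    fix j assume "j \<in> ?F"
    thus "(?J * qbin P n j - 1) * e j \<in> hpow h_scale N" by (rule hpow_lser_mult(2)[OF q])
  qed
  finally have 1: "?J * (\<Prod>k<n. ?f k) - sum e ?F \<in> hpow h_scale N" .
  have "?J * (?T - (\<Prod>k<n. ?f k)) \<in> hpow h_scale N"
    by (intro hpow_lser_mult(1) K) (simp add: n_def)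
  hence "?J * ?T - ?J * (\<Prod>k<n. ?f k) \<in> hpow h_scale N" by (simp only: right_diff_distrib)
  hence "?J * ?T - sum e ?F \<in> hpow h_scale N" using 1 by (rule lser.hpow_diff_trans)
  thus "\<exists>F. finite F \<and> F \<subseteq> UNIV \<and> (\<forall>i\<in>UNIV - F. e i \<in> hpow h_scale N) \<and> ?J * ?T - sum e F \<in> hpow h_scale N"
    by (intro exI[of _ ?F] conjI ballI M) auto
qed

lemma power2_nat: "0 \<le> k \<Longrightarrow> (S ^ 2) ^ nat k = (S::lser) ^ nat (2 * k)"
  by (simp add: nat_mult_distrib flip: power_mult)

lemma qsum_bound:
  assumes "S $ 0 = 0" "\<And>n. \<bar>n\<bar> - 1 \<le> E n"
  shows "\<exists>M::nat. \<forall>j. int M < \<bar>j\<bar> \<longrightarrow> S ^ nat (E j) * x powi j \<in> hpow h_scale N"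
proof (intro exI[of _ "N"] allI impI hpow_lser_mult(2))
  fix j assume "int N < \<bar>j\<bar>"
  thus "S ^ nat (E j) \<in> hpow h_scale N" using assms(2)[of j] by (intro hpow_lser_power assms(1)) auto
qed

lemma unit_mult_inverse: "(x::lser) $ 0 \<noteq> 0 \<Longrightarrow> x * inverse x = 1"
  by (subst mult.commute) (rule inverse_mult_eq_1)

lemma powi_plus1: "(x::lser) $ 0 \<noteq> 0 \<Longrightarrow> x powi (j + 1) = x * x powi j"
  by (simp add: powi_add powi_one mult.commute)

lemma powi_minus1: "(x::lser) $ 0 \<noteq> 0 \<Longrightarrow> x powi (j - 1) = inverse x * x powi j"
proof -
  assume x: "x $ 0 \<noteq> 0"
  have "inverse x * x powi j = inverse x * (x * x powi (j - 1))" using powi_plus1[OF x, of "j - 1"] by simp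
  also have "\<dots> = x powi (j - 1)" using unit_mult_inverse[OF x] by (metis mult.assoc mult.commute mult_1)
  finally show ?thesis by simp
qed

text \<open>
  For \<open>k = 1\<close> and \<open>k = 0\<close> this covers the two theta series; the recursion for \<open>E\<close> is what
  multiplication by \<open>S\<^sup>k x\<close> requires in \<open>triple_product\<close>.
\<close>
lemma qsum_product:
  assumes S: "S $ 0 = 0" and x: "x $ 0 \<noteq> 0" and k: "k \<le> 1"
    and E: "E 0 = 0" "\<And>j. E (j + 1) = E j + 2 * j + int k" "\<And>j. 0 \<le> E j" "\<And>j. \<bar>j\<bar> - 1 \<le> E j"
    and u: "(S ^ k * x) $ 0 \<noteq> - 1"
  shows "qsum S E x = qpoch (S ^ 2) (S ^ 2)
    * (qpoch (- (S ^ k * x)) (S ^ 2) * qpoch (- (S ^ (2 - k) * inverse x)) (S ^ 2))"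
proof (rule lser.has_hsum_unique[OF has_hsum_qsum[OF S E(4)]], rule triple_product)
  let ?e = "\<lambda>j. S ^ nat (E j) * x powi j"
  have k2: "2 = k + (2 - k)" using k by simp
  have z: "S ^ (2 - k) $ 0 = 0" using S k by (simp add: fps_power_zeroth power_0_left)
  show "(S ^ 2) $ 0 = 0" using S by (simp add: power2_eq_square)
  show "(S ^ (2 - k) * inverse x) $ 0 \<noteq> - 1" by (simp only: fps_mult_nth_0 z mult_zero_left) simp
  show "(S ^ k * x) $ 0 \<noteq> - 1" by fact
  have "S ^ k * x * (S ^ (2 - k) * inverse x) = S ^ (k + (2 - k)) * (x * inverse x)"
    by (simp only: power_add mult_ac)
  thus "S ^ k * x * (S ^ (2 - k) * inverse x) = S ^ 2"
    using k2 unit_mult_inverse[OF x] by simp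
  show "?e 0 = 1" by (simp add: E)
  show "\<exists>M::nat. \<forall>j. int M < \<bar>j\<bar> \<longrightarrow> ?e j \<in> hpow h_scale N" for N
    by (rule qsum_bound[OF S E(4)])
  have shift: "(S ^ 2) ^ n * (S ^ i * y) * ?e j = (S ^ 2) ^ nat m * (S ^ nat (E l) * (y * x powi j))"
    if "0 \<le> m" "2 * int n + int i + E j = 2 * m + E l" for n i y j m l
  proof -
    have nn: "0 \<le> 2 * int n" "0 \<le> int i" "0 \<le> 2 * int n + int i" by simp_all
    have "(S ^ 2) ^ n * (S ^ i * y) * ?e j = (S ^ nat (2 * int n) * S ^ nat (int i) * S ^ nat (E j)) * (y * x powi j)"
      using power2_nat[of "int n" S] by (simp add: mult_ac)
    also have "S ^ nat (2 * int n) * S ^ nat (int i) * S ^ nat (E j) = S ^ nat (2 * int n + int i + E j)"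
      by (simp only: power_nat_add nn E(3))
    also have "\<dots> = S ^ nat (2 * m) * S ^ nat (E l)"
      unfolding that(2) using that(1) by (intro power_nat_add[symmetric] E) simp
    finally show ?thesis using that(1) by (simp add: power2_nat mult_ac)
  qed
  show "(S ^ 2) ^ n * (S ^ k * x) * ?e j = (S ^ 2) ^ nat (int n - j) * ?e (j + 1)" if "j \<le> int n" for n j
    unfolding powi_plus1[OF x] by (rule shift) (use that in \<open>simp_all add: E(2)\<close>)
  show "(S ^ 2) ^ n * (S ^ (2 - k) * inverse x) * ?e j = (S ^ 2) ^ nat (int n + j) * ?e (j - 1)"
    if "- int n \<le> j" for n j
    unfolding powi_minus1[OF x]
    by (rule shift) (use that k E(2)[of "j - 1"] in \<open>simp_all add: of_nat_diff\<close>)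
qed

lemma tha_product:
  assumes S: "S $ 0 = 0" and x: "x $ 0 \<noteq> 0"
  shows "tha S x = qpoch (S ^ 2) (S ^ 2) * (qpoch (- (S * x)) (S ^ 2) * qpoch (- (S * inverse x)) (S ^ 2))"
  unfolding tha_def
  using qsum_product[OF S x, of 1 "\<lambda>n. n * n"] S square_bounds(1,5) by (simp add: algebra_simps)

lemma thb_product:
  assumes S: "S $ 0 = 0" and x: "x $ 0 \<noteq> 0" "x $ 0 \<noteq> - 1"
  shows "thb S x = qpoch (S ^ 2) (S ^ 2) * (qpoch (- x) (S ^ 2) * qpoch (- (S ^ 2 * inverse x)) (S ^ 2))"
  unfolding thb_def
  using qsum_product[OF S x(1), of 0 "\<lambda>n. n * n - n"] x(2) square_bounds(2,6) by (simp add: algebra_simps)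

section \<open>Theta function identities behind the fusion identity\<close>

lemma tha_mult':
  assumes "S $ 0 = 0" "x $ 0 \<noteq> 0" "y $ 0 \<noteq> 0" "y = w * x" "x * y = m"
  shows "tha S x * tha S y = th0 S m * th0 S w + S * y * (th1 S m * th1 S w)"
proof -
  have "y * inverse x = w" using unit_mult_inverse[OF assms(2)] assms(4) by algebra
  thus ?thesis using tha_mult[OF assms(1-3)] assms(5) by simp
qed

lemma thb_mult':
  assumes "S $ 0 = 0" "x $ 0 \<noteq> 0" "y $ 0 \<noteq> 0" "y = w * x" "x * y = m"
  shows "thb S x * thb S y = m * th1 S m * th0 S w + y * (th0 S m * th1 S w)"
proof -
  have "y * inverse x = w" using unit_mult_inverse[OF assms(2)] assms(4) by algebra
  thus ?thesis using thb_mult[OF assms(1-3)] assms(5) by simp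
qed

text \<open>
  Every product of two theta functions is expanded in the eight values of \<open>th0\<close> and \<open>th1\<close> at \<open>- t\<^sup>2\<close>,
  \<open>- q\<^sup>2\<close>, \<open>- (q t)\<^sup>2\<close> and \<open>- 1\<close>. Since \<open>th1\<close> vanishes at \<open>- 1\<close>, both sides become the same polynomial in
  the remaining seven values.
\<close>
lemma theta_identities:
  fixes S t q r :: lser
  assumes S: "S $ 0 = 0" and t: "t $ 0 \<noteq> 0" and q: "q $ 0 \<noteq> 0" and qr: "q * r = 1"
  defines "A \<equiv> \<lambda>z. tha S (- z)" and "B \<equiv> \<lambda>z. thb S (- z)"
  shows "B (q * t) * B (- (q * t)) * (A (r * t) * A (- (q * t)) + A (- (r * t)) * A (q * t))
      + q * (A (q * t) * A (- (q * t)) * (B (r * t) * B (- (q * t)) - B (- (r * t)) * B (q * t)))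
      = 2 * (B (- (q ^ 2 * t)) * B t * A t * A (- t))" (is ?I)
    and "B (q * t) * B (- (q * t)) * (A (r * t) * A (- (q * t)) - A (- (r * t)) * A (q * t))
      + q * (A (q * t) * A (- (q * t)) * (B (r * t) * B (- (q * t)) + B (- (r * t)) * B (q * t)))
      = 2 * q * (A (- (q ^ 2 * t)) * A t * B t * B (- t))" (is ?II)
proof -
  have "(q * r) $ 0 = 1" using qr by simp
  hence r: "r $ 0 \<noteq> 0" by auto
  let ?c0 = "th0 S (- (t ^ 2))" let ?c1 = "th1 S (- (t ^ 2))"
  let ?d0 = "th0 S (- (q ^ 2))" let ?d1 = "th1 S (- (q ^ 2))"
  let ?e0 = "th0 S (- ((q * t) ^ 2))" let ?e1 = "th1 S (- ((q * t) ^ 2))"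
  let ?k = "th0 S (- 1)"
  have u: "(r * t) $ 0 \<noteq> 0" "(- (r * t)) $ 0 \<noteq> 0" "(q * t) $ 0 \<noteq> 0" "(- (q * t)) $ 0 \<noteq> 0"
    "(- t) $ 0 \<noteq> 0" "(q ^ 2 * t) $ 0 \<noteq> 0"
    using t q r by (simp_all add: power2_eq_square)
  have A1: "A (r * t) * A (- (q * t)) = ?c0 * ?d0 + S * (q * t) * (?c1 * ?d1)"
    unfolding A_def minus_minus by (rule tha_mult'[OF S u(2) u(3)]) (use qr in algebra)+
  have A2: "A (- (r * t)) * A (q * t) = ?c0 * ?d0 + S * (- (q * t)) * (?c1 * ?d1)"
    unfolding A_def minus_minus by (rule tha_mult'[OF S u(1) u(4)]) (use qr in algebra)+
  have B1: "B (r * t) * B (- (q * t)) = - (t ^ 2) * ?c1 * ?d0 + (q * t) * (?c0 * ?d1)"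
    unfolding B_def minus_minus by (rule thb_mult'[OF S u(2) u(3)]) (use qr in algebra)+
  have B2: "B (- (r * t)) * B (q * t) = - (t ^ 2) * ?c1 * ?d0 + - (q * t) * (?c0 * ?d1)"
    unfolding B_def minus_minus by (rule thb_mult'[OF S u(1) u(4)]) (use qr in algebra)+
  have Aq: "A (q * t) * A (- (q * t)) = ?e0 * ?k + S * (q * t) * (?e1 * th1 S (- 1))"
    unfolding A_def minus_minus by (rule tha_mult'[OF S u(4) u(3)]) (use qr in algebra)+
  have Bq: "B (q * t) * B (- (q * t)) = - ((q * t) ^ 2) * ?e1 * ?k + (q * t) * (?e0 * th1 S (- 1))"
    unfolding B_def minus_minus by (rule thb_mult'[OF S u(4) u(3)]) (use qr in algebra)+
  have At: "A t * A (- t) = ?c0 * ?k + S * t * (?c1 * th1 S (- 1))"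
    unfolding A_def minus_minus by (rule tha_mult'[OF S u(5) t]) (use qr in algebra)+
  have Bt: "B t * B (- t) = - (t ^ 2) * ?c1 * ?k + t * (?c0 * th1 S (- 1))"
    unfolding B_def minus_minus by (rule thb_mult'[OF S u(5) t]) (use qr in algebra)+
  have Am: "A t * A (- (q ^ 2 * t)) = ?e0 * ?d0 + S * (q ^ 2 * t) * (?e1 * ?d1)"
    unfolding A_def minus_minus by (rule tha_mult'[OF S u(5) u(6)]) (use qr in algebra)+
  have Bm: "B t * B (- (q ^ 2 * t)) = - ((q * t) ^ 2) * ?e1 * ?d0 + q ^ 2 * t * (?e0 * ?d1)"
    unfolding B_def minus_minus by (rule thb_mult'[OF S u(5) u(6)]) (use qr in algebra)+
  note z = th1_minus_one[OF S]
  have "B (- (q ^ 2 * t)) * B t * A t * A (- t) = (B t * B (- (q ^ 2 * t))) * (A t * A (- t))"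
    by (simp only: mult_ac)
  thus ?I unfolding A1 A2 B1 B2 Aq Bq At Bm z by algebra
  have "A (- (q ^ 2 * t)) * A t * B t * B (- t) = (A t * A (- (q ^ 2 * t))) * (B t * B (- t))"
    by (simp only: mult_ac)
  thus ?II unfolding A1 A2 B1 B2 Aq Bq Bt Am z by algebra
qed

section \<open>Multiplier maps on Laurent coefficients\<close>

definition inner_cf :: "int \<Rightarrow> lser \<Rightarrow> complex fps" where
  "inner_cf m F = Abs_fps (\<lambda>n. F $ n $$ m)"

lemma inner_cf_nth [simp]: "inner_cf m F $ n = F $ n $$ m" by (simp add: inner_cf_def)

lemma lser_eqI: "(\<And>m. inner_cf m F = inner_cf m G) \<Longrightarrow> F = G"
  by (auto simp: fps_eq_iff fls_eq_iff)

lemma inner_cf_add [simp]: "inner_cf m (F + G) = inner_cf m F + inner_cf m G"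
  and inner_cf_diff [simp]: "inner_cf m (F - G) = inner_cf m F - inner_cf m G"
  and inner_cf_0 [simp]: "inner_cf m 0 = 0"
  and inner_cf_1 [simp]: "inner_cf m 1 = (if m = 0 then 1 else 0)"
  by (auto simp: fps_eq_iff)

lemma inner_cf_hc: "inner_cf m (hc c) = (if m = 0 then c else 0)"
  by (auto simp: fps_eq_iff)

lemma inner_cf_const: "inner_cf m (fps_const f) = fps_const (f $$ m)"
  by (auto simp: fps_eq_iff)

lemma inner_cf_hc_mult: "inner_cf m (hc c * F) = c * inner_cf m F"
  by (auto simp: fps_eq_iff fps_mult_nth fls_nth_sum)

lemma inner_cf_X_mult: "inner_cf m (fps_const (fls_X_intpow k) * F) = inner_cf (m - k) F"
  by (auto simp: fps_eq_iff fls_X_intpow_times_conv_shift)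

lemma lser_bound: "\<exists>d. \<forall>k\<le>n. \<forall>i<d. (F::lser) $ k $$ i = 0"
proof (intro exI[of _ "Min ((\<lambda>k. fls_subdegree (F $ k)) ` {..n})"] allI impI)
  fix k i assume "k \<le> n" "i < Min ((\<lambda>k. fls_subdegree (F $ k)) ` {..n})"
  hence "i < fls_subdegree (F $ k)" by auto
  thus "F $ k $$ i = 0" by simp
qed

lemma lser_bound2: "\<exists>d. \<forall>k\<le>n. \<forall>i<d. (F::lser) $ k $$ i = 0 \<and> (G::lser) $ k $$ i = 0"
proof -
  obtain d1 where "\<forall>k\<le>n. \<forall>i<d1. F $ k $$ i = 0" using lser_bound by blast
  moreover obtain d2 where "\<forall>k\<le>n. \<forall>i<d2. G $ k $$ i = 0" using lser_bound by blast
  ultimately show ?thesis by (intro exI[of _ "min d1 d2"]) auto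
qed

lemma fls_times_nth_bound:
  fixes f g :: "'a::comm_ring_1 fls"
  assumes "\<And>i. i < d \<Longrightarrow> f $$ i = 0" "\<And>i. i < d' \<Longrightarrow> g $$ i = 0"
  shows "(f * g) $$ m = (\<Sum>i\<in>{d..m - d'}. f $$ i * g $$ (m - i))"
proof (cases "f = 0 \<or> g = 0")
  case False
  hence "d \<le> fls_subdegree f" "d' \<le> fls_subdegree g"
    using assms by (meson fls_subdegree_geI)+
  thus ?thesis unfolding fls_times_nth(2) by (intro sum.mono_neutral_left) auto
qed auto

text \<open>
  Modulo a power of \<open>h\<close> the inner exponents are bounded below, which makes the Cauchy product in
  the inner variable finite.
\<close>
lemma inner_cf_mult_nth:
  assumes "\<And>k i. k \<le> n \<Longrightarrow> i < d \<Longrightarrow> F $ k $$ i = 0" "\<And>k i. k \<le> n \<Longrightarrow> i < d' \<Longrightarrow> G $ k $$ i = 0"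
  shows "inner_cf m (F * G) $ n = (\<Sum>i\<in>{d..m - d'}. inner_cf i F * inner_cf (m - i) G) $ n"
proof -
  have "inner_cf m (F * G) $ n = (\<Sum>k=0..n. (F $ k * G $ (n - k)) $$ m)"
    by (simp add: fps_mult_nth fls_nth_sum)
  also have "\<dots> = (\<Sum>k=0..n. \<Sum>i\<in>{d..m - d'}. F $ k $$ i * G $ (n - k) $$ (m - i))"
    by (intro sum.cong refl fls_times_nth_bound) (use assms in auto)
  also have "\<dots> = (\<Sum>i\<in>{d..m - d'}. \<Sum>k=0..n. F $ k $$ i * G $ (n - k) $$ (m - i))"
    by (rule sum.swap)
  finally show ?thesis by (simp add: fps_sum_nth fps_mult_nth)
qed

text \<open>
  Multiplication of the coefficient of \<open>t\<^sup>m\<close> by \<open>\<chi> m\<close>. For multiplicative \<open>\<chi>\<close> this is the substitution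
  of \<open>\<chi>(1) t\<close> for the inner variable \<open>t\<close>.
\<close>
definition twist :: "(int \<Rightarrow> complex fps) \<Rightarrow> lser \<Rightarrow> lser" where
  "twist \<chi> F = Abs_fps (\<lambda>n. Abs_fls (\<lambda>m. (\<chi> m * inner_cf m F) $ n))"

lemma twist_bound:
  assumes "\<forall>k\<le>n. \<forall>i<d. F $ k $$ i = 0" "i < d" "k \<le> n"
  shows "(\<chi> i * inner_cf i F) $ k = 0"
  using assms by (auto simp: fps_mult_nth intro!: sum.neutral)

lemma twist_nth: "twist \<chi> F $ n $$ m = (\<chi> m * inner_cf m F) $ n"
proof -
  obtain d where "\<forall>k\<le>n. \<forall>i<d. F $ k $$ i = 0" using lser_bound by blast
  hence "\<forall>i<d. (\<chi> i * inner_cf i F) $ n = 0" using twist_bound by blast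
  thus ?thesis unfolding twist_def by (simp add: nth_Abs_fls_lower_bound)
qed

lemma inner_cf_twist: "inner_cf m (twist \<chi> F) = \<chi> m * inner_cf m F"
  by (simp add: fps_eq_iff twist_nth)

lemma twist_add: "twist \<chi> (F + G) = twist \<chi> F + twist \<chi> G"
  by (rule lser_eqI) (simp add: inner_cf_twist algebra_simps)

text \<open>
  The assumption is multiplicativity on the supports, so that the lemma also covers multipliers
  that make sense for nonnegative exponents only, such as the one in \<open>q_twist\<close>.
\<close>
lemma twist_mult:
  assumes "\<And>i j. inner_cf i F \<noteq> 0 \<Longrightarrow> inner_cf j G \<noteq> 0 \<Longrightarrow> \<chi> (i + j) = \<chi> i * \<chi> j"
  shows "twist \<chi> (F * G) = twist \<chi> F * twist \<chi> G"
proof (rule lser_eqI, rule fps_ext)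
  fix m n
  obtain d where d: "\<forall>k\<le>n. \<forall>i<d. F $ k $$ i = 0 \<and> G $ k $$ i = 0" using lser_bound2 by blast
  have tw: "twist \<chi> F $ k $$ i = 0" "twist \<chi> G $ k $$ i = 0" if "k \<le> n" "i < d" for k i
    unfolding twist_nth using twist_bound[of n d _ i k] d that by auto
  have "(twist \<chi> F * twist \<chi> G) $ n $$ m = inner_cf m (twist \<chi> F * twist \<chi> G) $ n" by simp
  also have "\<dots> = (\<Sum>i\<in>{d..m - d}. inner_cf i (twist \<chi> F) * inner_cf (m - i) (twist \<chi> G)) $ n"
    by (rule inner_cf_mult_nth) (use tw in auto)
  also have "(\<Sum>i\<in>{d..m - d}. inner_cf i (twist \<chi> F) * inner_cf (m - i) (twist \<chi> G))
      = \<chi> m * (\<Sum>i\<in>{d..m - d}. inner_cf i F * inner_cf (m - i) G)"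
    unfolding sum_distrib_left
  proof (intro sum.cong refl)
    fix i
    show "inner_cf i (twist \<chi> F) * inner_cf (m - i) (twist \<chi> G) = \<chi> m * (inner_cf i F * inner_cf (m - i) G)"
    proof (cases "inner_cf i F = 0 \<or> inner_cf (m - i) G = 0")
      case False
      hence "\<chi> m = \<chi> i * \<chi> (m - i)" using assms[of i "m - i"] by simp
      thus ?thesis by (simp add: inner_cf_twist mult_ac)
    qed (auto simp: inner_cf_twist)
  qed
  also have "(\<chi> m * (\<Sum>i\<in>{d..m - d}. inner_cf i F * inner_cf (m - i) G)) $ n
      = (\<Sum>k=0..n. \<chi> m $ k * (\<Sum>i\<in>{d..m - d}. inner_cf i F * inner_cf (m - i) G) $ (n - k))"
    by (simp add: fps_mult_nth)
  also have "\<dots> = (\<Sum>k=0..n. \<chi> m $ k * inner_cf m (F * G) $ (n - k))"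
    by (intro sum.cong refl arg_cong2[where f = "(*)"] inner_cf_mult_nth[symmetric]) (use d in auto)
  also have "\<dots> = (\<chi> m * inner_cf m (F * G)) $ n" by (simp add: fps_mult_nth)
  finally show "inner_cf m (twist \<chi> (F * G)) $ n = inner_cf m (twist \<chi> F * twist \<chi> G) $ n"
    unfolding inner_cf_twist by simp
qed

lemma inner_cf_fps_X: "inner_cf m fps_X = (if m = 0 then fps_X else 0)"
  by (auto simp: fps_eq_iff fps_X_def)

lemma twist_hc: "\<chi> 0 = 1 \<Longrightarrow> twist \<chi> (hc c) = hc c"
  by (rule lser_eqI) (auto simp: inner_cf_twist inner_cf_hc)

lemma hhom_twist:
  assumes "\<chi> 0 = 1" "\<And>i j. \<chi> (i + j) = \<chi> i * \<chi> j"
  shows "hhom (twist \<chi>)"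
proof
  show "twist \<chi> (F + G) = twist \<chi> F + twist \<chi> G" for F G by (rule twist_add)
  show "twist \<chi> (F * G) = twist \<chi> F * twist \<chi> G" for F G by (rule twist_mult) (rule assms)
  show "twist \<chi> 1 = 1" using twist_hc[of \<chi> 1] assms(1) by (simp add: hc.one)
  show "twist \<chi> fps_X = fps_X" by (rule lser_eqI) (auto simp: inner_cf_twist inner_cf_fps_X assms)
qed

definition inner_X_inv :: lser where "inner_X_inv = fps_const fls_X_inv"

lemma inner_cf_inner_X_inv: "inner_cf m inner_X_inv = (if m = - 1 then 1 else 0)"
  by (auto simp: inner_X_inv_def inner_cf_const fps_eq_iff)

lemma twist_inner_X_inv: "twist \<chi> inner_X_inv = hc (\<chi> (- 1)) * inner_X_inv"
  by (rule lser_eqI) (auto simp: inner_cf_twist inner_cf_inner_X_inv inner_cf_hc_mult)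

section \<open>The substitutions \<open>z \<mapsto> q z\<close> and \<open>z \<mapsto> - z\<close>\<close>

text \<open>
  As \<open>t = 1/z\<close>, multiplying \<open>t\<^sup>m\<close> by \<open>q\<^sup>-\<^sup>m = e\<^bsup>- m h/2\<^esup>\<close> is the substitution \<open>z \<mapsto> q z\<close>.
\<close>
definition qshift :: "lser \<Rightarrow> lser" where "qshift = twist (\<lambda>m. fps_exp (- (of_int m / 2)))"
definition zneg :: "lser \<Rightarrow> lser" where "zneg = twist (\<lambda>m. fps_const ((- 1) powi m))"

interpretation qshift: hhom qshift
  unfolding qshift_def
  by (rule hhom_twist) (auto simp: field_simps simp flip: fps_exp_add_mult)

interpretation zneg: hhom zneg
  unfolding zneg_def
  by (rule hhom_twist) (auto simp: power_int_add)

lemma qshift_hc: "qshift (hc c) = hc c" unfolding qshift_def by (rule twist_hc) simp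
lemma zneg_hc: "zneg (hc c) = hc c" unfolding zneg_def by (rule twist_hc) simp
lemma qshift_inner_X_inv: "qshift inner_X_inv = hc (qpow 1) * inner_X_inv" by (simp add: qshift_def twist_inner_X_inv qpow_def)
lemma zneg_inner_X_inv: "zneg inner_X_inv = - inner_X_inv"
proof -
  have "hc (fps_const (- 1)) = - 1" by (auto simp: fps_eq_iff fls_const_uminus)
  thus ?thesis by (simp add: zneg_def twist_inner_X_inv)
qed

lemma qshift_zneg: "qshift (zneg F) = zneg (qshift F)"
  by (rule lser_eqI) (simp add: qshift_def zneg_def inner_cf_twist mult_ac)

lemma zneg_zneg: "zneg (zneg F) = F"
proof (rule lser_eqI)
  fix m
  have "((- 1) powi m * (- 1) powi m :: complex) = 1" by (simp flip: power_int_mult_distrib)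
  thus "inner_cf m (zneg (zneg F)) = inner_cf m F"
    by (simp add: zneg_def inner_cf_twist flip: mult.assoc)
qed

lemma zneg_nth: "zneg F $ n = zneg (fps_const (F $ n)) $ 0"
  by (simp add: zneg_def fls_eq_iff twist_nth)

section \<open>Expansion of rational functions at infinity\<close>

interpretation fc: fhom "fls_const :: complex \<Rightarrow> complex fls"
  by (intro fhomI fls_const_rhom)

lemma fls_nonconst: "f $$ m \<noteq> 0 \<Longrightarrow> m \<noteq> 0 \<Longrightarrow> f \<notin> range fls_const"
  by auto

interpretation at_inf: transcendental_subst "fls_const :: complex \<Rightarrow> complex fls" fls_X_inv
  by standard (rule fls_nonconst[of _ "- 1"], auto)

definition expand_inf :: "ratfun \<Rightarrow> complex fls" where "expand_inf = rat_subst fls_const fls_X_inv"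

text \<open>
  The expansion at \<open>z = \<infinity>\<close> of a series in \<open>h\<close> whose coefficients are rational functions of \<open>z\<close>.
\<close>
definition Eh :: "ratfun fps \<Rightarrow> lser" where "Eh = fps_lift expand_inf"

interpretation Eh: hhom Eh
  unfolding Eh_def expand_inf_def by (rule hhom_fps_lift) (rule at_inf.r.rhom_axioms)

lemma Eh_nth: "Eh F $ n = expand_inf (F $ n)" by (simp add: Eh_def)

lemma Eh_hconst: "Eh (hconst c) = hc c"
  by (simp add: fps_eq_iff Eh_nth expand_inf_def hconst_def at_inf.rat_subst_cz)

lemma Eh_const: "Eh (fps_const r) = fps_const (expand_inf r)"
  by (auto simp: fps_eq_iff Eh_nth expand_inf_def at_inf.r.zero)

lemma Eh_zvar: "Eh (fps_const zvar) = inner_X_inv"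
  by (simp add: Eh_const inner_X_inv_def expand_inf_def at_inf.rat_subst_zvar)

lemma Eh_zvar_inv: "Eh (fps_const (inverse zvar)) = inverse inner_X_inv"
  by (simp add: Eh_const inner_X_inv_def expand_inf_def at_inf.r.inverse at_inf.rat_subst_zvar fps_const_inverse)

interpretation cz: fhom cz
  by (intro fhomI cz_rhom)

interpretation at_neg: transcendental_subst cz "- zvar"
  by standard (rule zvar_not_const)

interpretation at_sq: transcendental_subst cz "zvar ^ 2"
  by standard (rule zvar_not_const)

lemma Eh_zsubst_neg: "Eh (zsubst (- zvar) F) = zneg (Eh F)"
proof (rule fps_ext)
  fix n
  define \<psi> where "\<psi> = (\<lambda>r. zneg (fps_const (expand_inf r)) $ 0)"
  have "rhom (\<lambda>g::complex fls. zneg (fps_const g) $ 0)"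
    by standard (simp_all add: zneg.add zneg.mult zneg.one flip: fps_const_add fps_const_mult)
  hence 1: "rhom \<psi>"
    unfolding \<psi>_def by (rule rhom_comp[rotated]) (unfold expand_inf_def, rule at_inf.r.rhom_axioms)
  have 2: "rhom (\<lambda>r. expand_inf (rat_subst cz (- zvar) r))"
    by (rule rhom_comp[OF at_neg.r.rhom_axioms]) (unfold expand_inf_def, rule at_inf.r.rhom_axioms)
  have "expand_inf (rat_subst cz (- zvar) r) = \<psi> r" for r
  proof (rule rhom_ratfun_unique[OF 2 1])
    fix c
    have "fps_const (fls_const c) = hc (fps_const c)" by (auto simp: fps_eq_iff)
    thus "expand_inf (rat_subst cz (- zvar) (cz c)) = \<psi> (cz c)"
      by (simp add: at_neg.rat_subst_cz \<psi>_def expand_inf_def at_inf.rat_subst_cz zneg_hc)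
  next
    show "expand_inf (rat_subst cz (- zvar) zvar) = \<psi> zvar"
      using zneg_inner_X_inv by (simp add: at_neg.rat_subst_zvar \<psi>_def expand_inf_def at_inf.rat_subst_zvar at_inf.r.minus inner_X_inv_def)
  qed
  thus "Eh (zsubst (- zvar) F) $ n = zneg (Eh F) $ n"
    unfolding zneg_nth[of "Eh F"] by (simp add: Eh_nth zsubst_def \<psi>_def)
qed

lemma hc_half: "hc (fps_const (1/2)) * 2 = 1"
proof -
  have "fls_const (1/2) * 2 = (1 :: complex fls)"
    by (metis fls_const_1 fls_const_mult_const nonzero_eq_divide_eq zero_neq_numeral fls_of_nat of_nat_numeral)
  hence "fps_const (fls_const (1/2)) * 2 = (1 :: lser)" by (metis fps_const_1_eq_1 fps_const_mult fps_numeral_fps_const)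
  moreover have "hc (fps_const (1/2)) = fps_const (fls_const (1/2))" by (auto simp: fps_eq_iff)
  ultimately show ?thesis by simp
qed

lemma Eh_even_part: "2 * Eh (even_part F) = Eh F + zneg (Eh F)"
  and Eh_odd_part: "2 * Eh (odd_part F) = Eh F - zneg (Eh F)"
proof -
  have "fps_const (cz (1/2)) = hconst (fps_const (1/2))"
    by (auto simp: fps_eq_iff hconst_def cz.zero)
  hence "2 * Eh (fps_const (cz (1/2))) = 1" by (simp only: Eh_hconst hc_half mult.commute[of 2])
  thus "2 * Eh (even_part F) = Eh F + zneg (Eh F)" "2 * Eh (odd_part F) = Eh F - zneg (Eh F)"
    unfolding even_part_def odd_part_def Eh.mult Eh.add Eh.diff Eh_zsubst_neg
    by (metis mult.assoc mult_1)+
qed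

section \<open>The recursion for the coefficients of \<open>f\<close>\<close>

text \<open>
  The coefficient of \<open>z\<^sup>m\<close> in \<open>(1 - z)/(1 - u z)\<close>.
\<close>
definition quot_coeff :: "'a::comm_ring_1 \<Rightarrow> nat \<Rightarrow> 'a" where
  "quot_coeff u m = (case m of 0 \<Rightarrow> 1 | Suc k \<Rightarrow> u ^ Suc k - u ^ k)"

text \<open>
  The coefficientwise form of \<open>g(z) g(u z) = (1 - z)/(1 - u z)\<close> with \<open>g(0) = 1\<close>, for which \<open>u = q\<^sup>2\<close> is
  the case of interest.
\<close>
definition f_recursion :: "'a::comm_ring_1 \<Rightarrow> (nat \<Rightarrow> 'a) \<Rightarrow> bool" where
  "f_recursion u g \<longleftrightarrow> g 0 = 1 \<and> (\<forall>m. (\<Sum>i\<le>m. g i * (g (m - i) * u ^ (m - i))) = quot_coeff u m)"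

lemma f_recursion_step:
  assumes "f_recursion u g" "m > 0"
  shows "g m * (1 + u ^ m) = quot_coeff u m - (\<Sum>i\<in>{0<..<m}. g i * (g (m - i) * u ^ (m - i)))"
proof -
  have "{..m} = insert 0 (insert m {0<..<m})" using assms(2) by auto
  hence "(\<Sum>i\<le>m. g i * (g (m - i) * u ^ (m - i))) =
    g m * u ^ m + (g m + (\<Sum>i\<in>{0<..<m}. g i * (g (m - i) * u ^ (m - i))))"
    using assms by (simp add: f_recursion_def)
  thus ?thesis using assms(1) unfolding f_recursion_def by (simp add: algebra_simps)
qed

text \<open>
  The unknown \<open>g m\<close> enters the \<open>m\<close>-th equation with the factor \<open>1 + u\<^sup>m\<close>.
\<close>
lemma f_recursion_unique:
  fixes g g' :: "nat \<Rightarrow> 'a::idom"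
  assumes "f_recursion u g" "f_recursion u g'" "\<And>m. m > 0 \<Longrightarrow> 1 + u ^ m \<noteq> 0"
  shows "g m = g' m"
proof (induction m rule: less_induct)
  case (less m)
  show ?case
  proof (cases "m = 0")
    case True thus ?thesis using assms by (simp add: f_recursion_def)
  next
    case False
    hence "g m * (1 + u ^ m) = g' m * (1 + u ^ m)"
      using f_recursion_step[OF assms(1), of m] f_recursion_step[OF assms(2), of m] less by simp
    thus ?thesis using assms(3)[of m] False by simp
  qed
qed

lemma f_recursion_hom:
  assumes "rhom \<phi>" "f_recursion u g"
  shows "f_recursion (\<phi> u) (\<lambda>m. \<phi> (g m))"
proof -
  interpret rhom \<phi> by fact
  have "(\<Sum>i\<le>m. \<phi> (g i) * (\<phi> (g (m - i)) * \<phi> u ^ (m - i))) = \<phi> (\<Sum>i\<le>m. g i * (g (m - i) * u ^ (m - i)))" for m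
    by (simp add: sum hom)
  moreover have "\<phi> (quot_coeff u m) = quot_coeff (\<phi> u) m" for m
    by (cases m) (simp_all add: quot_coeff_def hom)
  ultimately show ?thesis using assms(2) by (simp add: f_recursion_def one)
qed

lemma f_recursion_hom_inj:
  assumes "rhom \<phi>" "inj \<phi>" "f_recursion (\<phi> u) (\<lambda>m. \<phi> (g m))"
  shows "f_recursion u g"
proof -
  interpret rhom \<phi> by fact
  have "\<phi> (\<Sum>i\<le>m. g i * (g (m - i) * u ^ (m - i))) = (\<Sum>i\<le>m. \<phi> (g i) * (\<phi> (g (m - i)) * \<phi> u ^ (m - i)))" for m
    by (simp add: sum hom)
  moreover have "\<phi> (quot_coeff u m) = quot_coeff (\<phi> u) m" for m
    by (cases m) (simp_all add: quot_coeff_def hom)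
  ultimately show ?thesis using assms(3) injD[OF assms(2)] unfolding f_recursion_def by (metis one)
qed

text \<open>
  The equation for the product only gives \<open>g(0)\<^sup>2 = 1\<close>; the last assumption selects the sign.
\<close>
lemma f_recursion_from_product:
  fixes g H :: "nat \<Rightarrow> 'a::idom"
  assumes "\<And>m. H m = (\<Sum>i\<le>m. g i * (g (m - i) * u ^ (m - i)))"
    and "H 0 = 1" "H 1 - u * H 0 = - 1" "\<And>m. H (Suc (Suc m)) - u * H (Suc m) = 0"
    and "g 0 \<noteq> - 1"
  shows "f_recursion u g"
proof -
  have "g 0 * g 0 = 1" using assms(1)[of 0] assms(2) by simp
  hence "(g 0 - 1) * (g 0 + 1) = 0" by (simp add: algebra_simps)
  hence "g 0 - 1 = 0 \<or> g 0 + 1 = 0" by (simp only: mult_eq_0_iff)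
  moreover have "g 0 + 1 \<noteq> 0" using assms(5) by (simp only: eq_neg_iff_add_eq_0 not_False_eq_True)
  ultimately have g0: "g 0 = 1" by (simp only: right_minus_eq simp_thms)
  have "H (Suc m) = u ^ Suc m - u ^ m" for m
  proof (induction m)
    case 0
    have "H (Suc 0) = u * H 0 - 1" using assms(3) by (simp add: diff_eq_eq)
    thus ?case by (simp add: assms(2))
  next
    case (Suc m)
    have "H (Suc (Suc m)) = u * H (Suc m)" using assms(4)[of m] by simp
    thus ?case unfolding Suc by (simp add: right_diff_distrib)
  qed
  hence "H m = quot_coeff u m" for m using assms(2) by (cases m) (auto simp: quot_coeff_def)
  thus ?thesis using assms(1) g0 by (simp add: f_recursion_def)
qed

section \<open>Series without negative powers\<close>

definition nonneg :: "lser \<Rightarrow> bool" where "nonneg F \<longleftrightarrow> (\<forall>m<0. inner_cf m F = 0)"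

lemma nonneg_iff: "nonneg F \<longleftrightarrow> (\<forall>n. \<forall>m<0. F $ n $$ m = 0)"
  unfolding nonneg_def by (auto simp: fps_eq_iff)

lemma nonneg_diff: "nonneg F \<Longrightarrow> nonneg G \<Longrightarrow> nonneg (F - G)"
  and nonneg_1: "nonneg 1"
  by (auto simp: nonneg_def)

lemma inner_cf_mult_nonneg:
  assumes "nonneg F" "nonneg G"
  shows "inner_cf m (F * G) = (\<Sum>i\<in>{0..m}. inner_cf i F * inner_cf (m - i) G)"
proof (rule fps_ext)
  fix n show "inner_cf m (F * G) $ n = (\<Sum>i\<in>{0..m}. inner_cf i F * inner_cf (m - i) G) $ n"
    using inner_cf_mult_nth[of n 0 F 0 G m] assms by (simp add: nonneg_iff)
qed

lemma nonneg_mult: "nonneg F \<Longrightarrow> nonneg G \<Longrightarrow> nonneg (F * G)"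
  unfolding nonneg_def[of "F * G"] by (simp add: inner_cf_mult_nonneg)

lemma nonneg_power: "nonneg F \<Longrightarrow> nonneg (F ^ n)"
  by (induction n) (auto simp: nonneg_1 nonneg_mult)

lemma nonneg_prod: "(\<And>i. i \<in> A \<Longrightarrow> nonneg (f i)) \<Longrightarrow> nonneg (prod f A)"
  by (induction A rule: infinite_finite_induct) (auto simp: nonneg_1 nonneg_mult)

lemma nonneg_hc: "nonneg (hc c)"
  by (simp add: nonneg_def inner_cf_hc)

lemma nonneg_prodinf:
  assumes "hprod_ok f" "\<And>k. nonneg (f k)"
  shows "nonneg (prodinf f)"
  unfolding nonneg_iff
proof (intro allI impI)
  fix n m :: int and k
  assume "m < 0"
  obtain K where "\<forall>n\<ge>K. \<forall>M\<le>k. prodinf f $ M = (\<Prod>k<n. f k) $ M"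
    using prodinf_nth[OF assms(1)] by blast
  hence "prodinf f $ k = (\<Prod>k<K. f k) $ k" by simp
  thus "prodinf f $ k $$ m = 0"
    using nonneg_prod[of "{..<K}" f] assms(2) \<open>m < 0\<close> by (simp add: nonneg_iff)
qed

text \<open>
  Induction on the power of \<open>h\<close>: as \<open>D\<close> starts with \<open>1\<close>, the equation for \<open>F D\<close> expresses each
  coefficient of \<open>F\<close> by the preceding ones.
\<close>
lemma nonneg_div:
  assumes "nonneg (F * D)" "nonneg D" "D $ 0 = 1"
  shows "nonneg F"
proof -
  have "\<forall>m<0. F $ n $$ m = 0" for n
  proof (induction n rule: less_induct)
    case (less n)
    have "(F * D) $ n = (\<Sum>i=0..n. F $ i * D $ (n - i))" by (simp add: fps_mult_nth)
    also have "\<dots> = F $ n + (\<Sum>i=0..<n. F $ i * D $ (n - i))"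
      using assms(3) by (simp add: atLeastLessThanSuc_atLeastAtMost[symmetric] add.commute)
    finally have e: "F $ n = (F * D) $ n - (\<Sum>i=0..<n. F $ i * D $ (n - i))" by simp
    show ?case
    proof (intro allI impI)
      fix m :: int assume m: "m < 0"
      have "(F $ i * D $ (n - i)) $$ m = 0" if "i < n" for i
        using less[OF that] assms(2) m by (subst fls_times_nth_bound[of 0 _ 0]) (auto simp: nonneg_iff)
      thus "F $ n $$ m = 0" unfolding e using assms(1) m by (simp add: fls_nth_sum nonneg_iff)
    qed
  qed
  thus ?thesis by (simp add: nonneg_iff)
qed

lemma inner_cf_product_rec:
  assumes "nonneg F" and tw: "\<And>m. m \<ge> 0 \<Longrightarrow> inner_cf m F' = u ^ nat m * inner_cf m F" "nonneg F'"
  shows "inner_cf (int m) (F * F') = (\<Sum>i\<le>m. inner_cf (int i) F * (inner_cf (int (m - i)) F * u ^ (m - i)))"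
proof -
  have "inner_cf (int m) (F * F') = (\<Sum>i\<in>{0..int m}. inner_cf i F * inner_cf (int m - i) F')"
    by (rule inner_cf_mult_nonneg) fact+
  also have "\<dots> = (\<Sum>i\<le>m. inner_cf (int i) F * inner_cf (int m - int i) F')"
    by (rule sum.reindex_bij_witness[of _ int nat]) auto
  also have "\<dots> = (\<Sum>i\<le>m. inner_cf (int i) F * (inner_cf (int (m - i)) F * u ^ (m - i)))"
    by (intro sum.cong refl) (auto simp: tw of_nat_diff mult_ac nat_diff_distrib)
  finally show ?thesis .
qed

definition inner_X :: lser where "inner_X = fps_const fls_X"

lemma inner_cf_inner_X: "inner_cf m inner_X = (if m = 1 then 1 else 0)"
  by (auto simp: inner_X_def inner_cf_const fps_eq_iff)

lemma inner_cf_inner_X_mult: "inner_cf m (inner_X * F) = inner_cf (m - 1) F"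
  using inner_cf_X_mult[of m 1 F] by (simp add: inner_X_def fls_X_conv_shift_1)

lemma nonneg_inner_X: "nonneg inner_X" by (simp add: nonneg_def inner_cf_inner_X)

lemma f_recursion_from_lser:
  assumes F: "nonneg F" "nonneg F'" and tw: "\<And>m. m \<ge> 0 \<Longrightarrow> inner_cf m F' = u ^ nat m * inner_cf m F"
    and eq: "F * F' * (1 - hc u * inner_X) = 1 - inner_X" and F0: "F $ 0 $$ 0 \<noteq> - 1"
  shows "f_recursion u (\<lambda>m. inner_cf (int m) F)"
proof (rule f_recursion_from_product)
  define H where "H = F * F'"
  show "inner_cf (int m) H = (\<Sum>i\<le>m. inner_cf (int i) F * (inner_cf (int (m - i)) F * u ^ (m - i)))" for m
    unfolding H_def by (rule inner_cf_product_rec) fact+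
  have neg: "inner_cf (- 1) H = 0" using nonneg_mult[OF F] by (simp add: H_def nonneg_def)
  have "H - hc u * (inner_X * H) = 1 - inner_X" using eq by (simp add: H_def algebra_simps)
  hence "inner_cf m (H - hc u * (inner_X * H)) = inner_cf m (1 - inner_X)" for m by simp
  hence e: "inner_cf m H - u * inner_cf (m - 1) H = (if m = 0 then 1 else 0) - (if m = 1 then 1 else 0)" for m
    by (simp add: inner_cf_hc_mult inner_cf_inner_X_mult inner_cf_inner_X)
  show "inner_cf (int 0) H = 1" using e[of 0] neg by simp
  show "inner_cf (int 1) H - u * inner_cf (int 0) H = - 1" using e[of 1] by simp
  show "inner_cf (int (Suc (Suc m))) H - u * inner_cf (int (Suc m)) H = 0" for m
    using e[of "int (Suc (Suc m))"] by simp
  show "inner_cf (int 0) F \<noteq> - 1"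
  proof
    assume "inner_cf (int 0) F = - 1"
    hence "inner_cf (int 0) F $ 0 = - 1" by simp
    thus False using F0 by simp
  qed
qed

section \<open>The functional equation of the product defining \<open>f\<close>\<close>

text \<open>
  The substitution \<open>z \<mapsto> q\<^sup>2 z\<close> on series without negative powers of \<open>z\<close>, where the outer variable is
  \<open>q\<close> rather than \<open>h\<close>. On negative powers it would introduce negative powers of \<open>q\<close>; they are sent to
  \<open>0\<close>.
\<close>
definition q_twist :: "lser \<Rightarrow> lser" where
  "q_twist = twist (\<lambda>m. if m \<ge> 0 then fps_X ^ (2 * nat m) else 0)"

lemma q_twist_mult: "nonneg F \<Longrightarrow> nonneg G \<Longrightarrow> q_twist (F * G) = q_twist F * q_twist G"
  unfolding q_twist_def
proof (rule twist_mult)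
  fix i j assume "nonneg F" "nonneg G" "inner_cf i F \<noteq> 0" "inner_cf j G \<noteq> 0"
  hence "i \<ge> 0" "j \<ge> 0" unfolding nonneg_def using not_le by blast+
  thus "(if 0 \<le> i + j then fps_X ^ (2 * nat (i + j)) else 0) =
       (if 0 \<le> i then fps_X ^ (2 * nat i) else 0) * (if 0 \<le> j then fps_X ^ (2 * nat j) else (0::complex fps))"
    by (simp add: nat_add_distrib power_add add_mult_distrib2)
qed

lemma q_twist_hc: "q_twist (hc c) = hc c"
  unfolding q_twist_def by (rule twist_hc) simp

lemma q_twist_inner_X: "q_twist (hc c * inner_X) = hc (c * fps_X ^ 2) * inner_X"
  by (rule lser_eqI) (auto simp: q_twist_def inner_cf_twist inner_cf_hc_mult inner_cf_inner_X)

lemma twist_nth_cong: "(\<And>k. k \<le> n \<Longrightarrow> F $ k = G $ k) \<Longrightarrow> twist \<chi> F $ n = twist \<chi> G $ n"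
  by (auto simp: fls_eq_iff twist_nth fps_mult_nth intro!: sum.cong)

lemma fps_X_hc: "fps_X ^ n = hc (fps_X ^ n)"
  by (simp add: hc.power hc.fps_X)

lemma lser_rotate: "x * a * b = a * b * (x :: lser)" by (simp only: mult_ac)

lemma q_twist_qpoch:
  "q_twist (qpoch (inner_X * fps_X ^ j) (fps_X ^ 4)) = qpoch (inner_X * fps_X ^ (j + 2)) (fps_X ^ 4)" (is ?A)
  "nonneg (qpoch (inner_X * fps_X ^ j) (fps_X ^ 4))" (is ?B)
proof -
  let ?f = "\<lambda>k. 1 - inner_X * fps_X ^ j * (fps_X ^ 4) ^ k"
  let ?g = "\<lambda>k. 1 - inner_X * fps_X ^ (j + 2) * (fps_X ^ 4) ^ k :: lser"
  have "fls_X \<noteq> (1::complex fls)" by (metis fls_X_nth fls_one_nth one_neq_zero)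
  hence x0: "(inner_X * fps_X ^ i) $ 0 \<noteq> 1" for i by (cases i) (auto simp: inner_X_def)
  have ok: "hprod_ok ?f" "hprod_ok ?g"
    by (intro hprod_ok_qpoch x0; simp)+
  have f: "?f k = 1 - hc (fps_X ^ (j + 4 * k)) * inner_X" for k
  proof -
    have "(fps_X :: lser) ^ (j + 4 * k) = fps_X ^ j * (fps_X ^ 4) ^ k" by (simp only: power_add power_mult)
    hence "inner_X * fps_X ^ j * (fps_X ^ 4) ^ k = fps_X ^ (j + 4 * k) * inner_X"
      by (simp only: lser_rotate)
    thus ?thesis unfolding fps_X_hc[of "j + 4 * k", symmetric] by (rule arg_cong)
  qed
  have nf: "nonneg (?f k)" for k
    unfolding f by (intro nonneg_diff nonneg_1 nonneg_mult nonneg_inner_X nonneg_hc)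
  show ?B unfolding qpoch_def by (rule nonneg_prodinf[OF ok(1) nf])
  have q1: "q_twist 1 = 1" using q_twist_hc[of 1] by (simp add: hc.one)
  have qdiff: "q_twist (F - G) = q_twist F - q_twist G" for F G
    by (rule lser_eqI) (simp add: q_twist_def inner_cf_twist algebra_simps)
  have qf: "q_twist (?f k) = ?g k" for k
  proof -
    have "j + 4 * k + 2 = (j + 2) + 4 * k" by simp
    hence "(fps_X :: lser) ^ (j + 4 * k + 2) = fps_X ^ (j + 2) * (fps_X ^ 4) ^ k" by (simp only: power_add power_mult)
    hence "inner_X * fps_X ^ (j + 2) * (fps_X ^ 4) ^ k = fps_X ^ (j + 4 * k + 2) * inner_X"
      by (simp only: lser_rotate)
    thus ?thesis
      unfolding f qdiff q1 q_twist_inner_X power_add[symmetric] fps_X_hc[of "j + 4 * k + 2", symmetric]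
      by (simp only:)
  qed
  have part: "q_twist (\<Prod>k<n. ?f k) = (\<Prod>k<n. ?g k)" for n
  proof (induction n)
    case 0 show ?case by (simp add: q1)
  next
    case (Suc n)
    have "q_twist (\<Prod>k<Suc n. ?f k) = q_twist (\<Prod>k<n. ?f k) * q_twist (?f n)"
      unfolding prod.lessThan_Suc by (intro q_twist_mult nonneg_prod nf)
    thus ?case by (simp only: Suc qf prod.lessThan_Suc)
  qed
  show ?A unfolding qpoch_def
  proof (rule sym, rule prodinf_eqI[OF ok(2)])
    fix N
    obtain K where K: "\<forall>n\<ge>K. \<forall>M\<le>N. prodinf ?f $ M = (\<Prod>k<n. ?f k) $ M"
      using prodinf_nth[OF ok(1)] by blast
    have "(\<Prod>k<n. ?g k) $ N = q_twist (prodinf ?f) $ N" if "n \<ge> K" for n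
      unfolding part[symmetric] q_twist_def using K that by (intro twist_nth_cong) auto
    thus "\<exists>K. \<forall>n\<ge>K. (\<Prod>k<n. ?g k) $ N = q_twist (prodinf ?f) $ N" by blast
  qed
qed

text \<open>
  The substitution \<open>z \<mapsto> q\<^sup>2 z\<close> shifts the index \<open>j\<close> of the products \<open>(z q\<^sup>j; q\<^sup>4)\<close> by two. In
  \<open>f(z) f(q\<^sup>2 z)\<close> everything cancels except for the first factors that separate \<open>j = 0\<close> from \<open>4\<close> and \<open>2\<close>
  from \<open>6\<close>.
\<close>
lemma f_prod_equation:
  shows "nonneg f_prod" and "f_prod * q_twist f_prod * (1 - inner_X * fps_X ^ 2) = 1 - inner_X" and "f_prod $ 0 $$ 0 = 1"
    and "nonneg (q_twist f_prod)"
proof -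
  let ?Q = "\<lambda>j. qpoch (inner_X * fps_X ^ j) (fps_X ^ 4) :: lser"
  have "fls_X \<noteq> (1::complex fls)" by (metis fls_X_nth fls_one_nth one_neq_zero)
  hence x0: "(inner_X * fps_X ^ i) $ 0 \<noteq> 1" for i by (cases i) (auto simp: inner_X_def)
  have n0: "?Q i $ 0 = 1 - (inner_X * fps_X ^ i) $ 0" for i by (rule qpoch_nth_0) (use x0 in auto)
  have rec: "?Q i = (1 - inner_X * fps_X ^ i) * ?Q (i + 4)" for i
    by (subst qpoch_rec) (use x0 in \<open>auto simp: power_add mult.assoc\<close>)
  have Q2: "?Q i $ 0 = 1" if "i > 0" for i using n0[of i] that by (cases i) auto
  define D where "D = ?Q 2"
  have D0: "D $ 0 = 1" by (simp add: D_def Q2)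
  have *: "f_prod = ?Q 0 * ?Q 4 / D ^ 2"
    by (simp add: f_prod_def Let_def D_def inner_X_def)
  have fD: "f_prod * D ^ 2 = ?Q 0 * ?Q 4"
  proof -
    have u: "(D ^ 2) $ 0 \<noteq> 0" using D0 by (simp add: fps_power_zeroth)
    show ?thesis unfolding * fps_divide_unit[OF u] mult.assoc inverse_mult_eq_1[OF u] by simp
  qed
  have nn: "nonneg (?Q i)" for i by (rule q_twist_qpoch)
  have D2: "nonneg (D ^ 2)" "(D ^ 2) $ 0 = 1" using nn D0 by (auto simp: D_def nonneg_power fps_power_zeroth)
  show nf: "nonneg f_prod"
    by (rule nonneg_div[OF _ D2], unfold fD) (intro nonneg_mult nn)
  have t: "q_twist (?Q i) = ?Q (i + 2)" for i by (rule q_twist_qpoch)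
  have tD: "q_twist (D ^ 2) = ?Q 4 ^ 2"
    using q_twist_mult[OF nn nn, of 2 2] t[of 2] by (simp add: D_def power2_eq_square)
  have "q_twist f_prod * ?Q 4 ^ 2 = q_twist (f_prod * D ^ 2)"
    unfolding tD[symmetric] by (rule q_twist_mult[OF nf D2(1), symmetric])
  also have "\<dots> = q_twist (?Q 0) * q_twist (?Q 4)" unfolding fD by (rule q_twist_mult[OF nn nn])
  finally have "q_twist f_prod * ?Q 4 ^ 2 = q_twist (?Q 0) * q_twist (?Q 4)" .
  moreover have "q_twist (?Q 0) = D" using t[of 0] by (simp only: add_0 D_def)
  moreover have "q_twist (?Q 4) = ?Q 6" using t[of 4] by simp
  ultimately have e2: "q_twist f_prod * ?Q 4 ^ 2 = D * ?Q 6" by (simp only:)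
  have r0: "?Q 0 = (1 - inner_X) * ?Q 4" using rec[of 0] by simp
  have r2: "D = (1 - inner_X * fps_X ^ 2) * ?Q 6" using rec[of 2] by (simp add: D_def)
  have "(f_prod * q_twist f_prod * (1 - inner_X * fps_X ^ 2)) * (D ^ 2 * ?Q 4 ^ 2)
     = (f_prod * D ^ 2) * (q_twist f_prod * ?Q 4 ^ 2) * (1 - inner_X * fps_X ^ 2)" by (simp only: mult_ac)
  also have "\<dots> = (1 - inner_X) * ?Q 4 * ?Q 4 * (D * ((1 - inner_X * fps_X ^ 2) * ?Q 6))"
    unfolding fD e2 r0 by (simp only: mult_ac)
  also have "\<dots> = (1 - inner_X) * (D ^ 2 * ?Q 4 ^ 2)" unfolding r2[symmetric] by (simp add: power2_eq_square mult_ac)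
  finally have "(f_prod * q_twist f_prod * (1 - inner_X * fps_X ^ 2)) * (D ^ 2 * ?Q 4 ^ 2) = (1 - inner_X) * (D ^ 2 * ?Q 4 ^ 2)" .
  moreover have "D \<noteq> 0" "?Q 4 \<noteq> 0" using D0 Q2[of 4] by force+
  ultimately show "f_prod * q_twist f_prod * (1 - inner_X * fps_X ^ 2) = 1 - inner_X" by simp
  have "(f_prod * D ^ 2) $ 0 = f_prod $ 0" using D2 by (simp add: fps_mult_nth_0)
  moreover have "(?Q 0 * ?Q 4) $ 0 = 1 - fls_X" using n0[of 0] Q2[of 4] by (simp add: fps_mult_nth_0 inner_X_def)
  ultimately have "f_prod $ 0 = 1 - fls_X" using fD by simp
  thus "f_prod $ 0 $$ 0 = 1" by simp
  show "nonneg (q_twist f_prod)" by (simp add: nonneg_def q_twist_def inner_cf_twist)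
qed

lemma f_recursion_f_prod: "f_recursion (fps_X ^ 2) (\<lambda>m. inner_cf (int m) f_prod)"
proof (rule f_recursion_from_lser)
  show "f_prod * q_twist f_prod * (1 - hc (fps_X ^ 2) * inner_X) = 1 - inner_X"
    using f_prod_equation(2) by (simp add: fps_X_hc[symmetric] mult.commute)
  show "f_prod $ 0 $$ 0 \<noteq> - 1" using f_prod_equation(3) by simp
  show "inner_cf m (q_twist f_prod) = (fps_X ^ 2) ^ nat m * inner_cf m f_prod" if "m \<ge> 0" for m
    using that by (simp add: q_twist_def inner_cf_twist power_mult)
qed (use f_prod_equation in auto)

section \<open>Passage from \<open>q\<close> to \<open>e\<^bsup>h/2\<^esup>\<close>\<close>

interpretation at_zero: transcendental_subst "fls_const :: complex \<Rightarrow> complex fls" fls_X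
  by standard (rule fls_nonconst[of _ 1], auto)

interpretation at_q: transcendental_subst "fls_const :: complex \<Rightarrow> complex fls" "fps_to_fls (qpow 1)"
  by standard (rule fls_nonconst[of _ 1], auto simp: qpow_def)

lemma rat_of_series_eqI:
  assumes "rat_expand r = fps_to_fls F"
  shows "rat_of_series F = r"
  unfolding rat_of_series_def
proof (rule the_equality)
  show "rat_expand r = fps_to_fls F" by fact
next
  fix r' assume "rat_expand r' = fps_to_fls F"
  thus "r' = r" using assms injD[OF at_zero.r.inj] by (simp add: rat_expand_def)
qed

text \<open>
  Solving the recursion over \<open>\<complex>(q)\<close> produces a rational function with the right expansion at
  \<open>q = 0\<close>. Its denominators \<open>1 + q\<^bsup>2 m\<^esup>\<close> have constant term \<open>2\<close> at \<open>q = e\<^bsup>h/2\<^esup>\<close>, so it has no pole there.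
\<close>
lemma f_coeff_exists:
  "\<exists>r F. rat_expand r = fps_to_fls (inner_cf (int m) f_prod) \<and>
     rat_subst fls_const (fps_to_fls (qpow 1)) r = fps_to_fls F"
proof (induction m rule: less_induct)
  case (less m)
  let ?g = "\<lambda>m. inner_cf (int m) f_prod"
  interpret fl: rhom "fps_to_fls :: complex fps \<Rightarrow> complex fls" by (rule fps_to_fls_rhom)
  show ?case
  proof (cases "m = 0")
    case True
    have "?g 0 = 1" using f_recursion_f_prod by (simp add: f_recursion_def)
    thus ?thesis using True
      by (intro exI[of _ 1]) (simp add: rat_expand_def at_zero.r.one at_q.r.one)
  next
    case False
    obtain r F where rF: "\<And>i. i < m \<Longrightarrow> rat_expand (r i) = fps_to_fls (?g i)"
      "\<And>i. i < m \<Longrightarrow> rat_subst fls_const (fps_to_fls (qpow 1)) (r i) = fps_to_fls (F i)"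
      using less by metis
    define u where "u = zvar ^ 2"
    define num where "num = quot_coeff u m - (\<Sum>i\<in>{0<..<m}. r i * (r (m - i) * u ^ (m - i)))"
    define s where "s = num / (1 + u ^ m)"
    have hom_quot_coeff: "\<phi> (quot_coeff v k) = quot_coeff (\<phi> v) k" if "rhom \<phi>" for \<phi> :: "'x::comm_ring_1 \<Rightarrow> 'y::comm_ring_1" and v k
    proof -
      interpret \<phi>: rhom \<phi> by fact
      show ?thesis by (cases k) (simp_all add: quot_coeff_def \<phi>.hom)
    qed
    have zu: "rat_subst fls_const fls_X u = fps_to_fls (fps_X ^ 2)"
      by (simp add: u_def at_zero.r.power at_zero.rat_subst_zvar fl.power)
    have qu: "rat_subst fls_const (fps_to_fls (qpow 1)) u = fps_to_fls (qpow 1 ^ 2)"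
      by (simp add: u_def at_q.r.power at_q.rat_subst_zvar fl.power)
    have 1: "rat_subst fls_const fls_X num =
        fps_to_fls (quot_coeff (fps_X ^ 2) m - (\<Sum>i\<in>{0<..<m}. ?g i * (?g (m - i) * (fps_X ^ 2) ^ (m - i))))"
      unfolding num_def
      by (simp add: at_zero.r.diff at_zero.r.sum at_zero.r.mult at_zero.r.power zu hom_quot_coeff[OF at_zero.r.rhom_axioms]
          hom_quot_coeff[OF fl.rhom_axioms] fl.diff fl.sum fl.mult fl.power rF(1)[unfolded rat_expand_def])
    have 2: "rat_subst fls_const (fps_to_fls (qpow 1)) num =
        fps_to_fls (quot_coeff (qpow 1 ^ 2) m - (\<Sum>i\<in>{0<..<m}. F i * (F (m - i) * (qpow 1 ^ 2) ^ (m - i))))"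
      (is "_ = fps_to_fls ?N")
      unfolding num_def
      by (simp add: at_q.r.diff at_q.r.sum at_q.r.mult at_q.r.power qu hom_quot_coeff[OF at_q.r.rhom_axioms]
          hom_quot_coeff[OF fl.rhom_axioms] fl.diff fl.sum fl.mult fl.power rF(2))
    have d1: "rat_subst fls_const fls_X (1 + u ^ m) = fps_to_fls (1 + (fps_X ^ 2) ^ m)"
      by (simp add: at_zero.r.add at_zero.r.one at_zero.r.power zu fl.add fl.one fl.power)
    have d2: "rat_subst fls_const (fps_to_fls (qpow 1)) (1 + u ^ m) = fps_to_fls (1 + (qpow 1 ^ 2) ^ m)"
      by (simp add: at_q.r.add at_q.r.one at_q.r.power qu fl.add fl.one fl.power)
    have n1: "1 + (fps_X ^ 2) ^ m \<noteq> (0 :: complex fps)"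
    proof
      assume h: "1 + (fps_X ^ 2) ^ m = (0 :: complex fps)"
      have "(1 + (fps_X ^ 2) ^ m :: complex fps) $ 0 = 1" using False by (simp add: fps_power_zeroth)
      thus False unfolding h by simp
    qed
    have n2: "(1 + (qpow 1 ^ 2) ^ m) $ 0 \<noteq> 0" by (simp add: qpow_def fps_power_zeroth)
    have "rat_expand s = fps_to_fls (?g m)"
    proof -
      have "rat_subst fls_const fls_X num = fps_to_fls (?g m * (1 + (fps_X ^ 2) ^ m))"
        unfolding 1 using f_recursion_step[OF f_recursion_f_prod, of m] False by simp
      moreover have "fps_to_fls (1 + (fps_X ^ 2) ^ m) \<noteq> (0 :: complex fls)"
        using n1 by (simp only: fps_to_fls_eq_0_iff not_False_eq_True)
      ultimately show ?thesis
        unfolding rat_expand_def s_def at_zero.r.divide d1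
        by (metis fl.mult nonzero_mult_div_cancel_right)
    qed
    moreover have "rat_subst fls_const (fps_to_fls (qpow 1)) s = fps_to_fls (?N * inverse (1 + (qpow 1 ^ 2) ^ m))"
    proof -
      have "?N = ?N * inverse (1 + (qpow 1 ^ 2) ^ m) * (1 + (qpow 1 ^ 2) ^ m)"
        using inverse_mult_eq_1[OF n2] by (simp add: mult.assoc)
      hence "fps_to_fls ?N = fps_to_fls (?N * inverse (1 + (qpow 1 ^ 2) ^ m)) * fps_to_fls (1 + (qpow 1 ^ 2) ^ m)"
        by (metis fl.mult)
      moreover have "fps_to_fls (1 + (qpow 1 ^ 2) ^ m) \<noteq> 0"
      proof
        assume "fps_to_fls (1 + (qpow 1 ^ 2) ^ m) = 0"
        hence z: "1 + (qpow 1 ^ 2) ^ m = 0" by (simp only: fps_to_fls_eq_0_iff)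
        show False using n2 unfolding z by simp
      qed
      ultimately show ?thesis unfolding s_def at_q.r.divide 2 d2 by (simp add: field_simps)
    qed
    ultimately show ?thesis by blast
  qed
qed

lemma f_coeff: "rat_expand (f_coeff m) = fps_to_fls (inner_cf (int m) f_prod)"
  and f_hcoeff: "rat_subst fls_const (fps_to_fls (qpow 1)) (f_coeff m) = fps_to_fls (f_hcoeff m)"
proof -
  obtain r F where r: "rat_expand r = fps_to_fls (inner_cf (int m) f_prod)"
    "rat_subst fls_const (fps_to_fls (qpow 1)) r = fps_to_fls F"
    using f_coeff_exists by blast
  have "f_coeff m = r"
    unfolding f_coeff_def using rat_of_series_eqI[OF r(1)] by (simp add: inner_cf_def)
  thus "rat_expand (f_coeff m) = fps_to_fls (inner_cf (int m) f_prod)"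
    "rat_subst fls_const (fps_to_fls (qpow 1)) (f_coeff m) = fps_to_fls (f_hcoeff m)"
    using r by (simp_all add: f_hcoeff_def)
qed

lemma qpow_add: "qpow (r + s) = qpow r * qpow s"
  by (simp add: qpow_def add_divide_distrib fps_exp_add_mult)

lemma qpow_power: "qpow r ^ n = qpow (of_nat n * r)"
  by (simp add: qpow_def fps_exp_power_mult)

text \<open>
  The recursion descends along the injective expansion at \<open>q = 0\<close> to \<open>\<complex>(q)\<close>, and from there it
  passes to \<open>q = e\<^bsup>h/2\<^esup>\<close>.
\<close>
lemma f_recursion_f_hcoeff: "f_recursion (qpow 2) f_hcoeff"
proof -
  interpret fl: rhom "fps_to_fls :: complex fps \<Rightarrow> complex fls" by (rule fps_to_fls_rhom)
  have inj: "inj (fps_to_fls :: complex fps \<Rightarrow> complex fls)" by (auto simp: inj_on_def)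
  have "f_recursion (fps_to_fls (fps_X ^ 2)) (\<lambda>m. fps_to_fls (inner_cf (int m) f_prod))"
    by (rule f_recursion_hom[OF fl.rhom_axioms f_recursion_f_prod])
  hence "f_recursion (rat_subst fls_const fls_X (zvar ^ 2)) (\<lambda>m. rat_subst fls_const fls_X (f_coeff m))"
    by (simp add: f_coeff[symmetric] rat_expand_def at_zero.r.power at_zero.rat_subst_zvar fl.power)
  hence "f_recursion (zvar ^ 2) f_coeff" by (rule f_recursion_hom_inj[OF at_zero.r.rhom_axioms at_zero.r.inj])
  hence "f_recursion (rat_subst fls_const (fps_to_fls (qpow 1)) (zvar ^ 2)) (\<lambda>m. rat_subst fls_const (fps_to_fls (qpow 1)) (f_coeff m))"
    by (rule f_recursion_hom[OF at_q.r.rhom_axioms])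
  hence "f_recursion (fps_to_fls (qpow 1 ^ 2)) (\<lambda>m. fps_to_fls (f_hcoeff m))"
    by (simp add: f_hcoeff at_q.r.power at_q.rat_subst_zvar fl.power)
  hence "f_recursion (qpow 1 ^ 2) f_hcoeff" by (rule f_recursion_hom_inj[OF fl.rhom_axioms inj])
  thus ?thesis by (simp add: qpow_power)
qed

definition poly_at :: "complex fls \<Rightarrow> complex poly \<Rightarrow> complex fls" where
  "poly_at w p = poly (map_poly fls_const p) w"

interpretation poly_at: rhom "poly_at w" for w
  unfolding poly_at_def by (rule rhom_poly_eval) (rule fc.fhom_axioms)

lemma poly_at_pCons: "poly_at w (pCons c p) = fls_const c + w * poly_at w p"
  unfolding poly_at_def by (subst map_poly_pCons) auto

lemma poly_at_smult: "poly_at w (smult c p) = fls_const c * poly_at w p"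
  by (induction p) (auto simp: poly_at_pCons poly_at.zero algebra_simps simp flip: fls_const_mult_const)

section \<open>The Euler derivation and its exponential\<close>

text \<open>
  The derivation \<open>t d/dt\<close> in the inner variable.
\<close>
definition euler :: "complex fls \<Rightarrow> complex fls" where "euler f = fls_X * fls_deriv f"

lemma euler_nth: "euler f $$ m = of_int m * f $$ m"
  by (simp add: euler_def fls_X_times_conv_shift)

lemma euler_mult: "euler (f * g) = euler f * g + f * euler g"
  by (simp add: euler_def algebra_simps)

lemma euler_add: "euler (f + g) = euler f + euler g"
  by (simp add: euler_def algebra_simps)

lemma euler_const: "euler (fls_const c) = 0" by (simp add: euler_def)

text \<open>
  The derivation \<open>(w + w\<^sup>2) d/dw\<close> of \<open>\<complex>[w]\<close>. It corresponds to \<open>z d/dz\<close> under \<open>w = z/(1 - z)\<close>.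
\<close>
definition poly_euler :: "complex poly \<Rightarrow> complex poly" where "poly_euler p = [:0, 1, 1:] * pderiv p"

text \<open>
  Two values of \<open>w\<close> satisfy the assumption: \<open>z/(1 - z)\<close> with \<open>l = 1\<close> at \<open>z = 0\<close>, and \<open>z\<^sup>2/(1 - z\<^sup>2)\<close> at
  infinity with \<open>l = - 1/2\<close>, because \<open>t d/dt = - z d/dz\<close> for \<open>t = 1/z\<close>.
\<close>
lemma euler_poly_at:
  assumes "fls_const l * euler w = w + w ^ 2"
  shows "fls_const l * euler (poly_at w p) = poly_at w (poly_euler p)"
proof (induction p)
  case 0
  show ?case by (simp add: poly_euler_def poly_at.zero) (simp add: euler_def)
next
  case (pCons a p)
  have w: "poly_at w [:0, 1, 1:] = w + w ^ 2" by (simp add: poly_at_pCons poly_at.zero algebra_simps power2_eq_square)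
  have "fls_const l * euler (poly_at w (pCons a p)) = (fls_const l * euler w) * poly_at w p + w * (fls_const l * euler (poly_at w p))"
    by (simp add: poly_at_pCons euler_add euler_const euler_mult algebra_simps)
  also have "\<dots> = (w + w ^ 2) * (poly_at w p + w * poly_at w (pderiv p))"
    unfolding pCons(2) assms poly_euler_def poly_at.mult w by (simp add: algebra_simps)
  also have "\<dots> = poly_at w (poly_euler (pCons a p))"
    by (simp only: poly_euler_def poly_at.mult w pderiv_pCons poly_at.add) (simp only: poly_at_pCons fls_const_0 add_0)
  finally show ?case .
qed

text \<open>
  The operator \<open>exp(h l t d/dt)\<close>, i.e. the substitution \<open>t \<mapsto> e\<^bsup>l h\<^esup> t\<close>.
\<close>
definition exp_euler :: "complex \<Rightarrow> lser \<Rightarrow> lser" where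
  "exp_euler l = twist (\<lambda>m. fps_exp (l * of_int m))"

lemma exp_euler_nth:
  "exp_euler l F $ n = (\<Sum>k\<le>n. fls_const (1 / fact k) * ((\<lambda>f. fls_const l * euler f) ^^ k) (F $ (n - k)))"
proof (rule fls_eqI)
  fix m
  have pw: "((\<lambda>f. fls_const l * euler f) ^^ k) f $$ m = (l * of_int m) ^ k * f $$ m" for k f
    by (induction k) (auto simp: euler_nth mult_ac)
  show "exp_euler l F $ n $$ m = (\<Sum>k\<le>n. fls_const (1 / fact k) * ((\<lambda>f. fls_const l * euler f) ^^ k) (F $ (n - k))) $$ m"
    by (simp add: exp_euler_def twist_nth fps_mult_nth fls_nth_sum pw atMost_atLeast0)
qed

text \<open>
  The exponential of \<open>h\<close> times the derivation \<open>poly_euler\<close>.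
\<close>
definition poly_exp_euler :: "complex poly fps \<Rightarrow> complex poly fps" where
  "poly_exp_euler F = Abs_fps (\<lambda>n. \<Sum>k\<le>n. smult (1 / fact k) ((poly_euler ^^ k) (F $ (n - k))))"

lemma poly_exp_euler_lift:
  assumes "fls_const l * euler w = w + w ^ 2"
  shows "fps_lift (poly_at w) (poly_exp_euler F) = exp_euler l (fps_lift (poly_at w) F)"
proof (rule fps_ext)
  fix n
  have "((\<lambda>f. fls_const l * euler f) ^^ k) (poly_at w p) = poly_at w ((poly_euler ^^ k) p)" for k p
    by (induction k) (auto simp: euler_poly_at[OF assms])
  thus "fps_lift (poly_at w) (poly_exp_euler F) $ n = exp_euler l (fps_lift (poly_at w) F) $ n"
    by (simp add: exp_euler_nth poly_exp_euler_def poly_at.sum poly_at_smult)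
qed

text \<open>
  The series \<open>1 - (e\<^sup>h - 1) w = (1 - q\<^sup>2 z)/(1 - z)\<close> for \<open>w = z/(1 - z)\<close>.
\<close>
definition poly_factor :: "complex poly fps" where
  "poly_factor = Abs_fps (\<lambda>n. if n = 0 then 1 else [:0, - (1 / fact n):])"

lemma poly_factor_lift: "fps_lift (poly_at w) poly_factor = 1 - hc (fps_exp 1 - 1) * fps_const w"
proof (rule fps_ext)
  fix n
  show "fps_lift (poly_at w) poly_factor $ n = (1 - hc (fps_exp 1 - 1) * fps_const w) $ n"
    by (cases "n = 0") (auto simp: poly_factor_def poly_at.one poly_at_pCons poly_at.zero mult.commute fls_const_uminus)
qed

section \<open>The functional equation over polynomials in \<open>z/(1 - z)\<close>\<close>

text \<open>
  The functional equation of \<open>f\<close> says that this expression in \<open>f\<close> equals \<open>1\<close>.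
\<close>
definition poly_equation :: "complex poly fps \<Rightarrow> complex poly fps" where "poly_equation F = F * poly_exp_euler F * poly_factor"

lemma poly_exp_euler_nth_cong: "(\<And>k. k \<le> n \<Longrightarrow> F $ k = G $ k) \<Longrightarrow> poly_exp_euler F $ n = poly_exp_euler G $ n"
  by (simp add: poly_exp_euler_def)

text \<open>
  The coefficient of \<open>h\<^sup>n\<close> depends on \<open>F $ n\<close> through \<open>2 F $ n\<close> only, so that the functional equation
  can be solved successively in \<open>n\<close>.
\<close>
lemma poly_equation_nth:
  assumes n: "n > 0" and F0: "F $ 0 = 1" and T: "\<And>k. k < n \<Longrightarrow> T $ k = F $ k" "T $ n = 0"
  shows "poly_equation F $ n = 2 * F $ n + poly_equation T $ n"
proof -
  have E: "poly_exp_euler F $ j = poly_exp_euler T $ j" if "j < n" for j using that T by (intro poly_exp_euler_nth_cong) auto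
  have En: "poly_exp_euler F $ n = F $ n + poly_exp_euler T $ n"
  proof -
    have eq: "(\<Sum>k\<in>{0<..n}. smult (1 / fact k) ((poly_euler ^^ k) (F $ (n - k)))) =
          (\<Sum>k\<in>{0<..n}. smult (1 / fact k) ((poly_euler ^^ k) (T $ (n - k))))"
      using T(1) by (intro sum.cong) auto
    have "{..n} = insert 0 {0<..n}" by auto
    thus ?thesis using T(2) eq by (simp add: poly_exp_euler_def)
  qed
  have T0: "T $ 0 = 1" using T(1)[of 0] n F0 by simp
  have E0: "poly_exp_euler T $ 0 = 1" "poly_exp_euler F $ 0 = 1" using T0 F0 by (simp_all add: poly_exp_euler_def)
  have prod: "(F * poly_exp_euler F) $ j = (T * poly_exp_euler T) $ j" if "j < n" for j
    unfolding fps_mult_nth using that E T by (intro sum.cong) auto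
  have "(F * poly_exp_euler F) $ n = (T * poly_exp_euler T) $ n + 2 * F $ n"
  proof -
    have s: "{0..n} = insert 0 (insert n {0<..<n})" using n by auto
    have "(\<Sum>i\<in>{0<..<n}. F $ i * poly_exp_euler F $ (n - i)) = (\<Sum>i\<in>{0<..<n}. T $ i * poly_exp_euler T $ (n - i))"
      using T E by (intro sum.cong) auto
    thus ?thesis using n T E0 T0 F0 En by (simp add: fps_mult_nth s)
  qed
  moreover have "poly_equation F $ n = (F * poly_exp_euler F) $ n + (\<Sum>i\<in>{0..<n}. (F * poly_exp_euler F) $ i * poly_factor $ (n - i))" for F
  proof -
    have s: "{0..n} = insert n {0..<n}" by auto
    show ?thesis unfolding poly_equation_def fps_mult_nth[of "F * poly_exp_euler F"] s by (simp add: poly_factor_def)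
  qed
  moreover have "(\<Sum>i\<in>{0..<n}. (F * poly_exp_euler F) $ i * poly_factor $ (n - i)) = (\<Sum>i\<in>{0..<n}. (T * poly_exp_euler T) $ i * poly_factor $ (n - i))"
    using prod by (intro sum.cong) auto
  ultimately show ?thesis by simp
qed

text \<open>
  The solution of the functional equation with constant term \<open>1\<close>: the coefficient of \<open>h\<^sup>n\<close> is
  determined by the truncation of the solution below \<open>n\<close>.
\<close>
fun f_poly :: "nat \<Rightarrow> complex poly" where
  "f_poly n = (if n = 0 then 1 else smult (- (1 / 2)) (poly_equation (Abs_fps (\<lambda>k. if k < n then f_poly k else 0)) $ n))"

declare f_poly.simps [simp del]

lemma poly_equation_f_poly: "poly_equation (Abs_fps f_poly) = 1"
proof (rule fps_ext)
  fix n
  show "poly_equation (Abs_fps f_poly) $ n = 1 $ n"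
  proof (cases "n = 0")
    case True
    thus ?thesis by (simp add: poly_equation_def poly_exp_euler_def poly_factor_def f_poly.simps[of 0])
  next
    case False
    let ?T = "Abs_fps (\<lambda>k. if k < n then f_poly k else 0)"
    have "poly_equation (Abs_fps f_poly) $ n = 2 * f_poly n + poly_equation ?T $ n"
      using False poly_equation_nth[of n "Abs_fps f_poly" ?T] by (simp add: f_poly.simps[of 0])
    also have "f_poly n = smult (- (1 / 2)) (poly_equation ?T $ n)" using False by (subst f_poly.simps) simp
    also have "2 * smult (- (1/2)) q = - q" for q :: "complex poly"
      by (simp add: numeral_poly)
    finally show ?thesis using False by simp
  qed
qed

definition f_ser :: "complex fls \<Rightarrow> lser" where
  "f_ser w = fps_lift (poly_at w) (Abs_fps f_poly)"

lemma f_ser_nth: "f_ser w $ n = poly_at w (f_poly n)" by (simp add: f_ser_def)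

lemma f_ser_equation:
  assumes "fls_const l * euler w = w + w ^ 2"
  shows "f_ser w * exp_euler l (f_ser w) * (1 - hc (fps_exp 1 - 1) * fps_const w) = 1"
proof -
  interpret hhom "fps_lift (poly_at w)" by (rule hhom_fps_lift) (rule poly_at.rhom_axioms)
  have "fps_lift (poly_at w) (poly_equation (Abs_fps f_poly)) = 1" by (simp add: poly_equation_f_poly one)
  thus ?thesis by (simp add: poly_equation_def mult poly_exp_euler_lift[OF assms] poly_factor_lift f_ser_def)
qed

section \<open>Expansions of \<open>f\<close> as a series of rational functions\<close>

definition w0 :: "complex fls" where "w0 = fls_X / (1 - fls_X)"
definition w1 :: "complex fls" where "w1 = fls_X_inv ^ 2 / (1 - fls_X_inv ^ 2)"

lemma one_minus_X: "1 - fls_X \<noteq> (0 :: complex fls)"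
proof
  assume "1 - fls_X = (0 :: complex fls)"
  hence "(1 - fls_X) $$ 0 = (0::complex)" by simp
  thus False by simp
qed

lemma one_minus_X_inv: "1 - fls_X_inv ^ 2 \<noteq> (0 :: complex fls)"
proof
  assume "1 - fls_X_inv ^ 2 = (0 :: complex fls)"
  hence "(1 - fls_X_inv ^ 2) $$ 0 = (0::complex)" by simp
  thus False by (simp add: fls_X_inv_power_conv_shift_1)
qed

lemma euler_w0: "fls_const 1 * euler w0 = w0 + w0 ^ 2"
proof -
  have e: "w0 * (1 - fls_X) = fls_X" using one_minus_X by (simp add: w0_def)
  have t: "euler (1 - fls_X) = - fls_X" "euler fls_X = (fls_X :: complex fls)"
    by (simp_all add: euler_def)
  have "euler (w0 * (1 - fls_X)) = euler fls_X" by (simp only: e)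
  hence 1: "euler w0 * (1 - fls_X) = fls_X + w0 * fls_X"
    unfolding euler_mult t by (simp only: mult_minus_right diff_conv_add_uminus[symmetric] diff_eq_eq)
  have "(w0 + w0 ^ 2) * (1 - fls_X) = w0 * (1 - fls_X) + w0 * (w0 * (1 - fls_X))"
    by (simp only: distrib_right power2_eq_square mult.assoc)
  hence "euler w0 * (1 - fls_X) = (w0 + w0 ^ 2) * (1 - fls_X)" unfolding e 1 by (rule sym)
  hence "euler w0 = w0 + w0 ^ 2" using one_minus_X mult_right_cancel by blast
  thus ?thesis by simp
qed

lemma euler_w1: "fls_const (- 1 / 2) * euler w1 = w1 + w1 ^ 2"
proof -
  have e: "w1 * (1 - fls_X_inv ^ 2) = fls_X_inv ^ 2" using one_minus_X_inv by (simp add: w1_def)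
  have t0: "euler (fls_X_inv) = - (fls_X_inv :: complex fls)"
    by (rule fls_eqI) (simp add: euler_nth)
  hence t: "euler (fls_X_inv ^ 2) = - 2 * fls_X_inv ^ 2"
    by (simp add: power2_eq_square euler_mult)
  have "euler (1 - fls_X_inv ^ 2) = 0 - euler (fls_X_inv ^ 2)"
    by (simp add: euler_def algebra_simps)
  hence t': "euler (1 - fls_X_inv ^ 2) = 2 * fls_X_inv ^ 2" by (simp add: t)
  have c: "2 * fls_const (- 1 / 2) = (- 1 :: complex fls)"
    by (metis (no_types, opaque_lifting) fls_const_mult_const fls_const_uminus fls_const_1 fls_of_nat of_nat_numeral
        nonzero_mult_div_cancel_left times_divide_eq_right zero_neq_numeral)
  have "euler (w1 * (1 - fls_X_inv ^ 2)) = euler (fls_X_inv ^ 2)" by (simp only: e)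
  hence "fls_const (- 1 / 2) * euler w1 * (1 - fls_X_inv ^ 2) = (w1 + w1 ^ 2) * (1 - fls_X_inv ^ 2)"
    unfolding euler_mult t t' using e c by algebra
  thus ?thesis using one_minus_X_inv mult_right_cancel by blast
qed

lemma one_minus_eps_mult:
  fixes w Z e :: lser
  assumes "w * (1 - Z) = Z"
  shows "(1 - (e - 1) * w) * (1 - Z) = 1 - e * Z"
proof -
  have "(1 - (e - 1) * w) * (1 - Z) = (1 - Z) - (e - 1) * (w * (1 - Z))" by (simp add: algebra_simps)
  thus ?thesis unfolding assms by (simp add: algebra_simps)
qed

lemma mult_cancel_one:
  fixes F W Z V :: lser
  assumes "F * W = 1" "W * Z = V"
  shows "F * V = Z"
  unfolding assms(2)[symmetric] mult.assoc[symmetric] assms(1) by simp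

text \<open>
  The series obtained from the polynomials has the coefficients of \<open>f\<close>, because both satisfy the
  recursion, whose solution is unique.
\<close>
lemma f_ser_w0:
  shows "inner_cf (int m) (f_ser w0) = f_hcoeff m" "nonneg (f_ser w0)"
proof -
  have nw: "w0 $$ m = 0" if "m < 0" for m
  proof -
    have "(1 - fps_X :: complex fps) $ 0 \<noteq> 0" by simp
    hence "inverse (1 - fps_X) * (1 - fps_X) = (1 :: complex fps)" by (rule inverse_mult_eq_1)
    hence "fps_to_fls (fps_X * inverse (1 - fps_X)) * (1 - fls_X) = (fls_X :: complex fls)"
      by (metis (no_types, lifting) fls_times_fps_to_fls fps_X_to_fls fps_one_to_fls fps_to_fls_minus mult.assoc mult.right_neutral)
    hence w0: "w0 = fps_to_fls (fps_X * inverse (1 - fps_X))"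
      using one_minus_X by (simp add: w0_def divide_eq_eq)
    show ?thesis unfolding w0 fps_to_fls_nth using that by (simp only: if_True)
  qed
  have nfc: "nonneg (fps_const f) \<longleftrightarrow> (\<forall>m<0. f $$ m = 0)" for f by (auto simp: nonneg_iff)
  have np: "nonneg (fps_const (poly_at w0 p))" for p
  proof (induction p)
    case 0 show ?case by (simp add: poly_at.zero nonneg_def)
  next
    case (pCons a p)
    have "nonneg (fps_const w0 * fps_const (poly_at w0 p))"
      using pCons(2) nw nfc by (intro nonneg_mult) auto
    thus ?case by (simp add: poly_at_pCons nfc)
  qed
  show nn: "nonneg (f_ser w0)"
    using np unfolding nfc by (simp add: nonneg_iff f_ser_nth)
  have eq: "f_ser w0 * exp_euler 1 (f_ser w0) * (1 - hc (fps_exp 1) * inner_X) = 1 - inner_X"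
  proof -
    have "fps_const w0 * (1 - inner_X) = inner_X"
    proof -
      have "fps_const w0 * fps_const (1 - fls_X) = fps_const fls_X"
        using one_minus_X by (simp add: w0_def)
      thus ?thesis by (simp add: inner_X_def flip: fps_const_sub)
    qed
    hence "(1 - hc (fps_exp 1 - 1) * fps_const w0) * (1 - inner_X) = 1 - hc (fps_exp 1) * inner_X"
      unfolding hc.diff hc.one by (rule one_minus_eps_mult)
    with f_ser_equation[OF euler_w0] show ?thesis by (rule mult_cancel_one)
  qed
  have "f_recursion (fps_exp 1) (\<lambda>m. inner_cf (int m) (f_ser w0))"
  proof (rule f_recursion_from_lser[OF nn _ _ eq])
    show "nonneg (exp_euler 1 (f_ser w0))" using nn by (simp add: nonneg_def exp_euler_def inner_cf_twist)
    show "inner_cf m (exp_euler 1 (f_ser w0)) = fps_exp 1 ^ nat m * inner_cf m (f_ser w0)" if "m \<ge> 0" for m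
      using that by (simp add: exp_euler_def inner_cf_twist fps_exp_power_mult)
    show "f_ser w0 $ 0 $$ 0 \<noteq> - 1" by (simp add: f_ser_nth f_poly.simps poly_at.one)
  qed
  hence "f_recursion (qpow 2) (\<lambda>m. inner_cf (int m) (f_ser w0))" by (simp add: qpow_def)
  moreover have "1 + qpow 2 ^ m \<noteq> 0" for m
  proof
    assume h: "1 + qpow 2 ^ m = 0"
    have "(1 + qpow 2 ^ m) $ 0 = 2" by (simp add: qpow_def fps_power_zeroth)
    thus False unfolding h by simp
  qed
  ultimately show "inner_cf (int m) (f_ser w0) = f_hcoeff m"
    using f_recursion_unique[OF _ f_recursion_f_hcoeff, of "\<lambda>m. inner_cf (int m) (f_ser w0)"] by blast
qed

definition rat_at :: "complex poly \<Rightarrow> ratfun" where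
  "rat_at p = poly (map_poly cz p) (zvar / (1 - zvar))"

interpretation rat_at: rhom rat_at
  unfolding rat_at_def by (rule rhom_poly_eval) (rule cz.fhom_axioms)

lemma rat_at_pCons: "rat_at (pCons c p) = cz c + zvar / (1 - zvar) * rat_at p"
  unfolding rat_at_def by (subst map_poly_pCons) (auto simp: cz.zero)

lemma rat_at_image:
  assumes "fhom \<phi>" "\<And>c. \<phi> (cz c) = fls_const c" "\<phi> zvar / (1 - \<phi> zvar) = w"
  shows "\<phi> (rat_at p) = poly_at w p"
proof -
  interpret fhom \<phi> by fact
  show ?thesis
    by (induction p) (use assms in \<open>auto simp: rat_at_pCons poly_at_pCons rat_at.zero poly_at.zero zero hom divide\<close>)
qed

text \<open>
  This identifies the rational functions in the definition of \<open>f_rat\<close>, which is stated in terms of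
  their expansions at \<open>z = 0\<close>. It allows to expand them at infinity.
\<close>
lemma f_rat_nth: "f_rat $ n = rat_at (f_poly n)"
proof -
  have "rat_expand (rat_at (f_poly n)) = poly_at w0 (f_poly n)"
    unfolding rat_expand_def
    by (rule rat_at_image[OF at_zero.r.fhom_axioms]) (simp_all add: at_zero.rat_subst_cz at_zero.rat_subst_zvar w0_def)
  also have "\<dots> = fps_to_fls (Abs_fps (\<lambda>m. f_hcoeff m $ n))"
  proof (rule fls_eqI)
    fix m
    show "poly_at w0 (f_poly n) $$ m = fps_to_fls (Abs_fps (\<lambda>m. f_hcoeff m $ n)) $$ m"
    proof (cases "m < 0")
      case True
      thus ?thesis using f_ser_w0(2) by (simp add: nonneg_iff f_ser_nth)
    next
      case False
      hence "f_hcoeff (nat m) $ n = poly_at w0 (f_poly n) $$ m"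
        using f_ser_w0(1)[of "nat m"] by (simp flip: f_ser_nth inner_cf_nth)
      thus ?thesis using False by simp
    qed
  qed
  finally show ?thesis unfolding f_rat_def by (simp add: rat_of_series_eqI)
qed

text \<open>
  The series \<open>f(z\<^sup>2)\<close>, expanded at \<open>z = \<infinity>\<close>.
\<close>
definition f_sq :: lser where "f_sq = Eh (zsubst (zvar ^ 2) f_rat)"

lemma f_sq_eq: "f_sq = f_ser w1"
proof (rule fps_ext)
  fix n
  have h: "fhom (\<lambda>r. expand_inf (rat_subst cz (zvar ^ 2) r))"
    unfolding expand_inf_def by (intro fhomI rhom_comp[OF at_sq.r.rhom_axioms at_inf.r.rhom_axioms])
  have "expand_inf (rat_subst cz (zvar ^ 2) (rat_at (f_poly n))) = poly_at w1 (f_poly n)"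
    by (rule rat_at_image[OF h]) (simp_all add: expand_inf_def at_sq.rat_subst_cz at_sq.rat_subst_zvar
        at_inf.rat_subst_cz at_inf.r.power at_inf.rat_subst_zvar w1_def)
  thus "f_sq $ n = f_ser w1 $ n" by (simp add: f_sq_def Eh_nth zsubst_def f_rat_nth f_ser_nth)
qed

lemma qshift_exp_euler: "qshift F = exp_euler (- 1 / 2) F"
proof -
  have "- (of_int m / 2) = - 1 / 2 * (of_int m :: complex)" for m by simp
  thus ?thesis by (simp only: qshift_def exp_euler_def)
qed

text \<open>
  The functional equation of \<open>f\<close> at infinity, with \<open>z\<^sup>2\<close> in place of \<open>z\<close>. It is not obtained by
  continuing the equation at \<open>z = 0\<close> but by specialising the equation over \<open>\<complex>[w]\<close> anew.
\<close>
lemma f_sq_equation: "f_sq * qshift f_sq * (1 - hc (qpow 2) * inner_X_inv ^ 2) = 1 - inner_X_inv ^ 2"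
proof -
  have "fps_const w1 * fps_const (1 - fls_X_inv ^ 2) = fps_const (fls_X_inv ^ 2)"
    using one_minus_X_inv by (simp add: w1_def)
  hence "fps_const w1 * (1 - inner_X_inv ^ 2) = inner_X_inv ^ 2" by (simp add: inner_X_inv_def flip: fps_const_sub)
  hence "(1 - hc (fps_exp 1 - 1) * fps_const w1) * (1 - inner_X_inv ^ 2) = 1 - hc (fps_exp 1) * inner_X_inv ^ 2"
    unfolding hc.diff hc.one by (rule one_minus_eps_mult)
  moreover have "f_sq * qshift f_sq * (1 - hc (fps_exp 1 - 1) * fps_const w1) = 1"
    using f_ser_equation[OF euler_w1] by (simp only: f_sq_eq qshift_exp_euler)
  ultimately have "f_sq * qshift f_sq * (1 - hc (fps_exp 1) * inner_X_inv ^ 2) = 1 - inner_X_inv ^ 2"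
    using mult_cancel_one by blast
  thus ?thesis by (simp add: qpow_def)
qed

lemma f_sq_nth_0: "f_sq $ 0 = 1"
  by (simp add: f_sq_eq f_ser_nth f_poly.simps poly_at.one)

lemma zneg_f_sq: "zneg f_sq = f_sq"
proof -
  have "zsubst (- zvar) (zsubst (zvar ^ 2) f_rat) = zsubst (zvar ^ 2) f_rat"
  proof (rule fps_ext)
    fix n
    have "rat_subst cz (- zvar) (rat_subst cz (zvar ^ 2) r) = rat_subst cz (zvar ^ 2) r" for r
      by (rule rhom_ratfun_unique[OF rhom_comp[OF at_sq.r.rhom_axioms at_neg.r.rhom_axioms] at_sq.r.rhom_axioms])
        (simp_all add: at_sq.rat_subst_cz at_neg.rat_subst_cz at_sq.rat_subst_zvar at_neg.rat_subst_zvar at_neg.r.power)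
    thus "zsubst (- zvar) (zsubst (zvar ^ 2) f_rat) $ n = zsubst (zvar ^ 2) f_rat $ n"
      by (simp add: zsubst_def)
  qed
  thus ?thesis unfolding f_sq_def Eh_zsubst_neg[symmetric] by simp
qed

section \<open>Endomorphisms fixing the scalars\<close>

locale chom = hhom \<Phi> for \<Phi> :: "lser \<Rightarrow> lser" +
  assumes const: "\<Phi> (hc c) = hc c"
begin

lemma nonzero_nth_0:
  assumes "x $ 0 \<noteq> 0"
  shows "\<Phi> x $ 0 \<noteq> 0"
proof -
  have "\<Phi> (inverse x) * \<Phi> x = 1" using inverse_mult_eq_1[OF assms] by (metis mult one)
  hence "\<Phi> (inverse x) $ 0 * \<Phi> x $ 0 = 1" by (metis fps_mult_nth_0 fps_one_nth)
  thus ?thesis by auto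
qed

lemma inverse_hom:
  assumes "x $ 0 \<noteq> 0"
  shows "\<Phi> (inverse x) = inverse (\<Phi> x)"
proof -
  have "\<Phi> (inverse x) * \<Phi> x = 1" using inverse_mult_eq_1[OF assms] by (metis mult one)
  hence "\<Phi> (inverse x) * (\<Phi> x * inverse (\<Phi> x)) = inverse (\<Phi> x)"
    by (simp only: mult.assoc[symmetric] mult_1)
  thus ?thesis by (simp only: unit_mult_inverse[OF nonzero_nth_0[OF assms]] mult_1_right)
qed

lemma powi_hom: "x $ 0 \<noteq> 0 \<Longrightarrow> \<Phi> (x powi n) = \<Phi> x powi n"
  by (simp add: power_int_def power inverse_hom)

lemma has_hsum_hom: "has_hsum h_scale g A x \<Longrightarrow> has_hsum h_scale (\<lambda>i. \<Phi> (g i)) A (\<Phi> x)"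
  by (rule has_hsum_map[OF lser.hadic_axioms lser.hadic_axioms]) (simp_all add: add mult h_scale_def const)

lemma qsum_hom:
  assumes "S = hc s" "S $ 0 = 0" "\<And>n. \<bar>n\<bar> - 1 \<le> E n" "x $ 0 \<noteq> 0"
  shows "\<Phi> (qsum S E x) = qsum S E (\<Phi> x)"
proof -
  have "has_hsum h_scale (\<lambda>n. \<Phi> (S ^ nat (E n) * x powi n)) UNIV (\<Phi> (qsum S E x))"
    by (rule has_hsum_hom[OF has_hsum_qsum[OF assms(2,3)]])
  hence "has_hsum h_scale (\<lambda>n. S ^ nat (E n) * \<Phi> x powi n) UNIV (\<Phi> (qsum S E x))"
    using assms(1,4) by (simp add: mult power const powi_hom)
  thus ?thesis unfolding qsum_def by (rule lser.hsum_eqI[symmetric])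
qed

lemma tha_hom: "S = hc s \<Longrightarrow> S $ 0 = 0 \<Longrightarrow> x $ 0 \<noteq> 0 \<Longrightarrow> \<Phi> (tha S x) = tha S (\<Phi> x)"
  unfolding tha_def by (rule qsum_hom) (auto intro: square_bounds)

lemma thb_hom: "S = hc s \<Longrightarrow> S $ 0 = 0 \<Longrightarrow> x $ 0 \<noteq> 0 \<Longrightarrow> \<Phi> (thb S x) = thb S (\<Phi> x)"
  unfolding thb_def by (rule qsum_hom) (auto intro: square_bounds)

end

interpretation qshift: chom qshift by standard (rule qshift_hc)
interpretation zneg: chom zneg by standard (rule zneg_hc)

section \<open>\<open>f\<close> at arguments divisible by \<open>h\<close>\<close>

text \<open>
  For \<open>X\<close> divisible by \<open>h\<close>, the power series \<open>f(X)\<close> converges \<open>h\<close>-adically.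
\<close>
definition f_small :: "lser \<Rightarrow> lser" where
  "f_small X = hsum h_scale (\<lambda>m. hc (f_hcoeff m) * X ^ m) UNIV"

lemma has_hsum_power_series:
  assumes "X $ 0 = 0"
  shows "has_hsum h_scale (\<lambda>m. hc (c m) * X ^ m) UNIV (hsum h_scale (\<lambda>m. hc (c m) * X ^ m) UNIV)"
proof (rule lser.has_hsum_hsum, unfold lser.hsummable_def, rule allI)
  fix n
  have "{m \<in> UNIV. hc (c m) * X ^ m \<notin> hpow h_scale n} \<subseteq> {..<n}"
    using hpow_lser_mult(1)[OF hpow_lser_power[OF assms]] not_le by blast
  thus "finite {m \<in> UNIV. hc (c m) * X ^ m \<notin> hpow h_scale n}" by (rule finite_subset) simp
qed

lemma has_hsum_f_small: "X $ 0 = 0 \<Longrightarrow> has_hsum h_scale (\<lambda>m. hc (f_hcoeff m) * X ^ m) UNIV (f_small X)"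
  unfolding f_small_def by (rule has_hsum_power_series)

lemma (in chom) f_small_hom:
  assumes "X $ 0 = 0"
  shows "\<Phi> (f_small X) = f_small (\<Phi> X)"
proof -
  have "has_hsum h_scale (\<lambda>m. hc (f_hcoeff m) * \<Phi> X ^ m) UNIV (\<Phi> (f_small X))"
    using has_hsum_hom[OF has_hsum_f_small[OF assms]] by (simp add: mult power const)
  thus ?thesis unfolding f_small_def[of "\<Phi> X"] by (rule lser.hsum_eqI[symmetric])
qed

lemma f_small_cong_1:
  assumes "\<And>k. k < n \<Longrightarrow> X $ k = 0" "X $ 0 = 0" "m < n"
  shows "f_small X $ m = 1 $ m"
proof -
  have f0: "f_hcoeff 0 = 1" using f_recursion_f_hcoeff by (simp add: f_recursion_def)
  have X: "X \<in> hpow h_scale n" using assms(1) by (simp add: hpow_lser)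
  have "f_small X - (\<Sum>i\<in>{0}. hc (f_hcoeff i) * X ^ i) \<in> hpow h_scale n"
  proof (rule lser.has_hsum_partial[OF has_hsum_f_small[OF assms(2)]])
    fix i assume "i \<in> UNIV - {0::nat}"
    then obtain j where "i = Suc j" by (cases i) auto
    thus "hc (f_hcoeff i) * X ^ i \<in> hpow h_scale n"
      using X by (auto intro: hpow_lser_mult)
  qed auto
  thus ?thesis using assms(3) by (simp add: hpow_lser f0 hc.one)
qed

lemma antidiagonal_sum:
  fixes g :: "nat \<Rightarrow> nat \<Rightarrow> lser"
  assumes "has_hsum h_scale (\<lambda>(i, j). g i j) (UNIV \<times> UNIV) x"
  shows "has_hsum h_scale (\<lambda>m. \<Sum>i\<le>m. g i (m - i)) UNIV x"
proof -
  let ?f = "\<lambda>(m, i). (i, m - i :: nat)"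
  have im: "?f ` (Sigma UNIV (\<lambda>m. {..m})) = UNIV \<times> UNIV"
  proof -
    have "(i, j) \<in> ?f ` (Sigma UNIV (\<lambda>m. {..m}))" for i j
      by (rule image_eqI[of _ _ "(i + j, i)"]) auto
    thus ?thesis by auto
  qed
  have inj: "inj_on ?f (Sigma UNIV (\<lambda>m. {..m}))" by (auto simp: inj_on_def)
  have "has_hsum h_scale (\<lambda>p. case ?f p of (i, j) \<Rightarrow> g i j) (Sigma UNIV (\<lambda>m. {..m})) x"
    using assms unfolding im[symmetric] lser.has_hsum_reindex[OF inj] .
  hence "has_hsum h_scale (\<lambda>(m, i). g i (m - i)) (Sigma UNIV (\<lambda>m. {..m})) x"
    by (simp add: case_prod_unfold)
  from lser.has_hsum_Sigma[OF this]
  have "has_hsum h_scale (\<lambda>m. hsum h_scale (\<lambda>i. g i (m - i)) {..m}) UNIV x" .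
  moreover have "hsum h_scale (\<lambda>i. g i (m - i)) {..m} = (\<Sum>i\<le>m. g i (m - i))" for m
    by (rule lser.hsum_eqI[OF lser.has_hsum_finite]) simp
  ultimately show ?thesis by (simp only:)
qed

text \<open>
  The product of the two power series has the coefficients \<open>quot_coeff\<close>, and multiplication by
  \<open>1 - q\<^sup>2 X\<close> makes its partial sums telescope.
\<close>
lemma f_small_equation:
  assumes X: "X $ 0 = 0"
  shows "f_small X * f_small (hc (qpow 2) * X) * (1 - hc (qpow 2) * X) = 1 - X"
proof (rule lser.hpow_eqI)
  fix n
  let ?u = "hc (qpow 2)"
  let ?G = "f_small X * f_small (?u * X)"
  have uX: "(?u * X) $ 0 = 0" using X by simp
  have "has_hsum h_scale (\<lambda>(i, j). (hc (f_hcoeff i) * X ^ i) * (hc (f_hcoeff j) * (?u * X) ^ j)) (UNIV \<times> UNIV) ?G"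
    by (rule has_hsum_mult[OF has_hsum_f_small[OF X] has_hsum_f_small[OF uX]])
  from antidiagonal_sum[OF this]
  have "has_hsum h_scale (\<lambda>m. \<Sum>i\<le>m. (hc (f_hcoeff i) * X ^ i) * (hc (f_hcoeff (m - i)) * (?u * X) ^ (m - i))) UNIV ?G" .
  also have "(\<lambda>m. \<Sum>i\<le>m. (hc (f_hcoeff i) * X ^ i) * (hc (f_hcoeff (m - i)) * (?u * X) ^ (m - i)))
      = (\<lambda>m. hc (quot_coeff (qpow 2) m) * X ^ m)"
  proof
    fix m
    have "hc (quot_coeff (qpow 2) m) = hc (\<Sum>i\<le>m. f_hcoeff i * (f_hcoeff (m - i) * qpow 2 ^ (m - i)))"
      using f_recursion_f_hcoeff by (simp add: f_recursion_def)
    hence "hc (quot_coeff (qpow 2) m) * X ^ m = (\<Sum>i\<le>m. hc (f_hcoeff i) * (hc (f_hcoeff (m - i)) * ?u ^ (m - i)) * X ^ m)"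
      by (simp add: hc.sum hc.mult hc.power sum_distrib_right)
    also have "\<dots> = (\<Sum>i\<le>m. (hc (f_hcoeff i) * X ^ i) * (hc (f_hcoeff (m - i)) * (?u * X) ^ (m - i)))"
    proof (intro sum.cong refl)
      fix i assume "i \<in> {..m}"
      hence "X ^ m = X ^ i * X ^ (m - i)" by (simp flip: power_add)
      thus "hc (f_hcoeff i) * (hc (f_hcoeff (m - i)) * ?u ^ (m - i)) * X ^ m =
        (hc (f_hcoeff i) * X ^ i) * (hc (f_hcoeff (m - i)) * (?u * X) ^ (m - i))"
        by (simp only: power_mult_distrib mult_ac)
    qed
    finally show "(\<Sum>i\<le>m. (hc (f_hcoeff i) * X ^ i) * (hc (f_hcoeff (m - i)) * (?u * X) ^ (m - i)))
      = hc (quot_coeff (qpow 2) m) * X ^ m" by simp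
  qed
  finally have G: "has_hsum h_scale (\<lambda>m. hc (quot_coeff (qpow 2) m) * X ^ m) UNIV ?G" .
  have tel: "(\<Sum>m<Suc (Suc k). hc (quot_coeff (qpow 2) m) * X ^ m) * (1 - ?u * X)
      = 1 - X - ?u * hc (quot_coeff (qpow 2) (Suc k)) * X ^ Suc (Suc k)" for k
  proof (induction k)
    case 0
    show ?case by (simp add: quot_coeff_def hc.hom) (simp add: algebra_simps)
  next
    case (Suc k)
    have e: "hc (quot_coeff (qpow 2) (Suc (Suc k))) = ?u * hc (quot_coeff (qpow 2) (Suc k))"
      by (simp add: quot_coeff_def hc.hom algebra_simps)
    show ?case unfolding sum.lessThan_Suc[of _ "Suc (Suc k)"] distrib_right Suc e
      by (simp add: algebra_simps)
  qed
  let ?P = "\<Sum>m<Suc (Suc n). hc (quot_coeff (qpow 2) m) * X ^ m"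
  have "?G - ?P \<in> hpow h_scale n"
    by (rule lser.has_hsum_partial[OF G]) (auto intro!: hpow_lser_mult(1) hpow_lser_power[OF X])
  hence "(?G - ?P) * (1 - ?u * X) \<in> hpow h_scale n" by (rule hpow_lser_mult)
  moreover have "?u * hc (quot_coeff (qpow 2) (Suc n)) * X ^ Suc (Suc n) \<in> hpow h_scale n"
    by (intro hpow_lser_mult(1) hpow_lser_power[OF X]) simp
  ultimately have "(?G - ?P) * (1 - ?u * X) - ?u * hc (quot_coeff (qpow 2) (Suc n)) * X ^ Suc (Suc n) \<in> hpow h_scale n"
    by (rule lser.hpow_diff)
  also have "(?G - ?P) * (1 - ?u * X) - ?u * hc (quot_coeff (qpow 2) (Suc n)) * X ^ Suc (Suc n)
     = ?G * (1 - ?u * X) - (1 - X)"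
    unfolding left_diff_distrib tel by simp
  finally show "?G * (1 - ?u * X) - (1 - X) \<in> hpow h_scale n" .
qed

lemma f_at_nth:
  assumes "x $ 0 = 0"
  shows "f_at x $ N = (\<Sum>m\<le>N. (hconst (f_hcoeff m) * x ^ m) $ N)"
proof -
  let ?g = "\<lambda>m. hconst (f_hcoeff m) * x ^ m"
  let ?L = "Abs_fps (\<lambda>N. \<Sum>m\<le>N. ?g m $ N)"
  have "?g sums ?L"
    unfolding sums_def
  proof (rule tendsto_fpsI)
    fix n
    show "\<forall>\<^sub>F k in sequentially. (\<Sum>m<k. ?g m) $ n = ?L $ n"
      using eventually_gt_at_top[of n]
    proof eventually_elim
      case (elim k)
      have "(\<Sum>m<k. ?g m $ n) = (\<Sum>m\<le>n. ?g m $ n)"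
        using elim by (intro sum.mono_neutral_right) (auto simp: fps_mult_power_nth_below[OF assms])
      thus ?case by (simp add: fps_sum_nth)
    qed
  qed
  hence "f_at x = ?L" unfolding f_at_def by (rule sums_unique[symmetric])
  thus ?thesis by simp
qed

lemma Eh_nth_0: "F $ 0 = 0 \<Longrightarrow> Eh F $ 0 = 0"
  by (simp add: Eh_nth expand_inf_def at_inf.r.zero)

lemma Eh_nth_0_iff: "Eh F $ 0 = 0 \<longleftrightarrow> F $ 0 = 0"
  by (simp add: Eh_nth expand_inf_def at_inf.r.eq_0_iff)

lemma Eh_f_at:
  assumes "x $ 0 = 0"
  shows "Eh (f_at x) = f_small (Eh x)"
proof -
  have X: "Eh x $ 0 = 0" using assms by (rule Eh_nth_0)
  have "has_hsum h_scale (\<lambda>m. hc (f_hcoeff m) * Eh x ^ m) UNIV (Eh (f_at x))"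
    unfolding lser.has_hsum_iff
  proof
    fix n
    have g: "hc (f_hcoeff m) * Eh x ^ m = Eh (hconst (f_hcoeff m) * x ^ m)" for m
      by (simp add: Eh.mult Eh.power Eh_hconst)
    have "Eh (f_at x) - (\<Sum>m<n. hc (f_hcoeff m) * Eh x ^ m) \<in> hpow h_scale n"
      unfolding hpow_lser
    proof (intro allI impI)
      fix k assume "k < n"
      have "(\<Sum>m<n. (hconst (f_hcoeff m) * x ^ m)) $ k = (\<Sum>m\<le>k. (hconst (f_hcoeff m) * x ^ m) $ k)"
        unfolding fps_sum_nth using \<open>k < n\<close>
        by (intro sum.mono_neutral_right) (auto simp: fps_mult_power_nth_below[OF assms])
      hence "f_at x $ k = (\<Sum>m<n. (hconst (f_hcoeff m) * x ^ m)) $ k"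
        by (simp add: f_at_nth[OF assms])
      hence "Eh (f_at x) $ k = Eh (\<Sum>m<n. (hconst (f_hcoeff m) * x ^ m)) $ k" by (simp add: Eh_nth)
      thus "(Eh (f_at x) - (\<Sum>m<n. hc (f_hcoeff m) * Eh x ^ m)) $ k = 0"
        unfolding g Eh.sum[symmetric] by simp
    qed
    moreover have "hc (f_hcoeff i) * Eh x ^ i \<in> hpow h_scale n" if "i \<in> UNIV - {..<n}" for i
      using that by (intro hpow_lser_mult(1) hpow_lser_power[OF X]) auto
    ultimately show "\<exists>F. finite F \<and> F \<subseteq> UNIV \<and> (\<forall>i\<in>UNIV - F. hc (f_hcoeff i) * Eh x ^ i \<in> hpow h_scale n) \<and>
      Eh (f_at x) - (\<Sum>i\<in>F. hc (f_hcoeff i) * Eh x ^ i) \<in> hpow h_scale n"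
      by (intro exI[of _ "{..<n}"]) auto
  qed
  thus ?thesis unfolding f_small_def by (rule lser.hsum_eqI[symmetric])
qed

section \<open>The product of the \<open>f(p\<^sup>k z\<^sup>2)\<close>\<close>


definition f_tail :: "lser \<Rightarrow> lser \<Rightarrow> lser" where
  "f_tail P X = (\<Prod>k. f_small (P ^ (k + 1) * X ^ 2))"

lemma power_Suc_mult_nth:
  fixes P :: lser
  assumes "P $ 0 = 0" "m \<le> k"
  shows "(P ^ (k + 1) * Y) $ m = 0"
  using fps_mult_power_nth_below[OF assms(1), of m "k + 1" Y] assms(2) by (simp add: mult.commute)

lemma hprod_ok_f_tail:
  assumes "P $ 0 = 0"
  shows "hprod_ok (\<lambda>k. f_small (P ^ (k + 1) * X ^ 2))"
  unfolding hprod_ok_def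
proof (intro conjI allI)
  have c: "f_small (P ^ (k + 1) * X ^ 2) $ m = 1 $ m" if "m \<le> k" for k m
  proof (rule f_small_cong_1[of "Suc k"])
    show "(P ^ (k + 1) * X ^ 2) $ i = 0" if "i < Suc k" for i
      by (rule power_Suc_mult_nth[OF assms]) (use that in simp)
    show "(P ^ (k + 1) * X ^ 2) $ 0 = 0" by (rule power_Suc_mult_nth[OF assms]) simp
    show "m < Suc k" using that by simp
  qed
  show "f_small (P ^ (k + 1) * X ^ 2) \<noteq> 0" for k using c[of 0 k] by force
  show "\<exists>K. \<forall>k\<ge>K. \<forall>m\<le>N. f_small (P ^ (k + 1) * X ^ 2) $ m = 1 $ m" for N
    using c by (intro exI[of _ N]) auto
qed

lemma f_tail_nth_0:
  assumes "P $ 0 = 0"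
  shows "f_tail P X $ 0 = 1"
proof -
  obtain K where "\<forall>n\<ge>K. \<forall>M\<le>0. f_tail P X $ M = (\<Prod>k<n. f_small (P ^ (k + 1) * X ^ 2)) $ M"
    unfolding f_tail_def using prodinf_nth[OF hprod_ok_f_tail[OF assms]] by blast
  hence "f_tail P X $ 0 = (\<Prod>k<K. f_small (P ^ (k + 1) * X ^ 2)) $ 0" by simp
  also have "\<dots> = 1"
  proof -
    have "f_small (P ^ (k + 1) * X ^ 2) $ 0 = 1" for k
      using f_small_cong_1[of 1 "P ^ (k + 1) * X ^ 2" 0] power_Suc_mult_nth[OF assms, of 0 k "X ^ 2"] by simp
    thus ?thesis by (simp add: fps_prod_nth_zero)
  qed
  finally show ?thesis .
qed

lemma (in chom) f_tail_hom:
  assumes "P = hc p" "P $ 0 = 0"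
  shows "\<Phi> (f_tail P X) = f_tail P (\<Phi> X)"
proof -
  have e: "\<Phi> (f_small (P ^ (k + 1) * X ^ 2)) = f_small (P ^ (k + 1) * \<Phi> X ^ 2)" for k
    using power_Suc_mult_nth[OF assms(2), of 0 k] assms(1) by (subst f_small_hom) (simp_all add: mult power const)
  show ?thesis unfolding f_tail_def
    by (subst hhom_prodinf[OF hhom_axioms hprod_ok_f_tail[OF assms(2)]])
      (use hprod_ok_f_tail[OF assms(2), of "\<Phi> X"] e in \<open>auto simp: hprod_ok_def\<close>)
qed

text \<open>
  The functional equation of \<open>f\<close> in each factor.
\<close>
lemma f_tail_equation:
  assumes P: "P $ 0 = 0"
  shows "f_tail P X * f_tail P (hc (qpow 1) * X) * qpoch (P * (hc (qpow 1) * X) ^ 2) P = qpoch (P * X ^ 2) P"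
proof -
  let ?q = "hc (qpow 1)"
  have ok1: "hprod_ok (\<lambda>k. 1 - P * Y * P ^ k)" for Y by (rule hprod_ok_qpoch) (use P in auto)
  have "f_tail P X * f_tail P (?q * X) * qpoch (P * (?q * X) ^ 2) P =
    (\<Prod>k. f_small (P ^ (k + 1) * X ^ 2) * f_small (P ^ (k + 1) * (?q * X) ^ 2) * (1 - P * (?q * X) ^ 2 * P ^ k))"
    unfolding f_tail_def qpoch_def
    by (simp only: prodinf_mult_fps hprod_ok_f_tail[OF P] ok1 hprod_ok_mult)
  also have "(\<lambda>k. f_small (P ^ (k + 1) * X ^ 2) * f_small (P ^ (k + 1) * (?q * X) ^ 2) * (1 - P * (?q * X) ^ 2 * P ^ k))
     = (\<lambda>k. 1 - P * X ^ 2 * P ^ k)"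
  proof
    fix k
    have e: "P ^ (k + 1) * (?q * X) ^ 2 = hc (qpow 2) * (P ^ (k + 1) * X ^ 2)"
      by (simp add: power_mult_distrib qpow_power mult_ac flip: hc.power)
    have e2: "P * (?q * X) ^ 2 * P ^ k = hc (qpow 2) * (P ^ (k + 1) * X ^ 2)"
      using e by (simp add: mult_ac)
    have "(P ^ (k + 1) * X ^ 2) $ 0 = 0" by (rule power_Suc_mult_nth[OF P]) simp
    from f_small_equation[OF this]
    show "f_small (P ^ (k + 1) * X ^ 2) * f_small (P ^ (k + 1) * (?q * X) ^ 2) * (1 - P * (?q * X) ^ 2 * P ^ k) = 1 - P * X ^ 2 * P ^ k"
      unfolding e e2 by (simp add: mult_ac)
  qed
  finally show ?thesis by (simp add: qpoch_def)
qed

section \<open>The duplication formula\<close>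

text \<open>
  This is \<open>(U; P)(- U; P)(V; P)(- V; P) = (U\<^sup>2; P)\<close> for \<open>V = P\<^bsup>1/2\<^esup> U\<close>: the squares of the factors of
  the two pairs are the even and the odd factors of the right-hand side.
\<close>
lemma qpoch_duplication:
  fixes U V P :: lser
  assumes P: "P $ 0 = 0" and V: "V ^ 2 = U ^ 2 * P"
    and U0: "U $ 0 \<noteq> 1" "(- U) $ 0 \<noteq> 1" "(U ^ 2) $ 0 \<noteq> 1" and V0: "V $ 0 = 0"
  shows "qpoch U P * qpoch (- U) P * (qpoch V P * qpoch (- V) P) = qpoch (U ^ 2) P"
proof -
  have ok: "hprod_ok (\<lambda>k. 1 - U * P ^ k)" "hprod_ok (\<lambda>k. 1 - - U * P ^ k)"
    "hprod_ok (\<lambda>k. 1 - V * P ^ k)" "hprod_ok (\<lambda>k. 1 - - V * P ^ k)"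
    by (rule hprod_ok_qpoch; use P U0 V0 in simp)+
  let ?f = "\<lambda>k. (1 - U * P ^ k) * (1 - - U * P ^ k) * ((1 - V * P ^ k) * (1 - - V * P ^ k))"
  have okf: "hprod_ok ?f" by (intro hprod_ok_mult ok)
  have ok2: "hprod_ok (\<lambda>k. 1 - U ^ 2 * P ^ k)" by (rule hprod_ok_qpoch) fact+
  have f: "?f k = (1 - U ^ 2 * P ^ (2 * k)) * (1 - U ^ 2 * P ^ (2 * k + 1))" for k
  proof -
    have sq: "(1 - u) * (1 - - u) * ((1 - v) * (1 - - v)) = (1 - u ^ 2) * (1 - v ^ 2)" for u v :: lser
      by (simp add: algebra_simps power2_eq_square)
    have "(U * P ^ k) ^ 2 = U ^ 2 * P ^ (2 * k)" "(V * P ^ k) ^ 2 = U ^ 2 * P ^ (2 * k + 1)"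
      by (simp_all only: power_mult_distrib V power_even_eq power_add power_one_right) (simp only: mult_ac)
    thus ?thesis using sq[of "U * P ^ k" "V * P ^ k"] by (simp only: mult_minus_left)
  qed
  have part: "(\<Prod>k<n. ?f k) = (\<Prod>k<2 * n. 1 - U ^ 2 * P ^ k)" for n
  proof (induction n)
    case (Suc n)
    have e: "2 * Suc n = Suc (Suc (2 * n))" by simp
    show ?case using Suc unfolding f e prod.lessThan_Suc by (simp only: mult.assoc Suc_eq_plus1)
  qed simp
  have "qpoch U P * qpoch (- U) P * (qpoch V P * qpoch (- V) P) = prodinf ?f"
    unfolding qpoch_def by (simp only: prodinf_mult_fps ok hprod_ok_mult)
  also have "\<dots> = qpoch (U ^ 2) P"
  proof (rule prodinf_eqI[OF okf])
    fix N
    obtain K where K: "\<forall>n\<ge>K. \<forall>M\<le>N. qpoch (U ^ 2) P $ M = (\<Prod>k<n. 1 - U ^ 2 * P ^ k) $ M"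
      unfolding qpoch_def using prodinf_nth[OF ok2] by blast
    have "(\<Prod>k<n. ?f k) $ N = qpoch (U ^ 2) P $ N" if "n \<ge> K" for n
      unfolding part using K[rule_format, of "2 * n" N] that by simp
    thus "\<exists>K. \<forall>n\<ge>K. (\<Prod>k<n. ?f k) $ N = qpoch (U ^ 2) P $ N" by blast
  qed
  finally show ?thesis .
qed

section \<open>The scalar factor of the R-matrix\<close>

lemma Eh_inverse:
  assumes "b $ 0 \<noteq> 0"
  shows "Eh (inverse b) = inverse (Eh b)"
proof -
  have u: "Eh b $ 0 \<noteq> 0" using assms by (simp add: Eh_nth_0_iff)
  have "Eh (inverse b) * Eh b = 1" using inverse_mult_eq_1[OF assms] by (metis Eh.mult Eh.one)
  hence "Eh (inverse b) * (Eh b * inverse (Eh b)) = inverse (Eh b)"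
    by (simp only: mult.assoc[symmetric] mult_1)
  thus ?thesis by (simp only: unit_mult_inverse[OF u] mult_1_right)
qed

lemma Eh_divide: "b $ 0 \<noteq> 0 \<Longrightarrow> Eh (a / b) = Eh a * inverse (Eh b)"
  by (simp add: fps_divide_unit Eh.mult Eh_inverse)

lemma Eh_qpoch:
  assumes "x $ 0 = 0" "p $ 0 = 0"
  shows "Eh (qpoch x p) = qpoch (Eh x) (Eh p)"
  by (rule hhom_qpoch[OF Eh.hhom_axioms]) (use assms Eh_nth_0[of x] in auto)

lemma inverse_eqI:
  fixes x y :: lser
  assumes "x * y = 1" "y $ 0 \<noteq> 0"
  shows "inverse y = x"
proof -
  have "x * (y * inverse y) = inverse y" unfolding mult.assoc[symmetric] assms(1) by simp
  thus ?thesis unfolding unit_mult_inverse[OF assms(2)] by simp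
qed

lemma square_nth_0_neq_1: "x $ 0 \<noteq> 1 \<Longrightarrow> x $ 0 \<noteq> - 1 \<Longrightarrow> (x ^ 2) $ 0 \<noteq> (1 :: complex fls)"
  by (simp add: fps_power_zeroth power2_eq_1_iff)

lemma fps_inverse_nth_zero: "inverse f $ 0 = inverse (f $ 0 :: 'a :: field)"
  by (simp add: fps_inverse_def)

lemma cancel_quotient:
  fixes a b f :: lser
  assumes "a $ 0 \<noteq> 0" "b $ 0 \<noteq> 0"
  shows "inverse (a * inverse b * f) * a = b * inverse f"
proof -
  have "inverse (a * inverse b * f) * a = (inverse a * a) * (b * inverse f)"
    by (simp only: fps_inverse_mult fps_inverse_idempotent[OF assms(2)] mult_ac)
  thus ?thesis by (simp add: inverse_mult_eq_1[OF assms(1)])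
qed

text \<open>
  Here \<open>S = p\<^bsup>1/2\<^esup>\<close>, \<open>P = p\<close>, \<open>r = q\<^sup>-\<^sup>1\<close>, \<open>qh\<close> and \<open>rh\<close> are the square roots of \<open>q\<close> and \<open>r\<close>, and \<open>T\<close> is the
  variable \<open>z\<close>, expanded at infinity.
\<close>
locale elliptic =
  fixes s :: "complex fps"
  assumes s0: "s $ 0 = 0"
begin

abbreviation S where "S \<equiv> hc s"
abbreviation P where "P \<equiv> S ^ 2"
abbreviation q where "q \<equiv> hc (qpow 1)"
abbreviation r where "r \<equiv> hc (qpow (- 1))"
abbreviation qh where "qh \<equiv> hc (qpow (1 / 2))"
abbreviation rh where "rh \<equiv> hc (qpow (- 1 / 2))"
abbreviation "T \<equiv> inner_X_inv"
abbreviation "T' \<equiv> inverse inner_X_inv"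

lemma S0: "S $ 0 = 0" using s0 by simp
lemma P0: "P $ 0 = 0" using S0 by (simp add: power2_eq_square)
lemma P_hc: "P = hc (s ^ 2)" by (simp add: hc.power)

lemma qr: "q * r = 1" and qhrh: "rh * qh = 1" and qh: "qh = q * rh"
  by (simp_all add: hc.one[symmetric] flip: hc.mult qpow_add) (simp_all add: qpow_def)

lemma T0: "T $ 0 \<noteq> 0" by (simp add: inner_X_inv_def)
lemma q0: "q $ 0 = 1" "r $ 0 = 1" by (simp_all add: qpow_def)
lemma TT': "T * T' = 1" by (rule unit_mult_inverse[OF T0])

lemma fls_X_inv_neq: "fls_X_inv \<noteq> (1 :: complex fls)" "fls_X_inv \<noteq> (- 1 :: complex fls)"
proof -
  show "fls_X_inv \<noteq> (1 :: complex fls)"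
  proof
    assume h: "fls_X_inv = (1 :: complex fls)"
    have "(fls_X_inv :: complex fls) $$ 0 = 0" by simp
    thus False unfolding h by simp
  qed
  show "fls_X_inv \<noteq> (- 1 :: complex fls)"
  proof
    assume h: "fls_X_inv = (- 1 :: complex fls)"
    have "(fls_X_inv :: complex fls) $$ 0 = 0" by simp
    thus False unfolding h by simp
  qed
qed

lemma unit_cT:
  assumes "c $ 0 = 1"
  shows "(hc c * T) $ 0 \<noteq> 0" "(hc c * T) $ 0 \<noteq> 1" "(hc c * T) $ 0 \<noteq> - 1"
  using assms fls_X_inv_neq by (simp_all add: inner_X_inv_def)

lemma inverse_cT: "c $ 0 = 1 \<Longrightarrow> d * c = 1 \<Longrightarrow> inverse (hc c * T) = hc d * T'"
proof -
  assume c: "c $ 0 = 1" "d * c = 1"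
  have "hc d * hc c = 1" using c(2) by (metis hc.mult hc.one)
  hence "hc d * T' * (hc c * T) = 1" using TT' by algebra
  thus ?thesis using unit_cT(1)[OF c(1)] by (rule inverse_eqI)
qed

text \<open>
  Up to the factor \<open>J = (p; p)\<close>, the functions \<open>A\<close> and \<open>B\<close> are the theta functions
  \<open>(p\<^bsup>1/2\<^esup> x; p)(p\<^bsup>1/2\<^esup>/x; p)\<close> and \<open>(x; p)(p/x; p)\<close>; see \<open>A_prod\<close> and \<open>B_prod\<close>.
\<close>
definition A where "A x = tha S (- x)"
definition B where "B x = thb S (- x)"
definition J where "J = qpoch P P"

lemma P1: "P $ 0 \<noteq> 1" unfolding P0 by simp

lemma J_unit: "J $ 0 = 1"
  unfolding J_def qpoch_nth_0[OF P0 P1] P0 by simp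

lemma Py0: "(P * y) $ 0 = 0"
  by (simp only: fps_mult_nth_0 P0 mult_zero_left)

lemma qpoch_unitA: "x $ 0 = 0 \<Longrightarrow> qpoch x P $ 0 = 1"
  by (subst qpoch_nth_0[OF P0]) auto

lemma A_prod:
  assumes "x $ 0 \<noteq> 0"
  shows "A x = J * (qpoch (S * x) P * qpoch (S * inverse x) P)"
proof -
  have "inverse (- x) = - inverse x" by (rule fps_inverse_minus)
  thus ?thesis unfolding A_def J_def using tha_product[OF S0, of "- x"] assms by simp
qed

lemma B_prod:
  assumes "x $ 0 \<noteq> 0" "x $ 0 \<noteq> 1"
  shows "B x = J * (qpoch x P * qpoch (P * inverse x) P)"
proof -
  have "inverse (- x) = - inverse x" by (rule fps_inverse_minus)
  thus ?thesis unfolding B_def J_def using thb_product[OF S0, of "- x"] assms by simp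
qed

lemma A_unit: "x $ 0 \<noteq> 0 \<Longrightarrow> A x $ 0 \<noteq> 0"
  by (simp add: A_prod J_unit qpoch_nth_0[OF P0] s0)

lemma B_unit:
  assumes "x $ 0 \<noteq> 0" "x $ 0 \<noteq> 1"
  shows "B x $ 0 \<noteq> 0"
  unfolding B_prod[OF assms] fps_mult_nth_0 J_unit qpoch_unitA[OF Py0] qpoch_nth_0[OF P0 assms(2)]
  using assms(2) by simp

text \<open>
  All four theta functions combine by \<open>qpoch_duplication\<close> into a single one in \<open>x\<^sup>2\<close>. In this form
  the quotient at \<open>x = q z\<close> and \<open>x = z\<close> matches the products over \<open>f(p\<^sup>k z\<^sup>2)\<close>.
\<close>
lemma AB_duplication:
  assumes "x $ 0 \<noteq> 0" "x $ 0 \<noteq> 1" "x $ 0 \<noteq> - 1"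
  shows "A x * A (- x) * (B x * B (- x)) = J ^ 4 * (qpoch (x ^ 2) P * qpoch (P * inverse x ^ 2) P)"
proof -
  have m: "(- x) $ 0 \<noteq> 0" "(- x) $ 0 \<noteq> 1" using assms by (auto simp: minus_equation_iff)
  have x2: "(x ^ 2) $ 0 \<noteq> 1" using assms by (simp add: fps_power_zeroth power2_eq_1_iff)
  have i: "inverse (- x) = - inverse x" by (rule fps_inverse_minus)
  have d1: "qpoch x P * qpoch (- x) P * (qpoch (S * x) P * qpoch (- (S * x)) P) = qpoch (x ^ 2) P"
    by (rule qpoch_duplication[OF P0]) (use assms m x2 s0 in \<open>simp_all add: power_mult_distrib mult.commute\<close>)
  have d2: "qpoch (S * inverse x) P * qpoch (- (S * inverse x)) P * (qpoch (P * inverse x) P * qpoch (- (P * inverse x)) P)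
      = qpoch ((S * inverse x) ^ 2) P"
    by (rule qpoch_duplication[OF P0])
      (use s0 P0 in \<open>simp_all add: power_mult_distrib fps_power_zeroth power2_eq_square mult_ac\<close>)
  have "A x * A (- x) * (B x * B (- x)) = J ^ 4 *
    ((qpoch x P * qpoch (- x) P * (qpoch (S * x) P * qpoch (- (S * x)) P)) *
     (qpoch (S * inverse x) P * qpoch (- (S * inverse x)) P * (qpoch (P * inverse x) P * qpoch (- (P * inverse x)) P)))"
    unfolding A_prod[OF assms(1)] A_prod[OF m(1)] B_prod[OF assms(1,2)] B_prod[OF m] i
      mult_minus_right
    by (simp only: power4_eq_xxxx mult_ac)
  thus ?thesis unfolding d1 d2 by (simp add: power_mult_distrib)
qed

text \<open>
  The common scalar factor of the entries: the quotients of \<open>\<alpha>\<close> and of \<open>\<beta>\<close> contain the same products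
  over \<open>f\<close>.
\<close>
definition kappa where "kappa = inverse f_sq * (f_tail P T' * inverse (f_tail P T))"

lemma f_sq_unit: "f_sq $ 0 \<noteq> 0" by (simp add: f_sq_nth_0)
lemma f_tail_unit: "f_tail P x $ 0 \<noteq> 0" by (simp add: f_tail_nth_0[OF P0])

lemma f_tail_minus: "f_tail P (- x) = f_tail P x" by (simp add: f_tail_def)

lemma zneg_kappa: "zneg kappa = kappa"
proof -
  have "zneg T' = - T'" by (simp add: zneg.inverse_hom[OF T0] zneg_inner_X_inv)
  thus ?thesis unfolding kappa_def
    by (simp add: zneg.mult zneg.inverse_hom f_sq_unit f_tail_unit zneg_f_sq zneg.f_tail_hom[OF P_hc P0] zneg_inner_X_inv f_tail_minus)
qed

lemma qshift_T': "qshift T' = r * T'"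
proof -
  have "qpow (- 1) * qpow 1 = 1" by (simp add: qpow_def flip: qpow_add fps_exp_add_mult)
  moreover have "qpow 1 $ 0 = 1" by (simp add: qpow_def)
  ultimately show ?thesis using inverse_cT[of "qpow 1" "qpow (- 1)"] by (simp add: qshift.inverse_hom[OF T0] qshift_inner_X_inv)
qed

text \<open>
  In \<open>\<kappa>(z) \<kappa>(q z)\<close> the functional equations of \<open>f(z\<^sup>2)\<close> and of the products over \<open>f(p\<^sup>k z\<^sup>2)\<close> and
  \<open>f(p\<^sup>k z\<^sup>-\<^sup>2)\<close> leave a quotient of infinite products in \<open>z\<^sup>2\<close> and \<open>(q z)\<^sup>2\<close>, which \<open>AB_duplication\<close>
  identifies.
\<close>
lemma kappa_equation:
  "kappa * qshift kappa * (A T * A (- T) * (B T * B (- T))) = A (q * T) * A (- (q * T)) * (B (q * T) * B (- (q * T)))"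
proof -
  let ?F = "f_tail P T" and ?F' = "f_tail P T'" and ?sF = "f_tail P (q * T)" and ?sF' = "f_tail P (r * T')"
  let ?Q = "\<lambda>x. qpoch x P"
  have sk: "qshift kappa = inverse (qshift f_sq) * (?sF' * inverse ?sF)"
    unfolding kappa_def
    by (simp add: qshift.mult qshift.inverse_hom f_sq_unit f_tail_unit qshift.f_tail_hom[OF P_hc P0] qshift_inner_X_inv qshift_T')
  have u: "(hc (qpow 1) * T) $ 0 \<noteq> 0" "(hc (qpow 1) * T) $ 0 \<noteq> 1" "(hc (qpow 1) * T) $ 0 \<noteq> - 1"
    by (rule unit_cT; simp add: qpow_def)+
  have u': "T $ 0 \<noteq> 1" "T $ 0 \<noteq> - 1" using fls_X_inv_neq by (simp_all add: inner_X_inv_def)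
  have iq: "inverse (q * T) = r * T'"
    by (rule inverse_cT) (simp_all add: qpow_def flip: fps_exp_add_mult)
  have e1: "?F * ?sF * ?Q (P * (q * T) ^ 2) = ?Q (P * T ^ 2)"
    by (rule f_tail_equation[OF P0])
  have "f_tail P (r * T') * f_tail P (q * (r * T')) * ?Q (P * (q * (r * T')) ^ 2) = ?Q (P * (r * T') ^ 2)"
    by (rule f_tail_equation[OF P0])
  moreover have "q * (r * T') = T'" using qr by (simp flip: mult.assoc)
  ultimately have e2: "?sF' * ?F' * ?Q (P * T' ^ 2) = ?Q (P * (r * T') ^ 2)" by simp
  have e3: "f_sq * qshift f_sq * (1 - (q * T) ^ 2) = 1 - T ^ 2"
    using f_sq_equation by (simp add: power_mult_distrib qpow_power flip: hc.power)
  have t2: "(T ^ 2) $ 0 \<noteq> 1" "((q * T) ^ 2) $ 0 \<noteq> 1"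
    by (rule square_nth_0_neq_1[OF u'(1) u'(2)], rule square_nth_0_neq_1[OF u(2) u(3)])
  have e4: "?Q (T ^ 2) = (1 - T ^ 2) * ?Q (P * T ^ 2)"
    using qpoch_rec[OF P0 t2(1)] by (simp add: mult.commute)
  have e5: "?Q ((q * T) ^ 2) = (1 - (q * T) ^ 2) * ?Q (P * (q * T) ^ 2)"
    using qpoch_rec[OF P0 t2(2)] by (simp add: mult.commute)
  have dT: "A T * A (- T) * (B T * B (- T)) = J ^ 4 * (?Q (T ^ 2) * ?Q (P * T' ^ 2))"
    by (rule AB_duplication[OF T0 u'])
  have dq: "A (q * T) * A (- (q * T)) * (B (q * T) * B (- (q * T))) = J ^ 4 * (?Q ((q * T) ^ 2) * ?Q (P * (r * T') ^ 2))"
    using AB_duplication[OF u] unfolding iq .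
  have i: "f_sq * inverse f_sq = 1" "qshift f_sq * inverse (qshift f_sq) = 1" "?F * inverse ?F = 1" "?sF * inverse ?sF = 1"
    by (rule unit_mult_inverse; simp add: f_sq_unit f_tail_unit qshift.nonzero_nth_0)+
  let ?K = "inverse f_sq * inverse (qshift f_sq) * inverse ?F * inverse ?sF"
  have k: "kappa * qshift kappa = ?F' * ?sF' * ?K" unfolding sk by (simp only: kappa_def mult_ac)
  have kk: "f_sq * qshift f_sq * ?F * ?sF * ?K = 1"
  proof -
    have "f_sq * qshift f_sq * ?F * ?sF * ?K = (f_sq * inverse f_sq) * (qshift f_sq * inverse (qshift f_sq)) * (?F * inverse ?F) * (?sF * inverse ?sF)"
      by (simp only: mult_ac)
    thus ?thesis unfolding i by simp
  qed
  have "kappa * qshift kappa * (?Q (T ^ 2) * ?Q (P * T' ^ 2))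
    = ?K * (?sF' * ?F' * ?Q (P * T' ^ 2)) * ((1 - T ^ 2) * ?Q (P * T ^ 2))"
    unfolding k e4 by (simp only: mult_ac)
  also have "\<dots> = ?K * ?Q (P * (r * T') ^ 2) * ((f_sq * qshift f_sq * (1 - (q * T) ^ 2)) * (?F * ?sF * ?Q (P * (q * T) ^ 2)))"
    unfolding e1 e2 e3 ..
  also have "\<dots> = (f_sq * qshift f_sq * ?F * ?sF * ?K) * (?Q (P * (r * T') ^ 2) * ((1 - (q * T) ^ 2) * ?Q (P * (q * T) ^ 2)))"
    by (simp only: mult_ac)
  also have "\<dots> = ?Q ((q * T) ^ 2) * ?Q (P * (r * T') ^ 2)"
    unfolding kk e5 by (simp only: mult_1 mult_ac)
  finally have fin: "kappa * qshift kappa * (?Q (T ^ 2) * ?Q (P * T' ^ 2)) = ?Q ((q * T) ^ 2) * ?Q (P * (r * T') ^ 2)" .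
  show ?thesis unfolding dT dq fin[symmetric] by (rule mult.left_commute)
qed

section \<open>The sums \<open>a + d\<close> and \<open>b + c\<close> as quotients of theta functions\<close>

text \<open>
  The expansions at infinity of \<open>a(z) + d(z)\<close> and \<open>b(z) + c(z)\<close>.
\<close>
definition AD where "AD = Eh (ell_ad s)"
definition BC where "BC = Eh (ell_bc s)"

lemma hconst_small: "(hconst (s * c) * x) $ 0 = 0" "hconst (s ^ 2) $ 0 = 0" "(hconst (s ^ 2) * y) $ 0 = 0"
  using s0 by (simp_all add: hconst_def cz.zero power2_eq_square)

lemma hprod_ok_f_at: "hprod_ok (\<lambda>k. f_at (hconst (s ^ 2) ^ (k + 1) * x ^ 2))"
proof -
  let ?y = "\<lambda>k. hconst (s ^ 2) ^ (k + 1) * x ^ 2"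
  have y0: "?y k $ 0 = 0" for k using hconst_small(2) by simp
  have e: "Eh (f_at (?y k)) = f_small (P ^ (k + 1) * Eh x ^ 2)" for k
    unfolding Eh_f_at[OF y0] by (simp add: Eh.mult Eh.power Eh_hconst hc.power)
  have ok: "hprod_ok (\<lambda>k. Eh (f_at (?y k)))" unfolding e by (rule hprod_ok_f_tail[OF P0])
  have inj: "f_at (?y k) $ m = 1 $ m" if "Eh (f_at (?y k)) $ m = 1 $ m" for k m
  proof -
    have "expand_inf (f_at (?y k) $ m) = expand_inf (1 $ m)"
      using that by (cases "m = 0") (simp_all add: Eh_nth expand_inf_def at_inf.r.one at_inf.r.zero)
    thus ?thesis using injD[OF at_inf.r.inj] by (simp add: expand_inf_def)
  qed
  have nz: "f_at (?y k) \<noteq> 0" for k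
  proof
    assume "f_at (?y k) = 0"
    hence "Eh (f_at (?y k)) = 0" by (simp add: Eh.zero)
    thus False using ok by (auto simp: hprod_ok_def)
  qed
  show ?thesis using ok inj nz unfolding hprod_ok_def by blast
qed

lemma Eh_f_tail: "Eh (\<Prod>k. f_at (hconst (s ^ 2) ^ (k + 1) * x ^ 2)) = f_tail P (Eh x)"
proof -
  let ?y = "\<lambda>k. hconst (s ^ 2) ^ (k + 1) * x ^ 2"
  have y0: "?y k $ 0 = 0" for k using hconst_small(2) by simp
  have e: "Eh (f_at (?y k)) = f_small (P ^ (k + 1) * Eh x ^ 2)" for k
    unfolding Eh_f_at[OF y0] by (simp add: Eh.mult Eh.power Eh_hconst hc.power)
  have "Eh (prodinf (\<lambda>k. f_at (?y k))) = prodinf (\<lambda>k. Eh (f_at (?y k)))"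
    by (rule hhom_prodinf[OF Eh.hhom_axioms hprod_ok_f_at])
      (use hprod_ok_f_tail[OF P0, of "Eh x"] in \<open>unfold e, simp add: hprod_ok_def\<close>)
  thus ?thesis unfolding e f_tail_def .
qed

lemma f_at_product_unit: "(\<Prod>k. f_at (hconst (s ^ 2) ^ (k + 1) * x ^ 2)) $ 0 \<noteq> 0"
  using Eh_f_tail[of x] f_tail_unit[of "Eh x"] by (metis Eh_nth_0)

lemma qpoch_unit: "x $ 0 = 0 \<Longrightarrow> p $ 0 = 0 \<Longrightarrow> qpoch x p $ 0 = (1 :: ratfun)"
  by (simp add: qpoch_nth_0)

lemma Eh_alpha:
  "Eh (ell_alpha s x) = qpoch (S * (q * Eh x)) P * inverse (qpoch (S * (r * Eh x)) P) * f_tail P (Eh x)"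
  "ell_alpha s x $ 0 \<noteq> 0"
proof -
  have d: "qpoch (hconst (s * qpow (- 1)) * x) (hconst (s ^ 2)) $ 0 \<noteq> 0"
    unfolding qpoch_unit[OF hconst_small(1) hconst_small(2)] by simp
  show "Eh (ell_alpha s x) = qpoch (S * (q * Eh x)) P * inverse (qpoch (S * (r * Eh x)) P) * f_tail P (Eh x)"
    unfolding ell_alpha_def Let_def Eh.mult Eh_divide[OF d] Eh_f_tail Eh_qpoch[OF hconst_small(1) hconst_small(2)] Eh_hconst hc.mult P_hc[symmetric]
    by (simp only: mult.assoc)
  show "ell_alpha s x $ 0 \<noteq> 0"
    unfolding ell_alpha_def Let_def fps_divide_unit[OF d] fps_mult_nth_0 fps_inverse_nth_zero qpoch_unit[OF hconst_small(1) hconst_small(2)]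
    using f_at_product_unit by simp
qed

lemma Eh_beta:
  "Eh (ell_beta s x) = qpoch (- (P * (q * Eh x))) P * inverse (qpoch (- (P * (r * Eh x))) P) * f_tail P (Eh x)"
  "ell_beta s x $ 0 \<noteq> 0"
proof -
  have z: "(- (hconst (s ^ 2) * hconst c * x)) $ 0 = 0" for c using hconst_small(2) by simp
  have d: "qpoch (- (hconst (s ^ 2) * hconst (qpow (- 1)) * x)) (hconst (s ^ 2)) $ 0 \<noteq> 0"
    unfolding qpoch_unit[OF z hconst_small(2)] by simp
  show "Eh (ell_beta s x) = qpoch (- (P * (q * Eh x))) P * inverse (qpoch (- (P * (r * Eh x))) P) * f_tail P (Eh x)"
    unfolding ell_beta_def Let_def Eh.mult Eh_divide[OF d] Eh_f_tail Eh_qpoch[OF z hconst_small(2)] Eh_hconst Eh.minus P_hc[symmetric]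
    by (simp only: mult.assoc)
  show "ell_beta s x $ 0 \<noteq> 0"
    unfolding ell_beta_def Let_def fps_divide_unit[OF d] fps_mult_nth_0 fps_inverse_nth_zero qpoch_unit[OF z hconst_small(2)]
    using f_at_product_unit by simp
qed

lemma f_rat_sq_unit: "zsubst (zvar ^ 2) f_rat $ 0 \<noteq> 0"
  using f_sq_unit unfolding f_sq_def by (simp add: Eh_nth_0_iff)

lemma inverse_qT: "inverse (q * T) = r * T'" "inverse (r * T) = q * T'"
  by (rule inverse_cT; simp add: qpow_def flip: fps_exp_add_mult)+

lemma units_qT: "(q * T) $ 0 \<noteq> 0" "(q * T) $ 0 \<noteq> 1" "(q * T) $ 0 \<noteq> - 1"
  "(r * T) $ 0 \<noteq> 0" "(r * T) $ 0 \<noteq> 1" "(r * T) $ 0 \<noteq> - 1"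
  by (rule unit_cT; simp add: qpow_def)+

lemma units_minus_qT: "(- (q * T)) $ 0 \<noteq> 0" "(- (q * T)) $ 0 \<noteq> 1" "(- (r * T)) $ 0 \<noteq> 0" "(- (r * T)) $ 0 \<noteq> 1"
  using units_qT by (auto simp: minus_equation_iff)

text \<open>
  The infinite products of \<open>\<alpha>(z\<^sup>-\<^sup>1)\<close> and \<open>\<alpha>(z)\<close> other than those over \<open>f\<close> combine into theta functions
  at \<open>q\<^sup>-\<^sup>1 z\<close> and \<open>q z\<close>.
\<close>
lemma AD_equation: "AD * A (q * T) = rh * kappa * A (r * T)"
proof -
  let ?Q = "\<lambda>x. qpoch x P"
  have u: "?Q (S * x) $ 0 \<noteq> 0" for x using S0 by (simp add: qpoch_unitA)
  let ?X = "inverse (?Q (S * (q * T)) * inverse (?Q (S * (r * T))) * f_tail P T)"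
  have AD: "AD = rh * inverse f_sq * ((?Q (S * (q * T')) * inverse (?Q (S * (r * T'))) * f_tail P T') * ?X)"
    unfolding AD_def ell_ad_def Let_def Eh.mult Eh_divide[OF Eh_alpha(2)] Eh_alpha(1) Eh_hconst
      Eh_inverse[OF f_rat_sq_unit] f_sq_def[symmetric] Eh_zvar Eh_zvar_inv ..
  have i: "inverse (?Q (S * (r * T'))) * ?Q (S * (r * T')) = 1" by (rule inverse_mult_eq_1[OF u])
  have "AD * A (q * T) = rh * inverse f_sq * f_tail P T' * J * ?Q (S * (q * T')) *
     (inverse (?Q (S * (r * T'))) * ?Q (S * (r * T'))) * (?X * ?Q (S * (q * T)))"
    unfolding AD A_prod[OF units_qT(1)] inverse_qT by (simp only: mult_ac)
  also have "\<dots> = rh * kappa * A (r * T)"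
    unfolding i cancel_quotient[OF u u] A_prod[OF units_qT(4)] inverse_qT kappa_def by (simp only: mult_ac mult_1)
  finally show ?thesis .
qed

text \<open>
  As for \<open>AD_equation\<close>; the rational factor \<open>(1 + q\<^sup>-\<^sup>1 z)/(1 + q z)\<close> supplies the factors with which
  the products in \<open>\<beta>(z)\<close> begin as theta functions.
\<close>
lemma BC_equation: "BC * B (- (q * T)) = qh * kappa * B (- (r * T))"
proof -
  let ?Q = "\<lambda>x. qpoch x P"
  have u: "?Q (- (P * x)) $ 0 \<noteq> 0" for x using P0 by (simp add: qpoch_unitA)
  have d: "(1 + hconst (qpow 1) * fps_const zvar) $ 0 \<noteq> 0"
  proof -
    have "Eh (1 + hconst (qpow 1) * fps_const zvar) $ 0 \<noteq> 0"
      using units_qT(3) by (simp add: Eh.hom Eh_hconst Eh_zvar add_eq_0_iff)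
    thus ?thesis by (simp only: Eh_nth_0_iff not_False_eq_True)
  qed
  let ?X = "inverse (?Q (- (P * (q * T))) * inverse (?Q (- (P * (r * T)))) * f_tail P T)"
  have BC: "BC = qh * inverse f_sq * ((1 + r * T) * inverse (1 + q * T)) *
      ((?Q (- (P * (q * T'))) * inverse (?Q (- (P * (r * T')))) * f_tail P T') * ?X)"
    unfolding BC_def ell_bc_def Let_def Eh.mult Eh_divide[OF Eh_beta(2)] Eh_divide[OF d] Eh_beta(1) Eh_hconst
      Eh_inverse[OF f_rat_sq_unit] f_sq_def[symmetric] Eh_zvar Eh_zvar_inv Eh.add Eh.one Eh.mult ..
  have i1: "inverse (?Q (- (P * (r * T')))) * ?Q (- (P * (r * T'))) = 1" by (rule inverse_mult_eq_1[OF u])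
  have i2: "inverse (1 + q * T) * (1 + q * T) = 1"
    by (rule inverse_mult_eq_1) (use units_qT(3) in \<open>simp add: add_eq_0_iff\<close>)
  have im: "inverse (- x) = - inverse x" for x :: lser by (rule fps_inverse_minus)
  have Qq: "?Q (- (q * T)) = (1 + q * T) * ?Q (- (P * (q * T)))"
    using qpoch_rec[OF P0 units_minus_qT(2)] by (simp add: mult.commute)
  have Qr: "?Q (- (r * T)) = (1 + r * T) * ?Q (- (P * (r * T)))"
    using qpoch_rec[OF P0 units_minus_qT(4)] by (simp add: mult.commute)
  have "BC * B (- (q * T)) = qh * inverse f_sq * (1 + r * T) * f_tail P T' * J * ?Q (- (P * (q * T'))) *
     (inverse (1 + q * T) * (1 + q * T)) *
     (inverse (?Q (- (P * (r * T')))) * ?Q (- (P * (r * T')))) * (?X * ?Q (- (P * (q * T))))"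
    unfolding BC B_prod[OF units_minus_qT(1,2)] inverse_qT im mult_minus_right Qq by (simp only: mult_ac)
  also have "\<dots> = qh * kappa * B (- (r * T))"
    unfolding i1 i2 cancel_quotient[OF u u] B_prod[OF units_minus_qT(3,4)] inverse_qT im mult_minus_right Qr kappa_def
    by (simp only: mult_ac mult_1)
  finally show ?thesis .
qed

lemma mult_qT: "q * (q * T) = q ^ 2 * T" "r * (q * T) = T"
  using qr by (simp_all add: power2_eq_square mult.commute[of r] flip: mult.assoc)

lemma zneg_qT: "zneg (hc c * T) = - (hc c * T)"
  by (simp add: zneg.mult zneg.const zneg_inner_X_inv)

lemma zneg_A: "c $ 0 = 1 \<Longrightarrow> zneg (A (hc c * T)) = A (- (hc c * T))"
  and zneg_B: "c $ 0 = 1 \<Longrightarrow> zneg (B (hc c * T)) = B (- (hc c * T))"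
proof -
  assume "c $ 0 = 1"
  hence u: "(- (hc c * T)) $ 0 \<noteq> 0" using unit_cT(1)[of c] by simp
  show "zneg (A (hc c * T)) = A (- (hc c * T))" "zneg (B (hc c * T)) = B (- (hc c * T))"
    unfolding A_def B_def zneg.tha_hom[OF refl S0 u] zneg.thb_hom[OF refl S0 u] zneg.minus zneg_qT by simp_all
qed

lemma zneg_B': "c $ 0 = 1 \<Longrightarrow> zneg (B (- (hc c * T))) = B (hc c * T)"
  using zneg_B[of c] zneg_zneg by metis

lemma qshift_A: "x $ 0 \<noteq> 0 \<Longrightarrow> qshift (A (- x)) = A (- (qshift x))"
  and qshift_B: "x $ 0 \<noteq> 0 \<Longrightarrow> qshift (B (- x)) = B (- (qshift x))"
  by (simp_all add: A_def B_def qshift.tha_hom[OF refl S0] qshift.thb_hom[OF refl S0])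

lemma AD2: "zneg AD * A (- (q * T)) = rh * kappa * A (- (r * T))"
proof -
  have "zneg (AD * A (q * T)) = zneg (rh * kappa * A (r * T))" by (simp only: AD_equation)
  thus ?thesis by (simp only: zneg.mult zneg.const zneg_kappa zneg_A q0[unfolded hc_nth]) (simp add: zneg_A qpow_def)
qed

lemma BC2: "zneg BC * B (q * T) = qh * kappa * B (r * T)"
proof -
  have "zneg (BC * B (- (q * T))) = zneg (qh * kappa * B (- (r * T)))" by (simp only: BC_equation)
  thus ?thesis by (simp add: zneg.mult zneg.const zneg_kappa zneg_B' qpow_def)
qed

lemma qshift_BC: "qshift BC * B (- (q ^ 2 * T)) = qh * qshift kappa * B (- T)"
proof -
  have "qshift (BC * B (- (q * T))) = qshift (qh * kappa * B (- (r * T)))" by (simp only: BC_equation)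
  thus ?thesis by (simp only: qshift.mult qshift.const qshift_B units_qT qshift_inner_X_inv mult_qT not_False_eq_True)
qed

lemma qshift_zneg_AD: "qshift (zneg AD) * A (- (q ^ 2 * T)) = rh * qshift kappa * A (- T)"
proof -
  have "qshift (zneg AD * A (- (q * T))) = qshift (rh * kappa * A (- (r * T)))" by (simp only: AD2)
  thus ?thesis by (simp only: qshift.mult qshift.const qshift_A units_qT qshift_inner_X_inv mult_qT not_False_eq_True)
qed

lemma theta_I:
  "B (q * T) * B (- (q * T)) * (A (r * T) * A (- (q * T)) + A (- (r * T)) * A (q * T))
    + q * (A (q * T) * A (- (q * T)) * (B (r * T) * B (- (q * T)) - B (- (r * T)) * B (q * T)))
    = 2 * (B (- (q ^ 2 * T)) * B T * A T * A (- T))"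
  and theta_II:
  "B (q * T) * B (- (q * T)) * (A (r * T) * A (- (q * T)) - A (- (r * T)) * A (q * T))
    + q * (A (q * T) * A (- (q * T)) * (B (r * T) * B (- (q * T)) + B (- (r * T)) * B (q * T)))
    = 2 * q * (A (- (q ^ 2 * T)) * A T * B T * B (- T))"
proof -
  have q1: "q $ 0 \<noteq> 0" unfolding q0 by simp
  note th = theta_identities[OF S0 T0 q1 qr]
  show "B (q * T) * B (- (q * T)) * (A (r * T) * A (- (q * T)) + A (- (r * T)) * A (q * T))
    + q * (A (q * T) * A (- (q * T)) * (B (r * T) * B (- (q * T)) - B (- (r * T)) * B (q * T)))
    = 2 * (B (- (q ^ 2 * T)) * B T * A T * A (- T))"
    unfolding A_def B_def by (rule th(1))
  show "B (q * T) * B (- (q * T)) * (A (r * T) * A (- (q * T)) - A (- (r * T)) * A (q * T))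
    + q * (A (q * T) * A (- (q * T)) * (B (r * T) * B (- (q * T)) + B (- (r * T)) * B (q * T)))
    = 2 * q * (A (- (q ^ 2 * T)) * A T * B T * B (- T))"
    unfolding A_def B_def by (rule th(2))
qed

lemma q2T: "(- (q ^ 2 * T)) $ 0 \<noteq> 0" "(- (q ^ 2 * T)) $ 0 \<noteq> 1"
proof -
  have e: "q ^ 2 * T = hc (qpow 2) * T" by (simp add: qpow_power flip: hc.power)
  have p: "qpow 2 $ 0 = 1" by (simp add: qpow_def)
  have g: "x $ 0 \<noteq> 0 \<Longrightarrow> (- x) $ 0 \<noteq> 0" "x $ 0 \<noteq> - 1 \<Longrightarrow> (- x) $ 0 \<noteq> 1" for x :: lser
    by (auto simp: minus_equation_iff)
  show "(- (q ^ 2 * T)) $ 0 \<noteq> 0" "(- (q ^ 2 * T)) $ 0 \<noteq> 1"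
    unfolding e by (rule g(1)[OF unit_cT(1)[OF p]], rule g(2)[OF unit_cT(3)[OF p]])
qed

text \<open>
  The common last step of the two relations: the theta identities bring the first factor over
  the denominator \<open>M\<close>, the second factor has denominator \<open>u\<close>, and the scalar factors combine to
  \<open>\<kappa>(z) \<kappa>(q z) = M/W\<close>.
\<close>
lemma product_eq_2:
  assumes "X * M = kappa * c * (2 * N)" "Y * u = d * qshift kappa * v" "c * d = 1"
    and "kappa * qshift kappa * W = M" "N * v = u * W" and "M $ 0 \<noteq> 0" "u $ 0 \<noteq> 0"
  shows "X * Y = 2"
proof -
  have "X * Y * (M * u) = (X * M) * (Y * u)" by (simp only: mult_ac)
  also have "\<dots> = 2 * (c * d) * (kappa * qshift kappa) * (N * v)" unfolding assms(1,2) by (simp only: mult_ac)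
  also have "\<dots> = 2 * ((kappa * qshift kappa * W) * u)" unfolding assms(3,5) by (simp only: mult_ac mult_1)
  finally have "X * Y * (M * u) = 2 * (M * u)" unfolding assms(4) .
  moreover have "M * u \<noteq> 0" using assms(6,7) by (metis fps_mult_nth_0 fps_zero_nth mult_eq_0_iff)
  ultimately show ?thesis using mult_right_cancel by blast
qed

lemma M_unit: "(A (q * T) * A (- (q * T)) * (B (q * T) * B (- (q * T)))) $ 0 \<noteq> 0"
  unfolding fps_mult_nth_0 mult_eq_0_iff de_Morgan_disj
  by (intro conjI A_unit B_unit units_qT units_minus_qT)

text \<open>
  This is \<open>2 (a - c)(z) (b + c)(q z) = 2\<close>.
\<close>
lemma first_relation: "(AD + zneg AD - (BC - zneg BC)) * qshift BC = 2"
proof (rule product_eq_2[OF _ qshift_BC qhrh kappa_equation _ M_unit])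
  let ?a1 = "A (q * T)" and ?a2 = "A (- (q * T))" and ?b1 = "B (q * T)" and ?b2 = "B (- (q * T))"
  have "(AD + zneg AD - (BC - zneg BC)) * (?a1 * ?a2 * (?b1 * ?b2)) =
    (AD * ?a1) * (?a2 * (?b1 * ?b2)) + (zneg AD * ?a2) * (?a1 * (?b1 * ?b2))
     - (BC * ?b2) * (?a1 * ?a2 * ?b1) + (zneg BC * ?b1) * (?a1 * ?a2 * ?b2)"
    by (simp only: distrib_right left_diff_distrib) (simp add: mult_ac)
  also have "\<dots> = kappa * rh * (?b1 * ?b2 * (A (r * T) * ?a2 + A (- (r * T)) * ?a1)
    + q * (?a1 * ?a2 * (B (r * T) * ?b2 - B (- (r * T)) * ?b1)))"
    unfolding AD_equation AD2 BC_equation BC2 qh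
    by (simp only: distrib_left distrib_right right_diff_distrib left_diff_distrib) (simp add: mult_ac)
  finally show "(AD + zneg AD - (BC - zneg BC)) * (?a1 * ?a2 * (?b1 * ?b2)) =
    kappa * rh * (2 * (B (- (q ^ 2 * T)) * B T * A T * A (- T)))" unfolding theta_I .
  show "B (- (q ^ 2 * T)) * B T * A T * A (- T) * B (- T) = B (- (q ^ 2 * T)) * (A T * A (- T) * (B T * B (- T)))"
    by (simp only: mult_ac)
  show "B (- (q ^ 2 * T)) $ 0 \<noteq> 0" by (rule B_unit[OF q2T])
qed

text \<open>
  This is \<open>2 (b + d)(z) (a - d)(q z) = 2\<close>.
\<close>
lemma second_relation: "(BC + zneg BC + (AD - zneg AD)) * qshift (zneg AD) = 2"
proof (rule product_eq_2[OF _ qshift_zneg_AD _ kappa_equation _ M_unit])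
  let ?a1 = "A (q * T)" and ?a2 = "A (- (q * T))" and ?b1 = "B (q * T)" and ?b2 = "B (- (q * T))"
  have "(BC + zneg BC + (AD - zneg AD)) * (?a1 * ?a2 * (?b1 * ?b2)) =
    (AD * ?a1) * (?a2 * (?b1 * ?b2)) - (zneg AD * ?a2) * (?a1 * (?b1 * ?b2))
     + (BC * ?b2) * (?a1 * ?a2 * ?b1) + (zneg BC * ?b1) * (?a1 * ?a2 * ?b2)"
    by (simp only: distrib_right left_diff_distrib) (simp add: mult_ac)
  also have "\<dots> = kappa * rh * (?b1 * ?b2 * (A (r * T) * ?a2 - A (- (r * T)) * ?a1)
    + q * (?a1 * ?a2 * (B (r * T) * ?b2 + B (- (r * T)) * ?b1)))"
    unfolding AD_equation AD2 BC_equation BC2 qh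
    by (simp only: distrib_left distrib_right right_diff_distrib left_diff_distrib) (simp add: mult_ac)
  finally show "(BC + zneg BC + (AD - zneg AD)) * (?a1 * ?a2 * (?b1 * ?b2)) =
    kappa * (q * rh) * (2 * (A (- (q ^ 2 * T)) * A T * B T * B (- T)))"
    unfolding theta_II by (simp only: mult_ac)
  show "q * rh * rh = 1" using qhrh unfolding qh by (simp only: mult_ac)
  show "A (- (q ^ 2 * T)) * A T * B T * B (- T) * A (- T) = A (- (q ^ 2 * T)) * (A T * A (- T) * (B T * B (- T)))"
    by (simp only: mult_ac)
  show "A (- (q ^ 2 * T)) $ 0 \<noteq> 0" by (rule A_unit[OF q2T(1)])
qed
definition "ra = Eh (even_part (ell_ad s))"
definition "rd = Eh (odd_part (ell_ad s))"
definition "rb = Eh (even_part (ell_bc s))"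
definition "rc = Eh (odd_part (ell_bc s))"

lemma double_entries: "2 * ra = AD + zneg AD" "2 * rd = AD - zneg AD" "2 * rb = BC + zneg BC" "2 * rc = BC - zneg BC"
  by (simp_all add: ra_def rb_def rc_def rd_def AD_def BC_def Eh_even_part Eh_odd_part)

lemma two_cancel: "2 * x = 2 * y \<Longrightarrow> x = (y :: lser)"
  by simp

lemma zneg_two: "zneg (2 * x) = 2 * zneg x"
  by (simp only: mult_2 zneg.add)

lemma parity: "zneg ra = ra" "zneg rd = - rd" "zneg rb = rb" "zneg rc = - rc"
  by (rule two_cancel, simp add: double_entries zneg.add zneg.diff zneg_zneg flip: zneg_two)+

text \<open>
  The substitution \<open>z \<mapsto> - z\<close> changes the signs of \<open>c\<close> and \<open>d\<close>. The half-sums and half-differences of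
  each of the two relations and its image are the four equations.
\<close>
lemma qdet_relations:
  "ra * qshift rb - rc * qshift rc = 1" "ra * qshift rc = rc * qshift rb"
  "rb * qshift ra - rd * qshift rd = 1" "rb * qshift rd = rd * qshift ra"
proof -
  have BC: "BC = rb + rc" by (rule two_cancel) (simp add: distrib_left double_entries)
  have AD: "zneg AD = ra - rd" by (rule two_cancel) (simp add: right_diff_distrib double_entries)
  have "2 * ((ra - rc) * qshift BC) = 2"
    using first_relation unfolding double_entries[symmetric] by (simp only: right_diff_distrib[symmetric] mult.assoc)
  hence 1: "(ra - rc) * (qshift rb + qshift rc) = 1" by (simp add: BC qshift.add)
  have "2 * ((rb + rd) * qshift (zneg AD)) = 2"
    using second_relation unfolding double_entries[symmetric] by (simp only: distrib_left[symmetric] mult.assoc)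
  hence 2: "(rb + rd) * (qshift ra - qshift rd) = 1" by (simp add: AD qshift.diff)
  have "zneg ((ra - rc) * (qshift rb + qshift rc)) = 1" unfolding 1 by (rule zneg.one)
  hence 3: "(ra + rc) * (qshift rb - qshift rc) = 1"
    by (simp add: zneg.hom parity qshift_zneg[symmetric] qshift.minus)
  have "zneg ((rb + rd) * (qshift ra - qshift rd)) = 1" unfolding 2 by (rule zneg.one)
  hence 4: "(rb - rd) * (qshift ra + qshift rd) = 1"
    by (simp add: zneg.hom parity qshift_zneg[symmetric] qshift.minus)
  have "2 * (ra * qshift rb - rc * qshift rc) = (ra - rc) * (qshift rb + qshift rc) + (ra + rc) * (qshift rb - qshift rc)"
    by (simp add: algebra_simps)
  hence "2 * (ra * qshift rb - rc * qshift rc) = 2 * 1" unfolding 1 3 by simp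
  thus "ra * qshift rb - rc * qshift rc = 1" by (rule two_cancel)
  have "2 * (ra * qshift rc - rc * qshift rb) = (ra - rc) * (qshift rb + qshift rc) - (ra + rc) * (qshift rb - qshift rc)"
    by (simp add: algebra_simps)
  thus "ra * qshift rc = rc * qshift rb" unfolding 1 3 by simp
  have "2 * (rb * qshift ra - rd * qshift rd) = (rb + rd) * (qshift ra - qshift rd) + (rb - rd) * (qshift ra + qshift rd)"
    by (simp add: algebra_simps)
  hence "2 * (rb * qshift ra - rd * qshift rd) = 2 * 1" unfolding 2 4 by simp
  thus "rb * qshift ra - rd * qshift rd = 1" by (rule two_cancel)
  have "2 * (rd * qshift ra - rb * qshift rd) = (rb + rd) * (qshift ra - qshift rd) - (rb - rd) * (qshift ra + qshift rd)"
    by (simp add: algebra_simps)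
  thus "rb * qshift rd = rd * qshift ra" unfolding 2 4 by simp
qed

definition Rinf where "Rinf X Y = Eh (ell_R s X Y)"

lemma Rinf_entries:
  "Rinf (i1, i2) (j1, j2) =
     (if i1 = j1 \<and> i2 = j2 then (if i1 = i2 then ra else rb)
      else if i1 \<noteq> j1 \<and> i2 \<noteq> j2 then (if i1 = i2 then rd else rc) else 0)"
  by (simp add: Rinf_def ell_R_def ra_def rb_def rc_def rd_def Eh.zero)

text \<open>
  The matrix identity \<open>A\<^sub>1\<^sub>2 R\<^sub>0\<^sub>1(z) R\<^sub>0\<^sub>2(q z) = A\<^sub>1\<^sub>2\<close>: here \<open>\<alpha>\<close>, \<open>\<beta>\<close> are the indices at position \<open>0\<close>, and \<open>i\<close>,
  \<open>l\<close> those at the positions \<open>1\<close> and \<open>2\<close>. Since \<open>A\<close> has rank one, only the difference of the rows \<open>(1, 2)\<close>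
  and \<open>(2, 1)\<close> enters.
\<close>
lemma fusion:
  fixes \<alpha> \<beta> :: 2 and i l :: "2 \<times> 2"
  shows "(\<Sum>(k1, k2)\<in>UNIV. hc (fps_const (A_entry i (k1, k2))) *
      (\<Sum>\<gamma>\<in>UNIV. Rinf (\<alpha>, k1) (\<gamma>, fst l) * qshift (Rinf (\<gamma>, k2) (\<beta>, snd l))))
    = (if \<alpha> = \<beta> then hc (fps_const (A_entry i l)) else 0)"
proof -
  obtain i1 i2 where i: "i = (i1, i2)" by (cases i)
  obtain l1 l2 where l: "l = (l1, l2)" by (cases l)
  let ?G = "\<lambda>k1 k2. \<Sum>\<gamma>\<in>UNIV. Rinf (\<alpha>, k1) (\<gamma>, l1) * qshift (Rinf (\<gamma>, k2) (\<beta>, l2))"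
  have neg: "hc (fps_const (- c)) = - hc (fps_const c)" for c
    by (simp flip: hc.minus)
  have s: "(\<Sum>(k1, k2)\<in>UNIV. g k1 k2) = g 1 1 + g 1 2 + (g 2 1 + g 2 2)" for g :: "2 \<Rightarrow> 2 \<Rightarrow> lser"
    unfolding UNIV_Times_UNIV[symmetric] sum.cartesian_product[symmetric] by (simp add: sum_2)
  \<comment> \<open>The sixteen cases are the four relations, their negatives, and sums without nonzero terms.\<close>
  have G: "?G 1 2 - ?G 2 1 = (if \<alpha> = \<beta> then (if l1 = 1 \<and> l2 = 2 then 1 else if l1 = 2 \<and> l2 = 1 then - 1 else 0) else 0)"
    using exhaust_2[of \<alpha>] exhaust_2[of \<beta>] exhaust_2[of l1] exhaust_2[of l2] qdet_relations
    by (elim disjE) (simp_all add: sum_2 Rinf_entries qshift.zero algebra_simps)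
  have "(\<Sum>(k1, k2)\<in>UNIV. hc (fps_const (A_entry i (k1, k2))) * ?G k1 k2) =
     hc (fps_const (A_entry i (1, 2))) * (?G 1 2 - ?G 2 1)"
    unfolding s i using exhaust_2[of i1] exhaust_2[of i2]
    by (elim disjE) (simp_all add: A_entry_def hc.zero neg algebra_simps)
  also have "\<dots> = (if \<alpha> = \<beta> then hc (fps_const (A_entry i l)) else 0)"
    unfolding G i l using exhaust_2[of i1] exhaust_2[of i2] exhaust_2[of l1] exhaust_2[of l2]
    by (elim disjE) (simp_all add: A_entry_def hc.zero neg)
  finally show ?thesis by (simp add: l)
qed

end

section \<open>The expansion of \<open>R(x/y)\<close>\<close>

lemma inner_over_outer_eq: "inner_over_outer = fls_const fls_X * fls_X_inv"
  by (simp add: inner_over_outer_def divide_inverse fls_inverse_X)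

lemma cc_fhom: "fhom (\<lambda>t::complex. fls_const (fls_const t :: complex fls))"
  by (intro fhomI rhom_comp[OF fls_const_rhom fls_const_rhom])

interpretation at_ratio: transcendental_subst "\<lambda>t::complex. fls_const (fls_const t :: complex fls)" inner_over_outer
proof (unfold transcendental_subst_def transcendental_subst_axioms_def, intro conjI cc_fhom)
  have nz: "inner_over_outer $$ (- 1) \<noteq> 0" by (simp add: inner_over_outer_eq)
  show "inner_over_outer \<notin> range (\<lambda>t. fls_const (fls_const t))"
  proof
    assume "inner_over_outer \<in> range (\<lambda>t. fls_const (fls_const t))"
    then obtain t where e: "inner_over_outer = fls_const (fls_const t)" by (elim rangeE)
    show False using nz unfolding e by simp
  qed
qed

text \<open>
  The embedding of \<open>\<complex>((t))\<close> into \<open>\<complex>((x))((y))\<close> that sends \<open>t\<close> to \<open>y/x\<close>.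
\<close>
definition ratio_emb :: "complex fls \<Rightarrow> complex fls fls" where
  "ratio_emb f = Abs_fls (\<lambda>n. fls_const (f $$ n) * fls_X_intpow (- n))"

lemma ratio_emb_nth: "ratio_emb f $$ n = fls_const (f $$ n) * fls_X_intpow (- n)"
  unfolding ratio_emb_def by (rule nth_Abs_fls_lower_bound[of "fls_subdegree f"]) auto

lemma ratio_emb_nth_nth: "ratio_emb f $$ n $$ m = (if m = - n then f $$ n else 0)"
  by (simp add: ratio_emb_nth)

lemma rhom_ratio_emb: "rhom ratio_emb"
proof
  fix f g
  show "ratio_emb (f + g) = ratio_emb f + ratio_emb g"
    by (rule fls_eqI, rule fls_eqI) (simp add: ratio_emb_nth_nth)
  show "ratio_emb (f * g) = ratio_emb f * ratio_emb g"
  proof (rule fls_eqI)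
    fix n
    define d where "d = min (fls_subdegree f) (fls_subdegree g)"
    have f: "f $$ i = 0" "g $$ i = 0" if "i < d" for i using that by (auto simp: d_def)
    have "(ratio_emb f * ratio_emb g) $$ n = (\<Sum>i\<in>{d..n - d}. ratio_emb f $$ i * ratio_emb g $$ (n - i))"
      by (rule fls_times_nth_bound) (simp_all add: ratio_emb_nth f)
    also have "\<dots> = (\<Sum>i\<in>{d..n - d}. fls_const (f $$ i * g $$ (n - i)) * fls_X_intpow (- n))"
    proof (intro sum.cong refl)
      fix i
      have "fls_X_intpow (- i) * fls_X_intpow (- (n - i)) = (fls_X_intpow (- n) :: complex fls)"
        using fls_X_intpow_times_fls_X_intpow[of "- i" "- (n - i)", where ?'a = complex] by simp
      thus "ratio_emb f $$ i * ratio_emb g $$ (n - i) = fls_const (f $$ i * g $$ (n - i)) * fls_X_intpow (- n)"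
        unfolding ratio_emb_nth fls_const_mult_const[symmetric] by (metis (no_types, lifting) mult.assoc mult.left_commute)
    qed
    also have "\<dots> = fls_const ((f * g) $$ n) * fls_X_intpow (- n)"
      using fls_times_nth_bound[of d f d g n] f by (simp add: fc.sum flip: sum_distrib_right)
    finally show "ratio_emb (f * g) $$ n = (ratio_emb f * ratio_emb g) $$ n" by (simp add: ratio_emb_nth)
  qed
  show "ratio_emb 1 = 1"
    by (rule fls_eqI, rule fls_eqI) (auto simp: ratio_emb_nth_nth)
qed

text \<open>
  In \<open>\<complex>((x))((y))\<close> the element \<open>y/x\<close> is small, so that a rational function of \<open>z = x/y\<close> is expanded at
  \<open>z = \<infinity>\<close>.
\<close>
lemma R_coeff_eq:
  "R_coeff inner_over_outer R I J m n = (if m = - n then inner_cf n (Eh (R I J)) else 0)"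
proof (rule fps_ext)
  fix k
  have h: "rhom (\<lambda>r. ratio_emb (expand_inf r))"
    unfolding expand_inf_def by (rule rhom_comp[OF at_inf.r.rhom_axioms rhom_ratio_emb])
  have "rat_subst (\<lambda>t. fls_const (fls_const t)) inner_over_outer r = ratio_emb (expand_inf r)" for r
  proof (rule rhom_ratfun_unique[OF at_ratio.r.rhom_axioms h])
    fix c
    show "rat_subst (\<lambda>t. fls_const (fls_const t)) inner_over_outer (cz c) = ratio_emb (expand_inf (cz c))"
      unfolding at_ratio.rat_subst_cz expand_inf_def at_inf.rat_subst_cz
      by (rule fls_eqI, rule fls_eqI) (auto simp: ratio_emb_nth_nth)
    show "rat_subst (\<lambda>t. fls_const (fls_const t)) inner_over_outer zvar = ratio_emb (expand_inf zvar)"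
      unfolding at_ratio.rat_subst_zvar expand_inf_def at_inf.rat_subst_zvar
      by (subst inner_over_outer_eq, rule fls_eqI, rule fls_eqI) (auto simp: ratio_emb_nth_nth)
  qed
  thus "R_coeff inner_over_outer R I J m n $ k = (if m = - n then inner_cf n (Eh (R I J)) else 0) $ k"
    by (simp add: R_coeff_def ratio_emb_nth_nth Eh_nth)
qed

lemma inner_cf_sum: "inner_cf m (sum f A) = (\<Sum>i\<in>A. inner_cf m (f i))"
  by (induction A rule: infinite_finite_induct) auto

text \<open>
  The coefficient of \<open>(y/x)\<^sup>t\<close> in an entry of \<open>R(x/y)\<close>.
\<close>
definition R_cf :: "complex fps \<Rightarrow> 2 \<times> 2 \<Rightarrow> 2 \<times> 2 \<Rightarrow> int \<Rightarrow> complex fps" where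
  "R_cf s X Y t = inner_cf t (Eh (ell_R s X Y))"

text \<open>
  This is \<open>q\<^sup>-\<^sup>m\<close>, the value of \<open>x\<^sub>2\<^sup>m\<close> at \<open>x\<^sub>2 = y q\<^sup>-\<^sup>1\<close> up to \<open>y\<^sup>m\<close>.
\<close>
definition q_neg_pow :: "int \<Rightarrow> complex fps" where "q_neg_pow m = fps_exp (- (of_int m / 2))"

lemma q_neg_pow_add: "q_neg_pow (m + n) = q_neg_pow m * q_neg_pow n"
  by (simp add: q_neg_pow_def add_divide_distrib flip: fps_exp_add_mult)

lemma inner_cf_qshift: "inner_cf m (qshift F) = q_neg_pow m * inner_cf m F"
  by (simp add: qshift_def inner_cf_twist q_neg_pow_def)

lemma fusion_inner_cf:
  assumes "s $ 0 = 0"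
  shows "(\<Sum>k1\<in>UNIV. \<Sum>k2\<in>UNIV. \<Sum>g\<in>UNIV. fps_const (A_entry i (k1, k2)) *
       inner_cf N (Eh (ell_R s (\<alpha>, k1) (g, l1)) * qshift (Eh (ell_R s (g, k2) (\<beta>, l2)))))
    = (if \<alpha> = \<beta> \<and> N = 0 then fps_const (A_entry i (l1, l2)) else 0)"
proof -
  interpret elliptic s by standard fact
  have "inner_cf N (\<Sum>(k1, k2)\<in>UNIV. hc (fps_const (A_entry i (k1, k2))) *
      (\<Sum>g\<in>UNIV. Rinf (\<alpha>, k1) (g, l1) * qshift (Rinf (g, k2) (\<beta>, l2))))
    = inner_cf N (if \<alpha> = \<beta> then hc (fps_const (A_entry i (l1, l2))) else 0)"
    using fusion[where \<alpha> = \<alpha> and \<beta> = \<beta> and i = i and l = "(l1, l2)"] by (simp only: fst_conv snd_conv)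
  also have "\<dots> = (if \<alpha> = \<beta> \<and> N = 0 then fps_const (A_entry i (l1, l2)) else 0)"
    by (simp add: inner_cf_hc)
  finally show ?thesis
    unfolding UNIV_Times_UNIV[symmetric] sum.cartesian_product[symmetric] Rinf_def
    by (simp add: inner_cf_sum inner_cf_hc_mult sum_distrib_left)
qed

lemma sum_pair: "(\<Sum>(k, l)\<in>UNIV. f k l) = (\<Sum>k\<in>UNIV. \<Sum>l\<in>UNIV. f k l)"
  unfolding UNIV_Times_UNIV[symmetric] sum.cartesian_product[symmetric] ..

lemma finite_uniform_bound:
  fixes P :: "'a::finite \<Rightarrow> int \<Rightarrow> bool"
  assumes "\<And>x. \<exists>d. \<forall>t<d. P x t"
  shows "\<exists>d. \<forall>x. \<forall>t<d. P x t"
proof -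
  obtain d where d: "\<And>x t. t < d x \<Longrightarrow> P x t" using assms by metis
  show ?thesis by (rule exI[of _ "Min (range d)"]) (auto intro: d)
qed

context hadic
begin

lemma inner_cf_mult_hsum:
  "has_hsum sW (\<lambda>t. sW (inner_cf t F * inner_cf (N - t) G) x) UNIV (sW (inner_cf N (F * G)) x)"
proof (rule has_hsum_scalars)
  fix k
  obtain d where d: "\<forall>i\<le>k. \<forall>j<d. F $ i $$ j = 0 \<and> G $ i $$ j = 0" using lser_bound2 by blast
  have z: "(inner_cf t F * inner_cf (N - t) G) $ k = 0" if "t \<notin> {d..N - d}" for t
    unfolding fps_mult_nth using d that by (intro sum.neutral) auto
  have sub: "{t \<in> UNIV. (inner_cf t F * inner_cf (N - t) G) $ k \<noteq> 0} \<subseteq> {d..N - d}" using z by blast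
  show "finite {t \<in> UNIV. (inner_cf t F * inner_cf (N - t) G) $ k \<noteq> 0}" by (rule finite_subset[OF sub]) simp
  have "inner_cf N (F * G) $ k = (\<Sum>t\<in>{d..N - d}. (inner_cf t F * inner_cf (N - t) G) $ k)"
    using inner_cf_mult_nth[of k d F d G N] d by (simp add: fps_sum_nth)
  also have "\<dots> = (\<Sum>t\<in>{t \<in> UNIV. (inner_cf t F * inner_cf (N - t) G) $ k \<noteq> 0}. (inner_cf t F * inner_cf (N - t) G) $ k)"
    by (rule sum.mono_neutral_right) (use sub in auto)
  finally show "inner_cf N (F * G) $ k = \<dots>" .
qed

text \<open>
  Each of the sixteen entries has a lower bound for the exponents modulo \<open>h\<^sup>n\<close>.
\<close>
lemma R_cf_bound: "\<exists>K. \<forall>t<K. \<forall>X Y x. sW (R_cf s X Y t) x \<in> hpow sW n"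
proof -
  have "\<exists>d. \<forall>t<d. \<forall>x. sW (R_cf s (fst p) (snd p) t) x \<in> hpow sW n" for p
  proof -
    obtain d where d: "\<forall>k\<le>n. \<forall>i<d. Eh (ell_R s (fst p) (snd p)) $ k $$ i = 0" using lser_bound by blast
    have "sW (R_cf s (fst p) (snd p) t) x \<in> hpow sW n" if "t < d" for t x
      using d that by (intro hpow_scale_left) (simp add: R_cf_def)
    thus ?thesis by blast
  qed
  from finite_uniform_bound[of "\<lambda>p t. \<forall>x. sW (R_cf s (fst p) (snd p) t) x \<in> hpow sW n", OF this]
  show ?thesis by fastforce
qed

section \<open>Action of the R-matrix on series in several variables\<close>

text \<open>
  Membership in the \<open>h\<close>-adic completion of \<open>W((x\<^sub>0))\<dots>((x\<^sub>p\<^sub>-\<^sub>1))\<close>: modulo \<open>h\<^sup>n\<close>, the exponent of \<open>x\<^sub>a\<close> is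
  bounded below once the exponents of all later variables are fixed. This is the domain on which
  multiplication by \<open>R(x\<^sub>\<mu>/x\<^sub>\<nu>)\<close> for \<open>\<mu> < \<nu>\<close> makes sense.
\<close>
definition iter_laurent :: "nat \<Rightarrow> 'w tseries \<Rightarrow> bool" where
  "iter_laurent p S \<longleftrightarrow> (\<forall>n. \<forall>a<p. \<forall>M0. length M0 = p \<longrightarrow> (\<exists>N. \<forall>I J M. length I = p \<and> length J = p \<and> length M = p \<and>
      (\<forall>j. a < j \<and> j < p \<longrightarrow> M ! j = M0 ! j) \<and> M ! a < N \<longrightarrow> S I J M \<in> hpow sW n))"

text \<open>
  The exponent of \<open>x\<^sub>a\<close> is bounded below modulo \<open>h\<^sup>n\<close>, uniformly in the other exponents. Setting \<open>x\<^sub>m\<close>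
  and \<open>x\<^sub>m\<^sub>+\<^sub>1\<close> proportional requires this of both of them, because \<open>iter_laurent\<close> does not bound the
  first one uniformly.
\<close>
definition lower_bounded :: "nat \<Rightarrow> nat \<Rightarrow> 'w tseries \<Rightarrow> bool" where
  "lower_bounded p a S \<longleftrightarrow> (\<forall>n. \<exists>N. \<forall>I J M. length I = p \<and> length J = p \<and> length M = p \<and> M ! a < N \<longrightarrow>
      S I J M \<in> hpow sW n)"

lemma clsD:
  assumes "iter_laurent p S" "a < p" "length M0 = p"
  obtains N where "\<And>I J M. length I = p \<Longrightarrow> length J = p \<Longrightarrow> length M = p \<Longrightarrow>
      (\<And>j. a < j \<Longrightarrow> j < p \<Longrightarrow> M ! j = M0 ! j) \<Longrightarrow> M ! a < N \<Longrightarrow> S I J M \<in> hpow sW n"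
proof -
  have "\<exists>N. \<forall>I J M. length I = p \<and> length J = p \<and> length M = p \<and>
      (\<forall>j. a < j \<and> j < p \<longrightarrow> M ! j = M0 ! j) \<and> M ! a < N \<longrightarrow> S I J M \<in> hpow sW n"
    using assms unfolding iter_laurent_def by simp
  then obtain N where N: "\<forall>I J M. length I = p \<and> length J = p \<and> length M = p \<and>
      (\<forall>j. a < j \<and> j < p \<longrightarrow> M ! j = M0 ! j) \<and> M ! a < N \<longrightarrow> S I J M \<in> hpow sW n" by (elim exE)
  show ?thesis by (rule that[of N]) (use N in simp)
qed

lemma unibD:
  assumes "lower_bounded p a S"
  obtains N where "\<And>I J M. length I = p \<Longrightarrow> length J = p \<Longrightarrow> length M = p \<Longrightarrow> M ! a < N \<Longrightarrow> S I J M \<in> hpow sW n"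
  using assms unfolding lower_bounded_def by metis

text \<open>
  The contribution of \<open>(x\<^sub>\<nu>/x\<^sub>\<mu>)\<^sup>t\<close> to the product of \<open>R\<^sub>\<mu>\<^sub>\<nu>(x\<^sub>\<mu>/x\<^sub>\<nu>)\<close> and \<open>S\<close>.
\<close>
definition R_summand :: "complex fps \<Rightarrow> nat \<Rightarrow> nat \<Rightarrow> 'w tseries \<Rightarrow> 2 list \<Rightarrow> 2 list \<Rightarrow> int list \<Rightarrow> int \<Rightarrow> 'w" where
  "R_summand s \<mu> \<nu> S I J M t = (\<Sum>k\<in>UNIV. \<Sum>l\<in>UNIV. sW (R_cf s (I ! \<mu>, I ! \<nu>) (k, l) t)
      (S (I[\<mu> := k, \<nu> := l]) J (M[\<mu> := M ! \<mu> + t, \<nu> := M ! \<nu> - t])))"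

lemma R_act_eq:
  assumes "has_hsum sW (R_summand s \<mu> \<nu> S I J M) UNIV x"
  shows "R_act sW (ell_R s) (\<mu>, \<nu>) S I J M = x"
proof -
  let ?f = "\<lambda>t::int. (- t, t)"
  let ?g = "\<lambda>(a, t). \<Sum>(k, l)\<in>UNIV. sW (R_coeff inner_over_outer (ell_R s) (I ! \<mu>, I ! \<nu>) (k, l) a t)
           (S (I[\<mu> := k, \<nu> := l]) J (M[\<mu> := M ! \<mu> - a, \<nu> := M ! \<nu> - t]))"
  have inj: "inj ?f" by (auto simp: inj_on_def)
  have "?g (?f t) = R_summand s \<mu> \<nu> S I J M t" for t
    by (simp add: sum_pair R_summand_def R_coeff_eq R_cf_def)
  hence "has_hsum sW (\<lambda>t. ?g (?f t)) UNIV x" using assms by simp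
  hence "has_hsum sW ?g (range ?f) x" unfolding has_hsum_reindex[OF inj] .
  hence "has_hsum sW ?g UNIV x"
  proof (rule has_hsum_support)
    fix p assume "p \<in> UNIV - range ?f"
    moreover obtain a t where p: "p = (a, t)" by (cases p)
    ultimately have "a \<noteq> - t" by auto
    thus "?g p = 0" unfolding p by (simp add: R_coeff_eq)
  qed simp
  thus ?thesis unfolding R_act_def prod.case by (rule hsum_eqI)
qed

lemma R_summand_small:
  assumes "length I = p" "length J = p" "length M = p"
    and "\<And>X Y x. sW (R_cf s X Y t) x \<in> hpow sW n
       \<or> (\<forall>I'. length I' = p \<longrightarrow> S I' J (M[\<mu> := M ! \<mu> + t, \<nu> := M ! \<nu> - t]) \<in> hpow sW n)"
  shows "R_summand s \<mu> \<nu> S I J M t \<in> hpow sW n"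
  unfolding R_summand_def
proof (intro hpow_sum)
  fix k l :: 2
  show "sW (R_cf s (I ! \<mu>, I ! \<nu>) (k, l) t) (S (I[\<mu> := k, \<nu> := l]) J (M[\<mu> := M ! \<mu> + t, \<nu> := M ! \<nu> - t])) \<in> hpow sW n"
    using assms(4)[of "(I ! \<mu>, I ! \<nu>)" "(k, l)" "S (I[\<mu> := k, \<nu> := l]) J (M[\<mu> := M ! \<mu> + t, \<nu> := M ! \<nu> - t])"]
      assms(1) by (auto intro: hpow_scale)
qed

text \<open>
  Modulo \<open>h\<^sup>n\<close> the sum is finite: for \<open>t\<close> below a bound the coefficient of \<open>R\<close> is divisible by \<open>h\<^sup>n\<close>, and
  for large \<open>t\<close> the exponent of \<open>x\<^sub>\<nu>\<close> in \<open>S\<close> is so small that the coefficient of \<open>S\<close> is.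
\<close>
lemma has_hsum_R_act:
  assumes S: "iter_laurent p S" and mn: "\<mu> < \<nu>" "\<nu> < p" and len: "length I = p" "length J = p" "length M = p"
  shows "has_hsum sW (R_summand s \<mu> \<nu> S I J M) UNIV (R_act sW (ell_R s) (\<mu>, \<nu>) S I J M)"
proof -
  have "hsummable (R_summand s \<mu> \<nu> S I J M) UNIV"
    unfolding hsummable_def
  proof
    fix n
    obtain K where K: "\<And>t X Y x. t < K \<Longrightarrow> sW (R_cf s X Y t) x \<in> hpow sW n" using R_cf_bound by metis
    obtain N where N: "\<And>I J M'. length I = p \<Longrightarrow> length J = p \<Longrightarrow> length M' = p \<Longrightarrow>
      (\<And>j. \<nu> < j \<Longrightarrow> j < p \<Longrightarrow> M' ! j = M ! j) \<Longrightarrow> M' ! \<nu> < N \<Longrightarrow> S I J M' \<in> hpow sW n"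
      using clsD[OF S mn(2) len(3)] by metis
    have "R_summand s \<mu> \<nu> S I J M t \<in> hpow sW n" if "t \<notin> {K..M ! \<nu> - N}" for t
    proof (rule R_summand_small[OF len])
      fix X Y x
      show "sW (R_cf s X Y t) x \<in> hpow sW n
       \<or> (\<forall>I'. length I' = p \<longrightarrow> S I' J (M[\<mu> := M ! \<mu> + t, \<nu> := M ! \<nu> - t]) \<in> hpow sW n)"
      proof (cases "t < K")
        case False
        hence "M ! \<nu> - t < N" using that by auto
        thus ?thesis using len mn by (intro disjI2 allI impI N) auto
      qed (simp add: K)
    qed
    hence "{t \<in> UNIV. R_summand s \<mu> \<nu> S I J M t \<notin> hpow sW n} \<subseteq> {K..M ! \<nu> - N}" by blast
    thus "finite {t \<in> UNIV. R_summand s \<mu> \<nu> S I J M t \<notin> hpow sW n}" by (rule finite_subset) simp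
  qed
  hence h: "has_hsum sW (R_summand s \<mu> \<nu> S I J M) UNIV (hsum sW (R_summand s \<mu> \<nu> S I J M) UNIV)" by (rule has_hsum_hsum)
  thus ?thesis using R_act_eq[OF h] by simp
qed

text \<open>
  The R-matrix contributes the powers \<open>(x\<^sub>\<nu>/x\<^sub>\<mu>)\<^sup>t\<close> with \<open>t\<close> bounded below, so it can lower the
  exponent of \<open>x\<^sub>\<mu>\<close> without bound, but that of \<open>x\<^sub>\<nu>\<close> only by a bounded amount.
\<close>
lemma lower_bounded_R_act:
  assumes S: "iter_laurent p S" "lower_bounded p a S" and mn: "\<mu> < \<nu>" "\<nu> < p" and a: "a \<noteq> \<mu>" "a < p"
  shows "lower_bounded p a (R_act sW (ell_R s) (\<mu>, \<nu>) S)"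
  unfolding lower_bounded_def
proof
  fix n
  obtain K where K: "\<And>t X Y x. t < K \<Longrightarrow> sW (R_cf s X Y t) x \<in> hpow sW n" using R_cf_bound by metis
  obtain N where N: "\<And>I J M. length I = p \<Longrightarrow> length J = p \<Longrightarrow> length M = p \<Longrightarrow> M ! a < N \<Longrightarrow> S I J M \<in> hpow sW n"
    using unibD[OF S(2)] by metis
  show "\<exists>N. \<forall>I J M. length I = p \<and> length J = p \<and> length M = p \<and> M ! a < N \<longrightarrow>
      R_act sW (ell_R s) (\<mu>, \<nu>) S I J M \<in> hpow sW n"
  \<comment> \<open>For \<open>a = \<nu>\<close> the exponent in \<open>S\<close> is lower by \<open>t \<ge> K\<close>.\<close>
  proof (intro exI[of _ "min N (N + K)"] allI impI, elim conjE)
    fix I J :: "2 list" and M :: "int list"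
    assume len: "length I = p" "length J = p" "length M = p" and Ma: "M ! a < min N (N + K)"
    show "R_act sW (ell_R s) (\<mu>, \<nu>) S I J M \<in> hpow sW n"
    proof (rule hsum_in_hpow[OF has_hsum_R_act[OF S(1) mn len]], rule R_summand_small[OF len])
      fix t X Y x
      show "sW (R_cf s X Y t) x \<in> hpow sW n
       \<or> (\<forall>I'. length I' = p \<longrightarrow> S I' J (M[\<mu> := M ! \<mu> + t, \<nu> := M ! \<nu> - t]) \<in> hpow sW n)"
      proof (cases "t < K")
        case False
        hence "M[\<mu> := M ! \<mu> + t, \<nu> := M ! \<nu> - t] ! a < N" using Ma a len mn by (simp add: nth_list_update)
        thus ?thesis using len by (intro disjI2 allI impI N) auto
      qed (simp add: K)
    qed
  qed
qed

lemma iter_laurent_R_act: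
  assumes S: "iter_laurent p S" and mn: "\<mu> < \<nu>" "\<nu> < p"
  shows "iter_laurent p (R_act sW (ell_R s) (\<mu>, \<nu>) S)"
  unfolding iter_laurent_def
proof (intro allI impI)
  fix n a M0 assume a: "a < p" and M0: "length (M0 :: int list) = p"
  obtain K where K: "\<And>t X Y x. t < K \<Longrightarrow> sW (R_cf s X Y t) x \<in> hpow sW n" using R_cf_bound by metis
  obtain N\<nu> where N\<nu>: "\<And>I J M. length I = p \<Longrightarrow> length J = p \<Longrightarrow> length M = p \<Longrightarrow>
      (\<And>j. \<nu> < j \<Longrightarrow> j < p \<Longrightarrow> M ! j = M0 ! j) \<Longrightarrow> M ! \<nu> < N\<nu> \<Longrightarrow> S I J M \<in> hpow sW n"
    using clsD[OF S mn(2) M0] by metis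
  define Mt where "Mt t = M0[\<mu> := M0 ! \<mu> + t, \<nu> := M0 ! \<nu> - t]" for t
  have "length (Mt t) = p" for t by (simp add: Mt_def M0)
  hence "\<exists>N. \<forall>I J M. length I = p \<and> length J = p \<and> length M = p \<and>
      (\<forall>j. a < j \<and> j < p \<longrightarrow> M ! j = Mt t ! j) \<and> M ! a < N \<longrightarrow> S I J M \<in> hpow sW n" for t
    using S a unfolding iter_laurent_def by simp
  then obtain Na where NaX: "\<forall>t. \<forall>I J M. length I = p \<and> length J = p \<and> length M = p \<and>
      (\<forall>j. a < j \<and> j < p \<longrightarrow> M ! j = Mt t ! j) \<and> M ! a < Na t \<longrightarrow> S I J M \<in> hpow sW n" by metis
  have Na: "S I J M \<in> hpow sW n" if "length I = p" "length J = p" "length M = p"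
      "\<And>j. a < j \<Longrightarrow> j < p \<Longrightarrow> M ! j = Mt t ! j" "M ! a < Na t" for I J M t
    by (rule NaX[rule_format, of I J M t]) (use that in simp)
  obtain N0 where N0: "\<And>I J M. length I = p \<Longrightarrow> length J = p \<Longrightarrow> length M = p \<Longrightarrow>
      (\<And>j. a < j \<Longrightarrow> j < p \<Longrightarrow> M ! j = M0 ! j) \<Longrightarrow> M ! a < N0 \<Longrightarrow> S I J M \<in> hpow sW n"
    using clsD[OF S a M0] by metis
  define TT where "TT = {K..M0 ! \<nu> - N\<nu>}"
  \<comment> \<open>For \<open>a < \<nu>\<close> only the \<open>t\<close> in the finite set \<open>TT\<close> contribute; \<open>\<bar>t\<bar>\<close> allows for the shift of the exponent when \<open>a = \<mu>\<close>.\<close>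
  define NN where "NN = Min (insert N0 (insert (N\<nu> + K) ((\<lambda>t. Na t - \<bar>t\<bar>) ` TT)))"
  have fin: "finite (insert N0 (insert (N\<nu> + K) ((\<lambda>t. Na t - \<bar>t\<bar>) ` TT)))" by (simp add: TT_def)
  have NNle: "NN \<le> N0" "NN \<le> N\<nu> + K" "t \<in> TT \<Longrightarrow> NN \<le> Na t - \<bar>t\<bar>" for t
    unfolding NN_def by (rule Min_le[OF fin], simp)+
  show "\<exists>N. \<forall>I J M. length I = p \<and> length J = p \<and> length M = p \<and>
      (\<forall>j. a < j \<and> j < p \<longrightarrow> M ! j = M0 ! j) \<and> M ! a < N \<longrightarrow> R_act sW (ell_R s) (\<mu>, \<nu>) S I J M \<in> hpow sW n"
  proof (intro exI[of _ NN] allI impI, elim conjE)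
    fix I J :: "2 list" and M :: "int list"
    assume len: "length I = p" "length J = p" "length M = p"
      and tail: "\<forall>j. a < j \<and> j < p \<longrightarrow> M ! j = M0 ! j" and Ma: "M ! a < NN"
    show "R_act sW (ell_R s) (\<mu>, \<nu>) S I J M \<in> hpow sW n"
    proof (rule hsum_in_hpow[OF has_hsum_R_act[OF S mn len]], rule R_summand_small[OF len])
      fix t X Y x
      let ?M = "M[\<mu> := M ! \<mu> + t, \<nu> := M ! \<nu> - t]"
      have nth: "?M ! j = (if j = \<nu> then M ! \<nu> - t else if j = \<mu> then M ! \<mu> + t else M ! j)" if "j < p" for j
        using that len mn by (simp add: nth_list_update)
      have nth0: "Mt t ! j = (if j = \<nu> then M0 ! \<nu> - t else if j = \<mu> then M0 ! \<mu> + t else M0 ! j)" if "j < p" for j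
        using that M0 mn by (simp add: nth_list_update Mt_def)
      have "t < K \<or> a > \<nu> \<or> (a = \<nu> \<and> t \<ge> K) \<or> (a < \<nu> \<and> t \<in> TT) \<or> (a < \<nu> \<and> t > M0 ! \<nu> - N\<nu>)"
        unfolding TT_def by auto
      then consider "t < K" | "a > \<nu>" | "a = \<nu>" "t \<ge> K" | "a < \<nu>" "t \<in> TT" | "a < \<nu>" "t > M0 ! \<nu> - N\<nu>"
        by blast
      thus "sW (R_cf s X Y t) x \<in> hpow sW n \<or> (\<forall>I'. length I' = p \<longrightarrow> S I' J ?M \<in> hpow sW n)"
      proof cases
        case 1 thus ?thesis by (simp add: K)
      next
        case 2
        show ?thesis
          by (intro disjI2 allI impI N0) (use 2 len tail Ma NNle(1) mn a nth in auto)
      next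
        case 3
        show ?thesis
          by (intro disjI2 allI impI N\<nu>) (use 3 len tail Ma NNle(2) mn a nth in auto)
      next
        case 4
        show ?thesis
        proof (intro disjI2 allI impI Na[of _ _ _ t])
          show "?M ! j = Mt t ! j" if "a < j" "j < p" for j
            using tail that mn nth[OF that(2)] nth0[OF that(2)] 4 by auto
          have "M ! a < Na t - \<bar>t\<bar>" using Ma NNle(3)[OF 4(2)] by simp
          thus "?M ! a < Na t" using nth[OF a] 4(1) by (auto split: if_splits)
        qed (use len in auto)
      next
        case 5
        have "M ! \<nu> = M0 ! \<nu>" using tail 5(1) mn by simp
        thus ?thesis
          by (intro disjI2 allI impI N\<nu>) (use 5 len tail mn nth in auto)
      qed
    qed
  qed
qed

lemma R_act_cong:
  assumes "\<And>I J M. length I = p \<Longrightarrow> length J = p \<Longrightarrow> length M = p \<Longrightarrow> S I J M = S' I J M"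
    and "length I = p" "length J = p" "length M = p"
  shows "R_act sW R (\<mu>, \<nu>) S I J M = R_act sW R (\<mu>, \<nu>) S' I J M"
  unfolding R_act_def prod.case using assms by simp

section \<open>The trace over the last two factors\<close>

text \<open>
  The contribution of the exponents \<open>(z - m, m)\<close> of the last two variables to \<open>qtrace\<close>.
\<close>
definition qtrace_summand :: "'w tseries \<Rightarrow> 2 list \<Rightarrow> 2 list \<Rightarrow> int list \<Rightarrow> int \<Rightarrow> int \<Rightarrow> 'w" where
  "qtrace_summand S I J M z m = sW (q_neg_pow m) (\<Sum>i1\<in>UNIV. \<Sum>i2\<in>UNIV. \<Sum>k1\<in>UNIV. \<Sum>k2\<in>UNIV.
      sW (fps_const (A_entry (i1, i2) (k1, k2))) (S (I @ [k1, k2]) (J @ [i1, i2]) (M @ [z - m, m])))"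

text \<open>
  The coefficient of \<open>y\<^sup>z\<close> in the trace of \<open>A S\<close> over the last two positions, with \<open>y\<close> and \<open>y q\<^sup>-\<^sup>1\<close>
  substituted for the last two variables.
\<close>
definition qtrace :: "'w tseries \<Rightarrow> int \<Rightarrow> 'w tseries" where
  "qtrace S z I J M = hsum sW (qtrace_summand S I J M z) UNIV"

lemma qtrace_summand_in_hpow:
  assumes "\<And>k1 k2 i1 i2. S (I @ [k1, k2]) (J @ [i1, i2]) (M @ [z - m, m]) \<in> hpow sW n"
  shows "qtrace_summand S I J M z m \<in> hpow sW n"
  unfolding qtrace_summand_def by (intro hpow_scale hpow_sum assms)

lemma has_hsum_qtrace:
  assumes u: "lower_bounded (m + 2) m S" "lower_bounded (m + 2) (m + 1) S"
    and len: "length I = m" "length J = m" "length M = m"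
  shows "has_hsum sW (qtrace_summand S I J M z) UNIV (qtrace S z I J M)"
  unfolding qtrace_def
proof (rule has_hsum_hsum, unfold hsummable_def, rule allI)
  fix n
  obtain N1 where N1: "\<And>I J M. length I = m + 2 \<Longrightarrow> length J = m + 2 \<Longrightarrow> length M = m + 2 \<Longrightarrow> M ! m < N1 \<Longrightarrow> S I J M \<in> hpow sW n"
    using unibD[OF u(1)] by metis
  obtain N2 where N2: "\<And>I J M. length I = m + 2 \<Longrightarrow> length J = m + 2 \<Longrightarrow> length M = m + 2 \<Longrightarrow> M ! (m + 1) < N2 \<Longrightarrow> S I J M \<in> hpow sW n"
    using unibD[OF u(2)] by metis
  have "qtrace_summand S I J M z x \<in> hpow sW n" if nx: "x \<notin> {N2..z - N1}" for x
  proof (rule qtrace_summand_in_hpow)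
    fix k1 k2 i1 i2
    have "x < N2 \<or> z - x < N1" using nx by auto
    then consider "x < N2" | "z - x < N1" by blast
    thus "S (I @ [k1, k2]) (J @ [i1, i2]) (M @ [z - x, x]) \<in> hpow sW n"
    proof cases
      case 1 show ?thesis by (rule N2) (use len 1 in \<open>simp_all add: nth_append\<close>)
    next
      case 2 show ?thesis by (rule N1) (use len 2 in \<open>simp_all add: nth_append\<close>)
    qed
  qed
  hence "{x \<in> UNIV. qtrace_summand S I J M z x \<notin> hpow sW n} \<subseteq> {N2..z - N1}" by blast
  thus "finite {x \<in> UNIV. qtrace_summand S I J M z x \<notin> hpow sW n}" by (rule finite_subset) simp
qed

text \<open>
  The R-matrix acts on positions and variables that the trace does not touch. The point is the
  summability of the double series, which justifies the exchange of the two sums.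
\<close>
lemma qtrace_R_act:
  assumes S: "iter_laurent (m + 2) S" and u: "lower_bounded (m + 2) m S" "lower_bounded (m + 2) (m + 1) S"
    and mn: "\<mu> < \<nu>" "\<nu> < m" and len: "length I = m" "length J = m" "length M = m"
  shows "qtrace (R_act sW (ell_R s) (\<mu>, \<nu>) S) z I J M = R_act sW (ell_R s) (\<mu>, \<nu>) (qtrace S z) I J M"
proof -
  have mn': "\<mu> < m" "\<nu> < m + 2" using mn by auto
  define F where "F x t = qtrace_summand (\<lambda>I' J' M'. R_summand s \<mu> \<nu> S I' J' M' t) I J M z x" for x t
  have inner: "has_hsum sW (F x) UNIV (qtrace_summand (R_act sW (ell_R s) (\<mu>, \<nu>) S) I J M z x)" for x
    unfolding F_def qtrace_summand_def
    by (intro has_hsum_scale has_hsum_sum has_hsum_R_act[OF S mn(1) mn'(2)]) (use len in auto)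
  have Rt: "R_summand s \<mu> \<nu> S (I @ [k1, k2]) J' (M @ [a, b]) t =
     (\<Sum>k\<in>UNIV. \<Sum>l\<in>UNIV. sW (R_cf s (I ! \<mu>, I ! \<nu>) (k, l) t)
      (S (I[\<mu> := k, \<nu> := l] @ [k1, k2]) J' (M[\<mu> := M ! \<mu> + t, \<nu> := M ! \<nu> - t] @ [a, b])))" for k1 k2 J' a b t
    unfolding R_summand_def using mn len by (simp add: nth_append list_update_append)
  have outer: "F x t = (\<Sum>k\<in>UNIV. \<Sum>l\<in>UNIV. sW (R_cf s (I ! \<mu>, I ! \<nu>) (k, l) t)
      (qtrace_summand S (I[\<mu> := k, \<nu> := l]) J (M[\<mu> := M ! \<mu> + t, \<nu> := M ! \<nu> - t]) z x))" for x t
    unfolding F_def qtrace_summand_def Rt sum_2 by (simp add: scale_right_distrib mult_ac add_ac)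
  have outer_sum: "has_hsum sW (\<lambda>x. F x t) UNIV (R_summand s \<mu> \<nu> (qtrace S z) I J M t)" for t
    unfolding outer R_summand_def
    by (intro has_hsum_sum has_hsum_scale has_hsum_qtrace[OF u]) (use len in auto)
  have summ: "hsummable (\<lambda>(x, t). F x t) (UNIV \<times> UNIV)"
    unfolding hsummable_def
  proof
    fix n
    obtain K where K: "\<And>t X Y x. t < K \<Longrightarrow> sW (R_cf s X Y t) x \<in> hpow sW n" using R_cf_bound by metis
    obtain N1 where N1: "\<And>I J M. length I = m + 2 \<Longrightarrow> length J = m + 2 \<Longrightarrow> length M = m + 2 \<Longrightarrow> M ! m < N1 \<Longrightarrow> S I J M \<in> hpow sW n"
      using unibD[OF u(1)] by metis
    obtain N2 where N2: "\<And>I J M. length I = m + 2 \<Longrightarrow> length J = m + 2 \<Longrightarrow> length M = m + 2 \<Longrightarrow> M ! (m + 1) < N2 \<Longrightarrow> S I J M \<in> hpow sW n"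
      using unibD[OF u(2)] by metis
    have "\<exists>N. \<forall>I J M'. length I = m + 2 \<and> length J = m + 2 \<and> length M' = m + 2 \<and>
      (\<forall>j. \<nu> < j \<and> j < m + 2 \<longrightarrow> M' ! j = (M @ [z - x, x]) ! j) \<and> M' ! \<nu> < N \<longrightarrow> S I J M' \<in> hpow sW n" for x
      using S mn'(2) len unfolding iter_laurent_def by simp
    then obtain Nx where Nx: "\<forall>x. \<forall>I J M'. length I = m + 2 \<and> length J = m + 2 \<and> length M' = m + 2 \<and>
      (\<forall>j. \<nu> < j \<and> j < m + 2 \<longrightarrow> M' ! j = (M @ [z - x, x]) ! j) \<and> M' ! \<nu> < Nx x \<longrightarrow> S I J M' \<in> hpow sW n"
      by metis
    have van: "F x t \<in> hpow sW n" if nx: "(x, t) \<notin> Sigma {N2..z - N1} (\<lambda>x. {K..M ! \<nu> - Nx x})" for x t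
    proof (cases "t < K")
      case True
      thus ?thesis unfolding outer by (intro hpow_sum K)
    next
      case False
      show ?thesis unfolding outer
      proof (intro hpow_sum hpow_scale qtrace_summand_in_hpow)
        fix k l k1 k2 i1 i2 :: 2
        let ?M = "M[\<mu> := M ! \<mu> + t, \<nu> := M ! \<nu> - t]"
        let ?I = "I[\<mu> := k, \<nu> := l] @ [k1, k2]"
        have "x < N2 \<or> z - x < N1 \<or> M ! \<nu> - t < Nx x" using nx False by auto
        then consider "x < N2" | "z - x < N1" | "M ! \<nu> - t < Nx x" by blast
        thus "S ?I (J @ [i1, i2]) (?M @ [z - x, x]) \<in> hpow sW n"
        proof cases
          case 1 show ?thesis by (rule N2) (use len 1 in \<open>simp_all add: nth_append\<close>)
        next
          case 2 show ?thesis by (rule N1) (use len 2 in \<open>simp_all add: nth_append\<close>)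
        next
          case 3
          have "(?M @ [z - x, x]) ! \<nu> < Nx x" using 3 mn len by (simp add: nth_append)
          moreover have "(?M @ [z - x, x]) ! j = (M @ [z - x, x]) ! j" if "\<nu> < j" for j
            using that mn len by (auto simp: nth_append nth_list_update)
          ultimately show ?thesis using len by (intro Nx[rule_format, of _ _ _ x]) auto
        qed
      qed
    qed
    have "{p \<in> UNIV \<times> UNIV. (case p of (x, t) \<Rightarrow> F x t) \<notin> hpow sW n} \<subseteq> Sigma {N2..z - N1} (\<lambda>x. {K..M ! \<nu> - Nx x})"
    proof (intro subsetI, elim CollectE conjE)
      fix p assume p: "(case p of (x, t) \<Rightarrow> F x t) \<notin> hpow sW n"
      obtain x t where xt: "p = (x, t)" by (cases p)
      show "p \<in> Sigma {N2..z - N1} (\<lambda>x. {K..M ! \<nu> - Nx x})"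
        by (rule ccontr) (use p van[of x t] in \<open>simp only: xt prod.case simp_thms\<close>)
    qed
    thus "finite {p \<in> UNIV \<times> UNIV. (case p of (x, t) \<Rightarrow> F x t) \<notin> hpow sW n}"
      by (rule finite_subset) auto
  qed
  define T0 where "T0 = hsum sW (\<lambda>(x, t). F x t) (UNIV \<times> UNIV)"
  have tot: "has_hsum sW (\<lambda>(x, t). F x t) (UNIV \<times> UNIV) T0"
    unfolding T0_def using summ by (rule has_hsum_hsum)
  have "has_hsum sW (\<lambda>x. hsum sW (F x) UNIV) UNIV T0" by (rule has_hsum_Sigma[OF tot])
  hence 1: "has_hsum sW (qtrace_summand (R_act sW (ell_R s) (\<mu>, \<nu>) S) I J M z) UNIV T0"
    by (simp only: hsum_eqI[OF inner])
  have "has_hsum sW (\<lambda>p. case prod.swap p of (x, t) \<Rightarrow> F x t) (UNIV \<times> UNIV) T0"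
    using tot has_hsum_reindex[of prod.swap "UNIV \<times> UNIV" "\<lambda>(x, t). F x t" T0] by (simp add: inj_on_def)
  hence "has_hsum sW (\<lambda>(t, x). F x t) (UNIV \<times> UNIV) T0" by (simp add: case_prod_unfold)
  from has_hsum_Sigma[OF this] have "has_hsum sW (\<lambda>t. hsum sW (\<lambda>x. F x t) UNIV) UNIV T0" .
  hence "has_hsum sW (R_summand s \<mu> \<nu> (qtrace S z) I J M) UNIV T0"
    by (simp only: hsum_eqI[OF outer_sum])
  hence "R_act sW (ell_R s) (\<mu>, \<nu>) (qtrace S z) I J M = T0" by (rule R_act_eq)
  moreover have "qtrace (R_act sW (ell_R s) (\<mu>, \<nu>) S) z I J M = T0" unfolding qtrace_def by (rule hsum_eqI[OF 1])
  ultimately show ?thesis by simp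
qed

text \<open>
  The fusion identity for the coefficients, applied to the elements \<open>X\<close> of the module.
\<close>
lemma fusion_coefficients:
  fixes X :: "2 \<Rightarrow> 2 \<Rightarrow> 2 \<Rightarrow> 'w"
  assumes s: "s $ 0 = 0"
  shows "has_hsum sW (\<lambda>t. \<Sum>k1\<in>UNIV. \<Sum>k2\<in>UNIV. \<Sum>g\<in>UNIV. \<Sum>l1\<in>UNIV. \<Sum>g'\<in>UNIV. \<Sum>l2\<in>UNIV.
      sW (q_neg_pow (u + N - t) * fps_const (A_entry i (k1, k2)) *
          (R_cf s (\<alpha>, k1) (g, l1) t * R_cf s (g, k2) (g', l2) (N - t))) (X l1 g' l2)) UNIV
    (if N = 0 then \<Sum>l1\<in>UNIV. \<Sum>l2\<in>UNIV. sW (q_neg_pow u * fps_const (A_entry i (l1, l2))) (X l1 \<alpha> l2) else 0)"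
proof -
  let ?F = "\<lambda>k1 g l1. Eh (ell_R s (\<alpha>, k1) (g, l1))"
  let ?G = "\<lambda>g k2 g' l2. qshift (Eh (ell_R s (g, k2) (g', l2)))"
  have "has_hsum sW (\<lambda>t. sW (q_neg_pow (u + N - t) * fps_const (A_entry i (k1, k2)) *
          (R_cf s (\<alpha>, k1) (g, l1) t * R_cf s (g, k2) (g', l2) (N - t))) x) UNIV
      (sW (q_neg_pow u) (sW (fps_const (A_entry i (k1, k2)) * inner_cf N (?F k1 g l1 * ?G g k2 g' l2)) x))"
    for k1 k2 g l1 g' l2 x
  proof -
    have "has_hsum sW (\<lambda>t. sW (q_neg_pow u) (sW (fps_const (A_entry i (k1, k2))) (sW (inner_cf t (?F k1 g l1) * inner_cf (N - t) (?G g k2 g' l2)) x)))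
      UNIV (sW (q_neg_pow u) (sW (fps_const (A_entry i (k1, k2))) (sW (inner_cf N (?F k1 g l1 * ?G g k2 g' l2)) x)))"
      by (intro has_hsum_scale inner_cf_mult_hsum)
    moreover have "sW (q_neg_pow u) (sW (fps_const (A_entry i (k1, k2))) (sW (inner_cf t (?F k1 g l1) * inner_cf (N - t) (?G g k2 g' l2)) x)) =
      sW (q_neg_pow (u + N - t) * fps_const (A_entry i (k1, k2)) * (R_cf s (\<alpha>, k1) (g, l1) t * R_cf s (g, k2) (g', l2) (N - t))) x" for t
      using q_neg_pow_add[of u "N - t"] by (simp add: R_cf_def inner_cf_qshift mult_ac add_diff_eq)
    ultimately show ?thesis by simp
  qed
  hence "has_hsum sW (\<lambda>t. \<Sum>k1\<in>UNIV. \<Sum>k2\<in>UNIV. \<Sum>g\<in>UNIV. \<Sum>l1\<in>UNIV. \<Sum>g'\<in>UNIV. \<Sum>l2\<in>UNIV.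
      sW (q_neg_pow (u + N - t) * fps_const (A_entry i (k1, k2)) *
          (R_cf s (\<alpha>, k1) (g, l1) t * R_cf s (g, k2) (g', l2) (N - t))) (X l1 g' l2)) UNIV
     (\<Sum>k1\<in>UNIV. \<Sum>k2\<in>UNIV. \<Sum>g\<in>UNIV. \<Sum>l1\<in>UNIV. \<Sum>g'\<in>UNIV. \<Sum>l2\<in>UNIV.
      sW (q_neg_pow u) (sW (fps_const (A_entry i (k1, k2)) * inner_cf N (?F k1 g l1 * ?G g k2 g' l2)) (X l1 g' l2)))"
    by (intro has_hsum_sum)
  also have "(\<Sum>k1\<in>UNIV. \<Sum>k2\<in>UNIV. \<Sum>g\<in>UNIV. \<Sum>l1\<in>UNIV. \<Sum>g'\<in>UNIV. \<Sum>l2\<in>UNIV.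
      sW (q_neg_pow u) (sW (fps_const (A_entry i (k1, k2)) * inner_cf N (?F k1 g l1 * ?G g k2 g' l2)) (X l1 g' l2)))
    = (\<Sum>l1\<in>UNIV. \<Sum>g'\<in>UNIV. \<Sum>l2\<in>UNIV. sW (q_neg_pow u) (sW (\<Sum>k1\<in>UNIV. \<Sum>k2\<in>UNIV. \<Sum>g\<in>UNIV. fps_const (A_entry i (k1, k2)) * inner_cf N (?F k1 g l1 * ?G g k2 g' l2)) (X l1 g' l2)))"
    unfolding sum_2 by (simp add: scale_left_distrib scale_right_distrib add_ac)
  also have "\<dots> = (\<Sum>l1\<in>UNIV. \<Sum>g'\<in>UNIV. \<Sum>l2\<in>UNIV. sW (q_neg_pow u) (sW (if \<alpha> = g' \<and> N = 0 then fps_const (A_entry i (l1, l2)) else 0) (X l1 g' l2)))"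
    by (simp only: fusion_inner_cf[OF s])
  also have "\<dots> = (if N = 0 then \<Sum>l1\<in>UNIV. \<Sum>l2\<in>UNIV. sW (q_neg_pow u * fps_const (A_entry i (l1, l2))) (X l1 \<alpha> l2) else 0)"
    using exhaust_2[of \<alpha>] by (cases "N = 0") (auto simp: sum_2)
  finally show ?thesis .
qed

text \<open>
  The product \<open>R\<^sub>\<mu>\<^sub>,\<^sub>m(x\<^sub>\<mu>/y) R\<^sub>\<mu>\<^sub>,\<^sub>m\<^sub>+\<^sub>1(q x\<^sub>\<mu>/y)\<close> is absorbed by \<open>A\<close>. The left-hand side is a triple series
  over the exponent \<open>x\<close> of the last variable and the exponents \<open>t\<close> and \<open>t'\<close> of the two R-matrices. It
  is summed again over \<open>N = t + t'\<close>, over the exponent \<open>u = x - t'\<close> of the last variable in \<open>S\<close>, and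
  over \<open>t\<close>; the innermost sum is then a coefficient of the product of the two R-matrices.
\<close>
lemma qtrace_fusion:
  assumes s: "s $ 0 = 0" and S: "iter_laurent (m + 2) S" and u: "lower_bounded (m + 2) m S" "lower_bounded (m + 2) (m + 1) S"
    and \<mu>: "\<mu> < m" and len: "length I = m" "length J = m" "length M = m"
  shows "qtrace (R_act sW (ell_R s) (\<mu>, m) (R_act sW (ell_R s) (\<mu>, m + 1) S)) z I J M = qtrace S z I J M"
proof -
  define S1 where "S1 = R_act sW (ell_R s) (\<mu>, m + 1) S"
  define S2 where "S2 = R_act sW (ell_R s) (\<mu>, m) S1"
  have c1: "iter_laurent (m + 2) S1" unfolding S1_def using S \<mu> by (intro iter_laurent_R_act) auto
  define X where "X i1 i2 N u l1 g' l2 = S (I[\<mu> := g'] @ [l1, l2]) (J @ [i1, i2]) (M[\<mu> := M ! \<mu> + N] @ [z - u - N, u])"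
    for i1 i2 N u l1 g' l2
  define H where "H x t t' = (\<Sum>i1\<in>UNIV. \<Sum>i2\<in>UNIV. \<Sum>k1\<in>UNIV. \<Sum>k2\<in>UNIV. \<Sum>g\<in>UNIV. \<Sum>l1\<in>UNIV. \<Sum>g'\<in>UNIV. \<Sum>l2\<in>UNIV.
      sW (q_neg_pow x * fps_const (A_entry (i1, i2) (k1, k2)) *
        (R_cf s (I ! \<mu>, k1) (g, l1) t * R_cf s (g, k2) (g', l2) t')) (X i1 i2 (t + t') (x - t') l1 g' l2))" for x t t'
  have r1: "R_summand s \<mu> m Q (I @ [k1, k2]) J' (M @ [a, b]) t =
     (\<Sum>g\<in>UNIV. \<Sum>l1\<in>UNIV. sW (R_cf s (I ! \<mu>, k1) (g, l1) t)
      (Q (I[\<mu> := g] @ [l1, k2]) J' (M[\<mu> := M ! \<mu> + t] @ [a - t, b])))" for Q k1 k2 J' a b t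
    unfolding R_summand_def using \<mu> len by (simp add: nth_append list_update_append)
  have r2: "R_summand s \<mu> (m + 1) S (I[\<mu> := g] @ [l1, k2]) J' (M[\<mu> := c] @ [a, b]) t' =
     (\<Sum>g'\<in>UNIV. \<Sum>l2\<in>UNIV. sW (R_cf s (g, k2) (g', l2) t')
      (S (I[\<mu> := g'] @ [l1, l2]) J' (M[\<mu> := c + t'] @ [a, b - t'])))" for g l1 k2 J' c a b t'
    unfolding R_summand_def using \<mu> len by (simp add: nth_append list_update_append)
  have inner: "has_hsum sW (\<lambda>t'. H x t t') UNIV (qtrace_summand (\<lambda>I' J' M'. R_summand s \<mu> m S1 I' J' M' t) I J M z x)" for x t
  proof -
    have "has_hsum sW (\<lambda>t'. sW (q_neg_pow x) (\<Sum>i1\<in>UNIV. \<Sum>i2\<in>UNIV. \<Sum>k1\<in>UNIV. \<Sum>k2\<in>UNIV. sW (fps_const (A_entry (i1, i2) (k1, k2)))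
       (\<Sum>g\<in>UNIV. \<Sum>l1\<in>UNIV. sW (R_cf s (I ! \<mu>, k1) (g, l1) t)
       (R_summand s \<mu> (m + 1) S (I[\<mu> := g] @ [l1, k2]) (J @ [i1, i2]) (M[\<mu> := M ! \<mu> + t] @ [z - x - t, x]) t')))) UNIV
      (qtrace_summand (\<lambda>I' J' M'. R_summand s \<mu> m S1 I' J' M' t) I J M z x)"
      unfolding qtrace_summand_def r1 S1_def
      by (intro has_hsum_scale has_hsum_sum has_hsum_R_act[OF S]) (use \<mu> len in auto)
    moreover have "sW (q_neg_pow x) (\<Sum>i1\<in>UNIV. \<Sum>i2\<in>UNIV. \<Sum>k1\<in>UNIV. \<Sum>k2\<in>UNIV. sW (fps_const (A_entry (i1, i2) (k1, k2)))
       (\<Sum>g\<in>UNIV. \<Sum>l1\<in>UNIV. sW (R_cf s (I ! \<mu>, k1) (g, l1) t)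
       (R_summand s \<mu> (m + 1) S (I[\<mu> := g] @ [l1, k2]) (J @ [i1, i2]) (M[\<mu> := M ! \<mu> + t] @ [z - x - t, x]) t'))) = H x t t'" for t'
    proof -
      have e: "z - (x - t') - (t + t') = z - x - t" "M ! \<mu> + t + t' = M ! \<mu> + (t + t')" by simp_all
      show ?thesis unfolding H_def X_def r2 e scale_sum_right scale_scale
        by (simp only: mult.assoc)
    qed
    ultimately show ?thesis by simp
  qed
  have middle: "has_hsum sW (\<lambda>t. qtrace_summand (\<lambda>I' J' M'. R_summand s \<mu> m S1 I' J' M' t) I J M z x) UNIV (qtrace_summand S2 I J M z x)" for x
    unfolding qtrace_summand_def S2_def
    by (intro has_hsum_scale has_hsum_sum has_hsum_R_act[OF c1]) (use \<mu> len in auto)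
  have summ: "hsummable (\<lambda>(x, t, t'). H x t t') (UNIV \<times> UNIV \<times> UNIV)"
    unfolding hsummable_def
  proof
    fix n
    obtain K where K: "\<And>t X Y x. t < K \<Longrightarrow> sW (R_cf s X Y t) x \<in> hpow sW n" using R_cf_bound by metis
    obtain N1 where N1: "\<And>I J M. length I = m + 2 \<Longrightarrow> length J = m + 2 \<Longrightarrow> length M = m + 2 \<Longrightarrow> M ! m < N1 \<Longrightarrow> S I J M \<in> hpow sW n"
      using unibD[OF u(1)] by metis
    obtain N2 where N2: "\<And>I J M. length I = m + 2 \<Longrightarrow> length J = m + 2 \<Longrightarrow> length M = m + 2 \<Longrightarrow> M ! (m + 1) < N2 \<Longrightarrow> S I J M \<in> hpow sW n"
      using unibD[OF u(2)] by metis
    \<comment> \<open>The exponents of the last two variables in \<open>S\<close> are \<open>z - x - t\<close> and \<open>x - t'\<close>; together with \<open>K \<le> t\<close> and \<open>K \<le> t'\<close> their lower bounds confine \<open>x\<close> as well.\<close>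
    let ?B = "Sigma {K + N2..z - N1 - K} (\<lambda>x. {K..z - x - N1} \<times> {K..x - N2})"
    have van: "H x t t' \<in> hpow sW n" if nx: "(x, t, t') \<notin> ?B" for x t t'
    proof -
      have "t < K \<or> t' < K \<or> x - t' < N2 \<or> z - x - t < N1"
      proof (rule ccontr)
        assume "\<not> (t < K \<or> t' < K \<or> x - t' < N2 \<or> z - x - t < N1)"
        hence "K \<le> t" "K \<le> t'" "N2 \<le> x - t'" "N1 \<le> z - x - t" by simp_all
        hence "(x, t, t') \<in> ?B" by simp
        thus False using nx by simp
      qed
      then consider "t < K" | "t' < K" | "x - t' < N2" | "z - x - t < N1" by blast
      hence "sW (q_neg_pow x * fps_const (A_entry (i1, i2) (k1, k2)) *
        (R_cf s (I ! \<mu>, k1) (g, l1) t * R_cf s (g, k2) (g', l2) t')) (X i1 i2 (t + t') (x - t') l1 g' l2) \<in> hpow sW n"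
        for i1 i2 k1 k2 g l1 g' l2
      proof cases
        case 1
        have "sW (q_neg_pow x * fps_const (A_entry (i1, i2) (k1, k2)) * R_cf s (g, k2) (g', l2) t')
          (sW (R_cf s (I ! \<mu>, k1) (g, l1) t) (X i1 i2 (t + t') (x - t') l1 g' l2)) \<in> hpow sW n"
          by (intro hpow_scale K 1)
        thus ?thesis by (simp add: mult_ac)
      next
        case 2
        have "sW (q_neg_pow x * fps_const (A_entry (i1, i2) (k1, k2)) * R_cf s (I ! \<mu>, k1) (g, l1) t)
          (sW (R_cf s (g, k2) (g', l2) t') (X i1 i2 (t + t') (x - t') l1 g' l2)) \<in> hpow sW n"
          by (intro hpow_scale K 2)
        thus ?thesis by (simp add: mult_ac)
      next
        case 3
        show ?thesis unfolding X_def by (intro hpow_scale N2) (use 3 len in \<open>simp_all add: nth_append\<close>)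
      next
        case 4
        show ?thesis unfolding X_def by (intro hpow_scale N1) (use 4 len in \<open>simp_all add: nth_append\<close>)
      qed
      thus ?thesis unfolding H_def by (intro hpow_sum)
    qed
    have "{p \<in> UNIV \<times> UNIV \<times> UNIV. (case p of (x, t, t') \<Rightarrow> H x t t') \<notin> hpow sW n} \<subseteq> ?B"
    proof (intro subsetI, elim CollectE conjE)
      fix p assume p: "(case p of (x, t, t') \<Rightarrow> H x t t') \<notin> hpow sW n"
      obtain x t t' where xt: "p = (x, t, t')" by (cases p)
      show "p \<in> ?B"
        by (rule ccontr) (use p van[of x t t'] in \<open>simp only: xt prod.case simp_thms\<close>)
    qed
    thus "finite {p \<in> UNIV \<times> UNIV \<times> UNIV. (case p of (x, t, t') \<Rightarrow> H x t t') \<notin> hpow sW n}"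
      by (rule finite_subset) (intro finite_SigmaI finite_cartesian_product finite_atLeastAtMost_int)
  qed
  define T0 where "T0 = hsum sW (\<lambda>(x, t, t'). H x t t') (UNIV \<times> UNIV \<times> UNIV)"
  have tot: "has_hsum sW (\<lambda>(x, t, t'). H x t t') (UNIV \<times> UNIV \<times> UNIV) T0"
    unfolding T0_def using summ by (rule has_hsum_hsum)
  have lhs: "has_hsum sW (qtrace_summand S2 I J M z) UNIV T0"
  proof -
    have "hsum sW (\<lambda>(t, t'). H x t t') (UNIV \<times> UNIV) = qtrace_summand S2 I J M z x" for x
    proof -
      have "hsummable (\<lambda>(t, t'). H x t t') (UNIV \<times> UNIV)"
        using hsummable_Sigma_slice[of "\<lambda>x p. case p of (t, t') \<Rightarrow> H x t t'" UNIV "\<lambda>_. UNIV \<times> UNIV" x] summ by simp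
      hence h: "has_hsum sW (\<lambda>(t, t'). H x t t') (UNIV \<times> UNIV) (hsum sW (\<lambda>(t, t'). H x t t') (UNIV \<times> UNIV))"
        by (rule has_hsum_hsum)
      from has_hsum_Sigma[OF h] have "has_hsum sW (\<lambda>t. hsum sW (H x t) UNIV) UNIV (hsum sW (\<lambda>(t, t'). H x t t') (UNIV \<times> UNIV))" .
      hence "has_hsum sW (\<lambda>t. qtrace_summand (\<lambda>I' J' M'. R_summand s \<mu> m S1 I' J' M' t) I J M z x) UNIV (hsum sW (\<lambda>(t, t'). H x t t') (UNIV \<times> UNIV))"
        by (simp only: hsum_eqI[OF inner])
      thus ?thesis using middle has_hsum_unique by blast
    qed
    moreover have "has_hsum sW (\<lambda>x. hsum sW (\<lambda>(t, t'). H x t t') (UNIV \<times> UNIV)) UNIV T0"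
      using has_hsum_Sigma[of "\<lambda>x p. case p of (t, t') \<Rightarrow> H x t t'" UNIV "\<lambda>_. UNIV \<times> UNIV" T0] tot by simp
    ultimately show ?thesis by simp
  qed
  \<comment> \<open>The inverse of the change of the summation indices from \<open>(x, t, t')\<close> to \<open>((u, N), t)\<close>.\<close>
  define \<phi> where "\<phi> = (\<lambda>((u, N), t). (u + N - t, t, N - t) :: int \<times> int \<times> int)"
  have inj: "inj \<phi>" by (auto simp: inj_on_def \<phi>_def)
  have surj: "range \<phi> = UNIV \<times> UNIV \<times> UNIV"
  proof -
    have "(x, t, t') \<in> range \<phi>" for x t t'
      by (rule range_eqI[of _ _ "((x - t', t + t'), t)"]) (simp add: \<phi>_def)
    thus ?thesis by auto
  qed
  have "has_hsum sW (\<lambda>p. case \<phi> p of (x, t, t') \<Rightarrow> H x t t') UNIV T0"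
    using tot unfolding surj[symmetric] has_hsum_reindex[OF inj] .
  hence re: "has_hsum sW (\<lambda>((u, N), t). H (u + N - t) t (N - t)) (UNIV \<times> UNIV) T0"
    by (simp add: \<phi>_def case_prod_unfold)
  have inner2: "has_hsum sW (\<lambda>t. H (u + N - t) t (N - t)) UNIV
     (if N = 0 then qtrace_summand S I J M z u else 0)" for u N
  proof -
    have e: "t + (N - t) = N" "(u + N - t) - (N - t) = u" for t by simp_all
    have "has_hsum sW (\<lambda>t. H (u + N - t) t (N - t)) UNIV (\<Sum>i1\<in>UNIV. \<Sum>i2\<in>UNIV.
       if N = 0 then \<Sum>l1\<in>UNIV. \<Sum>l2\<in>UNIV. sW (q_neg_pow u * fps_const (A_entry (i1, i2) (l1, l2))) (X i1 i2 N u l1 (I ! \<mu>) l2) else 0)"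
      unfolding H_def e by (intro has_hsum_sum fusion_coefficients s)
    moreover have "(\<Sum>i1\<in>UNIV. \<Sum>i2\<in>UNIV.
       if N = 0 then \<Sum>l1\<in>UNIV. \<Sum>l2\<in>UNIV. sW (q_neg_pow u * fps_const (A_entry (i1, i2) (l1, l2))) (X i1 i2 N u l1 (I ! \<mu>) l2) else 0)
      = (if N = 0 then qtrace_summand S I J M z u else 0)"
      by (cases "N = 0") (simp_all add: qtrace_summand_def X_def scale_sum_right)
    ultimately show ?thesis by simp
  qed
  have "has_hsum sW (\<lambda>p. hsum sW (\<lambda>t. case p of (u, N) \<Rightarrow> H (u + N - t) t (N - t)) UNIV) UNIV T0"
    using has_hsum_Sigma[of "\<lambda>p t. case p of (u, N) \<Rightarrow> H (u + N - t) t (N - t)" UNIV "\<lambda>_. UNIV" T0] re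
    by (simp add: case_prod_unfold)
  moreover have "hsum sW (\<lambda>t. case p of (u, N) \<Rightarrow> H (u + N - t) t (N - t)) UNIV
      = (case p of (u, N) \<Rightarrow> if N = 0 then qtrace_summand S I J M z u else 0)" for p
    using hsum_eqI[OF inner2] by (cases p) simp
  ultimately have fin1: "has_hsum sW (\<lambda>(u :: int, N :: int). if N = 0 then qtrace_summand S I J M z u else 0) UNIV T0" by (simp only:)
  let ?g = "\<lambda>u::int. (u, 0::int)"
  have "has_hsum sW (\<lambda>u. case ?g u of (u, N) \<Rightarrow> if N = 0 then qtrace_summand S I J M z u else 0) UNIV (qtrace S z I J M)"
    using has_hsum_qtrace[OF u len] by simp
  hence "has_hsum sW (\<lambda>(u, N). if N = 0 then qtrace_summand S I J M z u else 0) (range ?g) (qtrace S z I J M)"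
    by (subst has_hsum_reindex) (auto simp: inj_on_def)
  hence fin2: "has_hsum sW (\<lambda>(u :: int, N :: int). if N = 0 then qtrace_summand S I J M z u else 0) UNIV (qtrace S z I J M)"
    by (rule has_hsum_support) auto
  have "T0 = qtrace S z I J M" using fin1 fin2 by (rule has_hsum_unique)
  moreover have "qtrace S2 z I J M = T0" unfolding qtrace_def by (rule hsum_eqI[OF lhs])
  ultimately show ?thesis by (simp add: S2_def S1_def)
qed

end

section \<open>The products of the operators\<close>

text \<open>
  The part of the product of R-matrices in \<open>\<L>\<^sub>[\<^sub>n\<^sub>]\<close> whose first index is at least \<open>a\<close>.
\<close>
definition R_pairs :: "nat \<Rightarrow> nat \<Rightarrow> (nat \<times> nat) list" where
  "R_pairs a n = concat (map (\<lambda>\<mu>. map (Pair \<mu>) [Suc \<mu>..<n]) [a..<n])"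

lemma L_br_R_pairs: "L_br sW R L n w = foldr (R_act sW R) (R_pairs 0 n) (L_prod L w)"
  by (simp add: L_br_def R_pairs_def)

lemma R_pairs_rec: "a < n \<Longrightarrow> R_pairs a n = map (Pair a) [Suc a..<n] @ R_pairs (Suc a) n"
  by (simp add: R_pairs_def upt_conv_Cons)

lemma R_pairs_self: "R_pairs n n = []" by (simp add: R_pairs_def)

lemma R_pairs_base: "R_pairs m (m + 2) = [(m, m + 1)]"
  by (simp add: R_pairs_def upt_rec)

lemma R_pairs_rec2: "a < m \<Longrightarrow> R_pairs a (m + 2) = map (Pair a) [Suc a..<m] @ [(a, m), (a, m + 1)] @ R_pairs (Suc a) (m + 2)"
proof -
  assume a: "a < m"
  have "[Suc a..<m + 2] = [Suc a..<m] @ [m, m + 1]"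
    using a upt_add_eq_append[of "Suc a" m 2] by (simp add: upt_rec[of m])
  thus ?thesis using a by (subst R_pairs_rec) auto
qed

text \<open>
  An operator with the property that makes the products \<open>\<L>\<^sub>[\<^sub>n\<^sub>]\<close> meaningful, together with \<open>s = p\<^bsup>1/2\<^esup>\<close>.
\<close>
locale frt = hadic sW for sW :: "complex fps \<Rightarrow> 'w::ab_group_add \<Rightarrow> 'w" +
  fixes L :: "2 \<Rightarrow> 2 \<Rightarrow> int \<Rightarrow> 'w \<Rightarrow> 'w" and s :: "complex fps"
  assumes lau: "laurent_hom sW (L i j)" and s0: "s $ 0 = 0"
begin

lemma L_add: "L i j m (x + y) = L i j m x + L i j m y"
  and L_scale: "L i j m (sW c x) = sW c (L i j m x)"
  using lau unfolding laurent_hom_def module_hom_def module_hom_axioms_def by auto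

lemma L_hpow: "x \<in> hpow sW n \<Longrightarrow> L i j m x \<in> hpow sW n"
  unfolding hpow_def by (auto simp: L_scale)

lemma L_prod_add: "L_prod L (x + y) I J M = L_prod L x I J M + L_prod L y I J M"
  if "length I = length J" "length J = length M"
  using that by (induction I J M rule: list_induct3) (auto simp: L_add)

lemma L_prod_scale: "L_prod L (sW c x) I J M = sW c (L_prod L x I J M)"
  if "length I = length J" "length J = length M"
  using that by (induction I J M rule: list_induct3) (auto simp: L_scale)

lemma L_prod_append:
  assumes "length I = length J" "length J = length M"
  shows "L_prod L w (I @ I') (J @ J') (M @ M') = L_prod L (L_prod L w I' J' M') I J M"
  using assms by (induction I J M rule: list_induct3) auto

text \<open>
  The first operator acts last, on the finitely many elements obtained for fixed exponents of
  the others; for those its lower bounds are uniform.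
\<close>
lemma iter_laurent_L_prod: "iter_laurent p (L_prod L w)"
proof (induction p)
  case 0
  show ?case by (simp add: iter_laurent_def)
next
  case (Suc p)
  show ?case
    unfolding iter_laurent_def
  proof (intro allI impI)
    fix n a M0 assume a: "a < Suc p" and M0: "length (M0 :: int list) = Suc p"
    then obtain m0 M0' where M0': "M0 = m0 # M0'" "length M0' = p" by (cases M0) auto
    show "\<exists>N. \<forall>I J M. length I = Suc p \<and> length J = Suc p \<and> length M = Suc p \<and>
      (\<forall>j. a < j \<and> j < Suc p \<longrightarrow> M ! j = M0 ! j) \<and> M ! a < N \<longrightarrow> L_prod L w I J M \<in> hpow sW n"
    proof (cases a)
      case (Suc a')
      obtain N where N: "\<And>I J M. length I = p \<Longrightarrow> length J = p \<Longrightarrow> length M = p \<Longrightarrow>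
        (\<And>j. a' < j \<Longrightarrow> j < p \<Longrightarrow> M ! j = M0' ! j) \<Longrightarrow> M ! a' < N \<Longrightarrow> L_prod L w I J M \<in> hpow sW n"
        using clsD[OF Suc.IH, of a' M0' n] a Suc M0'(2) by auto
      show ?thesis
      proof (intro exI[of _ N] allI impI, elim conjE)
        fix I J :: "2 list" and M :: "int list"
        assume len: "length I = Suc p" "length J = Suc p" "length M = Suc p"
          and tail: "\<forall>j. a < j \<and> j < Suc p \<longrightarrow> M ! j = M0 ! j" and Ma: "M ! a < N"
        obtain i I' where I: "I = i # I'" "length I' = p" using len(1) by (cases I) auto
        obtain j J' where J: "J = j # J'" "length J' = p" using len(2) by (cases J) auto
        obtain k M' where M: "M = k # M'" "length M' = p" using len(3) by (cases M) auto
        have "L_prod L w I' J' M' \<in> hpow sW n"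
        proof (rule N)
          fix b assume "a' < b" "b < p"
          thus "M' ! b = M0' ! b" using tail[rule_format, of "Suc b"] Suc M M0' by simp
        qed (use Ma Suc I J M in auto)
        thus "L_prod L w I J M \<in> hpow sW n" using I J M by (simp add: L_hpow)
      qed
    next
      case 0
      have f: "finite {I :: 2 list. length I = p}"
        using finite_lists_length_eq[of "UNIV :: 2 set" p] by simp
      let ?Y = "(\<lambda>(I, J). L_prod L w I J M0') ` ({I. length I = p} \<times> {J. length J = p})"
      have fY: "finite ?Y" using f by simp
      have "\<exists>N. \<forall>y i j. \<forall>k<N. y \<in> Y \<longrightarrow> L i j k y \<in> hpow sW n" if "finite Y" for Y
        using that
      proof (induction Y)
        case (insert y Y)
        then obtain N where N: "\<forall>y i j. \<forall>k<N. y \<in> Y \<longrightarrow> L i j k y \<in> hpow sW n" by blast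
        have "\<exists>d. \<forall>p. \<forall>t<d. L (fst p) (snd p) t y \<in> hpow sW n"
          by (rule finite_uniform_bound) (use lau in \<open>auto simp: laurent_hom_def\<close>)
        then obtain d where d: "\<forall>p. \<forall>t<d. L (fst p) (snd p) t y \<in> hpow sW n" by blast
        hence "L i j t y \<in> hpow sW n" if "t < d" for i j t using that spec[OF d, of "(i, j)"] by simp
        thus ?case using N by (intro exI[of _ "min N d"]) auto
      qed simp
      from this[OF fY] obtain N where N: "\<forall>y i j. \<forall>k<N. y \<in> ?Y \<longrightarrow> L i j k y \<in> hpow sW n" by blast
      show ?thesis
      proof (intro exI[of _ N] allI impI, elim conjE)
        fix I J :: "2 list" and M :: "int list"
        assume len: "length I = Suc p" "length J = Suc p" "length M = Suc p"
          and tail: "\<forall>j. a < j \<and> j < Suc p \<longrightarrow> M ! j = M0 ! j" and Ma: "M ! a < N"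
        obtain i I' where I: "I = i # I'" "length I' = p" using len(1) by (cases I) auto
        obtain j J' where J: "J = j # J'" "length J' = p" using len(2) by (cases J) auto
        obtain k M' where M: "M = k # M'" "length M' = p" using len(3) by (cases M) auto
        have "M' = M0'"
        proof (rule nth_equalityI)
          fix b assume "b < length M'"
          thus "M' ! b = M0' ! b" using tail[rule_format, of "Suc b"] 0 M M0' by simp
        qed (simp add: M M0')
        moreover have "k < N" using Ma 0 M by simp
        moreover have "L_prod L w I' J' M0' \<in> ?Y" using I J by (auto intro!: image_eqI[of _ _ "(I', J')"])
        ultimately show "L_prod L w I J M \<in> hpow sW n" using N I J M by simp
      qed
    qed
  qed
qed

end

lemma powi_exp: "fps_exp (- 1 / 2) powi m = q_neg_pow m"
proof (cases "m \<ge> 0")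
  case True
  thus ?thesis by (simp add: power_int_def q_neg_pow_def fps_exp_power_mult)
next
  case False
  hence "inverse (fps_exp (- 1 / 2 :: complex)) ^ nat (- m) = fps_exp (of_nat (nat (- m)) * (1 / 2))"
    by (simp add: fps_exp_neg[symmetric] fps_exp_power_mult)
  also have "of_nat (nat (- m)) * (1 / 2) = - ((of_int m :: complex) / 2)"
    using False by (simp add: of_nat_nat)
  finally show ?thesis using False by (simp add: power_int_def q_neg_pow_def)
qed

lemma append_last_two:
  assumes "length xs = m + 2"
  obtains ys a b where "xs = ys @ [a, b]" "length ys = m"
proof -
  have "drop m xs = [xs ! m, xs ! (m + 1)]"
    using assms by (simp add: Cons_nth_drop_Suc[symmetric] numeral_2_eq_2)
  hence "xs = take m xs @ [xs ! m, xs ! (m + 1)]" by (metis append_take_drop_id)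
  thus ?thesis using that[of "take m xs"] assms by simp
qed

context frt
begin

abbreviation Ract :: "nat \<times> nat \<Rightarrow> 'w tseries \<Rightarrow> 'w tseries" where "Ract \<equiv> R_act sW (ell_R s)"

lemma L_br_2: "L_br sW R L 2 w = R_act sW R (0, 1) (L_prod L w)"
  using R_pairs_base[of 0] by (simp add: L_br_R_pairs numeral_2_eq_2)

lemma L_prod_0: "length I = length J \<Longrightarrow> length J = length M \<Longrightarrow> L_prod L 0 I J M = 0"
  using L_prod_scale[of I J M 0 0] by simp

text \<open>
  The operators at the first \<open>m\<close> positions are linear over \<open>\<complex>[[h]]\<close>, hence commute with the
  multiplication by \<open>R\<^sub>m\<^sub>,\<^sub>m\<^sub>+\<^sub>1\<close>, which then combines with the last two operators to \<open>\<L>\<^sub>[\<^sub>2\<^sub>]\<close>.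
\<close>
lemma L_br_append:
  assumes len: "length I = m" "length J = m" "length M = m"
  shows "Ract (m, m + 1) (L_prod L w) (I @ [k1, k2]) (J @ [i1, i2]) (M @ [a, b])
    = L_prod L (L_br sW (ell_R s) L 2 w [k1, k2] [i1, i2] [a, b]) I J M"
proof (rule R_act_eq)
  have "has_hsum sW (R_summand s 0 1 (L_prod L w) [k1, k2] [i1, i2] [a, b]) UNIV
      (L_br sW (ell_R s) L 2 w [k1, k2] [i1, i2] [a, b])"
    unfolding L_br_2 by (rule has_hsum_R_act[OF iter_laurent_L_prod[of 2]]) auto
  hence "has_hsum sW (\<lambda>t. L_prod L (R_summand s 0 1 (L_prod L w) [k1, k2] [i1, i2] [a, b] t) I J M) UNIV
      (L_prod L (L_br sW (ell_R s) L 2 w [k1, k2] [i1, i2] [a, b]) I J M)"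
    by (rule has_hsum_map[OF hadic_axioms hadic_axioms]) (use len in \<open>auto intro!: L_prod_add L_prod_scale\<close>)
  moreover have "L_prod L (R_summand s 0 1 (L_prod L w) [k1, k2] [i1, i2] [a, b] t) I J M
      = R_summand s m (m + 1) (L_prod L w) (I @ [k1, k2]) (J @ [i1, i2]) (M @ [a, b]) t" for t
    unfolding R_summand_def sum_2 using len
    by (simp add: L_prod_add L_prod_scale L_prod_append nth_append list_update_append)
  ultimately show "has_hsum sW (R_summand s m (m + 1) (L_prod L w) (I @ [k1, k2]) (J @ [i1, i2]) (M @ [a, b])) UNIV
      (L_prod L (L_br sW (ell_R s) L 2 w [k1, k2] [i1, i2] [a, b]) I J M)" by simp
qed

lemma iter_laurent_L_br_2: "iter_laurent (m + 2) (Ract (m, m + 1) (L_prod L w))"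
  by (intro iter_laurent_R_act iter_laurent_L_prod) auto

lemma invariantD:
  assumes "w \<in> invariants sW R L" "length I = n" "length J = n" "length M = n" "m \<in> set M" "m < 0"
  shows "L_br sW R L n w I J M = 0"
proof -
  have "n \<ge> 1" using assms by (cases n) auto
  thus ?thesis using assms unfolding invariants_def by blast
qed

text \<open>
  Invariance of \<open>w\<close> for two operators bounds both exponents below by \<open>0\<close>.
\<close>
lemma lower_bounded_base:
  assumes w: "w \<in> invariants sW (ell_R s) L"
  shows "lower_bounded (m + 2) m (Ract (m, m + 1) (L_prod L w))"
    and "lower_bounded (m + 2) (m + 1) (Ract (m, m + 1) (L_prod L w))"
proof -
  have *: "Ract (m, m + 1) (L_prod L w) I J M = 0"
    if len: "length I = m + 2" "length J = m + 2" "length M = m + 2" and neg: "M ! m < 0 \<or> M ! (m + 1) < 0" for I J M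
  proof -
    obtain I' k1 k2 where I: "I = I' @ [k1, k2]" "length I' = m" using len(1) by (rule append_last_two)
    obtain J' i1 i2 where J: "J = J' @ [i1, i2]" "length J' = m" using len(2) by (rule append_last_two)
    obtain M' a b where M: "M = M' @ [a, b]" "length M' = m" using len(3) by (rule append_last_two)
    have "a < 0 \<or> b < 0" using neg M by (simp add: nth_append)
    hence "L_br sW (ell_R s) L 2 w [k1, k2] [i1, i2] [a, b] = 0"
      by (elim disjE) (rule invariantD[OF w, of _ _ _ _ a] invariantD[OF w, of _ _ _ _ b]; simp)+
    thus ?thesis using I J M by (simp add: L_br_append[OF I(2) J(2) M(2), simplified] L_prod_0)
  qed
  show "lower_bounded (m + 2) m (Ract (m, m + 1) (L_prod L w))"
    "lower_bounded (m + 2) (m + 1) (Ract (m, m + 1) (L_prod L w))"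
    unfolding lower_bounded_def by (intro allI exI[of _ 0]; use * in simp)+
qed

lemma tr_A_L2_eq: "tr_A_L2 sW (ell_R s) L w z = qtrace (L_br sW (ell_R s) L 2 w) z [] [] []"
proof -
  let ?f = "\<lambda>m::int. (z - m, m)"
  let ?B = "L_br sW (ell_R s) L 2 w"
  let ?g = "\<lambda>(m1, m2). sW (fps_exp (- 1 / 2) powi m2)
         (\<Sum>(i1, i2)\<in>UNIV. \<Sum>(k1, k2)\<in>UNIV.
            sW (fps_const (A_entry (i1, i2) (k1, k2)))
              (?B [k1, k2] [i1, i2] [m1, m2]))"
  have inj: "inj_on ?f UNIV" by (auto simp: inj_on_def)
  have "{(m1, m2). m1 + m2 = z} = range ?f"
  proof (intro set_eqI iffI)
    fix p assume "p \<in> {(m1, m2). m1 + m2 = z}"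
    thus "p \<in> range ?f" by (intro range_eqI[of _ _ "snd p"]) auto
  qed auto
  hence "has_hsum sW ?g {(m1, m2). m1 + m2 = z} x \<longleftrightarrow> has_hsum sW (qtrace_summand ?B [] [] [] z) UNIV x" for x
    by (simp add: has_hsum_reindex[OF inj] qtrace_summand_def[abs_def] powi_exp[simplified] sum_pair)
  thus ?thesis unfolding tr_A_L2_def qtrace_def hsum_def by (intro arg_cong[of _ _ The] ext)
qed

lemma qtrace_base:
  assumes w: "w \<in> invariants sW (ell_R s) L" and len: "length I = m" "length J = m" "length M = m"
  shows "qtrace (Ract (m, m + 1) (L_prod L w)) z I J M = L_prod L (tr_A_L2 sW (ell_R s) L w z) I J M"
proof -
  let ?B = "L_br sW (ell_R s) L 2 w"
  have "lower_bounded (0 + 2) 0 ?B" "lower_bounded (0 + 2) (0 + 1) ?B"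
    using lower_bounded_base[OF w, of 0] by (simp_all only: L_br_2 add_0)
  hence "has_hsum sW (qtrace_summand ?B [] [] [] z) UNIV (qtrace ?B z [] [] [])" by (rule has_hsum_qtrace) simp_all
  hence "has_hsum sW (\<lambda>x. L_prod L (qtrace_summand ?B [] [] [] z x) I J M) UNIV (L_prod L (qtrace ?B z [] [] []) I J M)"
    by (rule has_hsum_map[OF hadic_axioms hadic_axioms]) (use len in \<open>auto intro!: L_prod_add L_prod_scale\<close>)
  moreover have "L_prod L (qtrace_summand ?B [] [] [] z x) I J M = qtrace_summand (Ract (m, m + 1) (L_prod L w)) I J M z x" for x
    unfolding qtrace_summand_def sum_2 L_br_append[OF len]
    using len by (simp add: L_prod_add L_prod_scale)
  ultimately show ?thesis unfolding tr_A_L2_eq qtrace_def by (simp add: hsum_eqI)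
qed

text \<open>
  The R-matrices \<open>R\<^sub>a\<^sub>\<nu>\<close> with \<open>\<nu> < m\<close> are moved out of the trace one by one.
\<close>
lemma qtrace_row:
  assumes S: "iter_laurent (m + 2) S" and u: "lower_bounded (m + 2) m S" "lower_bounded (m + 2) (m + 1) S"
    and ns: "\<And>\<nu>. \<nu> \<in> set ns \<Longrightarrow> a < \<nu> \<and> \<nu> < m"
    and T: "\<And>I J M. length I = m \<Longrightarrow> length J = m \<Longrightarrow> length M = m \<Longrightarrow> qtrace S z I J M = S' I J M"
  defines "SQ \<equiv> foldr Ract (map (Pair a) ns) S"
  shows "iter_laurent (m + 2) SQ \<and> lower_bounded (m + 2) m SQ \<and> lower_bounded (m + 2) (m + 1) SQ \<and>
    (\<forall>I J M. length I = m \<and> length J = m \<and> length M = m \<longrightarrow>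
      qtrace SQ z I J M = foldr Ract (map (Pair a) ns) S' I J M)"
  unfolding SQ_def using ns
proof (induction ns)
  case Nil
  thus ?case using S u T by simp
next
  case (Cons \<nu> ns)
  let ?S = "foldr Ract (map (Pair a) ns) S"
  have \<nu>: "a < \<nu>" "\<nu> < m" using Cons.prems by auto
  have IH: "iter_laurent (m + 2) ?S" "lower_bounded (m + 2) m ?S" "lower_bounded (m + 2) (m + 1) ?S"
    "\<And>I J M. length I = m \<Longrightarrow> length J = m \<Longrightarrow> length M = m \<Longrightarrow>
      qtrace ?S z I J M = foldr Ract (map (Pair a) ns) S' I J M"
    using Cons by auto
  have "qtrace (Ract (a, \<nu>) ?S) z I J M = Ract (a, \<nu>) (foldr Ract (map (Pair a) ns) S') I J M"
    if "length I = m" "length J = m" "length M = m" for I J M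
    unfolding qtrace_R_act[OF IH(1-3) \<nu> that] by (rule R_act_cong[OF IH(4) that])
  thus ?case using \<nu> IH by (auto intro!: iter_laurent_R_act lower_bounded_R_act)
qed

text \<open>
  Induction on the row \<open>a\<close> of R-matrices, starting from the last one. In each row the factors
  \<open>R\<^sub>a\<^sub>,\<^sub>m R\<^sub>a\<^sub>,\<^sub>m\<^sub>+\<^sub>1\<close> stand next to the rows already treated and disappear by fusion; the other factors
  leave the trace. For \<open>a = 0\<close> this is \<open>tr A \<L>\<^sub>[\<^sub>m\<^sub>+\<^sub>2\<^sub>] w = \<L>\<^sub>[\<^sub>m\<^sub>] u\<close> for the coefficients \<open>u\<close> of
  \<open>tr A \<L>\<^sub>[\<^sub>2\<^sub>] w\<close>.
\<close>
lemma qtrace_L_br_rows: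
  assumes w: "w \<in> invariants sW (ell_R s) L" and "a \<le> m"
  defines "SQ \<equiv> \<lambda>a. foldr Ract (R_pairs a (m + 2)) (L_prod L w)"
  shows "iter_laurent (m + 2) (SQ a) \<and> lower_bounded (m + 2) m (SQ a) \<and> lower_bounded (m + 2) (m + 1) (SQ a) \<and>
    (\<forall>I J M. length I = m \<and> length J = m \<and> length M = m \<longrightarrow>
      qtrace (SQ a) z I J M = foldr Ract (R_pairs a m) (L_prod L (tr_A_L2 sW (ell_R s) L w z)) I J M)"
  using \<open>a \<le> m\<close>
proof (induction rule: inc_induct)
  case base
  have "SQ m = Ract (m, m + 1) (L_prod L w)" unfolding SQ_def R_pairs_base by simp
  thus ?case using iter_laurent_L_br_2 lower_bounded_base[OF w] qtrace_base[OF w] by (simp add: R_pairs_self)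
next
  case (step a)
  let ?S = "SQ (Suc a)" and ?u = "tr_A_L2 sW (ell_R s) L w z"
  let ?T = "Ract (a, m) (Ract (a, m + 1) ?S)"
  have S: "iter_laurent (m + 2) ?S" "lower_bounded (m + 2) m ?S" "lower_bounded (m + 2) (m + 1) ?S" using step.IH by auto
  have c1: "iter_laurent (m + 2) (Ract (a, m + 1) ?S)" using step.hyps by (intro iter_laurent_R_act S) auto
  have c2: "lower_bounded (m + 2) m (Ract (a, m + 1) ?S)" "lower_bounded (m + 2) (m + 1) (Ract (a, m + 1) ?S)"
    by (rule lower_bounded_R_act[OF S(1) S(2)] lower_bounded_R_act[OF S(1) S(3)]; use step.hyps in simp)+
  have T: "iter_laurent (m + 2) ?T" "lower_bounded (m + 2) m ?T" "lower_bounded (m + 2) (m + 1) ?T"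
    by (rule iter_laurent_R_act[OF c1] lower_bounded_R_act[OF c1 c2(1)] lower_bounded_R_act[OF c1 c2(2)]; use step.hyps in simp)+
  have "SQ a = foldr Ract (map (Pair a) [Suc a..<m]) ?T"
    unfolding SQ_def R_pairs_rec2[OF step.hyps(2)] by simp
  moreover have "R_pairs a m = map (Pair a) [Suc a..<m] @ R_pairs (Suc a) m" using step.hyps by (simp add: R_pairs_rec)
  moreover have "qtrace ?T z I J M = foldr Ract (R_pairs (Suc a) m) (L_prod L ?u) I J M"
    if "length I = m" "length J = m" "length M = m" for I J M
    using qtrace_fusion[OF s0 S step.hyps(2) that] step.IH that by auto
  ultimately show ?case
    using qtrace_row[OF T, of "[Suc a..<m]" a z "foldr Ract (R_pairs (Suc a) m) (L_prod L ?u)"] by auto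
qed

text \<open>
  A coefficient of \<open>\<L>\<^sub>[\<^sub>n\<^sub>] u\<close> with a negative exponent is an \<open>h\<close>-adic combination of coefficients of
  \<open>\<L>\<^sub>[\<^sub>n\<^sub>+\<^sub>2\<^sub>] w\<close> with the same negative exponent.
\<close>
theorem tr_A_L2_invariant:
  assumes w: "w \<in> invariants sW (ell_R s) L"
  shows "tr_A_L2 sW (ell_R s) L w z \<in> invariants sW (ell_R s) L"
  unfolding invariants_def
proof (intro CollectI allI impI, elim conjE bexE)
  fix n and I J :: "2 list" and M :: "int list" and m assume len: "length I = n" "length J = n" "length M = n" and m: "m \<in> set M" "m < (0 :: int)"
  have "qtrace_summand (L_br sW (ell_R s) L (n + 2) w) I J M z x = 0" for x
    unfolding qtrace_summand_def by (subst invariantD[OF w, of _ "n + 2" _ _ m]) (use len m in auto)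
  hence "qtrace (L_br sW (ell_R s) L (n + 2) w) z I J M = 0"
    unfolding qtrace_def by (intro hsum_eqI) (simp add: has_hsum_zero cong: has_hsum_cong)
  thus "L_br sW (ell_R s) L n (tr_A_L2 sW (ell_R s) L w z) I J M = 0"
    using qtrace_L_br_rows[OF w, of 0 n z] len by (simp add: L_br_R_pairs)
qed

text \<open>
  By invariance of \<open>w\<close> the sum in the characterisation of \<open>Y\<close> extends over nonnegative exponents
  \<open>(z - x, x)\<close> only; \<open>x\<^sup>t/t!\<close> is the coefficient of \<open>u\<^sub>2\<^sup>t\<close> in \<open>e\<^bsup>x u\<^sub>2\<^esup>\<close>.
\<close>
lemma Y_quadratic:
  assumes Y: "coord_map sW sV l (ell_R s) L Y" and w: "w \<in> invariants sW (ell_R s) L"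
  shows "Y (l (0, k1, i1) * l (t, k2, i2)) z w =
    (\<Sum>x\<in>{0..z}. sW (fps_const (of_int x ^ t / fact t)) (L_br sW (ell_R s) L 2 w [k1, k2] [i1, i2] [z - x, x]))"
proof -
  let ?B = "L_br sW (ell_R s) L 2 w [k1, k2] [i1, i2]"
  let ?c = "\<lambda>M. fps_const (\<Prod>k<2. fps_exp (of_int (M ! k) :: complex) $ ([0, t] ! k))"
  let ?f = "\<lambda>x. [z - x, x]"
  have "Y (prod_list (map l (zip [0, t] (zip [k1, k2] [i1, i2])))) z w =
    hsum sW (\<lambda>M. sW (?c M) (?B M)) {M. length M = 2 \<and> sum_list M = z}"
    using Y unfolding coord_map_def by (elim conjE allE[of _ 2]) (simp del: zip_Cons_Cons)
  moreover have "has_hsum sW (\<lambda>M. sW (?c M) (?B M)) {M. length M = 2 \<and> sum_list M = z}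
      (\<Sum>M\<in>?f ` {0..z}. sW (?c M) (?B M))"
  proof (rule has_hsum_finite_support)
    fix M assume M: "M \<in> {M. length M = 2 \<and> sum_list M = z} - ?f ` {0..z}"
    then obtain a b where ab: "M = [a, b]" by (auto simp: numeral_2_eq_2 length_Suc_conv)
    hence "z = a + b" "b \<notin> {0..z}" using M by auto
    hence "a < 0 \<or> b < 0" by auto
    hence "?B M = 0" unfolding ab
      by (elim disjE) (rule invariantD[OF w, of _ _ _ _ a] invariantD[OF w, of _ _ _ _ b]; simp)+
    thus "sW (?c M) (?B M) = 0" by simp
  qed auto
  moreover have "(\<Sum>M\<in>?f ` {0..z}. sW (?c M) (?B M)) = (\<Sum>x\<in>{0..z}. sW (?c (?f x)) (?B (?f x)))"
    by (subst sum.reindex) (auto simp: inj_on_def)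
  ultimately show ?thesis by (simp add: hsum_eqI numeral_2_eq_2)
qed

text \<open>
  The sum over \<open>t\<close> of \<open>(- h/2)\<^sup>t x\<^sup>t/t!\<close> is \<open>e\<^bsup>- x h/2\<^esup> = q\<^sup>-\<^sup>x\<close>, the value of the second variable raised to
  the power \<open>x\<close>.
\<close>
lemma Y_qdet:
  assumes V: "hadic sV" and Y: "coord_map sW sV l (ell_R s) L Y" and w: "w \<in> invariants sW (ell_R s) L"
  shows "Y (qdet_coeff sV l 0) z w = tr_A_L2 sW (ell_R s) L w z"
proof -
  interpret V: hadic sV by fact
  let ?B = "L_br sW (ell_R s) L 2 w"
  let ?h = "- (fps_const (1 / 2) * fps_X) :: complex fps"
  have add: "Y (v + v') z w = Y v z w + Y v' z w" and scale: "Y (sV x v) z w = sW x (Y v z w)" for v v' x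
    using Y unfolding coord_map_def by auto
  define D where "D k1 k2 i1 i2 = hsum sV (\<lambda>t. sV (?h ^ t) (l (0, k1, i1) * l (t, k2, i2))) UNIV" for k1 k2 i1 i2
  have h_nth: "?h ^ t = fps_const ((- 1 / 2) ^ t) * fps_X ^ t" for t
  proof -
    have "?h = fps_const (- 1 / 2) * fps_X" by (simp add: fps_eq_iff)
    thus ?thesis by (simp only: power_mult_distrib fps_const_power)
  qed
  have qdet: "qdet_coeff sV l 0 = (\<Sum>i1\<in>UNIV. \<Sum>i2\<in>UNIV. \<Sum>k1\<in>UNIV. \<Sum>k2\<in>UNIV.
      sV (fps_const (A_entry (i1, i2) (k1, k2))) (D k1 k2 i1 i2))"
    unfolding qdet_coeff_def D_def by (simp add: sum_pair coeff_0_power)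
  have YD: "Y (D k1 k2 i1 i2) z w = (\<Sum>x\<in>{0..z}. sW (q_neg_pow x) (?B [k1, k2] [i1, i2] [z - x, x]))" for k1 k2 i1 i2
  proof -
    have "V.hsummable (\<lambda>t. sV (?h ^ t) (l (0, k1, i1) * l (t, k2, i2))) UNIV"
      unfolding V.hsummable_def
    proof
      fix n
      have "sV (?h ^ t) y \<in> hpow sV n" if "t \<ge> n" for t y
        using that by (intro V.hpow_scale_left) (simp add: h_nth fps_X_power_iff)
      hence "{t \<in> UNIV. sV (?h ^ t) (l (0, k1, i1) * l (t, k2, i2)) \<notin> hpow sV n} \<subseteq> {..<n}"
        by (intro subsetI, elim CollectE conjE) (meson lessThan_iff linorder_le_less_linear)
      thus "finite {t \<in> UNIV. sV (?h ^ t) (l (0, k1, i1) * l (t, k2, i2)) \<notin> hpow sV n}"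
        by (rule finite_subset) simp
    qed
    hence "has_hsum sV (\<lambda>t. sV (?h ^ t) (l (0, k1, i1) * l (t, k2, i2))) UNIV (D k1 k2 i1 i2)"
      unfolding D_def by (rule V.has_hsum_hsum)
    hence "has_hsum sW (\<lambda>t. Y (sV (?h ^ t) (l (0, k1, i1) * l (t, k2, i2))) z w) UNIV (Y (D k1 k2 i1 i2) z w)"
      by (rule has_hsum_map[OF V hadic_axioms]) (simp_all add: add scale)
    hence 1: "has_hsum sW (\<lambda>t. \<Sum>x\<in>{0..z}. sW (?h ^ t * fps_const (of_int x ^ t / fact t))
        (?B [k1, k2] [i1, i2] [z - x, x])) UNIV (Y (D k1 k2 i1 i2) z w)"
      by (simp add: scale Y_quadratic[OF Y w] scale_sum_right)
    have "has_hsum sW (\<lambda>t. \<Sum>x\<in>{0..z}. sW (?h ^ t * fps_const (of_int x ^ t / fact t))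
        (?B [k1, k2] [i1, i2] [z - x, x])) UNIV (\<Sum>x\<in>{0..z}. sW (q_neg_pow x) (?B [k1, k2] [i1, i2] [z - x, x]))"
    proof (intro has_hsum_sum has_hsum_scalars)
      fix x :: int and k
      have nth: "(?h ^ t * fps_const (of_int x ^ t / fact t)) $ k = (if t = k then q_neg_pow x $ k else 0)" for t
        by (simp add: h_nth fps_X_power_iff q_neg_pow_def power_minus' power_divide)
      have sub: "{t \<in> UNIV. (?h ^ t * fps_const (of_int x ^ t / fact t)) $ k \<noteq> 0} \<subseteq> {k}"
        unfolding nth by auto
      thus "finite {t \<in> UNIV. (?h ^ t * fps_const (of_int x ^ t / fact t)) $ k \<noteq> 0}"
        by (rule finite_subset) simp
      show "q_neg_pow x $ k = (\<Sum>t\<in>{t \<in> UNIV. (?h ^ t * fps_const (of_int x ^ t / fact t)) $ k \<noteq> 0}.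
          (?h ^ t * fps_const (of_int x ^ t / fact t)) $ k)"
        unfolding nth by (cases "q_neg_pow x $ k = 0") (auto simp: if_distrib cong: if_cong)
    qed
    with 1 show ?thesis by (rule has_hsum_unique)
  qed
  have "has_hsum sW (qtrace_summand ?B [] [] [] z) UNIV (\<Sum>x\<in>{0..z}. qtrace_summand ?B [] [] [] z x)"
  proof (rule has_hsum_finite_support)
    fix x assume "x \<in> UNIV - {0..z}"
    hence "z - x < 0 \<or> x < 0" by auto
    hence "?B [k1, k2] [i1, i2] [z - x, x] = 0" for k1 k2 i1 i2
      by (elim disjE) (rule invariantD[OF w, of _ _ _ _ "z - x"] invariantD[OF w, of _ _ _ _ x]; simp)+
    thus "qtrace_summand ?B [] [] [] z x = 0" by (simp add: qtrace_summand_def)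
  qed auto
  hence tr: "tr_A_L2 sW (ell_R s) L w z = (\<Sum>x\<in>{0..z}. qtrace_summand ?B [] [] [] z x)"
    unfolding tr_A_L2_eq qtrace_def by (rule hsum_eqI)
  show ?thesis
    unfolding tr qdet qtrace_summand_def sum_2 add scale YD
    by (simp add: scale_sum_right sum.distrib scale_right_distrib mult.commute)
qed

end

theorem theorem7p4:
  fixes a :: real and b :: nat and c :: complex
    and sW :: "complex fps \<Rightarrow> 'w::ab_group_add \<Rightarrow> 'w"
    and L :: "2 \<Rightarrow> 2 \<Rightarrow> int \<Rightarrow> 'w \<Rightarrow> 'w"
    and sV :: "complex fps \<Rightarrow> 'v::ring_1 \<Rightarrow> 'v"
    and l :: "gen \<Rightarrow> 'v"
    and Y :: "'v \<Rightarrow> int \<Rightarrow> 'w \<Rightarrow> 'w"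
    and w :: 'w
  assumes "a > 0" and "b > 0"
    and "topologically_free sW"
    and "frt_operator sW (R_ell a b) (R_ell_star a b c) L"
    and "is_VR (R_ell a b) (R_ell_star a b c) sV l"
    and "coord_map sW sV l (R_ell a b) L Y"
    and "w \<in> invariants sW (R_ell a b) L"
  shows "\<forall>s. Y (qdet_coeff sV l 0) s w = tr_A_L2 sW (R_ell a b) L w s \<and>
             Y (qdet_coeff sV l 0) s w \<in> invariants sW (R_ell a b) L"
proof -
  define s where "s = fps_const (complex_of_real (sqrt a)) * fps_X ^ b"
  have R: "R_ell a b = ell_R s" by (simp add: R_ell_def s_def)
  interpret frt sW L s
  proof (intro frt.intro frt_axioms.intro)
    show "hadic sW" by (rule hadic_topologically_free) fact
    show "laurent_hom sW (L i j)" for i j using assms(4) by (simp add: frt_operator_def)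
    show "s $ 0 = 0" using assms(2) by (simp add: s_def)
  qed
  have V: "hadic sV"
    using assms(5) by (intro hadic_topologically_free) (simp add: is_VR_def presented_algebra_def)
  show ?thesis
    using Y_qdet[OF V assms(6)[unfolded R] assms(7)[unfolded R]] tr_A_L2_invariant[OF assms(7)[unfolded R]]
    by (simp add: R)
qed

end
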